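(* (i) Let $\mathcal{C}$ be a category with finite coproducts and $\mathcal{W}$ a $(\Delta,\amalg_{<\infty})$-closed class of morphisms of $\Delta^{op}\mathcal{C}$. Then $(\Delta^{op}\mathcal{C},\mathcal{W},Cof)$ is a Brown category of cofibrant objects, where $Cof$ is the class of termwise coprojections. (ii) If in addition $\mathcal{C}$ is pointed, then a pair $(X\to Y\to Z,\ Z\to Z\sqcup\Lambda(X))$ in $(\Delta^{op}\mathcal{C})[\mathcal{W}^{-1}]$ is a simplicial distinguished triangle if and only if it is a cofibration sequence in the sense of Brown.
   Context: **$\Delta$-closed classes.** Finite coproducts include an initial object. $\Delta^{op}\mathcal{C}$ is the category of simplicial objects in $\mathcal{C}$. For $X\in\Delta^{op}\mathcal{C}$ and a simplicial finite set $K$, $(X\boxtimes K)_n=\coprod_{K_n}X_n$; the maps $d^0,d^1:[0]\to[1]$ induce $d_0^X,d_1^X:X\to X\boxtimes\Delta[1]$, with common retraction $s_0^X:X\boxtimes\Delta[1]\to X$; simplicial homotopies are defined with this cylinder. A class $\mathcal{W}$ of morphisms of $\Delta^{op}\mathcal{C}$ is $(\Delta,\amalg_{<\infty})$-closed if: (1) it contains the simplicial homotopy equivalences; (2) it satisfies 2-out-of-3; (3) if $F$ is a map of bisimplicial objects in $\mathcal{C}$ with $F_{n,\cdot}\in\mathcal{W}$ for all $n$ (or $F_{\cdot,n}\in\mathcal{W}$ for all $n$), then its diagonal $(F_{n,n})_n$ is in $\mathcal{W}$; (4) $F,G\in\mathcal{W}$ implies $F\sqcup G\in\mathcal{W}$.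 **Termwise coprojections.** $F:X\to Y$ in $\Delta^{op}\mathcal{C}$ is a termwise coprojection if for each $n\ge0$ there are $A^{(n)}\in\mathcal{C}$ and an isomorphism $Y_n\cong X_n\sqcup A^{(n)}$ identifying $F_n$ with the canonical map $X_n\to X_n\sqcup A^{(n)}$. **Simplicial distinguished triangles.** For $Z\xleftarrow{G}X\xrightarrow{F}Y$ in $\Delta^{op}\mathcal{C}$, $K(F,G)$ is the pushout of $Y\sqcup Z\xleftarrow{F\sqcup G}X\sqcup X\xrightarrow{(d_0^X,d_1^X)}X\boxtimes\Delta[1]$. Put $\mathtt{Cyl}(F)=K(F,1_X)$. If $\mathcal{C}$ is pointed with zero object $\ast$, put $\mathtt{Cone}(F)=K(F,X\to\ast)$ and $\Lambda(X)=K(X\to\ast,X\to\ast)$. Let $\Theta(F)=\mathtt{Cone}(X\to\mathtt{Cyl}(F))$, where $X\to \mathtt{Cyl}(F)=K(F,1_X)$ is the canonical map from the target $X$ of $1_X$. The commutative square with horizontal maps $X\to\mathtt{Cyl}(F)$ and $F:X\to Y$ and vertical maps $1_X$ and $\mathtt{Cyl}(F)\to Y$ (equal to $1_Y$ on $Y$, $F$ on $X$, $F s_0^X$ on $X\boxtimes\Delta[1]$) induces $\alpha:\Theta(F)\to\mathtt{Cone}(F)$, which is in $\mathcal{W}$. The natural map $\mathtt{Cyl}(F)\to\mathtt{Cone}(F)$ induces $\beta:\Theta(F)\to\mathtt{Cone}(X\to\ast\to\mathtt{Cone}(F))\cong\mathtt{Cone}(F)\sqcup\Lambda(X)$. Put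 $\mathtt{a}_F=\beta\circ\alpha^{-1}:\mathtt{Cone}(F)\to\mathtt{Cone}(F)\sqcup\Lambda(X)$ in $(\Delta^{op}\mathcal{C})[\mathcal{W}^{-1}]$. A simplicial distinguished triangle is a pair $(X\to Y\to Z,\ Z\to Z\sqcup\Lambda(X))$ isomorphic in $(\Delta^{op}\mathcal{C})[\mathcal{W}^{-1}]$ to $(X\xrightarrow{F}Y\to\mathtt{Cone}(F),\ \mathtt{a}_F)$ for some $F$ in $\Delta^{op}\mathcal{C}$. **Brown categories of cofibrant objects** (dual of Brown's categories of fibrant objects). A category $\mathcal{B}$ with finite coproducts and classes $\mathcal{W}$ (weak equivalences), $Cof$ (cofibrations) such that: $\mathcal{W}$ satisfies 2-out-of-3 and contains isomorphisms; $Cof$ is closed under composition and contains isomorphisms; pushouts of cofibrations along arbitrary maps exist, and cofibrations, as well as maps in $Cof\cap\mathcal{W}$ (trivial cofibrations), are stable under pushout; each codiagonal $X\sqcup X\to X$ factors as a cofibration $X\sqcup X\to\mathrm{Cyl}X$ (with components $\partial_0,\partial_1$) followed by a weak equivalence $\mathrm{Cyl}X\to X$; every map $0\to X$ is a cofibration. **Brown cofibration sequences.** In the pointed case, the Brown suspension $\Sigma X$ is the cofiber $\mathrm{Cyl}X\cup_{X\sqcup X}\ast$, well defined in $\mathcal{B}[\mathcal{W}^{-1}]$; for $\mathcal{B}=\Delta^{op}\mathcal{C}$ one takes $\mathrm{Cyl}X=X\boxtimes\Delta[1]$ and $\Sigma X=\Lambda(X)$. For a cofibration $i:X\to Y$ put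 $Z=Y\cup_X\ast$. Choose cylinders and a map $\mathrm{Cyl}X\to\mathrm{Cyl}Y$ compatible with $i$ such that $Y\cup_X\mathrm{Cyl}X\cup_XY\to\mathrm{Cyl}Y$ is a cofibration, and let $P=Z\cup_Y\mathrm{Cyl}Y\cup_YZ$, with $j_0,j_1:Z\to P$ the two canonical maps (corresponding to $\partial_0,\partial_1$). The map $Z\sqcup\Sigma X\to P$ given by $j_0$ and by the map induced by $\mathrm{Cyl}X\to\mathrm{Cyl}Y$ is a weak equivalence; the coaction $\mathtt{b}:Z\to Z\sqcup\Sigma X$ is its inverse composed with $j_1$, and does not depend on the choices. A cofibration sequence in the sense of Brown is a pair isomorphic in $\mathcal{B}[\mathcal{W}^{-1}]$ to $(X\xrightarrow{i}Y\to Z,\ \mathtt{b})$ for some cofibration $i$. *)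

theory Defs
  imports Main "HOL-Library.FuncSet"
begin

section \<open>Categories, functors, natural transformations\<close>

text \<open>
  Categories have explicit sets of objects and arrows, and composition is only meaningful on
  composable arrows of the carrier. \<open>g \<cdot>\<^bsub>C\<^esub> f\<close> is ``\<open>g\<close> after \<open>f\<close>''.
\<close>

record ('o, 'a) cat =
  Obj :: "'o set"
  Arr :: "'a set"
  Dom :: "'a \<Rightarrow> 'o"
  Cod :: "'a \<Rightarrow> 'o"
  Ident :: "'o \<Rightarrow> 'a"
  Comp :: "'a \<Rightarrow> 'a \<Rightarrow> 'a" (infixl "\<cdot>\<index>" 70)

definition hom :: "('o, 'a) cat \<Rightarrow> 'o \<Rightarrow> 'o \<Rightarrow> 'a set" where
  "hom C x y = {f \<in> Arr C. Dom C f = x \<and> Cod C f = y}"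

locale category =
  fixes C :: "('o, 'a) cat"
  assumes Dom_in_Obj: "f \<in> Arr C \<Longrightarrow> Dom C f \<in> Obj C"
    and Cod_in_Obj: "f \<in> Arr C \<Longrightarrow> Cod C f \<in> Obj C"
    and Ident_in_hom: "x \<in> Obj C \<Longrightarrow> Ident C x \<in> hom C x x"
    and Comp_in_hom: "f \<in> hom C x y \<Longrightarrow> g \<in> hom C y z \<Longrightarrow> g \<cdot>\<^bsub>C\<^esub> f \<in> hom C x z"
    and Comp_Ident: "f \<in> hom C x y \<Longrightarrow> f \<cdot>\<^bsub>C\<^esub> Ident C x = f"
    and Ident_Comp: "f \<in> hom C x y \<Longrightarrow> Ident C y \<cdot>\<^bsub>C\<^esub> f = f"
    and Comp_assoc: "f \<in> hom C w x \<Longrightarrow> g \<in> hom C x y \<Longrightarrow> h \<in> hom C y z \<Longrightarrow>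
          (h \<cdot>\<^bsub>C\<^esub> g) \<cdot>\<^bsub>C\<^esub> f = h \<cdot>\<^bsub>C\<^esub> (g \<cdot>\<^bsub>C\<^esub> f)"

definition inverse_arrs :: "('o, 'a) cat \<Rightarrow> 'a \<Rightarrow> 'a \<Rightarrow> bool" where
  "inverse_arrs C f g \<longleftrightarrow> f \<in> Arr C \<and> g \<in> hom C (Cod C f) (Dom C f) \<and>
     g \<cdot>\<^bsub>C\<^esub> f = Ident C (Dom C f) \<and> f \<cdot>\<^bsub>C\<^esub> g = Ident C (Cod C f)"

definition is_iso :: "('o, 'a) cat \<Rightarrow> 'a \<Rightarrow> bool" where
  "is_iso C f \<longleftrightarrow> (\<exists>g. inverse_arrs C f g)"

definition inv_arr :: "('o, 'a) cat \<Rightarrow> 'a \<Rightarrow> 'a" where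
  "inv_arr C f = (THE g. inverse_arrs C f g)"

definition op_cat :: "('o, 'a) cat \<Rightarrow> ('o, 'a) cat" where
  "op_cat C = \<lparr>Obj = Obj C, Arr = Arr C, Dom = Cod C, Cod = Dom C, Ident = Ident C,
     Comp = (\<lambda>g f. f \<cdot>\<^bsub>C\<^esub> g)\<rparr>"

definition prod_cat :: "('o, 'a) cat \<Rightarrow> ('p, 'b) cat \<Rightarrow> ('o \<times> 'p, 'a \<times> 'b) cat" where
  "prod_cat C D = \<lparr>Obj = Obj C \<times> Obj D, Arr = Arr C \<times> Arr D,
     Dom = map_prod (Dom C) (Dom D), Cod = map_prod (Cod C) (Cod D),
     Ident = map_prod (Ident C) (Ident D),
     Comp = (\<lambda>(g, g') (f, f'). (g \<cdot>\<^bsub>C\<^esub> f, g' \<cdot>\<^bsub>D\<^esub> f'))\<rparr>"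

text \<open>
  Functors and natural transformations are required to be extensional (\<open>undefined\<close> off the
  carriers), so that HOL equality is equality of functors, respectively of natural transformations.
\<close>

record ('o, 'a, 'p, 'b) fnctr =
  FOb :: "'o \<Rightarrow> 'p"
  FAr :: "'a \<Rightarrow> 'b"

definition is_functor ::
  "('o, 'a) cat \<Rightarrow> ('p, 'b) cat \<Rightarrow> ('o, 'a, 'p, 'b) fnctr \<Rightarrow> bool" where
  "is_functor C D F \<longleftrightarrow>
     FOb F \<in> Obj C \<rightarrow>\<^sub>E Obj D \<and> FAr F \<in> extensional (Arr C) \<and>
     (\<forall>f\<in>Arr C. FAr F f \<in> hom D (FOb F (Dom C f)) (FOb F (Cod C f))) \<and>
     (\<forall>x\<in>Obj C. FAr F (Ident C x) = Ident D (FOb F x)) \<and>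
     (\<forall>f\<in>Arr C. \<forall>g\<in>Arr C. Dom C g = Cod C f \<longrightarrow>
        FAr F (g \<cdot>\<^bsub>C\<^esub> f) = FAr F g \<cdot>\<^bsub>D\<^esub> FAr F f)"

record ('o, 'a, 'p, 'b) ntrans =
  NSrc :: "('o, 'a, 'p, 'b) fnctr"
  NTgt :: "('o, 'a, 'p, 'b) fnctr"
  NCmp :: "'o \<Rightarrow> 'b"

definition is_ntrans ::
  "('o, 'a) cat \<Rightarrow> ('p, 'b) cat \<Rightarrow> ('o, 'a, 'p, 'b) ntrans \<Rightarrow> bool" where
  "is_ntrans C D t \<longleftrightarrow>
     is_functor C D (NSrc t) \<and> is_functor C D (NTgt t) \<and> NCmp t \<in> extensional (Obj C) \<and>
     (\<forall>x\<in>Obj C. NCmp t x \<in> hom D (FOb (NSrc t) x) (FOb (NTgt t) x)) \<and>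
     (\<forall>f\<in>Arr C. NCmp t (Cod C f) \<cdot>\<^bsub>D\<^esub> FAr (NSrc t) f = FAr (NTgt t) f \<cdot>\<^bsub>D\<^esub> NCmp t (Dom C f))"

definition functor_cat :: "('o, 'a) cat \<Rightarrow> ('p, 'b) cat \<Rightarrow>
    (('o, 'a, 'p, 'b) fnctr, ('o, 'a, 'p, 'b) ntrans) cat" where
  "functor_cat C D = \<lparr>Obj = {F. is_functor C D F}, Arr = {t. is_ntrans C D t},
     Dom = NSrc, Cod = NTgt,
     Ident = (\<lambda>F. \<lparr>NSrc = F, NTgt = F, NCmp = restrict (\<lambda>x. Ident D (FOb F x)) (Obj C)\<rparr>),
     Comp = (\<lambda>t s. \<lparr>NSrc = NSrc s, NTgt = NTgt t,
                    NCmp = restrict (\<lambda>x. NCmp t x \<cdot>\<^bsub>D\<^esub> NCmp s x) (Obj C)\<rparr>)\<rparr>"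


section \<open>Coproducts, pushouts, zero objects\<close>

text \<open>
  Each universal property is stated as a predicate; the corresponding chosen (co)limit picks
  one solution by Hilbert choice, and arrows out of it are obtained by definite description.
\<close>

definition is_initial :: "('o, 'a) cat \<Rightarrow> 'o \<Rightarrow> bool" where
  "is_initial C z \<longleftrightarrow> z \<in> Obj C \<and> (\<forall>x\<in>Obj C. \<exists>!f. f \<in> hom C z x)"

definition is_terminal :: "('o, 'a) cat \<Rightarrow> 'o \<Rightarrow> bool" where
  "is_terminal C z \<longleftrightarrow> z \<in> Obj C \<and> (\<forall>x\<in>Obj C. \<exists>!f. f \<in> hom C x z)"

definition is_zero :: "('o, 'a) cat \<Rightarrow> 'o \<Rightarrow> bool" where
  "is_zero C z \<longleftrightarrow> is_initial C z \<and> is_terminal C z"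

definition pointed :: "('o, 'a) cat \<Rightarrow> bool" where
  "pointed C \<longleftrightarrow> (\<exists>z. is_zero C z)"

definition zero_ob :: "('o, 'a) cat \<Rightarrow> 'o" where
  "zero_ob C = (SOME z. is_zero C z)"

definition to_zero :: "('o, 'a) cat \<Rightarrow> 'o \<Rightarrow> 'a" where
  "to_zero C x = (THE f. f \<in> hom C x (zero_ob C))"

definition from_zero :: "('o, 'a) cat \<Rightarrow> 'o \<Rightarrow> 'a" where
  "from_zero C x = (THE f. f \<in> hom C (zero_ob C) x)"

definition zero_arr :: "('o, 'a) cat \<Rightarrow> 'o \<Rightarrow> 'o \<Rightarrow> 'a" where
  "zero_arr C x y = from_zero C y \<cdot>\<^bsub>C\<^esub> to_zero C x"

definition is_coprod :: "('o, 'a) cat \<Rightarrow> 'o \<Rightarrow> 'o \<Rightarrow> 'o \<Rightarrow> 'a \<Rightarrow> 'a \<Rightarrow> bool" where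
  "is_coprod C x y p i j \<longleftrightarrow>
     x \<in> Obj C \<and> y \<in> Obj C \<and> p \<in> Obj C \<and> i \<in> hom C x p \<and> j \<in> hom C y p \<and>
     (\<forall>t\<in>Obj C. \<forall>f\<in>hom C x t. \<forall>g\<in>hom C y t.
        \<exists>!u. u \<in> hom C p t \<and> u \<cdot>\<^bsub>C\<^esub> i = f \<and> u \<cdot>\<^bsub>C\<^esub> j = g)"

definition has_finite_coproducts :: "('o, 'a) cat \<Rightarrow> bool" where
  "has_finite_coproducts C \<longleftrightarrow> (\<exists>z. is_initial C z) \<and>
     (\<forall>x\<in>Obj C. \<forall>y\<in>Obj C. \<exists>p i j. is_coprod C x y p i j)"

definition coprod :: "('o, 'a) cat \<Rightarrow> 'o \<Rightarrow> 'o \<Rightarrow> 'o \<times> 'a \<times> 'a" where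
  "coprod C x y = (SOME (p, i, j). is_coprod C x y p i j)"

definition coprod_ob :: "('o, 'a) cat \<Rightarrow> 'o \<Rightarrow> 'o \<Rightarrow> 'o" where
  "coprod_ob C x y = fst (coprod C x y)"

definition in1 :: "('o, 'a) cat \<Rightarrow> 'o \<Rightarrow> 'o \<Rightarrow> 'a" where
  "in1 C x y = fst (snd (coprod C x y))"

definition in2 :: "('o, 'a) cat \<Rightarrow> 'o \<Rightarrow> 'o \<Rightarrow> 'a" where
  "in2 C x y = snd (snd (coprod C x y))"

text \<open>The arrow \<open>[f, g]\<close> out of a coproduct with coprojections \<open>i\<close> and \<open>j\<close>.\<close>

definition cotuple_along :: "('o, 'a) cat \<Rightarrow> 'a \<Rightarrow> 'a \<Rightarrow> 'a \<Rightarrow> 'a \<Rightarrow> 'a" where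
  "cotuple_along C i j f g =
     (THE u. u \<in> hom C (Cod C i) (Cod C f) \<and> u \<cdot>\<^bsub>C\<^esub> i = f \<and> u \<cdot>\<^bsub>C\<^esub> j = g)"

definition cotuple :: "('o, 'a) cat \<Rightarrow> 'a \<Rightarrow> 'a \<Rightarrow> 'a" where
  "cotuple C f g =
     cotuple_along C (in1 C (Dom C f) (Dom C g)) (in2 C (Dom C f) (Dom C g)) f g"

definition coprod_map :: "('o, 'a) cat \<Rightarrow> 'a \<Rightarrow> 'a \<Rightarrow> 'a" where
  "coprod_map C f g =
     cotuple C (in1 C (Cod C f) (Cod C g) \<cdot>\<^bsub>C\<^esub> f) (in2 C (Cod C f) (Cod C g) \<cdot>\<^bsub>C\<^esub> g)"

definition codiagonal :: "('o, 'a) cat \<Rightarrow> 'o \<Rightarrow> 'a" where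
  "codiagonal C x = cotuple C (Ident C x) (Ident C x)"

definition is_coprod_family ::
  "('o, 'a) cat \<Rightarrow> 'k set \<Rightarrow> ('k \<Rightarrow> 'o) \<Rightarrow> 'o \<Rightarrow> ('k \<Rightarrow> 'a) \<Rightarrow> bool" where
  "is_coprod_family C S A p \<iota> \<longleftrightarrow>
     p \<in> Obj C \<and> (\<forall>k\<in>S. A k \<in> Obj C \<and> \<iota> k \<in> hom C (A k) p) \<and>
     (\<forall>t\<in>Obj C. \<forall>h. (\<forall>k\<in>S. h k \<in> hom C (A k) t) \<longrightarrow>
        (\<exists>!u. u \<in> hom C p t \<and> (\<forall>k\<in>S. u \<cdot>\<^bsub>C\<^esub> \<iota> k = h k)))"

text \<open>The copower of \<open>x\<close> by \<open>S\<close>, i.e. the coproduct of copies of \<open>x\<close> indexed by \<open>S\<close>.\<close>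

definition copower :: "('o, 'a) cat \<Rightarrow> 'k set \<Rightarrow> 'o \<Rightarrow> 'o \<times> ('k \<Rightarrow> 'a)" where
  "copower C S x = (SOME (p, \<iota>). is_coprod_family C S (\<lambda>_. x) p \<iota>)"

definition copower_ob :: "('o, 'a) cat \<Rightarrow> 'k set \<Rightarrow> 'o \<Rightarrow> 'o" where
  "copower_ob C S x = fst (copower C S x)"

definition copower_in :: "('o, 'a) cat \<Rightarrow> 'k set \<Rightarrow> 'o \<Rightarrow> 'k \<Rightarrow> 'a" where
  "copower_in C S x = snd (copower C S x)"

definition copower_desc :: "('o, 'a) cat \<Rightarrow> 'k set \<Rightarrow> 'o \<Rightarrow> 'o \<Rightarrow> ('k \<Rightarrow> 'a) \<Rightarrow> 'a" where
  "copower_desc C S x t h =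
     (THE u. u \<in> hom C (copower_ob C S x) t \<and> (\<forall>k\<in>S. u \<cdot>\<^bsub>C\<^esub> copower_in C S x k = h k))"

text \<open>\<open>is_pushout C f g d p q\<close>: the square \<open>p f = q g\<close> with vertex \<open>d\<close> is a pushout.\<close>

definition is_pushout :: "('o, 'a) cat \<Rightarrow> 'a \<Rightarrow> 'a \<Rightarrow> 'o \<Rightarrow> 'a \<Rightarrow> 'a \<Rightarrow> bool" where
  "is_pushout C f g d p q \<longleftrightarrow>
     f \<in> Arr C \<and> g \<in> Arr C \<and> Dom C f = Dom C g \<and> d \<in> Obj C \<and>
     p \<in> hom C (Cod C f) d \<and> q \<in> hom C (Cod C g) d \<and> p \<cdot>\<^bsub>C\<^esub> f = q \<cdot>\<^bsub>C\<^esub> g \<and>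
     (\<forall>t\<in>Obj C. \<forall>h\<in>hom C (Cod C f) t. \<forall>k\<in>hom C (Cod C g) t. h \<cdot>\<^bsub>C\<^esub> f = k \<cdot>\<^bsub>C\<^esub> g \<longrightarrow>
        (\<exists>!u. u \<in> hom C d t \<and> u \<cdot>\<^bsub>C\<^esub> p = h \<and> u \<cdot>\<^bsub>C\<^esub> q = k))"

definition pushout :: "('o, 'a) cat \<Rightarrow> 'a \<Rightarrow> 'a \<Rightarrow> 'o \<times> 'a \<times> 'a" where
  "pushout C f g = (SOME (d, p, q). is_pushout C f g d p q)"

text \<open>\<open>p : y \<rightarrow> z\<close> exhibits \<open>z\<close> as the cofiber \<open>y \<union>\<^sub>x \<ast>\<close> of \<open>f : x \<rightarrow> y\<close>.\<close>

definition is_cofiber :: "('o, 'a) cat \<Rightarrow> 'a \<Rightarrow> 'a \<Rightarrow> bool" where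
  "is_cofiber C f p \<longleftrightarrow>
     is_pushout C f (to_zero C (Dom C f)) (Cod C p) p (from_zero C (Cod C p))"


section \<open>Localization\<close>

text \<open>
  The Gabriel--Zisman localization: arrows are zigzags modulo the congruence generated by the
  relations below. A zigzag is listed in order of traversal; \<open>Fwd f\<close> traverses \<open>f\<close> forwards
  and \<open>Bwd w\<close> traverses \<open>w \<in> W\<close> backwards.
\<close>

datatype 'a zigzag_step = Fwd 'a | Bwd 'a

fun zigzag :: "('o, 'a) cat \<Rightarrow> 'a set \<Rightarrow> 'o \<Rightarrow> 'a zigzag_step list \<Rightarrow> 'o \<Rightarrow> bool" where
  "zigzag C W x [] y \<longleftrightarrow> x \<in> Obj C \<and> x = y"
| "zigzag C W x (Fwd f # ss) y \<longleftrightarrow> f \<in> Arr C \<and> Dom C f = x \<and> zigzag C W (Cod C f) ss y"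
| "zigzag C W x (Bwd w # ss) y \<longleftrightarrow>
     w \<in> Arr C \<and> w \<in> W \<and> Cod C w = x \<and> zigzag C W (Dom C w) ss y"

inductive zigzag_red :: "('o, 'a) cat \<Rightarrow> 'a set \<Rightarrow> 'o \<Rightarrow> 'o \<Rightarrow>
    'a zigzag_step list \<Rightarrow> 'a zigzag_step list \<Rightarrow> bool"
  for C W x y where
  red_Ident: "zigzag C W x (p @ [Fwd (Ident C a)] @ q) y \<Longrightarrow> a \<in> Obj C \<Longrightarrow>
     zigzag_red C W x y (p @ [Fwd (Ident C a)] @ q) (p @ q)"
| red_Comp: "zigzag C W x (p @ [Fwd f, Fwd g] @ q) y \<Longrightarrow>
     zigzag_red C W x y (p @ [Fwd f, Fwd g] @ q) (p @ [Fwd (g \<cdot>\<^bsub>C\<^esub> f)] @ q)"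
| red_Fwd_Bwd: "zigzag C W x (p @ [Fwd w, Bwd w] @ q) y \<Longrightarrow>
     zigzag_red C W x y (p @ [Fwd w, Bwd w] @ q) (p @ q)"
| red_Bwd_Fwd: "zigzag C W x (p @ [Bwd w, Fwd w] @ q) y \<Longrightarrow>
     zigzag_red C W x y (p @ [Bwd w, Fwd w] @ q) (p @ q)"

definition zigzag_class :: "('o, 'a) cat \<Rightarrow> 'a set \<Rightarrow> 'o \<Rightarrow> 'o \<Rightarrow>
    'a zigzag_step list \<Rightarrow> 'a zigzag_step list set" where
  "zigzag_class C W x y ss = {ss'. equivclp (zigzag_red C W x y) ss ss'}"

definition localization ::
  "('o, 'a) cat \<Rightarrow> 'a set \<Rightarrow> ('o, 'o \<times> 'o \<times> 'a zigzag_step list set) cat" where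
  "localization C W = \<lparr>Obj = Obj C,
     Arr = {(x, y, zigzag_class C W x y ss) | x y ss. zigzag C W x ss y},
     Dom = (\<lambda>(x, y, _). x), Cod = (\<lambda>(x, y, _). y),
     Ident = (\<lambda>x. (x, x, zigzag_class C W x x [])),
     Comp = (\<lambda>(_, z, B) (x, _, A). (x, z, \<Union>ss\<in>A. \<Union>tt\<in>B. zigzag_class C W x z (ss @ tt)))\<rparr>"

definition loc_arr ::
  "('o, 'a) cat \<Rightarrow> 'a set \<Rightarrow> 'a \<Rightarrow> 'o \<times> 'o \<times> 'a zigzag_step list set" where
  "loc_arr C W f = (Dom C f, Cod C f, zigzag_class C W (Dom C f) (Cod C f) [Fwd f])"

text \<open>
  Action on \<open>(x, y, A)\<close> of the functor from the localization to \<open>D\<close> induced by a functor to \<open>D\<close>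
  (object map \<open>o'\<close>, arrow map \<open>m\<close>) that inverts \<open>W\<close>: evaluate any representing zigzag.
\<close>

fun zigzag_step_eval :: "('p, 'b) cat \<Rightarrow> ('a \<Rightarrow> 'b) \<Rightarrow> 'a zigzag_step \<Rightarrow> 'b" where
  "zigzag_step_eval D m (Fwd f) = m f"
| "zigzag_step_eval D m (Bwd w) = inv_arr D (m w)"

definition loc_extend :: "('p, 'b) cat \<Rightarrow> ('o \<Rightarrow> 'p) \<Rightarrow> ('a \<Rightarrow> 'b) \<Rightarrow>
    'o \<times> 'o \<times> 'a zigzag_step list set \<Rightarrow> 'b" where
  "loc_extend D o' m = (\<lambda>(x, y, A).
     foldl (\<lambda>g s. zigzag_step_eval D m s \<cdot>\<^bsub>D\<^esub> g) (Ident D (o' x)) (SOME ss. ss \<in> A))"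


section \<open>Simplicial objects\<close>

text \<open>
  An arrow \<open>(m, n, f)\<close> of the simplex category is the monotone map \<open>f : {0..m} \<rightarrow> {0..n}\<close>, from
  the ordinal \<open>[m]\<close> to \<open>[n]\<close>.
\<close>

type_synonym simplex_map = "nat \<times> nat \<times> (nat \<Rightarrow> nat)"

definition Delta :: "(nat, simplex_map) cat" where
  "Delta = \<lparr>Obj = UNIV,
     Arr = {(m, n, f). f \<in> {0..m} \<rightarrow>\<^sub>E {0..n} \<and> mono_on {0..m} f},
     Dom = (\<lambda>(m, n, f). m), Cod = (\<lambda>(m, n, f). n),
     Ident = (\<lambda>n. (n, n, restrict (\<lambda>i. i) {0..n})),
     Comp = (\<lambda>(_, p, g) (m, _, f). (m, p, compose {0..m} g f))\<rparr>"

type_synonym ('o, 'a) sobj = "(nat, simplex_map, 'o, 'a) fnctr"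
type_synonym ('o, 'a) smap = "(nat, simplex_map, 'o, 'a) ntrans"

definition Simp :: "('o, 'a) cat \<Rightarrow> (('o, 'a) sobj, ('o, 'a) smap) cat" where
  "Simp C = functor_cat (op_cat Delta) C"

type_synonym 'k fin_map = "'k set \<times> 'k set \<times> ('k \<Rightarrow> 'k)"

definition FinSet :: "('k set, 'k fin_map) cat" where
  "FinSet = \<lparr>Obj = {A. finite A},
     Arr = {(A, B, f). finite A \<and> finite B \<and> f \<in> A \<rightarrow>\<^sub>E B},
     Dom = (\<lambda>(A, B, f). A), Cod = (\<lambda>(A, B, f). B),
     Ident = (\<lambda>A. (A, A, restrict (\<lambda>a. a) A)),
     Comp = (\<lambda>(_, D, g) (A, _, f). (A, D, compose A g f))\<rparr>"

type_synonym 'k sfinset = "('k set, 'k fin_map) sobj"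

definition std_simplex :: "nat \<Rightarrow> simplex_map sfinset" where
  "std_simplex k = \<lparr>FOb = (\<lambda>n. hom Delta n k),
     FAr = restrict (\<lambda>\<theta>. (hom Delta (Cod Delta \<theta>) k, hom Delta (Dom Delta \<theta>) k,
             restrict (\<lambda>\<sigma>. \<sigma> \<cdot>\<^bsub>Delta\<^esub> \<theta>) (hom Delta (Cod Delta \<theta>) k))) (Arr Delta)\<rparr>"

text \<open>\<open>X \<boxtimes> K\<close>: on the summand indexed by \<open>k\<close>, \<open>\<theta>\<close> acts as \<open>X(\<theta>)\<close> into the summand \<open>K(\<theta>)(k)\<close>.\<close>

definition tensor :: "('o, 'a) cat \<Rightarrow> ('o, 'a) sobj \<Rightarrow> 'k sfinset \<Rightarrow> ('o, 'a) sobj" where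
  "tensor C X K = \<lparr>FOb = (\<lambda>n. copower_ob C (FOb K n) (FOb X n)),
     FAr = restrict (\<lambda>\<theta>. let n = Cod Delta \<theta>; m = Dom Delta \<theta> in
             copower_desc C (FOb K n) (FOb X n) (copower_ob C (FOb K m) (FOb X m))
               (\<lambda>k. copower_in C (FOb K m) (FOb X m) (snd (snd (FAr K \<theta>)) k) \<cdot>\<^bsub>C\<^esub> FAr X \<theta>))
           (Arr Delta)\<rparr>"

definition tensor_map :: "('o, 'a) cat \<Rightarrow> ('o, 'a) smap \<Rightarrow> 'k sfinset \<Rightarrow> ('o, 'a) smap" where
  "tensor_map C f K = \<lparr>NSrc = tensor C (NSrc f) K, NTgt = tensor C (NTgt f) K,
     NCmp = (\<lambda>n. copower_desc C (FOb K n) (FOb (NSrc f) n)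
               (copower_ob C (FOb K n) (FOb (NTgt f) n))
               (\<lambda>k. copower_in C (FOb K n) (FOb (NTgt f) n) k \<cdot>\<^bsub>C\<^esub> NCmp f n))\<rparr>"

definition scyl :: "('o, 'a) cat \<Rightarrow> ('o, 'a) sobj \<Rightarrow> ('o, 'a) sobj" where
  "scyl C X = tensor C X (std_simplex 1)"

definition scyl_map :: "('o, 'a) cat \<Rightarrow> ('o, 'a) smap \<Rightarrow> ('o, 'a) smap" where
  "scyl_map C f = tensor_map C f (std_simplex 1)"

text \<open>
  \<open>coface01 i : [0] \<rightarrow> [1]\<close> is the coface omitting \<open>i\<close>, so it has value \<open>1 - i\<close>. In degree \<open>n\<close>, the
  map \<open>X \<cong> X \<boxtimes> \<Delta>[0] \<rightarrow> X \<boxtimes> \<Delta>[1]\<close> it induces is the coprojection of the summand indexed by the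
  composite of \<open>[n] \<rightarrow> [0]\<close> with \<open>coface01 i\<close>.
\<close>

definition coface01 :: "nat \<Rightarrow> simplex_map" where
  "coface01 i = (0, 1, restrict (\<lambda>_. 1 - i) {0..0})"

definition to_point :: "nat \<Rightarrow> simplex_map" where
  "to_point n = (n, 0, restrict (\<lambda>_. 0) {0..n})"

definition scyl_d :: "('o, 'a) cat \<Rightarrow> nat \<Rightarrow> ('o, 'a) sobj \<Rightarrow> ('o, 'a) smap" where
  "scyl_d C i X = \<lparr>NSrc = X, NTgt = scyl C X,
     NCmp = (\<lambda>n. copower_in C (FOb (std_simplex 1) n) (FOb X n) (coface01 i \<cdot>\<^bsub>Delta\<^esub> to_point n))\<rparr>"

definition scyl_s :: "('o, 'a) cat \<Rightarrow> ('o, 'a) sobj \<Rightarrow> ('o, 'a) smap" where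
  "scyl_s C X = \<lparr>NSrc = scyl C X, NTgt = X,
     NCmp = (\<lambda>n. copower_desc C (FOb (std_simplex 1) n) (FOb X n) (FOb X n)
               (\<lambda>_. Ident C (FOb X n)))\<rparr>"


section \<open>\<open>(\<Delta>, \<amalg>\<^sub><\<^sub>\<infinity>)\<close>-closed classes\<close>

definition simplicial_homotopy ::
  "('o, 'a) cat \<Rightarrow> ('o, 'a) smap \<Rightarrow> ('o, 'a) smap \<Rightarrow> ('o, 'a) smap \<Rightarrow> bool" where
  "simplicial_homotopy C H f g \<longleftrightarrow>
     H \<in> hom (Simp C) (scyl C (NSrc f)) (NTgt f) \<and>
     H \<cdot>\<^bsub>Simp C\<^esub> scyl_d C 0 (NSrc f) = f \<and> H \<cdot>\<^bsub>Simp C\<^esub> scyl_d C 1 (NSrc f) = g"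

text \<open>
  Being linked by a simplicial homotopy is not a symmetric relation in general, so homotopies in
  either direction are allowed. No transitive closure is taken; it could only enlarge the class
  of homotopy equivalences, and thus strengthen the requirement on a closed class.
\<close>

definition simplicially_homotopic ::
  "('o, 'a) cat \<Rightarrow> ('o, 'a) smap \<Rightarrow> ('o, 'a) smap \<Rightarrow> bool" where
  "simplicially_homotopic C f g \<longleftrightarrow>
     (\<exists>H. simplicial_homotopy C H f g \<or> simplicial_homotopy C H g f)"

definition simplicial_homotopy_equivalence :: "('o, 'a) cat \<Rightarrow> ('o, 'a) smap \<Rightarrow> bool" where
  "simplicial_homotopy_equivalence C f \<longleftrightarrow> f \<in> Arr (Simp C) \<and>
     (\<exists>g\<in>hom (Simp C) (NTgt f) (NSrc f).
        simplicially_homotopic C (g \<cdot>\<^bsub>Simp C\<^esub> f) (Ident (Simp C) (NSrc f)) \<and>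
        simplicially_homotopic C (f \<cdot>\<^bsub>Simp C\<^esub> g) (Ident (Simp C) (NTgt f)))"

definition two_out_of_three :: "('o, 'a) cat \<Rightarrow> 'a set \<Rightarrow> bool" where
  "two_out_of_three C W \<longleftrightarrow>
     (\<forall>f\<in>Arr C. \<forall>g\<in>Arr C. Dom C g = Cod C f \<longrightarrow>
        (f \<in> W \<and> g \<in> W \<longrightarrow> g \<cdot>\<^bsub>C\<^esub> f \<in> W) \<and>
        (f \<in> W \<and> g \<cdot>\<^bsub>C\<^esub> f \<in> W \<longrightarrow> g \<in> W) \<and>
        (g \<in> W \<and> g \<cdot>\<^bsub>C\<^esub> f \<in> W \<longrightarrow> f \<in> W))"

type_synonym ('o, 'a) bisobj = "(nat \<times> nat, simplex_map \<times> simplex_map, 'o, 'a) fnctr"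
type_synonym ('o, 'a) bismap = "(nat \<times> nat, simplex_map \<times> simplex_map, 'o, 'a) ntrans"

definition BiSimp :: "('o, 'a) cat \<Rightarrow> (('o, 'a) bisobj, ('o, 'a) bismap) cat" where
  "BiSimp C = functor_cat (prod_cat (op_cat Delta) (op_cat Delta)) C"

text \<open>\<open>bi_row n X\<close> is \<open>X\<^sub>n\<^sub>,\<^sub>\<cdot>\<close> and \<open>bi_col n X\<close> is \<open>X\<^sub>\<cdot>\<^sub>,\<^sub>n\<close>.\<close>

definition bi_row :: "nat \<Rightarrow> ('o, 'a) bisobj \<Rightarrow> ('o, 'a) sobj" where
  "bi_row n X = \<lparr>FOb = (\<lambda>m. FOb X (n, m)),
     FAr = restrict (\<lambda>\<theta>. FAr X (Ident Delta n, \<theta>)) (Arr Delta)\<rparr>"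

definition bi_col :: "nat \<Rightarrow> ('o, 'a) bisobj \<Rightarrow> ('o, 'a) sobj" where
  "bi_col n X = \<lparr>FOb = (\<lambda>m. FOb X (m, n)),
     FAr = restrict (\<lambda>\<theta>. FAr X (\<theta>, Ident Delta n)) (Arr Delta)\<rparr>"

definition bi_diag :: "('o, 'a) bisobj \<Rightarrow> ('o, 'a) sobj" where
  "bi_diag X = \<lparr>FOb = (\<lambda>n. FOb X (n, n)), FAr = restrict (\<lambda>\<theta>. FAr X (\<theta>, \<theta>)) (Arr Delta)\<rparr>"

definition bi_row_map :: "nat \<Rightarrow> ('o, 'a) bismap \<Rightarrow> ('o, 'a) smap" where
  "bi_row_map n F = \<lparr>NSrc = bi_row n (NSrc F), NTgt = bi_row n (NTgt F),
     NCmp = (\<lambda>m. NCmp F (n, m))\<rparr>"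

definition bi_col_map :: "nat \<Rightarrow> ('o, 'a) bismap \<Rightarrow> ('o, 'a) smap" where
  "bi_col_map n F = \<lparr>NSrc = bi_col n (NSrc F), NTgt = bi_col n (NTgt F),
     NCmp = (\<lambda>m. NCmp F (m, n))\<rparr>"

definition bi_diag_map :: "('o, 'a) bismap \<Rightarrow> ('o, 'a) smap" where
  "bi_diag_map F = \<lparr>NSrc = bi_diag (NSrc F), NTgt = bi_diag (NTgt F),
     NCmp = (\<lambda>n. NCmp F (n, n))\<rparr>"

definition Delta_closed :: "('o, 'a) cat \<Rightarrow> ('o, 'a) smap set \<Rightarrow> bool" where
  "Delta_closed C W \<longleftrightarrow>
     W \<subseteq> Arr (Simp C) \<and>
     (\<forall>f. simplicial_homotopy_equivalence C f \<longrightarrow> f \<in> W) \<and>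
     two_out_of_three (Simp C) W \<and>
     (\<forall>F\<in>Arr (BiSimp C). (\<forall>n. bi_row_map n F \<in> W) \<or> (\<forall>n. bi_col_map n F \<in> W) \<longrightarrow>
        bi_diag_map F \<in> W) \<and>
     (\<forall>f\<in>W. \<forall>g\<in>W. coprod_map (Simp C) f g \<in> W)"

definition termwise_coprojections :: "('o, 'a) cat \<Rightarrow> ('o, 'a) smap set" where
  "termwise_coprojections C = {f \<in> Arr (Simp C).
     \<forall>n. \<exists>A\<in>Obj C. \<exists>\<phi>\<in>hom C (FOb (NTgt f) n) (coprod_ob C (FOb (NSrc f) n) A).
       is_iso C \<phi> \<and> \<phi> \<cdot>\<^bsub>C\<^esub> NCmp f n = in1 C (FOb (NSrc f) n) A}"


section \<open>Brown categories of cofibrant objects\<close>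

text \<open>A cylinder object of \<open>x\<close>: a factorization \<open>s \<circ> [e0, e1]\<close> of the codiagonal.\<close>

definition is_cylinder ::
  "('o, 'a) cat \<Rightarrow> 'a set \<Rightarrow> 'a set \<Rightarrow> 'o \<Rightarrow> 'o \<Rightarrow> 'a \<Rightarrow> 'a \<Rightarrow> 'a \<Rightarrow> bool" where
  "is_cylinder B W Cof x c e0 e1 s \<longleftrightarrow>
     e0 \<in> hom B x c \<and> e1 \<in> hom B x c \<and> s \<in> hom B c x \<and>
     cotuple B e0 e1 \<in> Cof \<and> s \<in> W \<and> s \<cdot>\<^bsub>B\<^esub> cotuple B e0 e1 = codiagonal B x"

definition brown_cofibrant_category :: "('o, 'a) cat \<Rightarrow> 'a set \<Rightarrow> 'a set \<Rightarrow> bool" where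
  "brown_cofibrant_category B W Cof \<longleftrightarrow>
     category B \<and> has_finite_coproducts B \<and> W \<subseteq> Arr B \<and> Cof \<subseteq> Arr B \<and>
     two_out_of_three B W \<and>
     (\<forall>f. is_iso B f \<longrightarrow> f \<in> W) \<and>
     (\<forall>f\<in>Cof. \<forall>g\<in>Cof. Dom B g = Cod B f \<longrightarrow> g \<cdot>\<^bsub>B\<^esub> f \<in> Cof) \<and>
     (\<forall>f. is_iso B f \<longrightarrow> f \<in> Cof) \<and>
     (\<forall>f\<in>Cof. \<forall>g\<in>Arr B. Dom B g = Dom B f \<longrightarrow> (\<exists>d p q. is_pushout B f g d p q)) \<and>
     (\<forall>f\<in>Cof. \<forall>g d p q. is_pushout B f g d p q \<longrightarrow> q \<in> Cof) \<and>
     (\<forall>f\<in>Cof \<inter> W. \<forall>g d p q. is_pushout B f g d p q \<longrightarrow> q \<in> Cof \<inter> W) \<and>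
     (\<forall>x\<in>Obj B. \<exists>c e0 e1 s. is_cylinder B W Cof x c e0 e1 s) \<and>
     (\<forall>z f. is_initial B z \<and> f \<in> Arr B \<and> Dom B f = z \<longrightarrow> f \<in> Cof)"


section \<open>Pairs \<open>(X \<rightarrow> Y \<rightarrow> Z, Z \<rightarrow> Z \<squnion> \<Sigma>X)\<close> in the localization\<close>

record ('o, 'l) copair =
  PX :: 'o
  PY :: 'o
  PZ :: 'o
  Pf :: 'l
  Pg :: 'l
  Ph :: 'l

text \<open>
  \<open>cyl\<close>, \<open>cyl0\<close>, \<open>cyl1\<close>, \<open>cylp\<close> are the chosen cylinder objects with their structure maps, \<open>susq X\<close>
  is the map from the cylinder of \<open>X\<close> onto the suspension \<open>sus X\<close>, and \<open>susl\<close> is the action of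
  the suspension functor on arrows of the localization.
\<close>

record ('o, 'a, 'l) suspension =
  cyl :: "'o \<Rightarrow> 'o"
  cyl0 :: "'o \<Rightarrow> 'a"
  cyl1 :: "'o \<Rightarrow> 'a"
  cylp :: "'o \<Rightarrow> 'a"
  sus :: "'o \<Rightarrow> 'o"
  susq :: "'o \<Rightarrow> 'a"
  susl :: "'l \<Rightarrow> 'l"

type_synonym ('o, 'a) loc_arrow = "'o \<times> 'o \<times> 'a zigzag_step list set"

definition is_copair :: "('o, 'a) cat \<Rightarrow> 'a set \<Rightarrow> ('o, 'a, ('o, 'a) loc_arrow) suspension \<Rightarrow>
    ('o, ('o, 'a) loc_arrow) copair \<Rightarrow> bool" where
  "is_copair B W S T \<longleftrightarrow> (let L = localization B W in
     PX T \<in> Obj B \<and> PY T \<in> Obj B \<and> PZ T \<in> Obj B \<and>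
     Pf T \<in> hom L (PX T) (PY T) \<and> Pg T \<in> hom L (PY T) (PZ T) \<and>
     Ph T \<in> hom L (PZ T) (coprod_ob B (PZ T) (sus S (PX T))))"

text \<open>
  Coproducts of \<open>B\<close> are used as coproducts in the localization, and \<open>\<omega>\<close> below is
  \<open>\<zeta> \<squnion> \<Sigma>\<xi> : Z \<squnion> \<Sigma>X \<rightarrow> Z' \<squnion> \<Sigma>X'\<close>.
\<close>

definition copair_iso :: "('o, 'a) cat \<Rightarrow> 'a set \<Rightarrow> ('o, 'a, ('o, 'a) loc_arrow) suspension \<Rightarrow>
    ('o, ('o, 'a) loc_arrow) copair \<Rightarrow> ('o, ('o, 'a) loc_arrow) copair \<Rightarrow> bool" where
  "copair_iso B W S T T' \<longleftrightarrow> (let L = localization B W; Q = loc_arr B W in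
     is_copair B W S T \<and> is_copair B W S T' \<and>
     (\<exists>\<xi>\<in>hom L (PX T) (PX T'). \<exists>\<eta>\<in>hom L (PY T) (PY T'). \<exists>\<zeta>\<in>hom L (PZ T) (PZ T').
        is_iso L \<xi> \<and> is_iso L \<eta> \<and> is_iso L \<zeta> \<and>
        \<eta> \<cdot>\<^bsub>L\<^esub> Pf T = Pf T' \<cdot>\<^bsub>L\<^esub> \<xi> \<and>
        \<zeta> \<cdot>\<^bsub>L\<^esub> Pg T = Pg T' \<cdot>\<^bsub>L\<^esub> \<eta> \<and>
        (let \<omega> = cotuple_along L
                   (Q (in1 B (PZ T) (sus S (PX T)))) (Q (in2 B (PZ T) (sus S (PX T))))
                   (Q (in1 B (PZ T') (sus S (PX T'))) \<cdot>\<^bsub>L\<^esub> \<zeta>)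
                   (Q (in2 B (PZ T') (sus S (PX T'))) \<cdot>\<^bsub>L\<^esub> susl S \<xi>)
         in \<omega> \<cdot>\<^bsub>L\<^esub> Ph T = Ph T' \<cdot>\<^bsub>L\<^esub> \<zeta>)))"

text \<open>
  \<open>brown_coaction B W Cof S i p b\<close>: \<open>b : Z \<rightarrow> Z \<squnion> \<Sigma>X\<close> is the coaction obtained for the cofibration
  \<open>i : X \<rightarrow> Y\<close> with cofiber \<open>p : Y \<rightarrow> Z\<close> from some choice of
    \<^item> a cylinder \<open>(c, e0, e1, s)\<close> of \<open>Y\<close> and a map \<open>u\<close> to it from the chosen cylinder of \<open>X\<close>,
      compatible with \<open>i\<close>, such that the map \<open>v\<close> from \<open>M = Y \<union>\<^sub>X Cyl X \<union>\<^sub>X Y\<close> is a cofibration;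
    \<^item> a pushout \<open>P = Z \<union>\<^sub>Y Cyl Y \<union>\<^sub>Y Z\<close>.
  The map \<open>\<Sigma>X \<rightarrow> P\<close> induced by \<open>u\<close> is \<open>k\<close>.
\<close>

definition brown_coaction :: "('o, 'a) cat \<Rightarrow> 'a set \<Rightarrow> 'a set \<Rightarrow>
    ('o, 'a, ('o, 'a) loc_arrow) suspension \<Rightarrow> 'a \<Rightarrow> 'a \<Rightarrow> ('o, 'a) loc_arrow \<Rightarrow> bool" where
  "brown_coaction B W Cof S i p b \<longleftrightarrow>
     (let X = Dom B i; Y = Cod B i; Z = Cod B p; L = localization B W; Q = loc_arr B W in
      i \<in> Cof \<and> is_cofiber B i p \<and>
      is_cylinder B W Cof X (cyl S X) (cyl0 S X) (cyl1 S X) (cylp S X) \<and>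
      susq S X \<in> hom B (cyl S X) (sus S X) \<and>
      is_cofiber B (cotuple B (cyl0 S X) (cyl1 S X)) (susq S X) \<and>
      (\<exists>c e0 e1 s u M m m' v P r q k.
         is_cylinder B W Cof Y c e0 e1 s \<and>
         u \<in> hom B (cyl S X) c \<and>
         u \<cdot>\<^bsub>B\<^esub> cyl0 S X = e0 \<cdot>\<^bsub>B\<^esub> i \<and> u \<cdot>\<^bsub>B\<^esub> cyl1 S X = e1 \<cdot>\<^bsub>B\<^esub> i \<and>
         s \<cdot>\<^bsub>B\<^esub> u = i \<cdot>\<^bsub>B\<^esub> cylp S X \<and>
         is_pushout B (coprod_map B i i) (cotuple B (cyl0 S X) (cyl1 S X)) M m m' \<and>
         v \<in> hom B M c \<and> v \<cdot>\<^bsub>B\<^esub> m = cotuple B e0 e1 \<and> v \<cdot>\<^bsub>B\<^esub> m' = u \<and> v \<in> Cof \<and>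
         is_pushout B (coprod_map B p p) (cotuple B e0 e1) P r q \<and>
         k \<in> hom B (sus S X) P \<and> k \<cdot>\<^bsub>B\<^esub> susq S X = q \<cdot>\<^bsub>B\<^esub> u \<and>
         (let j0 = r \<cdot>\<^bsub>B\<^esub> in1 B Z Z; j1 = r \<cdot>\<^bsub>B\<^esub> in2 B Z Z
          in b = inv_arr L (Q (cotuple B j0 k)) \<cdot>\<^bsub>L\<^esub> Q j1)))"

definition brown_cofibration_sequence :: "('o, 'a) cat \<Rightarrow> 'a set \<Rightarrow> 'a set \<Rightarrow>
    ('o, 'a, ('o, 'a) loc_arrow) suspension \<Rightarrow> ('o, ('o, 'a) loc_arrow) copair \<Rightarrow> bool" where
  "brown_cofibration_sequence B W Cof S T \<longleftrightarrow>
     (\<exists>i p b. brown_coaction B W Cof S i p b \<and>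
        copair_iso B W S T
          \<lparr>PX = Dom B i, PY = Cod B i, PZ = Cod B p,
           Pf = loc_arr B W i, Pg = loc_arr B W p, Ph = b\<rparr>)"


section \<open>Simplicial cones and distinguished triangles\<close>

text \<open>
  \<open>K(F, G)\<close> for \<open>Z \<leftarrow>(G) X \<rightarrow>(F) Y\<close>, with its structure maps from \<open>Y\<close>, \<open>Z\<close> and \<open>X \<boxtimes> \<Delta>[1]\<close>.
\<close>

definition K_pushout :: "('o, 'a) cat \<Rightarrow> ('o, 'a) smap \<Rightarrow> ('o, 'a) smap \<Rightarrow>
    ('o, 'a) sobj \<times> ('o, 'a) smap \<times> ('o, 'a) smap" where
  "K_pushout C F G = pushout (Simp C) (coprod_map (Simp C) F G)
     (cotuple (Simp C) (scyl_d C 0 (NSrc F)) (scyl_d C 1 (NSrc F)))"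

definition K_ob :: "('o, 'a) cat \<Rightarrow> ('o, 'a) smap \<Rightarrow> ('o, 'a) smap \<Rightarrow> ('o, 'a) sobj" where
  "K_ob C F G = fst (K_pushout C F G)"

definition K_in1 :: "('o, 'a) cat \<Rightarrow> ('o, 'a) smap \<Rightarrow> ('o, 'a) smap \<Rightarrow> ('o, 'a) smap" where
  "K_in1 C F G = fst (snd (K_pushout C F G)) \<cdot>\<^bsub>Simp C\<^esub> in1 (Simp C) (NTgt F) (NTgt G)"

definition K_in2 :: "('o, 'a) cat \<Rightarrow> ('o, 'a) smap \<Rightarrow> ('o, 'a) smap \<Rightarrow> ('o, 'a) smap" where
  "K_in2 C F G = fst (snd (K_pushout C F G)) \<cdot>\<^bsub>Simp C\<^esub> in2 (Simp C) (NTgt F) (NTgt G)"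

definition K_incyl :: "('o, 'a) cat \<Rightarrow> ('o, 'a) smap \<Rightarrow> ('o, 'a) smap \<Rightarrow> ('o, 'a) smap" where
  "K_incyl C F G = snd (snd (K_pushout C F G))"

text \<open>
  The map out of \<open>K(F, G)\<close> equal to \<open>y\<close> on \<open>Y\<close>, \<open>z\<close> on \<open>Z\<close> and \<open>h\<close> on \<open>X \<boxtimes> \<Delta>[1]\<close>, and the map
  \<open>K(F, G) \<rightarrow> K(F', G')\<close> induced by \<open>x : X \<rightarrow> X'\<close>, \<open>y : Y \<rightarrow> Y'\<close>, \<open>z : Z \<rightarrow> Z'\<close>.
\<close>

definition K_desc :: "('o, 'a) cat \<Rightarrow> ('o, 'a) smap \<Rightarrow> ('o, 'a) smap \<Rightarrow>
    ('o, 'a) smap \<Rightarrow> ('o, 'a) smap \<Rightarrow> ('o, 'a) smap \<Rightarrow> ('o, 'a) smap" where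
  "K_desc C F G y z h = (THE t. t \<in> hom (Simp C) (K_ob C F G) (NTgt h) \<and>
     t \<cdot>\<^bsub>Simp C\<^esub> K_in1 C F G = y \<and> t \<cdot>\<^bsub>Simp C\<^esub> K_in2 C F G = z \<and> t \<cdot>\<^bsub>Simp C\<^esub> K_incyl C F G = h)"

definition K_map :: "('o, 'a) cat \<Rightarrow> ('o, 'a) smap \<Rightarrow> ('o, 'a) smap \<Rightarrow>
    ('o, 'a) smap \<Rightarrow> ('o, 'a) smap \<Rightarrow>
    ('o, 'a) smap \<Rightarrow> ('o, 'a) smap \<Rightarrow> ('o, 'a) smap \<Rightarrow> ('o, 'a) smap" where
  "K_map C F G F' G' x y z = K_desc C F G
     (K_in1 C F' G' \<cdot>\<^bsub>Simp C\<^esub> y) (K_in2 C F' G' \<cdot>\<^bsub>Simp C\<^esub> z)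
     (K_incyl C F' G' \<cdot>\<^bsub>Simp C\<^esub> scyl_map C x)"

abbreviation to_pt :: "('o, 'a) cat \<Rightarrow> ('o, 'a) sobj \<Rightarrow> ('o, 'a) smap" where
  "to_pt C X \<equiv> to_zero (Simp C) X"

definition Cyl :: "('o, 'a) cat \<Rightarrow> ('o, 'a) smap \<Rightarrow> ('o, 'a) sobj" where
  "Cyl C F = K_ob C F (Ident (Simp C) (NSrc F))"

text \<open>The maps \<open>X \<rightarrow> Cyl(F)\<close>, from the target of \<open>1\<^sub>X\<close>, and \<open>Cyl(F) \<rightarrow> Y\<close>.\<close>

definition Cyl_in :: "('o, 'a) cat \<Rightarrow> ('o, 'a) smap \<Rightarrow> ('o, 'a) smap" where
  "Cyl_in C F = K_in2 C F (Ident (Simp C) (NSrc F))"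

definition Cyl_proj :: "('o, 'a) cat \<Rightarrow> ('o, 'a) smap \<Rightarrow> ('o, 'a) smap" where
  "Cyl_proj C F = K_desc C F (Ident (Simp C) (NSrc F))
     (Ident (Simp C) (NTgt F)) F (F \<cdot>\<^bsub>Simp C\<^esub> scyl_s C (NSrc F))"

definition Cone :: "('o, 'a) cat \<Rightarrow> ('o, 'a) smap \<Rightarrow> ('o, 'a) sobj" where
  "Cone C F = K_ob C F (to_pt C (NSrc F))"

definition Cone_in :: "('o, 'a) cat \<Rightarrow> ('o, 'a) smap \<Rightarrow> ('o, 'a) smap" where
  "Cone_in C F = K_in1 C F (to_pt C (NSrc F))"

text \<open>The map \<open>Cone(F) \<rightarrow> Cone(F')\<close> induced by a commutative square \<open>y F = F' x\<close>.\<close>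

definition Cone_map :: "('o, 'a) cat \<Rightarrow> ('o, 'a) smap \<Rightarrow> ('o, 'a) smap \<Rightarrow>
    ('o, 'a) smap \<Rightarrow> ('o, 'a) smap \<Rightarrow> ('o, 'a) smap" where
  "Cone_map C F F' x y = K_map C F (to_pt C (NSrc F)) F' (to_pt C (NSrc F')) x y
     (Ident (Simp C) (zero_ob (Simp C)))"

definition Lambda :: "('o, 'a) cat \<Rightarrow> ('o, 'a) sobj \<Rightarrow> ('o, 'a) sobj" where
  "Lambda C X = K_ob C (to_pt C X) (to_pt C X)"

definition Lambda_incyl :: "('o, 'a) cat \<Rightarrow> ('o, 'a) sobj \<Rightarrow> ('o, 'a) smap" where
  "Lambda_incyl C X = K_incyl C (to_pt C X) (to_pt C X)"

definition Lambda_map :: "('o, 'a) cat \<Rightarrow> ('o, 'a) smap \<Rightarrow> ('o, 'a) smap" where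
  "Lambda_map C x = K_map C (to_pt C (NSrc x)) (to_pt C (NSrc x)) (to_pt C (NTgt x)) (to_pt C (NTgt x))
     x (Ident (Simp C) (zero_ob (Simp C))) (Ident (Simp C) (zero_ob (Simp C)))"

definition simplicial_suspension :: "('o, 'a) cat \<Rightarrow> ('o, 'a) smap set \<Rightarrow>
    (('o, 'a) sobj, ('o, 'a) smap, (('o, 'a) sobj, ('o, 'a) smap) loc_arrow) suspension" where
  "simplicial_suspension C W = \<lparr>
     cyl = scyl C, cyl0 = scyl_d C 0, cyl1 = scyl_d C 1, cylp = scyl_s C,
     sus = Lambda C, susq = Lambda_incyl C,
     susl = loc_extend (localization (Simp C) W) (Lambda C)
              (\<lambda>x. loc_arr (Simp C) W (Lambda_map C x))\<rparr>"

definition Theta_alpha :: "('o, 'a) cat \<Rightarrow> ('o, 'a) smap \<Rightarrow> ('o, 'a) smap" where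
  "Theta_alpha C F = Cone_map C (Cyl_in C F) F (Ident (Simp C) (NSrc F)) (Cyl_proj C F)"

definition Cyl_to_Cone :: "('o, 'a) cat \<Rightarrow> ('o, 'a) smap \<Rightarrow> ('o, 'a) smap" where
  "Cyl_to_Cone C F = K_map C F (Ident (Simp C) (NSrc F)) F (to_pt C (NSrc F))
     (Ident (Simp C) (NSrc F)) (Ident (Simp C) (NTgt F)) (to_pt C (NSrc F))"

text \<open>The canonical isomorphism \<open>Cone(X \<rightarrow> \<ast> \<rightarrow> Z) \<rightarrow> Z \<squnion> \<Lambda>(X)\<close>.\<close>

definition Cone_zero_iso ::
  "('o, 'a) cat \<Rightarrow> ('o, 'a) sobj \<Rightarrow> ('o, 'a) sobj \<Rightarrow> ('o, 'a) smap" where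
  "Cone_zero_iso C X Z = K_desc C (zero_arr (Simp C) X Z) (to_pt C X)
     (in1 (Simp C) Z (Lambda C X))
     (from_zero (Simp C) (coprod_ob (Simp C) Z (Lambda C X)))
     (in2 (Simp C) Z (Lambda C X) \<cdot>\<^bsub>Simp C\<^esub> Lambda_incyl C X)"

definition Theta_beta :: "('o, 'a) cat \<Rightarrow> ('o, 'a) smap \<Rightarrow> ('o, 'a) smap" where
  "Theta_beta C F = Cone_zero_iso C (NSrc F) (Cone C F) \<cdot>\<^bsub>Simp C\<^esub>
     Cone_map C (Cyl_in C F) (zero_arr (Simp C) (NSrc F) (Cone C F))
       (Ident (Simp C) (NSrc F)) (Cyl_to_Cone C F)"

definition simplicial_coaction :: "('o, 'a) cat \<Rightarrow> ('o, 'a) smap set \<Rightarrow> ('o, 'a) smap \<Rightarrow>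
    (('o, 'a) sobj, ('o, 'a) smap) loc_arrow" where
  "simplicial_coaction C W F = (let L = localization (Simp C) W; Q = loc_arr (Simp C) W in
     Q (Theta_beta C F) \<cdot>\<^bsub>L\<^esub> inv_arr L (Q (Theta_alpha C F)))"

definition simplicial_distinguished_triangle :: "('o, 'a) cat \<Rightarrow> ('o, 'a) smap set \<Rightarrow>
    (('o, 'a) sobj, (('o, 'a) sobj, ('o, 'a) smap) loc_arrow) copair \<Rightarrow> bool" where
  "simplicial_distinguished_triangle C W T \<longleftrightarrow>
     (\<exists>F\<in>Arr (Simp C). copair_iso (Simp C) W (simplicial_suspension C W) T
        \<lparr>PX = NSrc F, PY = NTgt F, PZ = Cone C F,
         Pf = loc_arr (Simp C) W F, Pg = loc_arr (Simp C) W (Cone_in C F),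
         Ph = simplicial_coaction C W F\<rparr>)"

end

theory Submission
  imports Defs
begin

text \<open>
  All homotopical input comes from the double mapping cylinders \<open>K(F, G)\<close>. In degree \<open>n\<close> such an object
  is a coproduct of \<open>Y\<^sub>n\<close>, \<open>Z\<^sub>n\<close> and finitely many copies of \<open>X\<^sub>n\<close>, so \<open>K(F, G)\<close> is the diagonal of a
  bisimplicial object whose rows are finite coproducts of \<open>X\<close>, \<open>Y\<close> and \<open>Z\<close>; closedness under diagonals
  and coproducts makes \<open>K\<close> homotopy invariant. If \<open>F\<close> is a termwise coprojection, the columns of this
  bisimplicial object contract onto the pushout \<open>Y \<union>\<^sub>X Z\<close>, whence \<open>K(F, G) \<rightarrow> Y \<union>\<^sub>X Z\<close> is a weak
  equivalence and trivial cofibrations are stable under pushout.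

  For a cofibration \<open>i\<close> with cofiber \<open>Z\<close>, this gives a weak equivalence \<open>\<pi> : Cone(i) \<rightarrow> Z\<close>, and the two
  coactions correspond under it: with \<open>\<phi> : Cone(i) \<rightarrow> P\<close> induced by \<open>j\<^sub>0\<close> and \<open>Cyl X \<rightarrow> Cyl Y \<rightarrow> P\<close>, one has
  \<open>[j\<^sub>0, k] (\<pi> \<squnion> 1) \<beta> = \<phi> \<alpha>\<close> strictly, and \<open>\<phi>\<close> and \<open>j\<^sub>1 \<pi>\<close> agree in the localization because both factor
  through \<open>Cone(Cyl X \<rightarrow> Cyl Y)\<close>, along two sections of a single weak equivalence. Finally the triangle of
  an arbitrary \<open>F\<close> is isomorphic to that of the cofibration \<open>X \<rightarrow> Cyl(F)\<close>.
\<close>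

section \<open>Categories and colimits\<close>

text \<open>Beyond finite coproducts \<open>C\<close> is not assumed to have colimits, so each
  pushout must be recognised as a coproduct in every degree, and pushouts of simplicial objects are
  understood only where this succeeds. Hence colimits appear as predicates, with degreewise
  existence as a hypothesis. The complements of a termwise coprojection need not form a simplicial
  object; pushouts along it are therefore studied in columns, which are constant simplicial objects,
  while homotopy invariance, which involves no splitting, is read off the rows. The contraction of
  the cylinder is multiplication by the minimum on the standard 1-simplex. It is a homotopy in both
  directions of the double cylinder, and its four boundary identities return when the two maps from
  the cone to \<open>P\<close> are compared. Two facts about the localization have to be earned:
  coproducts stay coproducts, since the map of coproducts in \<open>copair_iso\<close> is defined
  there by description, and suspension is a functor. Comparisons of triangles are arranged to be the
  identity on \<open>X\<close>, so that the suspension never has to be computed on a new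
  arrow.\<close>

lemma homD:
  "f \<in> hom C x y \<Longrightarrow> f \<in> Arr C" "f \<in> hom C x y \<Longrightarrow> Dom C f = x" "f \<in> hom C x y \<Longrightarrow> Cod C f = y"
  by (simp_all add: hom_def)

context category begin

lemma comp_arr [simp]:
  assumes "f \<in> Arr C" "g \<in> Arr C" "Dom C g = Cod C f"
  shows "g \<cdot>\<^bsub>C\<^esub> f \<in> Arr C" "Dom C (g \<cdot>\<^bsub>C\<^esub> f) = Dom C f" "Cod C (g \<cdot>\<^bsub>C\<^esub> f) = Cod C g"
  using Comp_in_hom[of f "Dom C f" "Cod C f" g "Cod C g"] assms by (simp_all add: hom_def)

lemma comp_assoc [simp]:
  assumes "f \<in> Arr C" "g \<in> Arr C" "h \<in> Arr C" "Dom C g = Cod C f" "Dom C h = Cod C g"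
  shows "(h \<cdot>\<^bsub>C\<^esub> g) \<cdot>\<^bsub>C\<^esub> f = h \<cdot>\<^bsub>C\<^esub> (g \<cdot>\<^bsub>C\<^esub> f)"
  using Comp_assoc[of f "Dom C f" "Cod C f" g "Cod C g" h "Cod C h"] assms by (simp add: hom_def)

lemma Ident_arr [simp]:
  assumes "x \<in> Obj C"
  shows "Ident C x \<in> Arr C" "Dom C (Ident C x) = x" "Cod C (Ident C x) = x"
  using Ident_in_hom[OF assms] by (simp_all add: hom_def)

lemma comp_Ident [simp]: "f \<in> Arr C \<Longrightarrow> Dom C f = x \<Longrightarrow> f \<cdot>\<^bsub>C\<^esub> Ident C x = f"
  using Comp_Ident[of f x "Cod C f"] by (simp add: hom_def)

lemma Ident_comp [simp]: "f \<in> Arr C \<Longrightarrow> Cod C f = x \<Longrightarrow> Ident C x \<cdot>\<^bsub>C\<^esub> f = f"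
  using Ident_Comp[of f "Dom C f" x] by (simp add: hom_def)

lemma Dom_obj [simp]: "f \<in> Arr C \<Longrightarrow> Dom C f \<in> Obj C"
  and Cod_obj [simp]: "f \<in> Arr C \<Longrightarrow> Cod C f \<in> Obj C"
  by (auto intro: Dom_in_Obj Cod_in_Obj)

lemma hom_obj: "f \<in> hom C x y \<Longrightarrow> x \<in> Obj C" "f \<in> hom C x y \<Longrightarrow> y \<in> Obj C"
  by (auto simp: hom_def)

text \<open>Composites are kept right-nested by \<open>comp_assoc\<close>, which hides a known
  composite of \<open>g\<close> and \<open>f\<close> as soon as something precedes \<open>f\<close>.
  This is the form in which such an equation can still be applied in front of a further arrow
  \<open>k\<close>; \<open>comp_ext2\<close> does the same for commutative squares.\<close>

lemma comp_ext:
  assumes "g \<cdot>\<^bsub>C\<^esub> f = h" "f \<in> Arr C" "g \<in> Arr C" "Dom C g = Cod C f" "k \<in> Arr C" "Dom C f = Cod C k"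
  shows "g \<cdot>\<^bsub>C\<^esub> (f \<cdot>\<^bsub>C\<^esub> k) = h \<cdot>\<^bsub>C\<^esub> k"
  using assms by (metis comp_assoc)

lemma comp_ext2:
  assumes "g \<cdot>\<^bsub>C\<^esub> f = h \<cdot>\<^bsub>C\<^esub> h'" "f \<in> Arr C" "g \<in> Arr C" "Dom C g = Cod C f" "k \<in> Arr C" "Dom C f = Cod C k"
    "h \<in> Arr C" "h' \<in> Arr C" "Dom C h = Cod C h'"
  shows "g \<cdot>\<^bsub>C\<^esub> (f \<cdot>\<^bsub>C\<^esub> k) = h \<cdot>\<^bsub>C\<^esub> (h' \<cdot>\<^bsub>C\<^esub> k)"
  using assms comp_ext[OF assms(1-6)] by (metis comp_arr(2) comp_assoc)

lemma inverse_arrs_unique: "inverse_arrs C f g \<Longrightarrow> inverse_arrs C f h \<Longrightarrow> g = h"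
  unfolding inverse_arrs_def hom_def
  by clarsimp (metis comp_assoc comp_Ident Ident_comp)

lemma inv_arr_eqI: "inverse_arrs C f g \<Longrightarrow> inv_arr C f = g"
  unfolding inv_arr_def using inverse_arrs_unique by blast

lemma inv_arr_inverse: "is_iso C f \<Longrightarrow> inverse_arrs C f (inv_arr C f)"
  unfolding is_iso_def using inv_arr_eqI by blast

lemma iso_arr: "is_iso C f \<Longrightarrow> f \<in> Arr C"
  unfolding is_iso_def inverse_arrs_def by blast

lemma inv_arr_simps [simp]:
  assumes "is_iso C f"
  shows "inv_arr C f \<in> Arr C" "Dom C (inv_arr C f) = Cod C f" "Cod C (inv_arr C f) = Dom C f"
    "inv_arr C f \<cdot>\<^bsub>C\<^esub> f = Ident C (Dom C f)" "f \<cdot>\<^bsub>C\<^esub> inv_arr C f = Ident C (Cod C f)"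
  using inv_arr_inverse[OF assms] by (auto simp: inverse_arrs_def hom_def)

lemma isoI:
  assumes "f \<in> hom C x y" "g \<in> hom C y x" "g \<cdot>\<^bsub>C\<^esub> f = Ident C x" "f \<cdot>\<^bsub>C\<^esub> g = Ident C y"
  shows "is_iso C f" "inv_arr C f = g"
proof -
  have "inverse_arrs C f g" using assms by (auto simp: inverse_arrs_def hom_def)
  then show "is_iso C f" "inv_arr C f = g" by (auto simp: is_iso_def inv_arr_eqI)
qed

lemma iso_Ident [simp]: "x \<in> Obj C \<Longrightarrow> is_iso C (Ident C x)"
  by (rule isoI[where g="Ident C x" and x=x and y=x]) (auto simp: hom_def)

lemma iso_inv [simp]: "is_iso C f \<Longrightarrow> is_iso C (inv_arr C f)"
  by (rule isoI[where g=f and x="Cod C f" and y="Dom C f"]) (auto simp: hom_def iso_arr)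

lemma iso_comp:
  assumes "is_iso C f" "is_iso C g" "Dom C g = Cod C f"
  shows "is_iso C (g \<cdot>\<^bsub>C\<^esub> f)" "inv_arr C (g \<cdot>\<^bsub>C\<^esub> f) = inv_arr C f \<cdot>\<^bsub>C\<^esub> inv_arr C g"
proof -
  have [simp]: "f \<in> Arr C" "g \<in> Arr C" using assms iso_arr by auto
  have "inv_arr C g \<cdot>\<^bsub>C\<^esub> (g \<cdot>\<^bsub>C\<^esub> f) = f" "f \<cdot>\<^bsub>C\<^esub> (inv_arr C f \<cdot>\<^bsub>C\<^esub> inv_arr C g) = inv_arr C g"
    using assms comp_ext[OF inv_arr_simps(4)[OF assms(2)], of f]
      comp_ext[OF inv_arr_simps(5)[OF assms(1)], of "inv_arr C g"] by auto
  then show "is_iso C (g \<cdot>\<^bsub>C\<^esub> f)" "inv_arr C (g \<cdot>\<^bsub>C\<^esub> f) = inv_arr C f \<cdot>\<^bsub>C\<^esub> inv_arr C g"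
    using assms isoI[of "g \<cdot>\<^bsub>C\<^esub> f" "Dom C f" "Cod C g" "inv_arr C f \<cdot>\<^bsub>C\<^esub> inv_arr C g"]
    by (auto simp: hom_def)
qed

lemma iso_cancel_left:
  assumes "is_iso C f" "u \<in> Arr C" "v \<in> Arr C" "Cod C u = Dom C f" "Cod C v = Dom C f"
    "f \<cdot>\<^bsub>C\<^esub> u = f \<cdot>\<^bsub>C\<^esub> v"
  shows "u = v"
proof -
  have [simp]: "f \<in> Arr C" using assms iso_arr by auto
  have "inv_arr C f \<cdot>\<^bsub>C\<^esub> (f \<cdot>\<^bsub>C\<^esub> u) = u" "inv_arr C f \<cdot>\<^bsub>C\<^esub> (f \<cdot>\<^bsub>C\<^esub> v) = v"
    using assms(1-5) comp_ext[OF inv_arr_simps(4)[OF assms(1)]] by simp_all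
  then show ?thesis using assms(6) by metis
qed

lemma iso_cancel_right:
  assumes "is_iso C f" "u \<in> Arr C" "v \<in> Arr C" "Dom C u = Cod C f" "Dom C v = Cod C f"
    "u \<cdot>\<^bsub>C\<^esub> f = v \<cdot>\<^bsub>C\<^esub> f"
  shows "u = v"
proof -
  have [simp]: "f \<in> Arr C" using assms iso_arr by auto
  have "(u \<cdot>\<^bsub>C\<^esub> f) \<cdot>\<^bsub>C\<^esub> inv_arr C f = u" "(v \<cdot>\<^bsub>C\<^esub> f) \<cdot>\<^bsub>C\<^esub> inv_arr C f = v" using assms(1-5) by simp_all
  then show ?thesis using assms(6) by metis
qed

end

text \<open>
  A relation \<^term>\<open>(j, f, k, g)\<close> imposes \<open>h j \<circ> f = h k \<circ> g\<close> on a cocone \<open>h\<close>. Initial objects, coproducts,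
  pushouts and the gluing diagrams of \<open>K(F, G)\<close> are all colimits of this form.
\<close>

definition cocone :: "('o, 'a) cat \<Rightarrow> 'j set \<Rightarrow> ('j \<Rightarrow> 'o) \<Rightarrow> ('j \<times> 'a \<times> 'j \<times> 'a) set \<Rightarrow> 'o \<Rightarrow> ('j \<Rightarrow> 'a) \<Rightarrow> bool" where
  "cocone C J D R t h \<longleftrightarrow> (\<forall>j\<in>J. h j \<in> hom C (D j) t) \<and>
     (\<forall>j f k g. (j, f, k, g) \<in> R \<longrightarrow> h j \<cdot>\<^bsub>C\<^esub> f = h k \<cdot>\<^bsub>C\<^esub> g)"

definition diagram :: "('o, 'a) cat \<Rightarrow> 'j set \<Rightarrow> ('j \<Rightarrow> 'o) \<Rightarrow> ('j \<times> 'a \<times> 'j \<times> 'a) set \<Rightarrow> bool" where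
  "diagram C J D R \<longleftrightarrow> (\<forall>j\<in>J. D j \<in> Obj C) \<and>
     (\<forall>j f k g. (j, f, k, g) \<in> R \<longrightarrow> j \<in> J \<and> k \<in> J \<and> f \<in> Arr C \<and> g \<in> Arr C \<and>
        Dom C f = Dom C g \<and> Cod C f = D j \<and> Cod C g = D k)"

definition is_colim :: "('o, 'a) cat \<Rightarrow> 'j set \<Rightarrow> ('j \<Rightarrow> 'o) \<Rightarrow> ('j \<times> 'a \<times> 'j \<times> 'a) set \<Rightarrow> 'o \<Rightarrow> ('j \<Rightarrow> 'a) \<Rightarrow> bool" where
  "is_colim C J D R p c \<longleftrightarrow> diagram C J D R \<and> p \<in> Obj C \<and> cocone C J D R p c \<and>
     (\<forall>t\<in>Obj C. \<forall>h. cocone C J D R t h \<longrightarrow> (\<exists>!u. u \<in> hom C p t \<and> (\<forall>j\<in>J. u \<cdot>\<^bsub>C\<^esub> c j = h j)))"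

lemma is_colimD:
  assumes "is_colim C J D R p c"
  shows "diagram C J D R" "p \<in> Obj C" "cocone C J D R p c"
    "j \<in> J \<Longrightarrow> D j \<in> Obj C" "j \<in> J \<Longrightarrow> c j \<in> hom C (D j) p"
  using assms by (auto simp: is_colim_def diagram_def cocone_def)

lemma colim_desc:
  assumes "is_colim C J D R p c" "t \<in> Obj C" "cocone C J D R t h"
  obtains u where "u \<in> hom C p t" "\<And>j. j \<in> J \<Longrightarrow> u \<cdot>\<^bsub>C\<^esub> c j = h j"
  using assms unfolding is_colim_def by blast

context category begin

lemma cocone_comp:
  assumes "diagram C J D R" "cocone C J D R p c" "u \<in> hom C p t"
  shows "cocone C J D R t (\<lambda>j. u \<cdot>\<^bsub>C\<^esub> c j)"
  unfolding cocone_def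
proof (intro conjI ballI allI impI)
  show "u \<cdot>\<^bsub>C\<^esub> c j \<in> hom C (D j) t" if "j \<in> J" for j
    using assms that by (auto simp: cocone_def hom_def)
  show "(u \<cdot>\<^bsub>C\<^esub> c j) \<cdot>\<^bsub>C\<^esub> f = (u \<cdot>\<^bsub>C\<^esub> c k) \<cdot>\<^bsub>C\<^esub> g" if "(j, f, k, g) \<in> R" for j f k g
  proof -
    have "j \<in> J" "k \<in> J" "f \<in> Arr C" "g \<in> Arr C" "Cod C f = D j" "Cod C g = D k" "c j \<cdot>\<^bsub>C\<^esub> f = c k \<cdot>\<^bsub>C\<^esub> g"
      using assms that unfolding diagram_def cocone_def by blast+
    moreover have "c j \<in> hom C (D j) p" "c k \<in> hom C (D k) p"
      using assms \<open>j \<in> J\<close> \<open>k \<in> J\<close> by (auto simp: cocone_def)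
    ultimately show ?thesis using assms(3) by (simp add: hom_def)
  qed
qed

lemma colim_eqI:
  assumes "is_colim C J D R p c" "u \<in> hom C p t" "v \<in> hom C p t" "\<And>j. j \<in> J \<Longrightarrow> u \<cdot>\<^bsub>C\<^esub> c j = v \<cdot>\<^bsub>C\<^esub> c j"
  shows "u = v"
proof -
  have "cocone C J D R t (\<lambda>j. v \<cdot>\<^bsub>C\<^esub> c j)"
    using cocone_comp is_colimD[OF assms(1)] assms by blast
  moreover have "t \<in> Obj C" using assms hom_obj by blast
  ultimately have "\<exists>!w. w \<in> hom C p t \<and> (\<forall>j\<in>J. w \<cdot>\<^bsub>C\<^esub> c j = v \<cdot>\<^bsub>C\<^esub> c j)"
    using assms(1) unfolding is_colim_def by blast
  then show ?thesis using assms by blast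
qed

lemma is_colimI:
  assumes "diagram C J D R" "p \<in> Obj C" "cocone C J D R p c"
    "\<And>t h. t \<in> Obj C \<Longrightarrow> cocone C J D R t h \<Longrightarrow> \<exists>u. u \<in> hom C p t \<and> (\<forall>j\<in>J. u \<cdot>\<^bsub>C\<^esub> c j = h j)"
    "\<And>t u v. u \<in> hom C p t \<Longrightarrow> v \<in> hom C p t \<Longrightarrow> (\<And>j. j \<in> J \<Longrightarrow> u \<cdot>\<^bsub>C\<^esub> c j = v \<cdot>\<^bsub>C\<^esub> c j) \<Longrightarrow> u = v"
  shows "is_colim C J D R p c"
  unfolding is_colim_def
proof (intro conjI ballI allI impI)
  fix t h assume "t \<in> Obj C" "cocone C J D R t h"
  with assms(4) obtain u where "u \<in> hom C p t" "\<forall>j\<in>J. u \<cdot>\<^bsub>C\<^esub> c j = h j" by blast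
  moreover have "v = u" if "v \<in> hom C p t \<and> (\<forall>j\<in>J. v \<cdot>\<^bsub>C\<^esub> c j = h j)" for v
    using assms(5)[of v t u] that calculation by auto
  ultimately show "\<exists>!u. u \<in> hom C p t \<and> (\<forall>j\<in>J. u \<cdot>\<^bsub>C\<^esub> c j = h j)" by blast
qed (use assms in auto)

lemma colim_iso:
  assumes "is_colim C J D R p c" "is_colim C J D R q e"
  obtains u where "u \<in> hom C p q" "is_iso C u" "\<And>j. j \<in> J \<Longrightarrow> u \<cdot>\<^bsub>C\<^esub> c j = e j"
proof -
  note P = is_colimD[OF assms(1)] and Q = is_colimD[OF assms(2)]
  obtain u where u: "u \<in> hom C p q" "\<And>j. j \<in> J \<Longrightarrow> u \<cdot>\<^bsub>C\<^esub> c j = e j"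
    using colim_desc[OF assms(1) Q(2,3)] by blast
  obtain v where v: "v \<in> hom C q p" "\<And>j. j \<in> J \<Longrightarrow> v \<cdot>\<^bsub>C\<^esub> e j = c j"
    using colim_desc[OF assms(2) P(2,3)] by blast
  have "v \<cdot>\<^bsub>C\<^esub> u = Ident C p"
    by (rule colim_eqI[OF assms(1)]) (use u v P in \<open>auto simp: hom_def\<close>)
  moreover have "u \<cdot>\<^bsub>C\<^esub> v = Ident C q"
    by (rule colim_eqI[OF assms(2)]) (use u v Q in \<open>auto simp: hom_def\<close>)
  ultimately have "is_iso C u" using isoI u v by blast
  then show thesis using that u by blast
qed

text \<open>The cocone \<open>e\<close> need only agree on \<open>J\<close> with the transported
  one, so its relations are derived afresh; the factorisations are those through \<open>p\<close>,
  preceded by the inverse of \<open>u\<close>.\<close>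

lemma colim_transport:
  assumes "is_colim C J D R p c" "u \<in> hom C p q" "is_iso C u" "\<And>j. j \<in> J \<Longrightarrow> u \<cdot>\<^bsub>C\<^esub> c j = e j"
  shows "is_colim C J D R q e"
proof (rule is_colimI)
  note P = is_colimD[OF assms(1)]
  show "diagram C J D R" by (rule P)
  show "q \<in> Obj C" using assms hom_obj by blast
  have "cocone C J D R q (\<lambda>j. u \<cdot>\<^bsub>C\<^esub> c j)" using cocone_comp P assms by blast
  then show "cocone C J D R q e"
    using assms(4) P(1) unfolding cocone_def diagram_def by (metis (full_types))
  show "\<exists>w. w \<in> hom C q t \<and> (\<forall>j\<in>J. w \<cdot>\<^bsub>C\<^esub> e j = h j)" if t: "t \<in> Obj C" "cocone C J D R t h" for t h
  proof -
    obtain w where w: "w \<in> hom C p t" "\<And>j. j \<in> J \<Longrightarrow> w \<cdot>\<^bsub>C\<^esub> c j = h j"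
      using colim_desc[OF assms(1) t] by blast
    have "(w \<cdot>\<^bsub>C\<^esub> inv_arr C u) \<cdot>\<^bsub>C\<^esub> e j = h j" if "j \<in> J" for j
      using w(1) w(2)[OF that] assms(2,3) assms(4)[OF that, symmetric] P(5)[OF that]
        comp_ext[OF inv_arr_simps(4)[OF assms(3)], of "c j"] by (simp add: hom_def)
    then show ?thesis using w assms by (intro exI[of _ "w \<cdot>\<^bsub>C\<^esub> inv_arr C u"]) (auto simp: hom_def)
  qed
  show "f = g" if "f \<in> hom C q t" "g \<in> hom C q t" "\<And>j. j \<in> J \<Longrightarrow> f \<cdot>\<^bsub>C\<^esub> e j = g \<cdot>\<^bsub>C\<^esub> e j" for t f g
  proof -
    have "f \<cdot>\<^bsub>C\<^esub> u = g \<cdot>\<^bsub>C\<^esub> u"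
    proof (rule colim_eqI[OF assms(1)])
      show "f \<cdot>\<^bsub>C\<^esub> u \<in> hom C p t" "g \<cdot>\<^bsub>C\<^esub> u \<in> hom C p t" using that assms by (auto simp: hom_def)
      show "(f \<cdot>\<^bsub>C\<^esub> u) \<cdot>\<^bsub>C\<^esub> c j = (g \<cdot>\<^bsub>C\<^esub> u) \<cdot>\<^bsub>C\<^esub> c j" if j: "j \<in> J" for j
        using \<open>f \<in> _\<close> \<open>g \<in> _\<close> assms(2) assms(4)[OF j] P(5)[OF j] \<open>\<And>j. j \<in> J \<Longrightarrow> f \<cdot>\<^bsub>C\<^esub> e j = g \<cdot>\<^bsub>C\<^esub> e j\<close>[OF j]
        by (simp add: hom_def)
    qed
    then show ?thesis using iso_cancel_right[OF assms(3), of f g] that assms(2) by (simp add: hom_def)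
  qed
qed

subsection \<open>Special cases\<close>

lemma initial_iff_colim: "is_initial C z \<longleftrightarrow> is_colim C ({} :: bool set) D {} z c"
  by (auto simp: is_initial_def is_colim_def diagram_def cocone_def)

lemma family_iff_colim: "is_coprod_family C S A p c \<longleftrightarrow> is_colim C S A {} p c"
  by (auto simp: is_coprod_family_def is_colim_def diagram_def cocone_def)

text \<open>Indexing by \<open>bool\<close> lets statements proved once for \<open>is_colim\<close>,
  in particular that colimits of functors are degreewise, apply to binary coproducts.
  \<open>True\<close> stands for the first summand.\<close>

lemma coprod_iff_colim:
  "is_coprod C x y p i j \<longleftrightarrow> is_colim C UNIV (case_bool x y) {} p (case_bool i j)"
proof
  assume *: "is_coprod C x y p i j"
  then have obs: "x \<in> Obj C" "y \<in> Obj C" "p \<in> Obj C" "i \<in> hom C x p" "j \<in> hom C y p"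
    by (simp_all add: is_coprod_def)
  show "is_colim C UNIV (case_bool x y) {} p (case_bool i j)"
    unfolding is_colim_def diagram_def cocone_def
  proof (intro conjI ballI allI impI; (elim conjE)?)
    fix t h assume t: "t \<in> Obj C" and h: "\<forall>b\<in>UNIV. h b \<in> hom C (case b of True \<Rightarrow> x | False \<Rightarrow> y) t"
    have "h True \<in> hom C x t" "h False \<in> hom C y t" using h[rule_format, of True] h[rule_format, of False] by auto
    then have "\<exists>!u. u \<in> hom C p t \<and> u \<cdot>\<^bsub>C\<^esub> i = h True \<and> u \<cdot>\<^bsub>C\<^esub> j = h False"
      using * t unfolding is_coprod_def by blast
    then show "\<exists>!u. u \<in> hom C p t \<and> (\<forall>b\<in>UNIV. u \<cdot>\<^bsub>C\<^esub> (case b of True \<Rightarrow> i | False \<Rightarrow> j) = h b)"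
      by (simp add: all_bool_eq)
  qed (use obs in \<open>auto split: bool.splits\<close>)
next
  assume *: "is_colim C UNIV (case_bool x y) {} p (case_bool i j)"
  have "\<exists>!u. u \<in> hom C p t \<and> u \<cdot>\<^bsub>C\<^esub> i = f \<and> u \<cdot>\<^bsub>C\<^esub> j = g"
    if "t \<in> Obj C" "f \<in> hom C x t" "g \<in> hom C y t" for t f g
  proof -
    have "cocone C UNIV (case_bool x y) {} t (case_bool f g)"
      using that by (auto simp: cocone_def split: bool.splits)
    then have "\<exists>!u. u \<in> hom C p t \<and> (\<forall>b\<in>UNIV. u \<cdot>\<^bsub>C\<^esub> (case b of True \<Rightarrow> i | False \<Rightarrow> j) = case_bool f g b)"
      using * that(1) unfolding is_colim_def by blast
    then show ?thesis by (simp add: all_bool_eq)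
  qed
  moreover have "x \<in> Obj C" "y \<in> Obj C" "i \<in> hom C x p" "j \<in> hom C y p"
    using is_colimD(4,5)[OF *, of True] is_colimD(4,5)[OF *, of False] by auto
  ultimately show "is_coprod C x y p i j"
    using is_colimD(2)[OF *] unfolding is_coprod_def by simp
qed

lemma pushout_iff_colim:
  "is_pushout C f g d p q \<longleftrightarrow> Dom C f = Dom C g \<and> f \<in> Arr C \<and> g \<in> Arr C \<and>
     is_colim C UNIV (case_bool (Cod C f) (Cod C g)) {(True, f, False, g)} d (case_bool p q)"
proof
  assume *: "is_pushout C f g d p q"
  then have obs: "f \<in> Arr C" "g \<in> Arr C" "Dom C f = Dom C g" "d \<in> Obj C" "p \<in> hom C (Cod C f) d"
    "q \<in> hom C (Cod C g) d" "p \<cdot>\<^bsub>C\<^esub> f = q \<cdot>\<^bsub>C\<^esub> g"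
    by (simp_all add: is_pushout_def)
  have "is_colim C UNIV (case_bool (Cod C f) (Cod C g)) {(True, f, False, g)} d (case_bool p q)"
    unfolding is_colim_def diagram_def cocone_def
  proof (intro conjI ballI allI impI; (elim conjE)?)
    fix t h assume t: "t \<in> Obj C"
      and h: "\<forall>b\<in>UNIV. h b \<in> hom C (case b of True \<Rightarrow> Cod C f | False \<Rightarrow> Cod C g) t"
        "\<forall>j f' k g'. (j, f', k, g') \<in> {(True, f, False, g)} \<longrightarrow> h j \<cdot>\<^bsub>C\<^esub> f' = h k \<cdot>\<^bsub>C\<^esub> g'"
    have "h True \<in> hom C (Cod C f) t" "h False \<in> hom C (Cod C g) t" "h True \<cdot>\<^bsub>C\<^esub> f = h False \<cdot>\<^bsub>C\<^esub> g"
      using h(1)[rule_format, of True] h(1)[rule_format, of False] h(2) by auto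
    then have "\<exists>!u. u \<in> hom C d t \<and> u \<cdot>\<^bsub>C\<^esub> p = h True \<and> u \<cdot>\<^bsub>C\<^esub> q = h False"
      using * t unfolding is_pushout_def by blast
    then show "\<exists>!u. u \<in> hom C d t \<and> (\<forall>b\<in>UNIV. u \<cdot>\<^bsub>C\<^esub> (case b of True \<Rightarrow> p | False \<Rightarrow> q) = h b)"
      by (simp add: all_bool_eq)
  qed (use obs in \<open>auto split: bool.splits\<close>)
  then show "Dom C f = Dom C g \<and> f \<in> Arr C \<and> g \<in> Arr C \<and>
     is_colim C UNIV (case_bool (Cod C f) (Cod C g)) {(True, f, False, g)} d (case_bool p q)"
    using obs by blast
next
  assume A: "Dom C f = Dom C g \<and> f \<in> Arr C \<and> g \<in> Arr C \<and>
     is_colim C UNIV (case_bool (Cod C f) (Cod C g)) {(True, f, False, g)} d (case_bool p q)"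
  then have *: "is_colim C UNIV (case_bool (Cod C f) (Cod C g)) {(True, f, False, g)} d (case_bool p q)" by blast
  have "\<exists>!u. u \<in> hom C d t \<and> u \<cdot>\<^bsub>C\<^esub> p = h \<and> u \<cdot>\<^bsub>C\<^esub> q = k"
    if "t \<in> Obj C" "h \<in> hom C (Cod C f) t" "k \<in> hom C (Cod C g) t" "h \<cdot>\<^bsub>C\<^esub> f = k \<cdot>\<^bsub>C\<^esub> g" for t h k
  proof -
    have "cocone C UNIV (case_bool (Cod C f) (Cod C g)) {(True, f, False, g)} t (case_bool h k)"
      using that by (auto simp: cocone_def split: bool.splits)
    then have "\<exists>!u. u \<in> hom C d t \<and> (\<forall>b\<in>UNIV. u \<cdot>\<^bsub>C\<^esub> (case b of True \<Rightarrow> p | False \<Rightarrow> q) = case_bool h k b)"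
      using * that(1) unfolding is_colim_def by blast
    then show ?thesis by (simp add: all_bool_eq)
  qed
  moreover have "p \<in> hom C (Cod C f) d" "q \<in> hom C (Cod C g) d"
    using is_colimD(5)[OF *, of True] is_colimD(5)[OF *, of False] by auto
  moreover have "p \<cdot>\<^bsub>C\<^esub> f = q \<cdot>\<^bsub>C\<^esub> g" using is_colimD(3)[OF *] by (auto simp: cocone_def)
  ultimately show "is_pushout C f g d p q"
    using A is_colimD(2)[OF *] unfolding is_pushout_def by simp
qed

end

section \<open>Localization\<close>

abbreviation zz :: "('o, 'a) cat \<Rightarrow> 'a set \<Rightarrow> 'o \<Rightarrow> 'o \<Rightarrow> 'a zigzag_step list \<Rightarrow> ('o, 'a) loc_arrow" where
  "zz C W x y s \<equiv> (x, y, zigzag_class C W x y s)"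

lemma zigzag_class_eqI: "equivclp (zigzag_red C W x y) s t \<Longrightarrow> zigzag_class C W x y s = zigzag_class C W x y t"
  unfolding zigzag_class_def by (auto intro: equivclp_trans equivclp_sym)

lemma loc_simps [simp]:
  "Obj (localization C W) = Obj C" "Dom (localization C W) (x, y, A) = x" "Cod (localization C W) (x, y, A) = y"
  "Ident (localization C W) x = zz C W x x []"
  by (simp_all add: localization_def)

context category begin

lemma zigzag_obj: "zigzag C W x s y \<Longrightarrow> x \<in> Obj C \<and> y \<in> Obj C"
proof (induction s arbitrary: x)
  case (Cons a s) then show ?case by (cases a) auto
qed simp

lemma zigzag_append: "zigzag C W x (s @ t) z \<longleftrightarrow> (\<exists>y. zigzag C W x s y \<and> zigzag C W y t z)"
proof (induction s arbitrary: x)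
  case Nil then show ?case using zigzag_obj by auto
next
  case (Cons a s) then show ?case by (cases a) auto
qed

lemma zigzag_red_zigzag:
  assumes "zigzag_red C W x y s t" shows "zigzag C W x s y" "zigzag C W x t y"
  using assms by (induction; auto simp: zigzag_append)+

lemma zigzag_equiv: "equivclp (zigzag_red C W x y) s t \<Longrightarrow> zigzag C W x s y \<Longrightarrow> zigzag C W x t y"
  by (induction rule: equivclp_induct) (auto dest: zigzag_red_zigzag)

text \<open>Reductions may be whiskered on either side. Together with
  \<open>zigzag_red_prepend\<close> this makes the generated equivalence a congruence for
  concatenation.\<close>

lemma zigzag_red_append:
  assumes "zigzag_red C W x y s s'" "zigzag C W y t z"
  shows "zigzag_red C W x z (s @ t) (s' @ t)"
  using assms
proof (induction)
  case (red_Ident p a q)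
  then show ?case using zigzag_red.red_Ident[of C W x p a "q @ t" z] zigzag_append[of W x "p @ [Fwd (Ident C a)] @ q" t z] by auto
next
  case (red_Comp p f g q)
  then show ?case using zigzag_red.red_Comp[of C W x p f g "q @ t" z] zigzag_append[of W x "p @ [Fwd f, Fwd g] @ q" t z] by auto
next
  case (red_Fwd_Bwd p w q)
  then show ?case using zigzag_red.red_Fwd_Bwd[of C W x p w "q @ t" z] zigzag_append[of W x "p @ [Fwd w, Bwd w] @ q" t z] by auto
next
  case (red_Bwd_Fwd p w q)
  then show ?case using zigzag_red.red_Bwd_Fwd[of C W x p w "q @ t" z] zigzag_append[of W x "p @ [Bwd w, Fwd w] @ q" t z] by auto
qed

lemma zigzag_red_prepend:
  assumes "zigzag_red C W y z s s'" "zigzag C W x t y"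
  shows "zigzag_red C W x z (t @ s) (t @ s')"
  using assms
proof (induction)
  case (red_Ident p a q)
  then show ?case using zigzag_red.red_Ident[of C W x "t @ p" a q z] zigzag_append[of W x t "p @ [Fwd (Ident C a)] @ q" z] by auto
next
  case (red_Comp p f g q)
  then show ?case using zigzag_red.red_Comp[of C W x "t @ p" f g q z] zigzag_append[of W x t "p @ [Fwd f, Fwd g] @ q" z] by auto
next
  case (red_Fwd_Bwd p w q)
  then show ?case using zigzag_red.red_Fwd_Bwd[of C W x "t @ p" w q z] zigzag_append[of W x t "p @ [Fwd w, Bwd w] @ q" z] by auto
next
  case (red_Bwd_Fwd p w q)
  then show ?case using zigzag_red.red_Bwd_Fwd[of C W x "t @ p" w q z] zigzag_append[of W x t "p @ [Bwd w, Fwd w] @ q" z] by auto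
qed

lemma zigzag_equiv_append:
  assumes "equivclp (zigzag_red C W x y) s s'" "equivclp (zigzag_red C W y z) t t'"
    "zigzag C W x s y" "zigzag C W y t z"
  shows "equivclp (zigzag_red C W x z) (s @ t) (s' @ t')"
proof -
  have "equivclp (zigzag_red C W x z) (s @ t) (s' @ t)"
    using assms(1) by (induction rule: equivclp_induct)
      (blast intro: equivclp_trans r_into_equivclp converse_r_into_equivclp zigzag_red_append assms(4) equivclp_refl)+
  moreover have z: "zigzag C W x s' y" using zigzag_equiv assms by blast
  have "equivclp (zigzag_red C W x z) (s' @ t) (s' @ t')"
    using assms(2) by (induction rule: equivclp_induct)
      (blast intro: equivclp_trans r_into_equivclp converse_r_into_equivclp zigzag_red_prepend z equivclp_refl)+
  ultimately show ?thesis by (rule equivclp_trans)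
qed

lemma loc_arrs: "u \<in> Arr (localization C W) \<longleftrightarrow> (\<exists>x y s. u = zz C W x y s \<and> zigzag C W x s y)"
  by (auto simp: localization_def)

lemma loc_hom: "u \<in> hom (localization C W) x y \<longleftrightarrow> (\<exists>s. u = zz C W x y s \<and> zigzag C W x s y)"
  by (auto simp: hom_def loc_arrs)

text \<open>Composition in \<open>localization\<close> is a union over all representatives of both
  factors. By \<open>zigzag_equiv_append\<close> all sets in that union are the same class, which is
  therefore the class of any single concatenation.\<close>

lemma loc_comp [simp]:
  assumes "zigzag C W x s y" "zigzag C W y t z"
  shows "zz C W y z t \<cdot>\<^bsub>localization C W\<^esub> zz C W x y s = zz C W x z (s @ t)"
proof -
  have "zigzag_class C W x z (s' @ t') = zigzag_class C W x z (s @ t)"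
    if "s' \<in> zigzag_class C W x y s" "t' \<in> zigzag_class C W y z t" for s' t'
    using that assms by (metis mem_Collect_eq zigzag_class_def zigzag_class_eqI zigzag_equiv_append)
  moreover have "s \<in> zigzag_class C W x y s" "t \<in> zigzag_class C W y z t"
    by (auto simp: zigzag_class_def)
  ultimately have "(\<Union>ss\<in>zigzag_class C W x y s. \<Union>tt\<in>zigzag_class C W y z t. zigzag_class C W x z (ss @ tt))
     = zigzag_class C W x z (s @ t)" by blast
  then show ?thesis by (simp add: localization_def)
qed

lemma category_loc: "category (localization C W)"
proof
  let ?L = "localization C W"
  show "Dom ?L f \<in> Obj ?L" "Cod ?L f \<in> Obj ?L" if "f \<in> Arr ?L" for f
    using that zigzag_obj by (auto simp: loc_arrs)
  show "Ident ?L x \<in> hom ?L x x" if "x \<in> Obj ?L" for x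
    using that by (auto simp: loc_hom intro: exI[of _ "[]"])
  show "g \<cdot>\<^bsub>?L\<^esub> f \<in> hom ?L x z" if "f \<in> hom ?L x y" "g \<in> hom ?L y z" for f g x y z
  proof -
    obtain s t where "f = zz C W x y s" "zigzag C W x s y" "g = zz C W y z t" "zigzag C W y t z"
      using \<open>f \<in> _\<close> \<open>g \<in> _\<close> loc_hom by meson
    then show ?thesis unfolding loc_hom by (intro exI[of _ "s @ t"]) (auto simp: zigzag_append)
  qed
  show "f \<cdot>\<^bsub>?L\<^esub> Ident ?L x = f" "Ident ?L y \<cdot>\<^bsub>?L\<^esub> f = f" if "f \<in> hom ?L x y" for f x y
  proof -
    obtain s where s: "f = zz C W x y s" "zigzag C W x s y"
      using \<open>f \<in> hom ?L x y\<close> unfolding loc_hom by blast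
    have o: "zigzag C W x [] x" "zigzag C W y [] y" using zigzag_obj[OF s(2)] by auto
    show "f \<cdot>\<^bsub>?L\<^esub> Ident ?L x = f" "Ident ?L y \<cdot>\<^bsub>?L\<^esub> f = f"
      using loc_comp[OF o(1) s(2)] loc_comp[OF s(2) o(2)] s(1) by simp_all
  qed
  show "(h \<cdot>\<^bsub>?L\<^esub> g) \<cdot>\<^bsub>?L\<^esub> f = h \<cdot>\<^bsub>?L\<^esub> (g \<cdot>\<^bsub>?L\<^esub> f)"
    if "f \<in> hom ?L w x" "g \<in> hom ?L x y" "h \<in> hom ?L y z" for f g h w x y z
  proof -
    obtain s t r where *: "f = zz C W w x s" "zigzag C W w s x" "g = zz C W x y t" "zigzag C W x t y"
      "h = zz C W y z r" "zigzag C W y r z"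
      using \<open>f \<in> _\<close> \<open>g \<in> _\<close> \<open>h \<in> _\<close> loc_hom by meson
    have "zigzag C W w (s @ t) y" "zigzag C W x (t @ r) z" using * zigzag_append by blast+
    with * show ?thesis by simp
  qed
qed

lemma loc_arr_hom: "f \<in> hom C x y \<Longrightarrow> loc_arr C W f \<in> hom (localization C W) x y"
  unfolding loc_hom by (auto simp: loc_arr_def hom_def intro: exI[of _ "[Fwd f]"])

lemma loc_arr_arr [simp]:
  assumes "f \<in> Arr C"
  shows "loc_arr C W f \<in> Arr (localization C W)" "Dom (localization C W) (loc_arr C W f) = Dom C f"
    "Cod (localization C W) (loc_arr C W f) = Cod C f"
  using loc_arr_hom[of f "Dom C f" "Cod C f"] assms by (auto simp: hom_def)

lemma loc_arr_comp:
  assumes "f \<in> Arr C" "g \<in> Arr C" "Dom C g = Cod C f"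
  shows "loc_arr C W (g \<cdot>\<^bsub>C\<^esub> f) = loc_arr C W g \<cdot>\<^bsub>localization C W\<^esub> loc_arr C W f"
proof -
  have z: "zigzag C W (Dom C f) [Fwd f] (Cod C f)" "zigzag C W (Cod C f) [Fwd g] (Cod C g)"
    "zigzag C W (Dom C f) ([] @ [Fwd f, Fwd g] @ []) (Cod C g)"
    using assms by auto
  have "zigzag_class C W (Dom C f) (Cod C g) [Fwd f, Fwd g] = zigzag_class C W (Dom C f) (Cod C g) [Fwd (g \<cdot>\<^bsub>C\<^esub> f)]"
    using zigzag_red.red_Comp[OF z(3)] by (intro zigzag_class_eqI r_into_equivclp) simp
  then show ?thesis using loc_comp[OF z(1,2)] assms by (simp add: loc_arr_def)
qed

lemma loc_arr_Ident:
  assumes "x \<in> Obj C" shows "loc_arr C W (Ident C x) = Ident (localization C W) x"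
proof -
  have "zigzag C W x ([] @ [Fwd (Ident C x)] @ []) x" using assms by auto
  from zigzag_red.red_Ident[OF this assms]
  have "zigzag_class C W x x [Fwd (Ident C x)] = zigzag_class C W x x []"
    by (intro zigzag_class_eqI r_into_equivclp) simp
  then show ?thesis using assms by (simp add: loc_arr_def)
qed

lemma loc_arr_iso:
  assumes "w \<in> W" "w \<in> Arr C"
  shows "is_iso (localization C W) (loc_arr C W w)"
    and "inv_arr (localization C W) (loc_arr C W w) = zz C W (Cod C w) (Dom C w) [Bwd w]"
proof -
  interpret L: category "localization C W" by (rule category_loc)
  have z: "zigzag C W (Dom C w) [Fwd w] (Cod C w)" "zigzag C W (Cod C w) [Bwd w] (Dom C w)"
    "zigzag C W (Dom C w) ([] @ [Fwd w, Bwd w] @ []) (Dom C w)"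
    "zigzag C W (Cod C w) ([] @ [Bwd w, Fwd w] @ []) (Cod C w)"
    using assms by auto
  have "zigzag_class C W (Dom C w) (Dom C w) [Fwd w, Bwd w] = zigzag_class C W (Dom C w) (Dom C w) []"
    using zigzag_red.red_Fwd_Bwd[OF z(3)] by (intro zigzag_class_eqI r_into_equivclp) simp
  moreover have "zigzag_class C W (Cod C w) (Cod C w) [Bwd w, Fwd w] = zigzag_class C W (Cod C w) (Cod C w) []"
    using zigzag_red.red_Bwd_Fwd[OF z(4)] by (intro zigzag_class_eqI r_into_equivclp) simp
  ultimately have *: "zz C W (Cod C w) (Dom C w) [Bwd w] \<cdot>\<^bsub>localization C W\<^esub> loc_arr C W w = Ident (localization C W) (Dom C w)"
    "loc_arr C W w \<cdot>\<^bsub>localization C W\<^esub> zz C W (Cod C w) (Dom C w) [Bwd w] = Ident (localization C W) (Cod C w)"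
    using loc_comp[OF z(1,2)] loc_comp[OF z(2,1)] by (simp_all add: loc_arr_def)
  have h: "loc_arr C W w \<in> hom (localization C W) (Dom C w) (Cod C w)"
    "zz C W (Cod C w) (Dom C w) [Bwd w] \<in> hom (localization C W) (Cod C w) (Dom C w)"
    using z(2) assms by (auto simp: loc_hom loc_arr_def)
  show "is_iso (localization C W) (loc_arr C W w)"
    "inv_arr (localization C W) (loc_arr C W w) = zz C W (Cod C w) (Dom C w) [Bwd w]"
    by (rule L.isoI[OF h *])+
qed

text \<open>A zigzag grows by one step at its end, so every arrow of the localization is reached
  from an identity by postcomposing with images of arrows of \<open>C\<close> and with inverses of
  images of \<open>W\<close>. Naturality known over \<open>C\<close> is extended to the localization
  in this way.\<close>

lemma loc_induct [consumes 1, case_names Ident Fwd Bwd]: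
  assumes "u \<in> hom (localization C W) x y"
    and "\<And>x. x \<in> Obj C \<Longrightarrow> P x x (Ident (localization C W) x)"
    and "\<And>x y z u f. u \<in> hom (localization C W) x y \<Longrightarrow> P x y u \<Longrightarrow> f \<in> hom C y z \<Longrightarrow>
      P x z (loc_arr C W f \<cdot>\<^bsub>localization C W\<^esub> u)"
    and "\<And>x y z u w. u \<in> hom (localization C W) x y \<Longrightarrow> P x y u \<Longrightarrow> w \<in> hom C z y \<Longrightarrow> w \<in> W \<Longrightarrow>
      P x z (inv_arr (localization C W) (loc_arr C W w) \<cdot>\<^bsub>localization C W\<^esub> u)"
  shows "P x y u"
proof -
  have "P x y (zz C W x y s)" if "zigzag C W x s y" for s
    using that
  proof (induction s arbitrary: y rule: rev_induct)
    case Nil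
    then show ?case using assms(2)[of x] by auto
  next
    case (snoc a s)
    then obtain y' where y': "zigzag C W x s y'" "zigzag C W y' [a] y" by (auto simp: zigzag_append)
    then have u: "zz C W x y' s \<in> hom (localization C W) x y'" "P x y' (zz C W x y' s)"
      using snoc.IH by (auto simp: loc_hom)
    show ?case
    proof (cases a)
      case (Fwd f)
      then have f: "f \<in> hom C y' y" using y' by (auto simp: hom_def)
      have "loc_arr C W f = zz C W y' y [Fwd f]" using f by (auto simp: loc_arr_def hom_def)
      then show ?thesis using assms(3)[OF u f] loc_comp[OF y'] Fwd by simp
    next
      case (Bwd w)
      then have w: "w \<in> hom C y y'" "w \<in> W" using y' by (auto simp: hom_def)
      have "inv_arr (localization C W) (loc_arr C W w) = zz C W y' y [Bwd w]"
        using w loc_arr_iso(2)[of w] by (auto simp: hom_def)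
      then show ?thesis using assms(4)[OF u w] loc_comp[OF y'] Bwd by simp
    qed
  qed
  then show ?thesis using assms(1) by (auto simp: loc_hom)
qed

end

section \<open>Functors out of the localization\<close>

locale inverting_functor = C: category C + D: category D
  for C :: "('o, 'a) cat" and D :: "('p, 'b) cat" +
  fixes W :: "'a set" and F :: "'o \<Rightarrow> 'p" and m :: "'a \<Rightarrow> 'b"
  assumes F_obj [simp]: "x \<in> Obj C \<Longrightarrow> F x \<in> Obj D"
    and m_hom: "f \<in> hom C x y \<Longrightarrow> m f \<in> hom D (F x) (F y)"
    and m_Ident: "x \<in> Obj C \<Longrightarrow> m (Ident C x) = Ident D (F x)"
    and m_comp: "f \<in> Arr C \<Longrightarrow> g \<in> Arr C \<Longrightarrow> Dom C g = Cod C f \<Longrightarrow> m (g \<cdot>\<^bsub>C\<^esub> f) = m g \<cdot>\<^bsub>D\<^esub> m f"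
    and m_iso: "w \<in> W \<Longrightarrow> w \<in> Arr C \<Longrightarrow> is_iso D (m w)"
begin

text \<open>The accumulator \<open>g\<close> mirrors the \<open>foldl\<close> in
  \<open>loc_extend\<close>; leaving it arbitrary turns concatenation of zigzags into iteration of
  \<open>ev\<close>.\<close>

definition ev :: "'b \<Rightarrow> 'a zigzag_step list \<Rightarrow> 'b" where
  "ev g s = foldl (\<lambda>g a. zigzag_step_eval D m a \<cdot>\<^bsub>D\<^esub> g) g s"

lemma ev_simps [simp]: "ev g [] = g" "ev g (a # s) = ev (zigzag_step_eval D m a \<cdot>\<^bsub>D\<^esub> g) s"
  "ev g (s @ t) = ev (ev g s) t"
  by (simp_all add: ev_def)

lemma m_arr [simp]: "f \<in> Arr C \<Longrightarrow> m f \<in> Arr D" "f \<in> Arr C \<Longrightarrow> Dom D (m f) = F (Dom C f)"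
  "f \<in> Arr C \<Longrightarrow> Cod D (m f) = F (Cod C f)"
  using m_hom[of f "Dom C f" "Cod C f"] by (auto simp: hom_def)

lemma ev_hom: "zigzag C W x s y \<Longrightarrow> g \<in> hom D z (F x) \<Longrightarrow> ev g s \<in> hom D z (F y)"
proof (induction s arbitrary: g x)
  case (Cons a s) then show ?case
  proof (cases a)
    case (Fwd f)
    then have "ev (m f \<cdot>\<^bsub>D\<^esub> g) s \<in> hom D z (F y)" using Cons by (intro Cons.IH) (auto simp: hom_def)
    then show ?thesis using Fwd by simp
  next
    case (Bwd w)
    then have "ev (inv_arr D (m w) \<cdot>\<^bsub>D\<^esub> g) s \<in> hom D z (F y)" using Cons
      by (intro Cons.IH[of "Dom C w"]) (auto simp: hom_def m_iso)
    then show ?thesis using Bwd by simp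
  qed
qed auto

text \<open>The accumulator can be pulled out as a precomposed factor. This converts iteration of
  \<open>ev\<close> into composition in \<open>D\<close>, which is what compatibility with
  composition in \<open>ext_comp\<close> requires.\<close>

lemma ev_split: "zigzag C W x s y \<Longrightarrow> g \<in> hom D z (F x) \<Longrightarrow> ev g s = ev (Ident D (F x)) s \<cdot>\<^bsub>D\<^esub> g"
proof (induction s arbitrary: g x z)
  case (Cons a s) show ?case
  proof (cases a)
    case (Fwd f)
    have "ev (m f \<cdot>\<^bsub>D\<^esub> g) s = ev (Ident D (F (Cod C f))) s \<cdot>\<^bsub>D\<^esub> (m f \<cdot>\<^bsub>D\<^esub> g)"
      "ev (m f) s = ev (Ident D (F (Cod C f))) s \<cdot>\<^bsub>D\<^esub> m f"
      using Cons Fwd by (intro Cons.IH[of _ _ z] Cons.IH[of _ _ "F x"]; auto simp: hom_def)+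
    moreover have "ev (Ident D (F (Cod C f))) s \<in> hom D (F (Cod C f)) (F y)"
      using Cons Fwd by (intro ev_hom) (auto simp: hom_def)
    ultimately show ?thesis using Cons.prems Fwd by (auto simp: hom_def)
  next
    case (Bwd w)
    have i: "is_iso D (m w)" using Cons.prems Bwd m_iso by auto
    have "ev (inv_arr D (m w) \<cdot>\<^bsub>D\<^esub> g) s = ev (Ident D (F (Dom C w))) s \<cdot>\<^bsub>D\<^esub> (inv_arr D (m w) \<cdot>\<^bsub>D\<^esub> g)"
      "ev (inv_arr D (m w)) s = ev (Ident D (F (Dom C w))) s \<cdot>\<^bsub>D\<^esub> inv_arr D (m w)"
      using Cons Bwd i by (intro Cons.IH[of _ _ z] Cons.IH[of _ _ "F x"]; auto simp: hom_def)+
    moreover have "ev (Ident D (F (Dom C w))) s \<in> hom D (F (Dom C w)) (F y)"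
      using Cons Bwd by (intro ev_hom) (auto simp: hom_def)
    ultimately show ?thesis using Cons.prems Bwd i by (auto simp: hom_def)
  qed
qed (auto simp: hom_def)

text \<open>The prefix of the zigzag is absorbed into the accumulator, so only the rewritten steps
  matter: units and composites are respected by functoriality, the two cancellations because
  \<open>m w\<close> is invertible.\<close>

lemma ev_red:
  assumes "zigzag_red C W x y s t" "g \<in> hom D z (F x)" shows "ev g s = ev g t"
  using assms
proof (induction)
  case (red_Ident p a q)
  then have "ev g p \<in> hom D z (F a)" by (intro ev_hom[of x]) (auto simp: C.zigzag_append)
  then show ?case using red_Ident by (auto simp: m_Ident hom_def)
next
  case (red_Comp p f h q)
  then have "ev g p \<in> hom D z (F (Dom C f))" by (intro ev_hom[of x]) (auto simp: C.zigzag_append)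
  then show ?case using red_Comp by (auto simp: C.zigzag_append m_comp hom_def)
next
  case (red_Fwd_Bwd p w q)
  then have h: "ev g p \<in> hom D z (F (Dom C w))" and w: "w \<in> Arr C" "w \<in> W"
    by (auto intro!: ev_hom[of x] simp: C.zigzag_append)
  show ?case using h w D.comp_ext[OF D.inv_arr_simps(4)[OF m_iso], of w "ev g p"] m_iso
    by (auto simp: hom_def)
next
  case (red_Bwd_Fwd p w q)
  then have h: "ev g p \<in> hom D z (F (Cod C w))" and w: "w \<in> Arr C" "w \<in> W"
    by (auto intro!: ev_hom[of x] simp: C.zigzag_append)
  show ?case using h w D.comp_ext[OF D.inv_arr_simps(5)[OF m_iso], of w "ev g p"] m_iso
    by (auto simp: hom_def)
qed

abbreviation "ext \<equiv> loc_extend D F m :: ('o, 'a) loc_arrow \<Rightarrow> 'b"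

text \<open>\<open>loc_extend\<close> evaluates a representative picked by choice. Any two
  representatives are linked by reductions, along which \<open>ev\<close> is constant, so the picked
  one gives the same value as the zigzag \<open>s\<close> at hand.\<close>

lemma ext_zz:
  assumes "zigzag C W x s y" shows "ext (zz C W x y s) = ev (Ident D (F x)) s"
proof -
  define t where "t = (SOME t. t \<in> zigzag_class C W x y s)"
  have "s \<in> zigzag_class C W x y s" by (auto simp: zigzag_class_def)
  then have "t \<in> zigzag_class C W x y s" unfolding t_def by (rule someI)
  then have "equivclp (zigzag_red C W x y) s t" by (simp add: zigzag_class_def)
  then have "ev (Ident D (F x)) s = ev (Ident D (F x)) t"
    by (induction rule: equivclp_induct)
      (use C.zigzag_obj[OF assms] ev_red[where g="Ident D (F x)" and z="F x"] in \<open>fastforce simp: hom_def\<close>)+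
  then show ?thesis by (simp add: loc_extend_def ev_def t_def)
qed

lemma ext_hom: "u \<in> hom (localization C W) x y \<Longrightarrow> ext u \<in> hom D (F x) (F y)"
  using C.loc_hom ext_zz ev_hom C.zigzag_obj F_obj D.Ident_in_hom by (metis (no_types, lifting))

lemma ext_Ident: "x \<in> Obj C \<Longrightarrow> ext (Ident (localization C W) x) = Ident D (F x)"
  using ext_zz[of x "[]" x] by simp

lemma ext_comp:
  assumes "u \<in> hom (localization C W) x y" "v \<in> hom (localization C W) y z"
  shows "ext (v \<cdot>\<^bsub>localization C W\<^esub> u) = ext v \<cdot>\<^bsub>D\<^esub> ext u"
proof -
  obtain s t where st: "u = zz C W x y s" "zigzag C W x s y" "v = zz C W y z t" "zigzag C W y t z"
    using assms C.loc_hom by meson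
  have o: "F x \<in> Obj D" using C.zigzag_obj[OF st(2)] by simp
  have "zigzag C W x (s @ t) z" using st C.zigzag_append by blast
  then have "ext (v \<cdot>\<^bsub>localization C W\<^esub> u) = ev (ev (Ident D (F x)) s) t"
    using st ext_zz by simp
  also have "\<dots> = ev (Ident D (F y)) t \<cdot>\<^bsub>D\<^esub> ev (Ident D (F x)) s"
    by (rule ev_split[OF st(4), of _ "F x"], rule ev_hom[OF st(2)]) (use o in \<open>auto simp: hom_def\<close>)
  finally show ?thesis using st ext_zz by simp
qed

lemma ext_Q: "f \<in> Arr C \<Longrightarrow> ext (loc_arr C W f) = m f"
  using ext_zz[of "Dom C f" "[Fwd f]" "Cod C f"] by (simp add: loc_arr_def)

lemma ext_inv:
  assumes "w \<in> W" "w \<in> Arr C"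
  shows "ext (inv_arr (localization C W) (loc_arr C W w)) = inv_arr D (m w)"
  using ext_zz[of "Cod C w" "[Bwd w]" "Dom C w"] C.loc_arr_iso(2)[OF assms] assms m_iso[OF assms] by simp

end

text \<open>A transformation that is natural on arrows of \<open>C\<close> is automatically natural
  on the localization: the property passes to composites and, at an inverted \<open>w\<close>, is
  obtained by cancelling \<open>m' w\<close> in the square for \<open>w\<close>. Inclusions of
  summands and the interchange of coproduct functors are treated like this.\<close>

lemma ext_natural:
  assumes "inverting_functor C D W F m" "inverting_functor C D W F' m'"
    and t: "\<And>x. x \<in> Obj C \<Longrightarrow> \<tau> x \<in> hom D (F x) (F' x)"
    and nat: "\<And>f. f \<in> Arr C \<Longrightarrow> \<tau> (Cod C f) \<cdot>\<^bsub>D\<^esub> m f = m' f \<cdot>\<^bsub>D\<^esub> \<tau> (Dom C f)"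
    and u: "u \<in> hom (localization C W) x y"
  shows "\<tau> y \<cdot>\<^bsub>D\<^esub> loc_extend D F m u = loc_extend D F' m' u \<cdot>\<^bsub>D\<^esub> \<tau> x"
proof -
  interpret A: inverting_functor C D W F m by fact
  interpret B: inverting_functor C D W F' m' by fact
  interpret L: category "localization C W" by (rule A.C.category_loc)
  note t' = t[unfolded hom_def, simplified]
  show ?thesis using u
  proof (induction rule: A.C.loc_induct)
    case (Ident x)
    then show ?case using A.ext_Ident B.ext_Ident t'[OF Ident] by simp
  next
    case (Fwd x y z u f)
    have o: "x \<in> Obj C" "y \<in> Obj C" "z \<in> Obj C" using Fwd A.C.hom_obj L.hom_obj by auto
    have Q: "loc_arr C W f \<in> hom (localization C W) y z" using Fwd A.C.loc_arr_hom by blast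
    have f: "f \<in> Arr C" "Dom C f = y" "Cod C f = z" using Fwd by (auto simp: hom_def)
    have e: "loc_extend D F m u \<in> hom D (F x) (F y)" "loc_extend D F' m' u \<in> hom D (F' x) (F' y)"
      using Fwd A.ext_hom B.ext_hom by auto
    have "\<tau> z \<cdot>\<^bsub>D\<^esub> (m f \<cdot>\<^bsub>D\<^esub> loc_extend D F m u) = (m' f \<cdot>\<^bsub>D\<^esub> \<tau> y) \<cdot>\<^bsub>D\<^esub> loc_extend D F m u"
      using nat[of f] f e o t' A.D.comp_assoc[of "loc_extend D F m u" "m f" "\<tau> z"] by (simp add: hom_def)
    also have "\<dots> = m' f \<cdot>\<^bsub>D\<^esub> (loc_extend D F' m' u \<cdot>\<^bsub>D\<^esub> \<tau> x)"
      using f e o t' Fwd by (simp add: hom_def)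
    finally show ?case
      using A.ext_comp[OF Fwd(1) Q] B.ext_comp[OF Fwd(1) Q] f e o t' by (simp add: A.ext_Q B.ext_Q hom_def)
  next
    case (Bwd x y z u w)
    have o: "x \<in> Obj C" "y \<in> Obj C" "z \<in> Obj C" using Bwd A.C.hom_obj L.hom_obj by auto
    have w: "w \<in> Arr C" "Dom C w = z" "Cod C w = y" using Bwd by (auto simp: hom_def)
    have Q: "inv_arr (localization C W) (loc_arr C W w) \<in> hom (localization C W) y z"
      using Bwd w A.C.loc_arr_iso(1)[of w W] by (auto simp: hom_def)
    have i: "is_iso D (m w)" "is_iso D (m' w)" using A.m_iso B.m_iso Bwd w by auto
    have e: "loc_extend D F m u \<in> hom D (F x) (F y)" "loc_extend D F' m' u \<in> hom D (F' x) (F' y)"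
      using Bwd A.ext_hom B.ext_hom by auto
    \<comment> \<open>After multiplication by the isomorphism \<open>m' w\<close> the two sides
      become those of the induction hypothesis.\<close>
    have 1: "m' w \<cdot>\<^bsub>D\<^esub> (\<tau> z \<cdot>\<^bsub>D\<^esub> (inv_arr D (m w) \<cdot>\<^bsub>D\<^esub> loc_extend D F m u)) = \<tau> y \<cdot>\<^bsub>D\<^esub> loc_extend D F m u"
      using A.D.comp_ext2[OF nat[symmetric], of w "inv_arr D (m w) \<cdot>\<^bsub>D\<^esub> loc_extend D F m u"]
        A.D.comp_ext[OF A.D.inv_arr_simps(5)[OF i(1)], of "loc_extend D F m u"]
        i e o t' w by (simp add: hom_def)
    have 2: "m' w \<cdot>\<^bsub>D\<^esub> (inv_arr D (m' w) \<cdot>\<^bsub>D\<^esub> (loc_extend D F' m' u \<cdot>\<^bsub>D\<^esub> \<tau> x)) = loc_extend D F' m' u \<cdot>\<^bsub>D\<^esub> \<tau> x"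
      using A.D.comp_ext[OF A.D.inv_arr_simps(5)[OF i(2)], of "loc_extend D F' m' u \<cdot>\<^bsub>D\<^esub> \<tau> x"]
        i e o t' w by (simp add: hom_def)
    have "\<tau> z \<cdot>\<^bsub>D\<^esub> (inv_arr D (m w) \<cdot>\<^bsub>D\<^esub> loc_extend D F m u) = inv_arr D (m' w) \<cdot>\<^bsub>D\<^esub> (loc_extend D F' m' u \<cdot>\<^bsub>D\<^esub> \<tau> x)"
    proof (rule A.D.iso_cancel_left[OF i(2)])
      show "m' w \<cdot>\<^bsub>D\<^esub> (\<tau> z \<cdot>\<^bsub>D\<^esub> (inv_arr D (m w) \<cdot>\<^bsub>D\<^esub> loc_extend D F m u)) =
        m' w \<cdot>\<^bsub>D\<^esub> (inv_arr D (m' w) \<cdot>\<^bsub>D\<^esub> (loc_extend D F' m' u \<cdot>\<^bsub>D\<^esub> \<tau> x))"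
        using 1 2 Bwd.IH by metis
    qed (use i e o t' w in \<open>auto simp: hom_def\<close>)
    then show ?case
      using A.ext_comp[OF Bwd(1) Q] B.ext_comp[OF Bwd(1) Q] w e i o t' Bwd by (simp add: A.ext_inv B.ext_inv hom_def)
  qed
qed

text \<open>So far identities of the localization were unfolded to classes of empty zigzags. From
  here they stay opaque, so that the unit laws of a category apply to them.\<close>

declare loc_simps(4) [simp del]

section \<open>Colimits in functor categories are pointwise\<close>

definition at_rel :: "'o \<Rightarrow> ('j \<times> ('o, 'a, 'p, 'b) ntrans \<times> 'j \<times> ('o, 'a, 'p, 'b) ntrans) set \<Rightarrow> ('j \<times> 'b \<times> 'j \<times> 'b) set" where
  "at_rel x R = (\<lambda>(j, f, k, g). (j, NCmp f x, k, NCmp g x)) ` R"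

lemma at_relI: "(j, f, k, g) \<in> R \<Longrightarrow> (j, NCmp f x, k, NCmp g x) \<in> at_rel x R"
  by (force simp: at_rel_def)

lemma at_relE:
  assumes "(j, a, k, b) \<in> at_rel x R"
  obtains f g where "(j, f, k, g) \<in> R" "a = NCmp f x" "b = NCmp g x"
  using assms by (auto simp: at_rel_def)

text \<open>The index categories are the opposite simplex category and its square, whose objects
  exhaust their types. With \<open>Obj A = UNIV\<close> extensionality on objects is automatic, and
  natural transformations with the same source and target are equal as soon as all components
  are.\<close>

locale functors = A: category A + C: category C
  for A :: "('i, 'm) cat" and C :: "('o, 'a) cat" +
  assumes Obj_UNIV: "Obj A = UNIV"
begin

abbreviation "E \<equiv> functor_cat A C"

lemma E_simps [simp]: "Obj E = {F. is_functor A C F}" "Arr E = {t. is_ntrans A C t}" "Dom E = NSrc" "Cod E = NTgt"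
  "NSrc (t \<cdot>\<^bsub>E\<^esub> s) = NSrc s" "NTgt (t \<cdot>\<^bsub>E\<^esub> s) = NTgt t" "NCmp (t \<cdot>\<^bsub>E\<^esub> s) x = NCmp t x \<cdot>\<^bsub>C\<^esub> NCmp s x"
  "NSrc (Ident E F) = F" "NTgt (Ident E F) = F" "NCmp (Ident E F) x = Ident C (FOb F x)"
  by (simp_all add: functor_cat_def Obj_UNIV)

lemma obj_A [simp]: "x \<in> Obj A" by (simp add: Obj_UNIV)

lemma functor_simps [simp]:
  assumes "is_functor A C F"
  shows "FOb F x \<in> Obj C" "\<theta> \<in> Arr A \<Longrightarrow> FAr F \<theta> \<in> Arr C" "\<theta> \<in> Arr A \<Longrightarrow> Dom C (FAr F \<theta>) = FOb F (Dom A \<theta>)"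
    "\<theta> \<in> Arr A \<Longrightarrow> Cod C (FAr F \<theta>) = FOb F (Cod A \<theta>)" "FAr F (Ident A x) = Ident C (FOb F x)"
  using assms by (auto simp: is_functor_def Obj_UNIV hom_def)

lemma functor_comp:
  assumes "is_functor A C F" "\<theta> \<in> Arr A" "\<theta>' \<in> Arr A" "Dom A \<theta>' = Cod A \<theta>"
  shows "FAr F (\<theta>' \<cdot>\<^bsub>A\<^esub> \<theta>) = FAr F \<theta>' \<cdot>\<^bsub>C\<^esub> FAr F \<theta>"
  using assms unfolding is_functor_def by blast

lemma is_functorI:
  assumes "\<And>x. FOb F x \<in> Obj C" "FAr F \<in> extensional (Arr A)"
    "\<And>\<theta>. \<theta> \<in> Arr A \<Longrightarrow> FAr F \<theta> \<in> hom C (FOb F (Dom A \<theta>)) (FOb F (Cod A \<theta>))"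
    "\<And>x. FAr F (Ident A x) = Ident C (FOb F x)"
    "\<And>\<theta> \<theta>'. \<theta> \<in> Arr A \<Longrightarrow> \<theta>' \<in> Arr A \<Longrightarrow> Dom A \<theta>' = Cod A \<theta> \<Longrightarrow> FAr F (\<theta>' \<cdot>\<^bsub>A\<^esub> \<theta>) = FAr F \<theta>' \<cdot>\<^bsub>C\<^esub> FAr F \<theta>"
  shows "is_functor A C F"
proof -
  have "FOb F \<in> Obj A \<rightarrow>\<^sub>E Obj C" using assms(1) by (auto simp: Obj_UNIV)
  with assms(2-) show ?thesis unfolding is_functor_def by blast
qed

lemma is_ntransI:
  assumes "is_functor A C (NSrc t)" "is_functor A C (NTgt t)"
    "\<And>x. NCmp t x \<in> hom C (FOb (NSrc t) x) (FOb (NTgt t) x)"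
    "\<And>\<theta>. \<theta> \<in> Arr A \<Longrightarrow> NCmp t (Cod A \<theta>) \<cdot>\<^bsub>C\<^esub> FAr (NSrc t) \<theta> = FAr (NTgt t) \<theta> \<cdot>\<^bsub>C\<^esub> NCmp t (Dom A \<theta>)"
  shows "is_ntrans A C t"
  using assms unfolding is_ntrans_def Obj_UNIV extensional_def by blast

lemma ntrans_simps [simp]:
  assumes "is_ntrans A C t"
  shows "is_functor A C (NSrc t)" "is_functor A C (NTgt t)" "NCmp t x \<in> Arr C"
    "Dom C (NCmp t x) = FOb (NSrc t) x" "Cod C (NCmp t x) = FOb (NTgt t) x"
  using assms by (auto simp: is_ntrans_def Obj_UNIV hom_def)

lemma ntrans_natural:
  assumes "is_ntrans A C t" "\<theta> \<in> Arr A"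
  shows "NCmp t (Cod A \<theta>) \<cdot>\<^bsub>C\<^esub> FAr (NSrc t) \<theta> = FAr (NTgt t) \<theta> \<cdot>\<^bsub>C\<^esub> NCmp t (Dom A \<theta>)"
  using assms unfolding is_ntrans_def by blast

lemma ntrans_eqI:
  fixes s t :: "('i, 'm, 'o, 'a) ntrans"
  assumes "NSrc t = NSrc s" "NTgt t = NTgt s" "\<And>x. NCmp t x = NCmp s x"
  shows "t = s"
  using assms by (intro ntrans.equality) auto

lemma ntrans_comp:
  assumes "is_ntrans A C s" "is_ntrans A C t" "NSrc t = NTgt s"
  shows "is_ntrans A C (t \<cdot>\<^bsub>E\<^esub> s)"
proof (rule is_ntransI)
  fix \<theta> assume th: "\<theta> \<in> Arr A"
  show "NCmp (t \<cdot>\<^bsub>E\<^esub> s) (Cod A \<theta>) \<cdot>\<^bsub>C\<^esub> FAr (NSrc (t \<cdot>\<^bsub>E\<^esub> s)) \<theta> = FAr (NTgt (t \<cdot>\<^bsub>E\<^esub> s)) \<theta> \<cdot>\<^bsub>C\<^esub> NCmp (t \<cdot>\<^bsub>E\<^esub> s) (Dom A \<theta>)"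
    using ntrans_natural[OF assms(1) th] C.comp_ext2[OF ntrans_natural[OF assms(2) th], of "NCmp s (Dom A \<theta>)"] assms th
    by simp
qed (use assms in \<open>auto simp: hom_def\<close>)

lemma category_E: "category E"
proof
  show "Ident E F \<in> hom E F F" if "F \<in> Obj E" for F
    using that by (auto simp: hom_def intro!: is_ntransI)
  show "t \<cdot>\<^bsub>E\<^esub> s \<in> hom E F H" if "s \<in> hom E F G" "t \<in> hom E G H" for s t F G H
    using that ntrans_comp by (auto simp: hom_def simp del: E_simps(7))
qed (auto simp: hom_def intro!: ntrans_eqI)

lemma ntrans_iso:
  assumes "is_iso E t"
  shows "is_iso C (NCmp t x)"
proof -
  interpret E: category E by (rule category_E)
  have t: "is_ntrans A C t" and i: "is_ntrans A C (inv_arr E t)"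
    using E.iso_arr[OF assms] E.inv_arr_simps(1)[OF assms] by auto
  have "NCmp (inv_arr E t \<cdot>\<^bsub>E\<^esub> t) x = NCmp (Ident E (NSrc t)) x" "NCmp (t \<cdot>\<^bsub>E\<^esub> inv_arr E t) x = NCmp (Ident E (NTgt t)) x"
    using E.inv_arr_simps(4,5)[OF assms] by (auto simp del: E_simps(7))
  then show ?thesis
    using t i E.inv_arr_simps(2,3)[OF assms] by (intro C.isoI(1)[of _ _ _ "NCmp (inv_arr E t) x"]) (auto simp: hom_def)
qed

text \<open>The mediating arrows are found separately in each degree. Their naturality is forced:
  both sides of a naturality square agree after the legs of the colimit at
  \<open>Dom A \<theta>\<close>, and these are jointly epimorphic.\<close>

lemma colim_of_pointwise:
  assumes dia: "diagram E J D R" and p: "is_functor A C p" and c: "\<And>j. j \<in> J \<Longrightarrow> c j \<in> hom E (D j) p"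
    and pt: "\<And>x. is_colim C J (\<lambda>j. FOb (D j) x) (at_rel x R) (FOb p x) (\<lambda>j. NCmp (c j) x)"
  shows "is_colim E J D R p c"
proof -
  interpret E: category E by (rule category_E)
  have R: "j \<in> J" "k \<in> J" "is_ntrans A C f" "is_ntrans A C g" "NSrc f = NSrc g" "NTgt f = D j" "NTgt g = D k"
    if "(j, f, k, g) \<in> R" for j f k g
    using dia that unfolding diagram_def by auto
  have c': "is_ntrans A C (c j)" "NSrc (c j) = D j" "NTgt (c j) = p" if "j \<in> J" for j
    using c[OF that] by (auto simp: hom_def)
  show ?thesis
  proof (rule E.is_colimI)
    show "diagram E J D R" by fact
    show "p \<in> Obj E" using p by simp
    show "cocone E J D R p c"
      unfolding cocone_def
    proof (intro conjI ballI allI impI)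
      fix j f k g assume r: "(j, f, k, g) \<in> R"
      show "c j \<cdot>\<^bsub>E\<^esub> f = c k \<cdot>\<^bsub>E\<^esub> g"
      proof (rule ntrans_eqI)
        show "NCmp (c j \<cdot>\<^bsub>E\<^esub> f) x = NCmp (c k \<cdot>\<^bsub>E\<^esub> g) x" for x
          using is_colimD(3)[OF pt[of x]] at_relI[OF r, of x] unfolding cocone_def by auto
      qed (use R[OF r] c' in auto)
    qed (use c in auto)
  next
    fix t h assume t: "t \<in> Obj E" and h: "cocone E J D R t h"
    have h': "is_ntrans A C (h j)" "NSrc (h j) = D j" "NTgt (h j) = t" if "j \<in> J" for j
      using h that by (auto simp: hom_def cocone_def)
    have "cocone C J (\<lambda>j. FOb (D j) x) (at_rel x R) (FOb t x) (\<lambda>j. NCmp (h j) x)" for x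
      unfolding cocone_def
    proof (intro conjI ballI allI impI)
      show "NCmp (h j) x \<in> hom C (FOb (D j) x) (FOb t x)" if "j \<in> J" for j
        using h'[OF that] by (auto simp: hom_def)
      fix j f k g assume "(j, f, k, g) \<in> at_rel x R"
      then obtain f' g' where r: "(j, f', k, g') \<in> R" "f = NCmp f' x" "g = NCmp g' x" by (rule at_relE)
      have "h j \<cdot>\<^bsub>E\<^esub> f' = h k \<cdot>\<^bsub>E\<^esub> g'" using h r unfolding cocone_def by blast
      from this[THEN arg_cong[where f="\<lambda>t. NCmp t x"]]
      show "NCmp (h j) x \<cdot>\<^bsub>C\<^esub> f = NCmp (h k) x \<cdot>\<^bsub>C\<^esub> g" using r by simp
    qed
    then have "\<exists>u. u \<in> hom C (FOb p x) (FOb t x) \<and> (\<forall>j\<in>J. u \<cdot>\<^bsub>C\<^esub> NCmp (c j) x = NCmp (h j) x)" for x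
      using colim_desc[OF pt[of x], of "FOb t x"] t by (metis (no_types, lifting) E_simps(1) functor_simps(1) mem_Collect_eq)
    then obtain u where u: "\<And>x. u x \<in> hom C (FOb p x) (FOb t x)" "\<And>x j. j \<in> J \<Longrightarrow> u x \<cdot>\<^bsub>C\<^esub> NCmp (c j) x = NCmp (h j) x"
      by metis
    define U where "U = \<lparr>NSrc = p, NTgt = t, NCmp = u\<rparr>"
    have "is_ntrans A C U"
    proof (rule is_ntransI)
      fix \<theta> assume th: "\<theta> \<in> Arr A"
      have "u (Cod A \<theta>) \<cdot>\<^bsub>C\<^esub> FAr p \<theta> = FAr t \<theta> \<cdot>\<^bsub>C\<^esub> u (Dom A \<theta>)"
      proof (rule C.colim_eqI[OF pt])
        show "u (Cod A \<theta>) \<cdot>\<^bsub>C\<^esub> FAr p \<theta> \<in> hom C (FOb p (Dom A \<theta>)) (FOb t (Cod A \<theta>))"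
          "FAr t \<theta> \<cdot>\<^bsub>C\<^esub> u (Dom A \<theta>) \<in> hom C (FOb p (Dom A \<theta>)) (FOb t (Cod A \<theta>))"
          using u(1)[of "Cod A \<theta>"] u(1)[of "Dom A \<theta>"] p t th by (auto simp: hom_def)
        fix j assume j: "j \<in> J"
        have n: "NCmp (c j) (Cod A \<theta>) \<cdot>\<^bsub>C\<^esub> FAr (D j) \<theta> = FAr p \<theta> \<cdot>\<^bsub>C\<^esub> NCmp (c j) (Dom A \<theta>)"
          "NCmp (h j) (Cod A \<theta>) \<cdot>\<^bsub>C\<^esub> FAr (D j) \<theta> = FAr t \<theta> \<cdot>\<^bsub>C\<^esub> NCmp (h j) (Dom A \<theta>)"
          using ntrans_natural[OF c'(1)[OF j] th] ntrans_natural[OF h'(1)[OF j] th] c'[OF j] h'[OF j] by auto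
        have "(u (Cod A \<theta>) \<cdot>\<^bsub>C\<^esub> FAr p \<theta>) \<cdot>\<^bsub>C\<^esub> NCmp (c j) (Dom A \<theta>) = (u (Cod A \<theta>) \<cdot>\<^bsub>C\<^esub> NCmp (c j) (Cod A \<theta>)) \<cdot>\<^bsub>C\<^esub> FAr (D j) \<theta>"
          using n(1) u(1)[of "Cod A \<theta>"] p t th c'[OF j] ntrans_simps(1)[OF c'(1)[OF j]] by (simp add: hom_def)
        also have "\<dots> = FAr t \<theta> \<cdot>\<^bsub>C\<^esub> (u (Dom A \<theta>) \<cdot>\<^bsub>C\<^esub> NCmp (c j) (Dom A \<theta>))"
          using n(2) u(2)[OF j] by simp
        also have "\<dots> = (FAr t \<theta> \<cdot>\<^bsub>C\<^esub> u (Dom A \<theta>)) \<cdot>\<^bsub>C\<^esub> NCmp (c j) (Dom A \<theta>)"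
          using u(1)[of "Dom A \<theta>"] p t th c'[OF j] by (simp add: hom_def)
        finally show "(u (Cod A \<theta>) \<cdot>\<^bsub>C\<^esub> FAr p \<theta>) \<cdot>\<^bsub>C\<^esub> NCmp (c j) (Dom A \<theta>) = (FAr t \<theta> \<cdot>\<^bsub>C\<^esub> u (Dom A \<theta>)) \<cdot>\<^bsub>C\<^esub> NCmp (c j) (Dom A \<theta>)" .
      qed
      then show "NCmp U (Cod A \<theta>) \<cdot>\<^bsub>C\<^esub> FAr (NSrc U) \<theta> = FAr (NTgt U) \<theta> \<cdot>\<^bsub>C\<^esub> NCmp U (Dom A \<theta>)" by (simp add: U_def)
    qed (use p t u in \<open>auto simp: U_def\<close>)
    moreover have "U \<cdot>\<^bsub>E\<^esub> c j = h j" if "j \<in> J" for j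
      using u(2)[OF that] c'[OF that] h'[OF that] by (intro ntrans_eqI) (auto simp: U_def)
    ultimately show "\<exists>u. u \<in> hom E p t \<and> (\<forall>j\<in>J. u \<cdot>\<^bsub>E\<^esub> c j = h j)"
      by (intro exI[of _ U]) (auto simp: hom_def U_def)
  next
    fix t u v assume uv: "u \<in> hom E p t" "v \<in> hom E p t" "\<And>j. j \<in> J \<Longrightarrow> u \<cdot>\<^bsub>E\<^esub> c j = v \<cdot>\<^bsub>E\<^esub> c j"
    have "NCmp u x = NCmp v x" for x
    proof (rule C.colim_eqI[OF pt])
      show "NCmp u x \<in> hom C (FOb p x) (FOb t x)" "NCmp v x \<in> hom C (FOb p x) (FOb t x)"
        using uv by (auto simp: hom_def)
      show "NCmp u x \<cdot>\<^bsub>C\<^esub> NCmp (c j) x = NCmp v x \<cdot>\<^bsub>C\<^esub> NCmp (c j) x" if "j \<in> J" for j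
        using uv(3)[OF that, THEN arg_cong[where f="\<lambda>t. NCmp t x"]] by simp
    qed
    then show "u = v" using uv by (intro ntrans_eqI) (auto simp: hom_def)
  qed
qed

text \<open>The arrow map of the colimit is specified rather than constructed: \<open>up\<close>
  records what it must do on the legs. Existence and uniqueness of such arrows come from the
  degreewise colimits, and uniqueness yields functoriality.\<close>

lemma pointwise_colim_exists:
  assumes dia: "diagram E J D R"
    and pt: "\<And>x. \<exists>p c. is_colim C J (\<lambda>j. FOb (D j) x) (at_rel x R) p c"
  obtains p c where "is_functor A C p" "\<And>j. j \<in> J \<Longrightarrow> c j \<in> hom E (D j) p"
    "\<And>x. is_colim C J (\<lambda>j. FOb (D j) x) (at_rel x R) (FOb p x) (\<lambda>j. NCmp (c j) x)"
proof -
  have R: "j \<in> J" "k \<in> J" "is_ntrans A C f" "is_ntrans A C g" "NSrc f = NSrc g" "NTgt f = D j" "NTgt g = D k"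
    if "(j, f, k, g) \<in> R" for j f k g
    using dia that unfolding diagram_def by auto
  have D: "is_functor A C (D j)" if "j \<in> J" for j using dia that unfolding diagram_def by auto
  from pt obtain P e where P: "\<And>x. is_colim C J (\<lambda>j. FOb (D j) x) (at_rel x R) (P x) (e x)" by metis
  have e: "e x j \<in> Arr C" "Dom C (e x j) = FOb (D j) x" "Cod C (e x j) = P x" if "j \<in> J" for x j
    using is_colimD(5)[OF P that] by (auto simp: hom_def)
  define up where "up \<theta> u \<longleftrightarrow> u \<in> hom C (P (Dom A \<theta>)) (P (Cod A \<theta>)) \<and>
    (\<forall>j\<in>J. u \<cdot>\<^bsub>C\<^esub> e (Dom A \<theta>) j = e (Cod A \<theta>) j \<cdot>\<^bsub>C\<^esub> FAr (D j) \<theta>)" for \<theta> u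
  have ex: "\<exists>u. up \<theta> u" if th: "\<theta> \<in> Arr A" for \<theta>
  proof -
    have "cocone C J (\<lambda>j. FOb (D j) (Dom A \<theta>)) (at_rel (Dom A \<theta>) R) (P (Cod A \<theta>)) (\<lambda>j. e (Cod A \<theta>) j \<cdot>\<^bsub>C\<^esub> FAr (D j) \<theta>)"
      unfolding cocone_def
    proof (intro conjI ballI allI impI)
      show "e (Cod A \<theta>) j \<cdot>\<^bsub>C\<^esub> FAr (D j) \<theta> \<in> hom C (FOb (D j) (Dom A \<theta>)) (P (Cod A \<theta>))" if "j \<in> J" for j
        using e[OF that] D[OF that] th by (auto simp: hom_def)
      fix j f k g assume "(j, f, k, g) \<in> at_rel (Dom A \<theta>) R"
      then obtain f' g' where r: "(j, f', k, g') \<in> R" "f = NCmp f' (Dom A \<theta>)" "g = NCmp g' (Dom A \<theta>)" by (rule at_relE)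
      have q: "e (Cod A \<theta>) j \<cdot>\<^bsub>C\<^esub> NCmp f' (Cod A \<theta>) = e (Cod A \<theta>) k \<cdot>\<^bsub>C\<^esub> NCmp g' (Cod A \<theta>)"
        using is_colimD(3)[OF P] at_relI[OF r(1)] unfolding cocone_def by blast
      have "(e (Cod A \<theta>) j \<cdot>\<^bsub>C\<^esub> FAr (D j) \<theta>) \<cdot>\<^bsub>C\<^esub> f = (e (Cod A \<theta>) j \<cdot>\<^bsub>C\<^esub> NCmp f' (Cod A \<theta>)) \<cdot>\<^bsub>C\<^esub> FAr (NSrc f') \<theta>"
        using ntrans_natural[OF R(3)[OF r(1)] th] R[OF r(1)] e D th r by simp
      also have "\<dots> = (e (Cod A \<theta>) k \<cdot>\<^bsub>C\<^esub> FAr (D k) \<theta>) \<cdot>\<^bsub>C\<^esub> g"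
        using ntrans_natural[OF R(4)[OF r(1)] th] R[OF r(1)] e D th r q by simp
      finally show "(e (Cod A \<theta>) j \<cdot>\<^bsub>C\<^esub> FAr (D j) \<theta>) \<cdot>\<^bsub>C\<^esub> f = (e (Cod A \<theta>) k \<cdot>\<^bsub>C\<^esub> FAr (D k) \<theta>) \<cdot>\<^bsub>C\<^esub> g" .
    qed
    from colim_desc[OF P is_colimD(2)[OF P] this] show ?thesis unfolding up_def by metis
  qed
  have uniq: "u = v" if "up \<theta> u" "up \<theta> v" for \<theta> u v
    using that C.colim_eqI[OF P, of u _ _ v] unfolding up_def by metis
  define p where "p = \<lparr>FOb = P, FAr = restrict (\<lambda>\<theta>. SOME u. up \<theta> u) (Arr A)\<rparr>"
  have upp: "up \<theta> (FAr p \<theta>)" if "\<theta> \<in> Arr A" for \<theta>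
    using someI_ex[OF ex[OF that]] that by (simp add: p_def)
  have p: "is_functor A C p"
  proof (rule is_functorI)
    show "FOb p x \<in> Obj C" for x using is_colimD(2)[OF P] by (simp add: p_def)
    show "FAr p \<in> extensional (Arr A)" by (simp add: p_def)
    show "FAr p \<theta> \<in> hom C (FOb p (Dom A \<theta>)) (FOb p (Cod A \<theta>))" if "\<theta> \<in> Arr A" for \<theta>
      using upp[OF that] by (simp add: up_def) (simp add: p_def)
    show "FAr p (Ident A x) = Ident C (FOb p x)" for x
    proof (rule uniq)
      show "up (Ident A x) (FAr p (Ident A x))" by (rule upp) simp
      show "up (Ident A x) (Ident C (FOb p x))"
        using is_colimD(2)[OF P] e D by (auto simp: up_def p_def hom_def)
    qed
    fix \<theta> \<theta>' assume th: "\<theta> \<in> Arr A" "\<theta>' \<in> Arr A" "Dom A \<theta>' = Cod A \<theta>"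
    show "FAr p (\<theta>' \<cdot>\<^bsub>A\<^esub> \<theta>) = FAr p \<theta>' \<cdot>\<^bsub>C\<^esub> FAr p \<theta>"
    proof (rule uniq)
      show "up (\<theta>' \<cdot>\<^bsub>A\<^esub> \<theta>) (FAr p (\<theta>' \<cdot>\<^bsub>A\<^esub> \<theta>))" by (rule upp) (use th in simp)
      have u: "FAr p \<theta> \<in> Arr C" "Dom C (FAr p \<theta>) = P (Dom A \<theta>)" "Cod C (FAr p \<theta>) = P (Cod A \<theta>)"
        "FAr p \<theta>' \<in> Arr C" "Dom C (FAr p \<theta>') = P (Dom A \<theta>')" "Cod C (FAr p \<theta>') = P (Cod A \<theta>')"
        "\<And>j. j \<in> J \<Longrightarrow> FAr p \<theta> \<cdot>\<^bsub>C\<^esub> e (Dom A \<theta>) j = e (Cod A \<theta>) j \<cdot>\<^bsub>C\<^esub> FAr (D j) \<theta>"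
        "\<And>j. j \<in> J \<Longrightarrow> FAr p \<theta>' \<cdot>\<^bsub>C\<^esub> e (Dom A \<theta>') j = e (Cod A \<theta>') j \<cdot>\<^bsub>C\<^esub> FAr (D j) \<theta>'"
        using upp[OF th(1)] upp[OF th(2)] by (auto simp: up_def hom_def)
      have "FAr p \<theta>' \<cdot>\<^bsub>C\<^esub> (e (Cod A \<theta>) j \<cdot>\<^bsub>C\<^esub> FAr (D j) \<theta>) = e (Cod A \<theta>') j \<cdot>\<^bsub>C\<^esub> (FAr (D j) \<theta>' \<cdot>\<^bsub>C\<^esub> FAr (D j) \<theta>)" if "j \<in> J" for j
        using C.comp_ext2[OF u(8)[OF that], of "FAr (D j) \<theta>"] u e[OF that] D[OF that] th by auto
      then show "up (\<theta>' \<cdot>\<^bsub>A\<^esub> \<theta>) (FAr p \<theta>' \<cdot>\<^bsub>C\<^esub> FAr p \<theta>)"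
        using u e D th by (auto simp: up_def hom_def functor_comp)
    qed
  qed
  define c where "c j = \<lparr>NSrc = D j, NTgt = p, NCmp = (\<lambda>x. e x j)\<rparr>" for j
  have "is_ntrans A C (c j)" if "j \<in> J" for j
    using p D[OF that] e[OF that] upp that by (intro is_ntransI) (auto simp: c_def hom_def p_def up_def simp del: functor_simps(1))
  then have "c j \<in> hom E (D j) p" if "j \<in> J" for j using that by (simp add: hom_def) (simp add: c_def)
  then show thesis using that[of p c] p P by (simp add: c_def p_def)
qed

text \<open>A colimit of functors need not be degreewise in general. When the degreewise colimits
  exist they assemble to a second colimit, and the comparison isomorphism with the given one has
  invertible components.\<close>

lemma colim_is_pointwise:
  assumes colim: "is_colim E J D R p c"
    and pt: "\<And>x. \<exists>p c. is_colim C J (\<lambda>j. FOb (D j) x) (at_rel x R) p c"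
  shows "is_colim C J (\<lambda>j. FOb (D j) x) (at_rel x R) (FOb p x) (\<lambda>j. NCmp (c j) x)"
proof -
  interpret E: category E by (rule category_E)
  note dia = is_colimD(1)[OF colim]
  obtain q e where q: "is_functor A C q" "\<And>j. j \<in> J \<Longrightarrow> e j \<in> hom E (D j) q"
    "\<And>x. is_colim C J (\<lambda>j. FOb (D j) x) (at_rel x R) (FOb q x) (\<lambda>j. NCmp (e j) x)"
    using pointwise_colim_exists[OF dia pt] by blast
  obtain u where u: "u \<in> hom E q p" "is_iso E u" "\<And>j. j \<in> J \<Longrightarrow> u \<cdot>\<^bsub>E\<^esub> e j = c j"
    using E.colim_iso[OF colim_of_pointwise[OF dia q] colim] by blast
  show ?thesis
  proof (rule C.colim_transport[OF q(3)])
    show "NCmp u x \<in> hom C (FOb q x) (FOb p x)" using u(1) by (auto simp: hom_def)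
    show "is_iso C (NCmp u x)" using u(2) by (rule ntrans_iso)
    show "NCmp u x \<cdot>\<^bsub>C\<^esub> NCmp (e j) x = NCmp (c j) x" if "j \<in> J" for j
      using u(3)[OF that, THEN arg_cong[where f="\<lambda>t. NCmp t x"]] by simp
  qed
qed

end

subsection \<open>Restriction along a functor of index categories\<close>

text \<open>Precomposition with \<open>P\<close>. Rows, columns, diagonals and objects constant in
  one direction are all of this form, so that one set of lemmas serves for all of them.\<close>

definition res_ob :: "('i, 'm) cat \<Rightarrow> ('i, 'm, 'j, 'n) fnctr \<Rightarrow> ('j, 'n, 'o, 'a) fnctr \<Rightarrow> ('i, 'm, 'o, 'a) fnctr" where
  "res_ob A P X = \<lparr>FOb = (\<lambda>x. FOb X (FOb P x)), FAr = restrict (\<lambda>\<theta>. FAr X (FAr P \<theta>)) (Arr A)\<rparr>"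

definition res_map :: "('i, 'm) cat \<Rightarrow> ('i, 'm, 'j, 'n) fnctr \<Rightarrow> ('j, 'n, 'o, 'a) ntrans \<Rightarrow> ('i, 'm, 'o, 'a) ntrans" where
  "res_map A P t = \<lparr>NSrc = res_ob A P (NSrc t), NTgt = res_ob A P (NTgt t), NCmp = (\<lambda>x. NCmp t (FOb P x))\<rparr>"

lemma res_simps [simp]: "FOb (res_ob A P X) x = FOb X (FOb P x)" "NSrc (res_map A P t) = res_ob A P (NSrc t)"
  "NTgt (res_map A P t) = res_ob A P (NTgt t)" "NCmp (res_map A P t) x = NCmp t (FOb P x)"
  "\<theta> \<in> Arr A \<Longrightarrow> FAr (res_ob A P X) \<theta> = FAr X (FAr P \<theta>)"
  by (simp_all add: res_ob_def res_map_def)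

locale restriction = S: functors A C + T: functors B C
  for A :: "('i, 'm) cat" and B :: "('j, 'n) cat" and C :: "('o, 'a) cat" +
  fixes P :: "('i, 'm, 'j, 'n) fnctr"
  assumes P: "is_functor A B P"
begin

lemma P_simps [simp]: "\<theta> \<in> Arr A \<Longrightarrow> FAr P \<theta> \<in> Arr B" "\<theta> \<in> Arr A \<Longrightarrow> Dom B (FAr P \<theta>) = FOb P (Dom A \<theta>)"
   "\<theta> \<in> Arr A \<Longrightarrow> Cod B (FAr P \<theta>) = FOb P (Cod A \<theta>)" "FAr P (Ident A x) = Ident B (FOb P x)"
   "\<theta> \<in> Arr A \<Longrightarrow> \<theta>' \<in> Arr A \<Longrightarrow> Dom A \<theta>' = Cod A \<theta> \<Longrightarrow> FAr P (\<theta>' \<cdot>\<^bsub>A\<^esub> \<theta>) = FAr P \<theta>' \<cdot>\<^bsub>B\<^esub> FAr P \<theta>"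
  using P by (auto simp: is_functor_def hom_def S.Obj_UNIV)

lemma res_ob_functor [simp]: "is_functor B C X \<Longrightarrow> is_functor A C (res_ob A P X)"
  by (rule S.is_functorI) (auto simp: hom_def res_ob_def T.functor_comp)

lemma res_map_ntrans [simp]: "is_ntrans B C t \<Longrightarrow> is_ntrans A C (res_map A P t)"
proof (rule S.is_ntransI)
  fix \<theta> assume t: "is_ntrans B C t" and th: "\<theta> \<in> Arr A"
  then show "NCmp (res_map A P t) (Cod A \<theta>) \<cdot>\<^bsub>C\<^esub> FAr (NSrc (res_map A P t)) \<theta>
    = FAr (NTgt (res_map A P t)) \<theta> \<cdot>\<^bsub>C\<^esub> NCmp (res_map A P t) (Dom A \<theta>)"
    using T.ntrans_natural[of t "FAr P \<theta>"] by simp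
qed (auto simp: hom_def)

lemma res_map_comp: "res_map A P (t \<cdot>\<^bsub>T.E\<^esub> s) = res_map A P t \<cdot>\<^bsub>S.E\<^esub> res_map A P s"
  by (rule S.ntrans_eqI) auto

abbreviation "res_rel \<equiv> \<lambda>R. (\<lambda>(j, f, k, g). (j, res_map A P f, k, res_map A P g)) ` R"

end

section \<open>Coproducts and double pushouts\<close>

lemma is_coprodD:
  assumes "is_coprod C x y p i j"
  shows "x \<in> Obj C" "y \<in> Obj C" "p \<in> Obj C" "i \<in> hom C x p" "j \<in> hom C y p"
  using assms by (simp_all add: is_coprod_def)

lemma is_coprod_desc:
  assumes "is_coprod C x y p i j" "f \<in> hom C x t" "g \<in> hom C y t" "t \<in> Obj C"
  obtains u where "u \<in> hom C p t" "u \<cdot>\<^bsub>C\<^esub> i = f" "u \<cdot>\<^bsub>C\<^esub> j = g"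
  using assms unfolding is_coprod_def by blast

lemma is_pushoutD:
  assumes "is_pushout C f g d p q"
  shows "f \<in> Arr C" "g \<in> Arr C" "Dom C f = Dom C g" "d \<in> Obj C" "p \<in> hom C (Cod C f) d" "q \<in> hom C (Cod C g) d"
    "p \<cdot>\<^bsub>C\<^esub> f = q \<cdot>\<^bsub>C\<^esub> g"
  using assms by (simp_all add: is_pushout_def)

lemma is_pushout_desc:
  assumes "is_pushout C f g d p q" "h \<in> hom C (Cod C f) t" "k \<in> hom C (Cod C g) t" "t \<in> Obj C"
    "h \<cdot>\<^bsub>C\<^esub> f = k \<cdot>\<^bsub>C\<^esub> g"
  obtains u where "u \<in> hom C d t" "u \<cdot>\<^bsub>C\<^esub> p = h" "u \<cdot>\<^bsub>C\<^esub> q = k"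
  using assms unfolding is_pushout_def by blast

lemma is_coprod_familyD:
  assumes "is_coprod_family C S A p i"
  shows "p \<in> Obj C" "k \<in> S \<Longrightarrow> A k \<in> Obj C" "k \<in> S \<Longrightarrow> i k \<in> hom C (A k) p"
  using assms by (simp_all add: is_coprod_family_def)

lemma is_coprod_family_desc:
  assumes "is_coprod_family C S A p i" "t \<in> Obj C" "\<And>k. k \<in> S \<Longrightarrow> h k \<in> hom C (A k) t"
  obtains u where "u \<in> hom C p t" "\<And>k. k \<in> S \<Longrightarrow> u \<cdot>\<^bsub>C\<^esub> i k = h k"
proof -
  have "\<exists>!u. u \<in> hom C p t \<and> (\<forall>k\<in>S. u \<cdot>\<^bsub>C\<^esub> i k = h k)"
    using assms unfolding is_coprod_family_def by simp
  then show thesis using that by blast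
qed

text \<open>
  \<^term>\<open>k\<close> is the colimit of the diagram \<open>Y \<leftarrow> X \<rightarrow> T \<leftarrow> X \<rightarrow> Z\<close> formed by \<open>F\<close>, \<open>d0\<close>, \<open>d1\<close>, \<open>G\<close>. Unlike the
  pushout defining \<open>K(F, G)\<close>, this does not refer to chosen coproducts, so functors such as the
  diagonal of bisimplicial objects preserve it on the nose.
\<close>

definition is_dpo :: "('o, 'a) cat \<Rightarrow> 'a \<Rightarrow> 'a \<Rightarrow> 'a \<Rightarrow> 'a \<Rightarrow> 'o \<Rightarrow> 'a \<Rightarrow> 'a \<Rightarrow> 'a \<Rightarrow> bool" where
  "is_dpo C F G d0 d1 k a b c \<longleftrightarrow>
     is_colim C {0, 1, 2 :: nat} (\<lambda>j. if j = 0 then Cod C F else if j = 1 then Cod C G else Cod C d0)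
       {(0, F, 2, d0), (1, G, 2, d1)} k (\<lambda>j. if j = 0 then a else if j = 1 then b else c)"

lemma is_dpoD:
  assumes "is_dpo C F G d0 d1 k a b c"
  shows "F \<in> Arr C" "G \<in> Arr C" "d0 \<in> Arr C" "d1 \<in> Arr C" "Dom C F = Dom C d0" "Dom C G = Dom C d1" "Cod C d1 = Cod C d0"
    "k \<in> Obj C" "a \<in> hom C (Cod C F) k" "b \<in> hom C (Cod C G) k" "c \<in> hom C (Cod C d0) k"
    "a \<cdot>\<^bsub>C\<^esub> F = c \<cdot>\<^bsub>C\<^esub> d0" "b \<cdot>\<^bsub>C\<^esub> G = c \<cdot>\<^bsub>C\<^esub> d1"
proof -
  note * = assms[unfolded is_dpo_def, THEN is_colimD(1), unfolded diagram_def]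
    assms[unfolded is_dpo_def, THEN is_colimD(2)] assms[unfolded is_dpo_def, THEN is_colimD(3), unfolded cocone_def]
  show "F \<in> Arr C" "G \<in> Arr C" "d0 \<in> Arr C" "d1 \<in> Arr C" "Dom C F = Dom C d0" "Dom C G = Dom C d1" "Cod C d1 = Cod C d0"
    "k \<in> Obj C" "a \<in> hom C (Cod C F) k" "b \<in> hom C (Cod C G) k" "c \<in> hom C (Cod C d0) k"
    "a \<cdot>\<^bsub>C\<^esub> F = c \<cdot>\<^bsub>C\<^esub> d0" "b \<cdot>\<^bsub>C\<^esub> G = c \<cdot>\<^bsub>C\<^esub> d1"
    using * by auto
qed

lemma is_dpo_desc:
  assumes "is_dpo C F G d0 d1 k a b c" "y \<in> hom C (Cod C F) t" "z \<in> hom C (Cod C G) t" "h \<in> hom C (Cod C d0) t"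
    "t \<in> Obj C" "y \<cdot>\<^bsub>C\<^esub> F = h \<cdot>\<^bsub>C\<^esub> d0" "z \<cdot>\<^bsub>C\<^esub> G = h \<cdot>\<^bsub>C\<^esub> d1"
  obtains u where "u \<in> hom C k t" "u \<cdot>\<^bsub>C\<^esub> a = y" "u \<cdot>\<^bsub>C\<^esub> b = z" "u \<cdot>\<^bsub>C\<^esub> c = h"
proof -
  have cc: "cocone C {0, 1, 2 :: nat} (\<lambda>j. if j = 0 then Cod C F else if j = 1 then Cod C G else Cod C d0)
       {(0, F, 2, d0), (1, G, 2, d1)} t (\<lambda>j. if j = 0 then y else if j = 1 then z else h)"
    using assms by (auto simp: cocone_def)
  obtain u where u: "u \<in> hom C k t" "\<And>j. j \<in> {0, 1, 2 :: nat} \<Longrightarrow>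
     u \<cdot>\<^bsub>C\<^esub> (if j = 0 then a else if j = 1 then b else c) = (if j = 0 then y else if j = 1 then z else h)"
    using colim_desc[OF assms(1)[unfolded is_dpo_def] assms(5) cc] by blast
  show thesis using that[of u] u(1) u(2)[of 0] u(2)[of 1] u(2)[of 2] by simp
qed

context category begin

lemma coprod_eqI:
  assumes "is_coprod C x y p i j" "u \<in> hom C p t" "v \<in> hom C p t" "u \<cdot>\<^bsub>C\<^esub> i = v \<cdot>\<^bsub>C\<^esub> i" "u \<cdot>\<^bsub>C\<^esub> j = v \<cdot>\<^bsub>C\<^esub> j"
  shows "u = v"
  by (rule colim_eqI[OF assms(1)[unfolded coprod_iff_colim] assms(2,3)]) (use assms in \<open>auto split: bool.splits\<close>)

lemma pushout_eqI:
  assumes "is_pushout C f g d p q" "u \<in> hom C d t" "v \<in> hom C d t" "u \<cdot>\<^bsub>C\<^esub> p = v \<cdot>\<^bsub>C\<^esub> p" "u \<cdot>\<^bsub>C\<^esub> q = v \<cdot>\<^bsub>C\<^esub> q"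
  shows "u = v"
  by (rule colim_eqI[of UNIV "case_bool (Cod C f) (Cod C g)" "{(True, f, False, g)}" d "case_bool p q"])
    (use assms in \<open>auto simp: pushout_iff_colim split: bool.splits\<close>)

lemma coprodI:
  assumes "x \<in> Obj C" "y \<in> Obj C" "p \<in> Obj C" "i \<in> hom C x p" "j \<in> hom C y p"
    "\<And>t f g. t \<in> Obj C \<Longrightarrow> f \<in> hom C x t \<Longrightarrow> g \<in> hom C y t \<Longrightarrow> \<exists>u. u \<in> hom C p t \<and> u \<cdot>\<^bsub>C\<^esub> i = f \<and> u \<cdot>\<^bsub>C\<^esub> j = g"
    "\<And>t u v. u \<in> hom C p t \<Longrightarrow> v \<in> hom C p t \<Longrightarrow> u \<cdot>\<^bsub>C\<^esub> i = v \<cdot>\<^bsub>C\<^esub> i \<Longrightarrow> u \<cdot>\<^bsub>C\<^esub> j = v \<cdot>\<^bsub>C\<^esub> j \<Longrightarrow> u = v"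
  shows "is_coprod C x y p i j"
  unfolding is_coprod_def
proof (intro conjI ballI)
  fix t f g assume "t \<in> Obj C" "f \<in> hom C x t" "g \<in> hom C y t"
  then obtain u where u: "u \<in> hom C p t" "u \<cdot>\<^bsub>C\<^esub> i = f" "u \<cdot>\<^bsub>C\<^esub> j = g" using assms(6) by blast
  show "\<exists>!u. u \<in> hom C p t \<and> u \<cdot>\<^bsub>C\<^esub> i = f \<and> u \<cdot>\<^bsub>C\<^esub> j = g"
  proof (rule ex1I[of _ u])
    fix v assume "v \<in> hom C p t \<and> v \<cdot>\<^bsub>C\<^esub> i = f \<and> v \<cdot>\<^bsub>C\<^esub> j = g"
    then show "v = u" by (intro assms(7)[of v t u]) (use u in simp_all)
  qed (use u in blast)
qed (use assms in auto)

lemma pushoutI: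
  assumes "f \<in> hom C x y" "g \<in> hom C x z" "p \<in> hom C y d" "q \<in> hom C z d" "p \<cdot>\<^bsub>C\<^esub> f = q \<cdot>\<^bsub>C\<^esub> g"
    "\<And>t h k. t \<in> Obj C \<Longrightarrow> h \<in> hom C y t \<Longrightarrow> k \<in> hom C z t \<Longrightarrow> h \<cdot>\<^bsub>C\<^esub> f = k \<cdot>\<^bsub>C\<^esub> g \<Longrightarrow>
      \<exists>u. u \<in> hom C d t \<and> u \<cdot>\<^bsub>C\<^esub> p = h \<and> u \<cdot>\<^bsub>C\<^esub> q = k"
    "\<And>t u v. u \<in> hom C d t \<Longrightarrow> v \<in> hom C d t \<Longrightarrow> u \<cdot>\<^bsub>C\<^esub> p = v \<cdot>\<^bsub>C\<^esub> p \<Longrightarrow> u \<cdot>\<^bsub>C\<^esub> q = v \<cdot>\<^bsub>C\<^esub> q \<Longrightarrow> u = v"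
  shows "is_pushout C f g d p q"
  unfolding is_pushout_def
proof (intro conjI ballI impI)
  fix t h k assume "t \<in> Obj C" "h \<in> hom C (Cod C f) t" "k \<in> hom C (Cod C g) t" "h \<cdot>\<^bsub>C\<^esub> f = k \<cdot>\<^bsub>C\<^esub> g"
  then obtain u where u: "u \<in> hom C d t" "u \<cdot>\<^bsub>C\<^esub> p = h" "u \<cdot>\<^bsub>C\<^esub> q = k"
    using assms(6)[of t h k] assms(1,2) by (auto simp: hom_def)
  show "\<exists>!u. u \<in> hom C d t \<and> u \<cdot>\<^bsub>C\<^esub> p = h \<and> u \<cdot>\<^bsub>C\<^esub> q = k"
  proof (rule ex1I[of _ u])
    fix v assume "v \<in> hom C d t \<and> v \<cdot>\<^bsub>C\<^esub> p = h \<and> v \<cdot>\<^bsub>C\<^esub> q = k"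
    then show "v = u" by (intro assms(7)[of v t u]) (use u in simp_all)
  qed (use u in blast)
qed (use assms hom_obj in \<open>auto simp: hom_def\<close>)

lemma pushout_sym: "is_pushout C f g d p q \<Longrightarrow> is_pushout C g f d q p"
  unfolding is_pushout_def by metis

lemma dpo_eqI:
  assumes "is_dpo C F G d0 d1 k a b c" "u \<in> hom C k t" "v \<in> hom C k t"
    "u \<cdot>\<^bsub>C\<^esub> a = v \<cdot>\<^bsub>C\<^esub> a" "u \<cdot>\<^bsub>C\<^esub> b = v \<cdot>\<^bsub>C\<^esub> b" "u \<cdot>\<^bsub>C\<^esub> c = v \<cdot>\<^bsub>C\<^esub> c"
  shows "u = v"
  by (rule colim_eqI[OF assms(1)[unfolded is_dpo_def] assms(2,3)]) (use assms in auto)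

lemma dpoI:
  assumes "F \<in> hom C X Y" "G \<in> hom C X Z" "d0 \<in> hom C X T" "d1 \<in> hom C X T"
    "a \<in> hom C Y k" "b \<in> hom C Z k" "c \<in> hom C T k" "a \<cdot>\<^bsub>C\<^esub> F = c \<cdot>\<^bsub>C\<^esub> d0" "b \<cdot>\<^bsub>C\<^esub> G = c \<cdot>\<^bsub>C\<^esub> d1"
    "\<And>t y z h. t \<in> Obj C \<Longrightarrow> y \<in> hom C Y t \<Longrightarrow> z \<in> hom C Z t \<Longrightarrow> h \<in> hom C T t \<Longrightarrow>
       y \<cdot>\<^bsub>C\<^esub> F = h \<cdot>\<^bsub>C\<^esub> d0 \<Longrightarrow> z \<cdot>\<^bsub>C\<^esub> G = h \<cdot>\<^bsub>C\<^esub> d1 \<Longrightarrow>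
       \<exists>u. u \<in> hom C k t \<and> u \<cdot>\<^bsub>C\<^esub> a = y \<and> u \<cdot>\<^bsub>C\<^esub> b = z \<and> u \<cdot>\<^bsub>C\<^esub> c = h"
    "\<And>t u v. u \<in> hom C k t \<Longrightarrow> v \<in> hom C k t \<Longrightarrow> u \<cdot>\<^bsub>C\<^esub> a = v \<cdot>\<^bsub>C\<^esub> a \<Longrightarrow> u \<cdot>\<^bsub>C\<^esub> b = v \<cdot>\<^bsub>C\<^esub> b \<Longrightarrow>
       u \<cdot>\<^bsub>C\<^esub> c = v \<cdot>\<^bsub>C\<^esub> c \<Longrightarrow> u = v"
  shows "is_dpo C F G d0 d1 k a b c"
  unfolding is_dpo_def
proof (rule is_colimI)
  show "diagram C {0, 1, 2 :: nat} (\<lambda>j. if j = 0 then Cod C F else if j = 1 then Cod C G else Cod C d0)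
       {(0, F, 2, d0), (1, G, 2, d1)}"
    using assms(1-4) by (auto simp: diagram_def hom_def)
  show "k \<in> Obj C" using assms(5) hom_obj by blast
  show "cocone C {0, 1, 2 :: nat} (\<lambda>j. if j = 0 then Cod C F else if j = 1 then Cod C G else Cod C d0)
       {(0, F, 2, d0), (1, G, 2, d1)} k (\<lambda>j. if j = 0 then a else if j = 1 then b else c)"
    using assms(1-9) by (auto simp: cocone_def hom_def)
next
  fix t and h :: "nat \<Rightarrow> 'a"
  assume t: "t \<in> Obj C" and h: "cocone C {0, 1, 2 :: nat}
     (\<lambda>j. if j = 0 then Cod C F else if j = 1 then Cod C G else Cod C d0) {(0, F, 2, d0), (1, G, 2, d1)} t h"
  have "h 0 \<in> hom C Y t" "h 1 \<in> hom C Z t" "h 2 \<in> hom C T t" "h 0 \<cdot>\<^bsub>C\<^esub> F = h 2 \<cdot>\<^bsub>C\<^esub> d0" "h 1 \<cdot>\<^bsub>C\<^esub> G = h 2 \<cdot>\<^bsub>C\<^esub> d1"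
    using h assms(1-4) by (auto simp: cocone_def hom_def)
  from assms(10)[OF t this] show "\<exists>u. u \<in> hom C k t \<and> (\<forall>j\<in>{0, 1, 2 :: nat}.
      u \<cdot>\<^bsub>C\<^esub> (if j = 0 then a else if j = 1 then b else c) = h j)" by auto
next
  fix t u v assume "u \<in> hom C k t" "v \<in> hom C k t" and
    *: "\<And>j. j \<in> {0, 1, 2 :: nat} \<Longrightarrow> u \<cdot>\<^bsub>C\<^esub> (if j = 0 then a else if j = 1 then b else c) =
      v \<cdot>\<^bsub>C\<^esub> (if j = 0 then a else if j = 1 then b else c)"
  then show "u = v" using *[of 0] *[of 1] *[of 2] by (intro assms(11)[of u t v]) simp_all
qed

lemma family_eqI:
  assumes "is_coprod_family C S A p i" "u \<in> hom C p t" "v \<in> hom C p t" "\<And>k. k \<in> S \<Longrightarrow> u \<cdot>\<^bsub>C\<^esub> i k = v \<cdot>\<^bsub>C\<^esub> i k"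
  shows "u = v"
  by (rule colim_eqI[OF assms(1)[unfolded family_iff_colim] assms(2-4)])

lemma familyI:
  assumes "p \<in> Obj C" "\<And>k. k \<in> S \<Longrightarrow> A k \<in> Obj C" "\<And>k. k \<in> S \<Longrightarrow> i k \<in> hom C (A k) p"
    "\<And>t h. t \<in> Obj C \<Longrightarrow> (\<And>k. k \<in> S \<Longrightarrow> h k \<in> hom C (A k) t) \<Longrightarrow> \<exists>u. u \<in> hom C p t \<and> (\<forall>k\<in>S. u \<cdot>\<^bsub>C\<^esub> i k = h k)"
    "\<And>t u v. u \<in> hom C p t \<Longrightarrow> v \<in> hom C p t \<Longrightarrow> (\<And>k. k \<in> S \<Longrightarrow> u \<cdot>\<^bsub>C\<^esub> i k = v \<cdot>\<^bsub>C\<^esub> i k) \<Longrightarrow> u = v"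
  shows "is_coprod_family C S A p i"
  unfolding family_iff_colim
  by (rule is_colimI) (use assms in \<open>auto simp: diagram_def cocone_def\<close>)

lemma family_insert:
  assumes f: "is_coprod_family C S A p i" and c: "is_coprod C p (A s) q j j'" and "s \<notin> S"
  shows "is_coprod_family C (insert s S) A q (\<lambda>k. if k = s then j' else j \<cdot>\<^bsub>C\<^esub> i k)"
proof (rule familyI)
  note F = is_coprod_familyD[OF f] and c' = is_coprodD[OF c]
  show "q \<in> Obj C" "\<And>k. k \<in> insert s S \<Longrightarrow> A k \<in> Obj C" using F c' by auto
  show "(if k = s then j' else j \<cdot>\<^bsub>C\<^esub> i k) \<in> hom C (A k) q" if "k \<in> insert s S" for k
    using that F(3)[of k] c' by (auto simp: hom_def)
  show "\<exists>u. u \<in> hom C q t \<and> (\<forall>k\<in>insert s S. u \<cdot>\<^bsub>C\<^esub> (if k = s then j' else j \<cdot>\<^bsub>C\<^esub> i k) = h k)"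
    if t: "t \<in> Obj C" and h: "\<And>k. k \<in> insert s S \<Longrightarrow> h k \<in> hom C (A k) t" for t h
  proof -
    obtain u where u: "u \<in> hom C p t" "\<And>k. k \<in> S \<Longrightarrow> u \<cdot>\<^bsub>C\<^esub> i k = h k"
      using is_coprod_family_desc[OF f t, of h] h by blast
    obtain v where v: "v \<in> hom C q t" "v \<cdot>\<^bsub>C\<^esub> j = u" "v \<cdot>\<^bsub>C\<^esub> j' = h s"
      using is_coprod_desc[OF c u(1) _ t] h by blast
    have "v \<cdot>\<^bsub>C\<^esub> (j \<cdot>\<^bsub>C\<^esub> i k) = h k" if "k \<in> S" for k
      using comp_ext[OF v(2), of "i k"] F(3)[OF that] c' v(1) u(2)[OF that] by (simp add: hom_def)
    then show ?thesis using v \<open>s \<notin> S\<close> by (intro exI[of _ v]) auto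
  qed
  show "u = v" if uv: "u \<in> hom C q t" "v \<in> hom C q t" and
    *: "\<And>k. k \<in> insert s S \<Longrightarrow> u \<cdot>\<^bsub>C\<^esub> (if k = s then j' else j \<cdot>\<^bsub>C\<^esub> i k) = v \<cdot>\<^bsub>C\<^esub> (if k = s then j' else j \<cdot>\<^bsub>C\<^esub> i k)"
    for t u v
  proof (rule coprod_eqI[OF c uv])
    show "u \<cdot>\<^bsub>C\<^esub> j' = v \<cdot>\<^bsub>C\<^esub> j'" using *[of s] by simp
    show "u \<cdot>\<^bsub>C\<^esub> j = v \<cdot>\<^bsub>C\<^esub> j"
    proof (rule family_eqI[OF f])
      show "u \<cdot>\<^bsub>C\<^esub> j \<in> hom C p t" "v \<cdot>\<^bsub>C\<^esub> j \<in> hom C p t" using uv c' by (auto simp: hom_def)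
      show "(u \<cdot>\<^bsub>C\<^esub> j) \<cdot>\<^bsub>C\<^esub> i k = (v \<cdot>\<^bsub>C\<^esub> j) \<cdot>\<^bsub>C\<^esub> i k" if "k \<in> S" for k
      proof -
        have "k \<noteq> s" using that \<open>s \<notin> S\<close> by blast
        then show ?thesis using *[of k] F(3)[OF that] c' uv that by (simp add: hom_def)
      qed
    qed
  qed
qed

text \<open>Gluing \<open>Y\<close> and \<open>Z\<close> to the copower \<open>T\<close> along two
  different summands replaces these two copies of \<open>X\<close> and leaves the others alone.
  Applied in each degree this exhibits a double mapping cylinder as a finite coproduct.\<close>

lemma family_of_dpo:
  assumes T: "is_coprod_family C S (\<lambda>_. X) T i" and k: "k0 \<in> S" "k1 \<in> S" "k0 \<noteq> k1"
    and F: "F \<in> hom C X Y" and G: "G \<in> hom C X Z"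
    and p: "is_dpo C F G (i k0) (i k1) p a b c"
  shows "is_coprod_family C S (\<lambda>k. if k = k0 then Y else if k = k1 then Z else X) p
    (\<lambda>k. if k = k0 then a else if k = k1 then b else c \<cdot>\<^bsub>C\<^esub> i k)"
proof (rule familyI)
  note P = is_dpoD[OF p] and T' = is_coprod_familyD[OF T]
  have i: "i k \<in> Arr C" "Dom C (i k) = X" "Cod C (i k) = T" if "k \<in> S" for k using T'(3)[OF that] by (auto simp: hom_def)
  have abc: "a \<in> hom C Y p" "b \<in> hom C Z p" "c \<in> hom C T p" using P(9-11) F G i k by (auto simp: hom_def)
  show "p \<in> Obj C" by (rule P)
  show "(if k = k0 then Y else if k = k1 then Z else X) \<in> Obj C" if "k \<in> S" for k
    using hom_obj F G by auto
  show "(if k = k0 then a else if k = k1 then b else c \<cdot>\<^bsub>C\<^esub> i k) \<in> hom C (if k = k0 then Y else if k = k1 then Z else X) p"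
    if "k \<in> S" for k using abc i[OF that] by (auto simp: hom_def)
  show "\<exists>u. u \<in> hom C p t \<and> (\<forall>k\<in>S. u \<cdot>\<^bsub>C\<^esub> (if k = k0 then a else if k = k1 then b else c \<cdot>\<^bsub>C\<^esub> i k) = h k)"
    if t: "t \<in> Obj C" and h: "\<And>k. k \<in> S \<Longrightarrow> h k \<in> hom C (if k = k0 then Y else if k = k1 then Z else X) t" for t h
  proof -
    have h': "h k0 \<in> hom C Y t" "h k1 \<in> hom C Z t" using h[OF k(1)] h[OF k(2)] k(3) by auto
    have hh: "(if k = k0 then h k0 \<cdot>\<^bsub>C\<^esub> F else if k = k1 then h k1 \<cdot>\<^bsub>C\<^esub> G else h k) \<in> hom C X t" if "k \<in> S" for k
      using h[OF that] h' F G by (auto simp: hom_def)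
    \<comment> \<open>On the two glued summands the map out of \<open>T\<close> is dictated by the
      maps prescribed on \<open>Y\<close> and \<open>Z\<close>; on the others it is free and taken
      from \<open>h\<close>.\<close>
    obtain w where w: "w \<in> hom C T t"
      "\<And>k. k \<in> S \<Longrightarrow> w \<cdot>\<^bsub>C\<^esub> i k = (if k = k0 then h k0 \<cdot>\<^bsub>C\<^esub> F else if k = k1 then h k1 \<cdot>\<^bsub>C\<^esub> G else h k)"
      using is_coprod_family_desc[OF T t, of "\<lambda>k. if k = k0 then h k0 \<cdot>\<^bsub>C\<^esub> F else if k = k1 then h k1 \<cdot>\<^bsub>C\<^esub> G else h k", OF hh]
      by blast
    obtain u where u: "u \<in> hom C p t" "u \<cdot>\<^bsub>C\<^esub> a = h k0" "u \<cdot>\<^bsub>C\<^esub> b = h k1" "u \<cdot>\<^bsub>C\<^esub> c = w"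
    proof (rule is_dpo_desc[OF p, of "h k0" t "h k1" w])
      show "h k0 \<cdot>\<^bsub>C\<^esub> F = w \<cdot>\<^bsub>C\<^esub> i k0" "h k1 \<cdot>\<^bsub>C\<^esub> G = w \<cdot>\<^bsub>C\<^esub> i k1"
        using w(2)[OF k(1)] w(2)[OF k(2)] k(3) by auto
    qed (use h' w(1) t F G i[OF k(1)] in \<open>auto simp: hom_def\<close>)
    have "u \<cdot>\<^bsub>C\<^esub> (c \<cdot>\<^bsub>C\<^esub> i k) = h k" if "k \<in> S" "k \<noteq> k0" "k \<noteq> k1" for k
      using comp_ext[OF u(4), of "i k"] i[OF that(1)] abc u(1) w(2)[OF that(1)] that by (simp add: hom_def)
    then show ?thesis using u by (intro exI[of _ u]) auto
  qed
  show "u = v" if uv: "u \<in> hom C p t" "v \<in> hom C p t" and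
    *: "\<And>k. k \<in> S \<Longrightarrow> u \<cdot>\<^bsub>C\<^esub> (if k = k0 then a else if k = k1 then b else c \<cdot>\<^bsub>C\<^esub> i k) = v \<cdot>\<^bsub>C\<^esub> (if k = k0 then a else if k = k1 then b else c \<cdot>\<^bsub>C\<^esub> i k)"
    for t u v
  proof (rule dpo_eqI[OF p uv])
    show ua: "u \<cdot>\<^bsub>C\<^esub> a = v \<cdot>\<^bsub>C\<^esub> a" using *[OF k(1)] by simp
    show ub: "u \<cdot>\<^bsub>C\<^esub> b = v \<cdot>\<^bsub>C\<^esub> b" using *[OF k(2)] k(3) by simp
    show "u \<cdot>\<^bsub>C\<^esub> c = v \<cdot>\<^bsub>C\<^esub> c"
    proof (rule family_eqI[OF T])
      show "u \<cdot>\<^bsub>C\<^esub> c \<in> hom C T t" "v \<cdot>\<^bsub>C\<^esub> c \<in> hom C T t" using uv abc by (auto simp: hom_def)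
      fix k assume kS: "k \<in> S"
      have "u \<cdot>\<^bsub>C\<^esub> (c \<cdot>\<^bsub>C\<^esub> i k) = v \<cdot>\<^bsub>C\<^esub> (c \<cdot>\<^bsub>C\<^esub> i k)"
      proof (cases "k = k0 \<or> k = k1")
        case True
        then show ?thesis
          using comp_ext[OF ua, of F] comp_ext[OF ub, of G] abc uv F G P(12,13) by (auto simp: hom_def)
      qed (use *[OF kS] in auto)
      then show "(u \<cdot>\<^bsub>C\<^esub> c) \<cdot>\<^bsub>C\<^esub> i k = (v \<cdot>\<^bsub>C\<^esub> c) \<cdot>\<^bsub>C\<^esub> i k"
        using uv abc i[OF kS] by (simp add: hom_def)
    qed
  qed
qed

text \<open>This direction provides existence: in the absence of pushouts in \<open>C\<close> the
  glued object is built as a coproduct, and the leg \<open>c\<close> from \<open>T\<close> is then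
  defined summand by summand.\<close>

lemma dpo_of_family:
  assumes T: "is_coprod_family C S (\<lambda>_. X) T i" and k: "k0 \<in> S" "k1 \<in> S" "k0 \<noteq> k1"
    and F: "F \<in> hom C X Y" and G: "G \<in> hom C X Z"
    and p: "is_coprod_family C S (\<lambda>k. if k = k0 then Y else if k = k1 then Z else X) p e"
  shows "\<exists>c. is_dpo C F G (i k0) (i k1) p (e k0) (e k1) c"
proof -
  note T' = is_coprod_familyD[OF T]
  have i: "i k \<in> Arr C" "Dom C (i k) = X" "Cod C (i k) = T" if "k \<in> S" for k using T'(3)[OF that] by (auto simp: hom_def)
  note P = is_coprod_familyD[OF p]
  have e: "e k0 \<in> hom C Y p" "e k1 \<in> hom C Z p" using P(3)[OF k(1)] P(3)[OF k(2)] k by simp_all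
  have e': "e k \<in> hom C X p" if "k \<in> S" "k \<noteq> k0" "k \<noteq> k1" for k using P(3)[OF that(1)] that by simp
  obtain c where c: "c \<in> hom C T p"
    "\<And>k. k \<in> S \<Longrightarrow> c \<cdot>\<^bsub>C\<^esub> i k = (if k = k0 then e k0 \<cdot>\<^bsub>C\<^esub> F else if k = k1 then e k1 \<cdot>\<^bsub>C\<^esub> G else e k)"
  proof (rule is_coprod_family_desc[OF T P(1), of "\<lambda>k. if k = k0 then e k0 \<cdot>\<^bsub>C\<^esub> F else if k = k1 then e k1 \<cdot>\<^bsub>C\<^esub> G else e k"])
    show "(if k = k0 then e k0 \<cdot>\<^bsub>C\<^esub> F else if k = k1 then e k1 \<cdot>\<^bsub>C\<^esub> G else e k) \<in> hom C X p" if "k \<in> S" for k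
      using e e'[OF that] F G by (auto simp: hom_def)
  qed blast
  have "is_dpo C F G (i k0) (i k1) p (e k0) (e k1) c"
  proof (rule dpoI[OF F G T'(3)[OF k(1)] T'(3)[OF k(2)] e(1,2) c(1)])
    show "e k0 \<cdot>\<^bsub>C\<^esub> F = c \<cdot>\<^bsub>C\<^esub> i k0" "e k1 \<cdot>\<^bsub>C\<^esub> G = c \<cdot>\<^bsub>C\<^esub> i k1" using c(2)[OF k(1)] c(2)[OF k(2)] k(3) by auto
    show "\<exists>u. u \<in> hom C p t \<and> u \<cdot>\<^bsub>C\<^esub> e k0 = y \<and> u \<cdot>\<^bsub>C\<^esub> e k1 = z \<and> u \<cdot>\<^bsub>C\<^esub> c = h"
      if t: "t \<in> Obj C" and y: "y \<in> hom C Y t" and z: "z \<in> hom C Z t" and h: "h \<in> hom C T t"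
        and yF: "y \<cdot>\<^bsub>C\<^esub> F = h \<cdot>\<^bsub>C\<^esub> i k0" and zG: "z \<cdot>\<^bsub>C\<^esub> G = h \<cdot>\<^bsub>C\<^esub> i k1" for t y z h
    proof -
      obtain u where u: "u \<in> hom C p t"
        "\<And>k. k \<in> S \<Longrightarrow> u \<cdot>\<^bsub>C\<^esub> e k = (if k = k0 then y else if k = k1 then z else h \<cdot>\<^bsub>C\<^esub> i k)"
      proof (rule is_coprod_family_desc[OF p t, of "\<lambda>k. if k = k0 then y else if k = k1 then z else h \<cdot>\<^bsub>C\<^esub> i k"])
        show "(if k = k0 then y else if k = k1 then z else h \<cdot>\<^bsub>C\<^esub> i k) \<in> hom C (if k = k0 then Y else if k = k1 then Z else X) t"
          if "k \<in> S" for k using y z h i[OF that] by (auto simp: hom_def)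
      qed blast
      have ue: "u \<cdot>\<^bsub>C\<^esub> e k0 = y" "u \<cdot>\<^bsub>C\<^esub> e k1 = z" using u(2)[OF k(1)] u(2)[OF k(2)] k(3) by auto
      have "u \<cdot>\<^bsub>C\<^esub> c = h"
      proof (rule family_eqI[OF T _ h])
        show "u \<cdot>\<^bsub>C\<^esub> c \<in> hom C T t" using u(1) c(1) by (auto simp: hom_def)
        fix k assume kS: "k \<in> S"
        have "u \<cdot>\<^bsub>C\<^esub> (c \<cdot>\<^bsub>C\<^esub> i k) = h \<cdot>\<^bsub>C\<^esub> i k"
          using c(2)[OF kS] u(2)[OF kS] comp_ext[OF ue(1), of F] comp_ext[OF ue(2), of G] e(1,2) u(1) F G yF zG
          by (auto simp: hom_def)
        then show "(u \<cdot>\<^bsub>C\<^esub> c) \<cdot>\<^bsub>C\<^esub> i k = h \<cdot>\<^bsub>C\<^esub> i k" using u(1) c(1) i[OF kS] by (simp add: hom_def)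
      qed
      then show ?thesis using u(1) ue by blast
    qed
    show "u = v" if uv: "u \<in> hom C p t" "v \<in> hom C p t" and q: "u \<cdot>\<^bsub>C\<^esub> e k0 = v \<cdot>\<^bsub>C\<^esub> e k0" "u \<cdot>\<^bsub>C\<^esub> e k1 = v \<cdot>\<^bsub>C\<^esub> e k1"
      "u \<cdot>\<^bsub>C\<^esub> c = v \<cdot>\<^bsub>C\<^esub> c" for t u v
    proof (rule family_eqI[OF p uv])
      fix k assume kS: "k \<in> S"
      show "u \<cdot>\<^bsub>C\<^esub> e k = v \<cdot>\<^bsub>C\<^esub> e k"
      proof (cases "k = k0 \<or> k = k1")
        case False
        then have "e k = c \<cdot>\<^bsub>C\<^esub> i k" using c(2)[OF kS] by auto
        moreover have "(u \<cdot>\<^bsub>C\<^esub> c) \<cdot>\<^bsub>C\<^esub> i k = (v \<cdot>\<^bsub>C\<^esub> c) \<cdot>\<^bsub>C\<^esub> i k" using q(3) by simp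
        ultimately show ?thesis using uv c(1) i[OF kS] by (simp add: hom_def)
      qed (use q in auto)
    qed
  qed
  then show ?thesis by blast
qed

end

subsection \<open>Chosen coproducts\<close>

context category begin

lemma cotuple_along:
  assumes "is_coprod C x y p i j" "f \<in> hom C x t" "g \<in> hom C y t"
  shows "cotuple_along C i j f g \<in> hom C p t" "cotuple_along C i j f g \<cdot>\<^bsub>C\<^esub> i = f" "cotuple_along C i j f g \<cdot>\<^bsub>C\<^esub> j = g"
proof -
  have "\<exists>!u. u \<in> hom C p t \<and> u \<cdot>\<^bsub>C\<^esub> i = f \<and> u \<cdot>\<^bsub>C\<^esub> j = g"
    using assms hom_obj unfolding is_coprod_def by blast
  moreover have "Cod C i = p" "Cod C f = t" using assms(2) is_coprodD(4)[OF assms(1)] by (simp_all add: hom_def)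
  ultimately show "cotuple_along C i j f g \<in> hom C p t" "cotuple_along C i j f g \<cdot>\<^bsub>C\<^esub> i = f" "cotuple_along C i j f g \<cdot>\<^bsub>C\<^esub> j = g"
    unfolding cotuple_along_def using theI'[of "\<lambda>u. u \<in> hom C p t \<and> u \<cdot>\<^bsub>C\<^esub> i = f \<and> u \<cdot>\<^bsub>C\<^esub> j = g"] by simp_all
qed

end

locale coprods = category C for C :: "('o, 'a) cat" +
  assumes fin: "has_finite_coproducts C"
begin

lemma coprod_is:
  assumes "x \<in> Obj C" "y \<in> Obj C"
  shows "is_coprod C x y (coprod_ob C x y) (in1 C x y) (in2 C x y)"
proof -
  have "\<exists>q. case q of (p, i, j) \<Rightarrow> is_coprod C x y p i j"
    using fin assms unfolding has_finite_coproducts_def by fastforce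
  from someI_ex[OF this] show ?thesis
    by (simp add: coprod_ob_def in1_def in2_def coprod_def case_prod_unfold)
qed

lemma coprod_simps [simp]:
  assumes "x \<in> Obj C" "y \<in> Obj C"
  shows "coprod_ob C x y \<in> Obj C" "in1 C x y \<in> Arr C" "Dom C (in1 C x y) = x" "Cod C (in1 C x y) = coprod_ob C x y"
   "in2 C x y \<in> Arr C" "Dom C (in2 C x y) = y" "Cod C (in2 C x y) = coprod_ob C x y"
  using is_coprodD[OF coprod_is[OF assms]] by (auto simp: hom_def)

lemma cotuple_simps [simp]:
  assumes "f \<in> Arr C" "g \<in> Arr C" "Cod C f = Cod C g"
  shows "cotuple C f g \<in> Arr C" "Dom C (cotuple C f g) = coprod_ob C (Dom C f) (Dom C g)"
    "Cod C (cotuple C f g) = Cod C g"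
    "x = Dom C f \<Longrightarrow> y = Dom C g \<Longrightarrow> cotuple C f g \<cdot>\<^bsub>C\<^esub> in1 C x y = f"
    "x = Dom C f \<Longrightarrow> y = Dom C g \<Longrightarrow> cotuple C f g \<cdot>\<^bsub>C\<^esub> in2 C x y = g"
  using cotuple_along[OF coprod_is, of "Dom C f" "Dom C g" f "Cod C f" g] assms by (auto simp: cotuple_def hom_def)

lemma cotuple_ext [simp]:
  assumes "f \<in> Arr C" "g \<in> Arr C" "Cod C f = Cod C g" "x = Dom C f" "y = Dom C g" "k \<in> Arr C"
  shows "Cod C k = x \<Longrightarrow> cotuple C f g \<cdot>\<^bsub>C\<^esub> (in1 C x y \<cdot>\<^bsub>C\<^esub> k) = f \<cdot>\<^bsub>C\<^esub> k"
    "Cod C k = y \<Longrightarrow> cotuple C f g \<cdot>\<^bsub>C\<^esub> (in2 C x y \<cdot>\<^bsub>C\<^esub> k) = g \<cdot>\<^bsub>C\<^esub> k"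
  using comp_ext[OF cotuple_simps(4)[OF assms(1-5)], of k] comp_ext[OF cotuple_simps(5)[OF assms(1-5)], of k] assms by auto

lemma chosen_eqI:
  assumes "u \<in> hom C (coprod_ob C x y) t" "v \<in> hom C (coprod_ob C x y) t" "x \<in> Obj C" "y \<in> Obj C"
    "u \<cdot>\<^bsub>C\<^esub> in1 C x y = v \<cdot>\<^bsub>C\<^esub> in1 C x y" "u \<cdot>\<^bsub>C\<^esub> in2 C x y = v \<cdot>\<^bsub>C\<^esub> in2 C x y"
  shows "u = v"
  using coprod_eqI[OF coprod_is] assms by blast

lemma coprod_map_simps [simp]:
  assumes "f \<in> Arr C" "g \<in> Arr C"
  shows "coprod_map C f g \<in> Arr C" "Dom C (coprod_map C f g) = coprod_ob C (Dom C f) (Dom C g)"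
    "Cod C (coprod_map C f g) = coprod_ob C (Cod C f) (Cod C g)"
    "x = Dom C f \<Longrightarrow> y = Dom C g \<Longrightarrow> coprod_map C f g \<cdot>\<^bsub>C\<^esub> in1 C x y = in1 C (Cod C f) (Cod C g) \<cdot>\<^bsub>C\<^esub> f"
    "x = Dom C f \<Longrightarrow> y = Dom C g \<Longrightarrow> coprod_map C f g \<cdot>\<^bsub>C\<^esub> in2 C x y = in2 C (Cod C f) (Cod C g) \<cdot>\<^bsub>C\<^esub> g"
  using assms by (auto simp: coprod_map_def)

lemma coprod_map_ext [simp]:
  assumes "f \<in> Arr C" "g \<in> Arr C" "x = Dom C f" "y = Dom C g" "k \<in> Arr C"
  shows "Cod C k = x \<Longrightarrow> coprod_map C f g \<cdot>\<^bsub>C\<^esub> (in1 C x y \<cdot>\<^bsub>C\<^esub> k) = in1 C (Cod C f) (Cod C g) \<cdot>\<^bsub>C\<^esub> (f \<cdot>\<^bsub>C\<^esub> k)"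
    "Cod C k = y \<Longrightarrow> coprod_map C f g \<cdot>\<^bsub>C\<^esub> (in2 C x y \<cdot>\<^bsub>C\<^esub> k) = in2 C (Cod C f) (Cod C g) \<cdot>\<^bsub>C\<^esub> (g \<cdot>\<^bsub>C\<^esub> k)"
  using assms by (auto simp: coprod_map_def)

lemma cotuple_eqI:
  assumes "u \<in> Arr C" "v \<in> Arr C" "Dom C u = coprod_ob C x y" "Dom C v = coprod_ob C x y" "Cod C u = Cod C v"
    "x \<in> Obj C" "y \<in> Obj C"
    "u \<cdot>\<^bsub>C\<^esub> in1 C x y = v \<cdot>\<^bsub>C\<^esub> in1 C x y" "u \<cdot>\<^bsub>C\<^esub> in2 C x y = v \<cdot>\<^bsub>C\<^esub> in2 C x y"
  shows "u = v"
  using chosen_eqI[of u x y "Cod C v" v] assms by (auto simp: hom_def)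

lemma coprod_map_comp:
  assumes "f \<in> Arr C" "g \<in> Arr C" "f' \<in> Arr C" "g' \<in> Arr C" "Dom C f' = Cod C f" "Dom C g' = Cod C g"
  shows "coprod_map C f' g' \<cdot>\<^bsub>C\<^esub> coprod_map C f g = coprod_map C (f' \<cdot>\<^bsub>C\<^esub> f) (g' \<cdot>\<^bsub>C\<^esub> g)"
  by (rule cotuple_eqI[of _ _ "Dom C f" "Dom C g"]) (use assms in auto)

lemma coprod_map_Ident: "x \<in> Obj C \<Longrightarrow> y \<in> Obj C \<Longrightarrow> coprod_map C (Ident C x) (Ident C y) = Ident C (coprod_ob C x y)"
  by (rule cotuple_eqI[of _ _ x y]) auto

lemma family_exists: "finite S \<Longrightarrow> (\<And>k. k \<in> S \<Longrightarrow> A k \<in> Obj C) \<Longrightarrow> \<exists>p i. is_coprod_family C S A p i"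
proof (induction rule: finite_induct)
  case empty
  obtain z where "is_initial C z" using fin by (auto simp: has_finite_coproducts_def)
  then show ?case by (auto simp: is_coprod_family_def is_initial_def)
next
  case (insert s S)
  then obtain p i where p: "is_coprod_family C S A p i" by auto
  have "is_coprod C p (A s) (coprod_ob C p (A s)) (in1 C p (A s)) (in2 C p (A s))"
    using coprod_is is_coprod_familyD(1)[OF p] insert by auto
  from family_insert[OF p this] insert show ?case by blast
qed

lemma copower_is:
  assumes "finite S" "x \<in> Obj C"
  shows "is_coprod_family C S (\<lambda>_. x) (copower_ob C S x) (copower_in C S x)"
proof -
  have "\<exists>q. case q of (p, i) \<Rightarrow> is_coprod_family C S (\<lambda>_. x) p i" using family_exists[of S "\<lambda>_. x"] assms by auto
  from someI_ex[OF this] show ?thesis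
    by (simp add: copower_ob_def copower_in_def copower_def case_prod_unfold)
qed

lemma copower_simps [simp]:
  assumes "finite S" "x \<in> Obj C"
  shows "copower_ob C S x \<in> Obj C" "k \<in> S \<Longrightarrow> copower_in C S x k \<in> Arr C" "k \<in> S \<Longrightarrow> Dom C (copower_in C S x k) = x"
    "k \<in> S \<Longrightarrow> Cod C (copower_in C S x k) = copower_ob C S x"
  using is_coprod_familyD[OF copower_is[OF assms]] by (auto simp: hom_def)

lemma copower_desc:
  assumes "finite S" "x \<in> Obj C" "t \<in> Obj C" "\<And>k. k \<in> S \<Longrightarrow> h k \<in> hom C x t"
  shows "copower_desc C S x t h \<in> Arr C" "Dom C (copower_desc C S x t h) = copower_ob C S x"
    "Cod C (copower_desc C S x t h) = t"
    "k \<in> S \<Longrightarrow> copower_desc C S x t h \<cdot>\<^bsub>C\<^esub> copower_in C S x k = h k"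
    "k \<in> S \<Longrightarrow> f \<in> Arr C \<Longrightarrow> Cod C f = x \<Longrightarrow> copower_desc C S x t h \<cdot>\<^bsub>C\<^esub> (copower_in C S x k \<cdot>\<^bsub>C\<^esub> f) = h k \<cdot>\<^bsub>C\<^esub> f"
proof -
  have "\<exists>!u. u \<in> hom C (copower_ob C S x) t \<and> (\<forall>k\<in>S. u \<cdot>\<^bsub>C\<^esub> copower_in C S x k = h k)"
    using copower_is[OF assms(1,2)] assms(3,4) unfolding is_coprod_family_def by simp
  from theI'[OF this]
  have *: "copower_desc C S x t h \<in> hom C (copower_ob C S x) t"
     "\<forall>k\<in>S. copower_desc C S x t h \<cdot>\<^bsub>C\<^esub> copower_in C S x k = h k" by (simp_all add: copower_desc_def)
  then show "copower_desc C S x t h \<in> Arr C" "Dom C (copower_desc C S x t h) = copower_ob C S x"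
    "Cod C (copower_desc C S x t h) = t"
    "k \<in> S \<Longrightarrow> copower_desc C S x t h \<cdot>\<^bsub>C\<^esub> copower_in C S x k = h k" by (auto simp: hom_def)
  show "copower_desc C S x t h \<cdot>\<^bsub>C\<^esub> (copower_in C S x k \<cdot>\<^bsub>C\<^esub> f) = h k \<cdot>\<^bsub>C\<^esub> f" if "k \<in> S" "f \<in> Arr C" "Cod C f = x"
    using comp_ext[of "copower_desc C S x t h" "copower_in C S x k" "h k" f] * that assms by (simp add: hom_def)
qed

lemma copower_eqI:
  assumes "finite S" "x \<in> Obj C" "u \<in> Arr C" "v \<in> Arr C" "Dom C u = copower_ob C S x" "Dom C v = copower_ob C S x"
    "Cod C u = Cod C v" "\<And>k. k \<in> S \<Longrightarrow> u \<cdot>\<^bsub>C\<^esub> copower_in C S x k = v \<cdot>\<^bsub>C\<^esub> copower_in C S x k"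
  shows "u = v"
  using family_eqI[OF copower_is[OF assms(1,2)], of u "Cod C v" v] assms by (auto simp: hom_def)

text \<open>Translates the pushouts along coproduct maps that occur in \<open>K_pushout\<close> and
  \<open>brown_coaction\<close> into the form without chosen coproducts. The legs from
  \<open>Y\<close> and \<open>Z\<close> are the restrictions of the single leg
  \<open>p\<close>.\<close>

lemma dpo_of_pushout:
  assumes k: "is_pushout C (coprod_map C F G) (cotuple C d0 d1) k p c"
    and F: "F \<in> hom C X Y" and G: "G \<in> hom C X Z" and d: "d0 \<in> hom C X T" "d1 \<in> hom C X T"
  shows "is_dpo C F G d0 d1 k (p \<cdot>\<^bsub>C\<^esub> in1 C Y Z) (p \<cdot>\<^bsub>C\<^esub> in2 C Y Z) c"
proof (rule dpoI[OF F G d])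
  have o [simp]: "X \<in> Obj C" "Y \<in> Obj C" "Z \<in> Obj C" "T \<in> Obj C" using F G d hom_obj by auto
  note F' = homD[OF F] homD[OF G] homD[OF d(1)] homD[OF d(2)]
  have p: "p \<in> Arr C" "Dom C p = coprod_ob C Y Z" "Cod C p = k" "c \<in> Arr C" "Dom C c = T" "Cod C c = k"
    using is_pushoutD[OF k] F' by (auto simp: hom_def)
  have e: "p \<cdot>\<^bsub>C\<^esub> coprod_map C F G = c \<cdot>\<^bsub>C\<^esub> cotuple C d0 d1" using is_pushoutD[OF k] by simp
  show "p \<cdot>\<^bsub>C\<^esub> in1 C Y Z \<in> hom C Y k" "p \<cdot>\<^bsub>C\<^esub> in2 C Y Z \<in> hom C Z k" "c \<in> hom C T k"
    using p by (auto simp: hom_def)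
  show "(p \<cdot>\<^bsub>C\<^esub> in1 C Y Z) \<cdot>\<^bsub>C\<^esub> F = c \<cdot>\<^bsub>C\<^esub> d0"
    using comp_ext2[OF e, of "in1 C X X"] p F' by simp
  show "(p \<cdot>\<^bsub>C\<^esub> in2 C Y Z) \<cdot>\<^bsub>C\<^esub> G = c \<cdot>\<^bsub>C\<^esub> d1"
    using comp_ext2[OF e, of "in2 C X X"] p F' by simp
  show "\<exists>u. u \<in> hom C k t \<and> u \<cdot>\<^bsub>C\<^esub> (p \<cdot>\<^bsub>C\<^esub> in1 C Y Z) = y \<and> u \<cdot>\<^bsub>C\<^esub> (p \<cdot>\<^bsub>C\<^esub> in2 C Y Z) = z \<and> u \<cdot>\<^bsub>C\<^esub> c = h"
    if t: "t \<in> Obj C" and y: "y \<in> hom C Y t" and z: "z \<in> hom C Z t" and h: "h \<in> hom C T t"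
      and yF: "y \<cdot>\<^bsub>C\<^esub> F = h \<cdot>\<^bsub>C\<^esub> d0" and zG: "z \<cdot>\<^bsub>C\<^esub> G = h \<cdot>\<^bsub>C\<^esub> d1" for t y z h
  proof -
    note y' = homD[OF y] homD[OF z] homD[OF h]
    have "cotuple C y z \<cdot>\<^bsub>C\<^esub> coprod_map C F G = h \<cdot>\<^bsub>C\<^esub> cotuple C d0 d1"
      by (rule cotuple_eqI[of _ _ X X]) (use y' F' yF zG in auto)
    then obtain u where u: "u \<in> hom C k t" "u \<cdot>\<^bsub>C\<^esub> p = cotuple C y z" "u \<cdot>\<^bsub>C\<^esub> c = h"
      using is_pushout_desc[OF k, of "cotuple C y z" t h] t h y' F' by (auto simp: hom_def)
    then show ?thesis
      using comp_ext[OF u(2)] p y' by (intro exI[of _ u]) (auto simp: hom_def)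
  qed
  show "u = v" if uv: "u \<in> hom C k t" "v \<in> hom C k t" and
    q: "u \<cdot>\<^bsub>C\<^esub> (p \<cdot>\<^bsub>C\<^esub> in1 C Y Z) = v \<cdot>\<^bsub>C\<^esub> (p \<cdot>\<^bsub>C\<^esub> in1 C Y Z)" "u \<cdot>\<^bsub>C\<^esub> (p \<cdot>\<^bsub>C\<^esub> in2 C Y Z) = v \<cdot>\<^bsub>C\<^esub> (p \<cdot>\<^bsub>C\<^esub> in2 C Y Z)"
    "u \<cdot>\<^bsub>C\<^esub> c = v \<cdot>\<^bsub>C\<^esub> c" for t u v
  proof (rule pushout_eqI[OF k uv _ q(3)])
    show "u \<cdot>\<^bsub>C\<^esub> p = v \<cdot>\<^bsub>C\<^esub> p"
      by (rule cotuple_eqI[of _ _ Y Z]) (use uv p q in \<open>auto simp: hom_def\<close>)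
  qed
qed

end

section \<open>Weak equivalences closed under coproducts\<close>

text \<open>Closure under binary coproducts is the one condition beyond the usual ones; it is what
  allows coproducts to survive localization.\<close>

locale weq = coprods C for C :: "('o, 'a) cat" +
  fixes W :: "'a set"
  assumes W_arr: "W \<subseteq> Arr C" and W_23: "two_out_of_three C W"
    and W_iso: "is_iso C f \<Longrightarrow> f \<in> W"
    and W_coprod: "f \<in> W \<Longrightarrow> g \<in> W \<Longrightarrow> coprod_map C f g \<in> W"
begin

lemma W_in [simp]: "w \<in> W \<Longrightarrow> w \<in> Arr C" using W_arr by blast

lemma W_comp: "f \<in> W \<Longrightarrow> g \<in> W \<Longrightarrow> Dom C g = Cod C f \<Longrightarrow> g \<cdot>\<^bsub>C\<^esub> f \<in> W"
  and W_cancel_right: "f \<in> W \<Longrightarrow> g \<cdot>\<^bsub>C\<^esub> f \<in> W \<Longrightarrow> g \<in> Arr C \<Longrightarrow> Dom C g = Cod C f \<Longrightarrow> g \<in> W"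
  and W_cancel_left: "g \<in> W \<Longrightarrow> g \<cdot>\<^bsub>C\<^esub> f \<in> W \<Longrightarrow> f \<in> Arr C \<Longrightarrow> Dom C g = Cod C f \<Longrightarrow> f \<in> W"
  using W_23 W_in unfolding two_out_of_three_def by blast+

lemma W_Ident [simp]: "x \<in> Obj C \<Longrightarrow> Ident C x \<in> W" by (simp add: W_iso)

lemma W_section: "s \<cdot>\<^bsub>C\<^esub> f = Ident C x \<Longrightarrow> s \<in> W \<Longrightarrow> f \<in> hom C x y \<Longrightarrow> Dom C s = y \<Longrightarrow> f \<in> W"
  using W_cancel_left[of s f] hom_obj by (auto simp: hom_def)

lemma W_retract: "s \<cdot>\<^bsub>C\<^esub> f = Ident C x \<Longrightarrow> f \<in> W \<Longrightarrow> f \<in> hom C x y \<Longrightarrow> s \<in> Arr C \<Longrightarrow> Dom C s = y \<Longrightarrow> s \<in> W"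
  using W_cancel_right[of f s] hom_obj by (auto simp: hom_def)

text \<open>Closure is postulated for chosen coproducts. The comparison isomorphisms with
  \<open>p\<close> and \<open>q\<close> are weak equivalences, and 2-out-of-3 carries the property
  over to arbitrary coproducts.\<close>

lemma coprod_W:
  assumes p: "is_coprod C x y p i j" and q: "is_coprod C x' y' q i' j'"
    and f: "f \<in> W" "f \<in> hom C x x'" and g: "g \<in> W" "g \<in> hom C y y'"
    and u: "u \<in> hom C p q" "u \<cdot>\<^bsub>C\<^esub> i = i' \<cdot>\<^bsub>C\<^esub> f" "u \<cdot>\<^bsub>C\<^esub> j = j' \<cdot>\<^bsub>C\<^esub> g"
  shows "u \<in> W"
proof -
  note p' = is_coprodD[OF p] and q' = is_coprodD[OF q]
  have P: "i \<in> Arr C" "Dom C i = x" "Cod C i = p" "j \<in> Arr C" "Dom C j = y" "Cod C j = p"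
    "i' \<in> Arr C" "Dom C i' = x'" "Cod C i' = q" "j' \<in> Arr C" "Dom C j' = y'" "Cod C j' = q"
    using p' q' by (auto simp: hom_def)
  obtain a where a: "a \<in> hom C (coprod_ob C x y) p" "is_iso C a" "\<And>b. b \<in> UNIV \<Longrightarrow> a \<cdot>\<^bsub>C\<^esub> case_bool (in1 C x y) (in2 C x y) b = case_bool i j b"
    using colim_iso[OF coprod_is[OF p'(1,2), unfolded coprod_iff_colim] p[unfolded coprod_iff_colim]] by blast
  obtain b where b: "b \<in> hom C (coprod_ob C x' y') q" "is_iso C b" "\<And>c. c \<in> UNIV \<Longrightarrow> b \<cdot>\<^bsub>C\<^esub> case_bool (in1 C x' y') (in2 C x' y') c = case_bool i' j' c"
    using colim_iso[OF coprod_is[OF q'(1,2), unfolded coprod_iff_colim] q[unfolded coprod_iff_colim]] by blast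
  have ab: "a \<cdot>\<^bsub>C\<^esub> in1 C x y = i" "a \<cdot>\<^bsub>C\<^esub> in2 C x y = j" "b \<cdot>\<^bsub>C\<^esub> in1 C x' y' = i'" "b \<cdot>\<^bsub>C\<^esub> in2 C x' y' = j'"
    using a(3)[of True] a(3)[of False] b(3)[of True] b(3)[of False] by auto
  note h = homD[OF a(1)] homD[OF b(1)] homD[OF f(2)] homD[OF g(2)] homD[OF u(1)] p'(1-3) q'(1-3)
  have k: "b \<cdot>\<^bsub>C\<^esub> (in1 C x' y' \<cdot>\<^bsub>C\<^esub> f) = i' \<cdot>\<^bsub>C\<^esub> f" "b \<cdot>\<^bsub>C\<^esub> (in2 C x' y' \<cdot>\<^bsub>C\<^esub> g) = j' \<cdot>\<^bsub>C\<^esub> g"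
    using comp_ext[OF ab(3), of f] comp_ext[OF ab(4), of g] h by simp_all
  have "u \<cdot>\<^bsub>C\<^esub> a = b \<cdot>\<^bsub>C\<^esub> coprod_map C f g"
    by (rule cotuple_eqI[of _ _ x y]) (simp_all add: h ab u(2,3) k)
  moreover have "b \<cdot>\<^bsub>C\<^esub> coprod_map C f g \<in> W"
    using W_comp[OF W_coprod[OF f(1) g(1)] W_iso[OF b(2)]] f g b by (auto simp: hom_def)
  ultimately have "u \<cdot>\<^bsub>C\<^esub> a \<in> W" by simp
  from W_cancel_right[OF W_iso[OF a(2)] this] show ?thesis using h by simp
qed

text \<open>Induction on the index set: up to isomorphism a coproduct over \<open>insert s S\<close>
  is the binary coproduct of one over \<open>S\<close> with the summand at \<open>s\<close>. In the
  empty case \<open>u\<close> is a map between initial objects, hence invertible.\<close>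

lemma family_W:
  assumes "finite S" "is_coprod_family C S A p i" "is_coprod_family C S B q j"
    and "\<And>k. k \<in> S \<Longrightarrow> w k \<in> W" "\<And>k. k \<in> S \<Longrightarrow> w k \<in> hom C (A k) (B k)"
    and "u \<in> hom C p q" "\<And>k. k \<in> S \<Longrightarrow> u \<cdot>\<^bsub>C\<^esub> i k = j k \<cdot>\<^bsub>C\<^esub> w k"
  shows "u \<in> W"
  using assms
proof (induction S arbitrary: p q i j u rule: finite_induct)
  case empty
  have "is_iso C u"
  proof -
    obtain v where v: "v \<in> hom C q p" using is_coprod_family_desc[OF empty(2) is_coprod_familyD(1)[OF empty(1)]] by blast
    have "v \<cdot>\<^bsub>C\<^esub> u = Ident C p"
      by (rule family_eqI[OF empty(1), of _ p]) (use v empty(5) hom_obj[OF v] in \<open>auto simp: hom_def\<close>)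
    moreover have "u \<cdot>\<^bsub>C\<^esub> v = Ident C q"
      by (rule family_eqI[OF empty(2), of _ q]) (use v empty(5) hom_obj[OF v] in \<open>auto simp: hom_def\<close>)
    ultimately show ?thesis using isoI v empty(5) by blast
  qed
  then show ?case by (rule W_iso)
next
  case (insert s S)
  have AB: "\<And>k. k \<in> insert s S \<Longrightarrow> A k \<in> Obj C" "\<And>k. k \<in> insert s S \<Longrightarrow> B k \<in> Obj C"
    using is_coprod_familyD(2)[OF insert.prems(1)] is_coprod_familyD(2)[OF insert.prems(2)] by auto
  obtain p' i' where p': "is_coprod_family C S A p' i'" using family_exists[OF insert.hyps(1), of A] AB by auto
  obtain q' j' where q': "is_coprod_family C S B q' j'" using family_exists[OF insert.hyps(1), of B] AB by auto
  have i': "\<And>k. k \<in> S \<Longrightarrow> i' k \<in> hom C (A k) p'" and j': "\<And>k. k \<in> S \<Longrightarrow> j' k \<in> hom C (B k) q'"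
    using is_coprod_familyD[OF p'] is_coprod_familyD[OF q'] by auto
  have jw: "j' k \<cdot>\<^bsub>C\<^esub> w k \<in> hom C (A k) q'" if "k \<in> S" for k
    using j'[OF that] insert.prems(4)[of k] that by (auto simp: hom_def)
  obtain u' where u': "u' \<in> hom C p' q'" "\<And>k. k \<in> S \<Longrightarrow> u' \<cdot>\<^bsub>C\<^esub> i' k = j' k \<cdot>\<^bsub>C\<^esub> w k"
    using is_coprod_family_desc[OF p' is_coprod_familyD(1)[OF q'], of "\<lambda>k. j' k \<cdot>\<^bsub>C\<^esub> w k", OF jw] by blast
  have "u' \<in> W" by (rule insert.IH[OF p' q']) (use insert.prems u' in auto)
  have o: "p' \<in> Obj C" "q' \<in> Obj C" "A s \<in> Obj C" "B s \<in> Obj C"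
    using is_coprod_familyD[OF p'] is_coprod_familyD[OF q'] AB by auto
  have ii: "\<And>k. k \<in> insert s S \<Longrightarrow> i k \<in> hom C (A k) p"
    and jj: "\<And>k. k \<in> insert s S \<Longrightarrow> j k \<in> hom C (B k) q"
    using is_coprod_familyD[OF insert.prems(1)] is_coprod_familyD[OF insert.prems(2)] by auto
  note ws = insert.prems(4)[of s, simplified]
  let ?P = "coprod_ob C p' (A s)" and ?Q = "coprod_ob C q' (B s)"
  have P: "is_coprod_family C (insert s S) A ?P (\<lambda>k. if k = s then in2 C p' (A s) else in1 C p' (A s) \<cdot>\<^bsub>C\<^esub> i' k)"
    by (rule family_insert[OF p' coprod_is insert.hyps(2)]) (use o in auto)
  have Q: "is_coprod_family C (insert s S) B ?Q (\<lambda>k. if k = s then in2 C q' (B s) else in1 C q' (B s) \<cdot>\<^bsub>C\<^esub> j' k)"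
    by (rule family_insert[OF q' coprod_is insert.hyps(2)]) (use o in auto)
  obtain a where a: "a \<in> hom C ?P p" "is_iso C a" "\<And>k. k \<in> insert s S \<Longrightarrow> a \<cdot>\<^bsub>C\<^esub> (if k = s then in2 C p' (A s) else in1 C p' (A s) \<cdot>\<^bsub>C\<^esub> i' k) = i k"
    using colim_iso[OF P[unfolded family_iff_colim] insert.prems(1)[unfolded family_iff_colim]] by blast
  obtain b where b: "b \<in> hom C ?Q q" "is_iso C b" "\<And>k. k \<in> insert s S \<Longrightarrow> b \<cdot>\<^bsub>C\<^esub> (if k = s then in2 C q' (B s) else in1 C q' (B s) \<cdot>\<^bsub>C\<^esub> j' k) = j k"
    using colim_iso[OF Q[unfolded family_iff_colim] insert.prems(2)[unfolded family_iff_colim]] by blast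
  have c: "coprod_map C u' (w s) \<in> W" by (rule W_coprod) (use insert.prems \<open>u' \<in> W\<close> in auto)
  have "u \<cdot>\<^bsub>C\<^esub> a = b \<cdot>\<^bsub>C\<^esub> coprod_map C u' (w s)"
  proof (rule family_eqI[OF P])
    show "u \<cdot>\<^bsub>C\<^esub> a \<in> hom C ?P q" using insert.prems(5) a by (auto simp: hom_def)
    show "b \<cdot>\<^bsub>C\<^esub> coprod_map C u' (w s) \<in> hom C ?P q" using u' ws b by (auto simp: hom_def)
    fix k assume k: "k \<in> insert s S"
    show "(u \<cdot>\<^bsub>C\<^esub> a) \<cdot>\<^bsub>C\<^esub> (if k = s then in2 C p' (A s) else in1 C p' (A s) \<cdot>\<^bsub>C\<^esub> i' k) =
      (b \<cdot>\<^bsub>C\<^esub> coprod_map C u' (w s)) \<cdot>\<^bsub>C\<^esub> (if k = s then in2 C p' (A s) else in1 C p' (A s) \<cdot>\<^bsub>C\<^esub> i' k)"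
    proof (cases "k = s")
      case True
      have "a \<cdot>\<^bsub>C\<^esub> in2 C p' (A s) = i s" "b \<cdot>\<^bsub>C\<^esub> in2 C q' (B s) = j s" using a(3)[of s] b(3)[of s] by auto
      then show ?thesis
        using True insert.prems(5) insert.prems(6)[of s] a(1) b(1) o u'(1) ws comp_ext[of b "in2 C q' (B s)" "j s" "w s"]
        by (simp add: hom_def)
    next
      case False
      then have kS: "k \<in> S" using k by simp
      have *: "a \<cdot>\<^bsub>C\<^esub> (in1 C p' (A s) \<cdot>\<^bsub>C\<^esub> i' k) = i k" "b \<cdot>\<^bsub>C\<^esub> (in1 C q' (B s) \<cdot>\<^bsub>C\<^esub> j' k) = j k" using a(3)[of k] b(3)[of k] False k by auto
      have "b \<cdot>\<^bsub>C\<^esub> (in1 C q' (B s) \<cdot>\<^bsub>C\<^esub> (j' k \<cdot>\<^bsub>C\<^esub> w k)) = j k \<cdot>\<^bsub>C\<^esub> w k"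
        using comp_ext[OF *(2), of "w k"] b(1) o j'[OF kS] insert.prems(4)[OF k] by (simp add: hom_def)
      then show ?thesis
        using False * insert.prems(5) insert.prems(6)[OF k] a(1) b(1) o u'(1) u'(2)[OF kS] ws i'[OF kS] by (simp add: hom_def)
    qed
  qed
  moreover have "b \<cdot>\<^bsub>C\<^esub> coprod_map C u' (w s) \<in> W"
    using W_comp[OF c W_iso[OF b(2)]] u' ws b by (auto simp: hom_def)
  ultimately have "u \<cdot>\<^bsub>C\<^esub> a \<in> W" by simp
  from W_cancel_right[OF W_iso[OF a(2)] this] show ?case using insert.prems(5) a(1) by (simp add: hom_def)
qed

subsection \<open>Coproducts in the localization\<close>

abbreviation "L \<equiv> localization C W"
abbreviation "Q \<equiv> loc_arr C W"

sublocale L: category L by (rule category_loc)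

lemma Q_iso [simp]: "w \<in> W \<Longrightarrow> is_iso L (Q w)" by (simp add: loc_arr_iso)

lemma Q_comp: "f \<in> Arr C \<Longrightarrow> g \<in> Arr C \<Longrightarrow> Dom C g = Cod C f \<Longrightarrow> Q g \<cdot>\<^bsub>L\<^esub> Q f = Q (g \<cdot>\<^bsub>C\<^esub> f)"
  by (simp add: loc_arr_comp)

lemma Q_Ident: "x \<in> Obj C \<Longrightarrow> Q (Ident C x) = Ident L x" by (simp add: loc_arr_Ident)

lemma inverting_id: "inverting_functor C L W (\<lambda>x. x) Q"
  by unfold_locales (auto simp: loc_arr_comp loc_arr_Ident loc_arr_hom)

text \<open>The inclusion of a fixed summand \<open>y\<close> is natural from the constant functor
  at \<open>y\<close>. To feed it to \<open>ext_natural\<close>, the constant functor must also be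
  presented as one that is extended to the localization.\<close>

lemma inverting_const:
  assumes "y \<in> Obj C" shows "inverting_functor C L W (\<lambda>_. y) (\<lambda>_. Ident L y)"
  by unfold_locales (use assms L.Ident_arr[of y] in \<open>auto simp: hom_def\<close>)

text \<open>\<open>W\<close> is inverted because the coproduct of a weak equivalence with an
  identity is again a weak equivalence.\<close>

lemma inverting_left:
  assumes "y \<in> Obj C" shows "inverting_functor C L W (\<lambda>x. coprod_ob C x y) (\<lambda>f. Q (coprod_map C f (Ident C y)))"
proof unfold_locales
  show "Q (coprod_map C f (Ident C y)) \<in> hom L (coprod_ob C x y) (coprod_ob C z y)" if "f \<in> hom C x z" for f x z
    using that assms by (intro loc_arr_hom) (auto simp: hom_def)
qed (use assms in \<open>auto simp: coprod_map_Ident loc_arr_Ident Q_comp coprod_map_comp intro!: Q_iso W_coprod\<close>)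

lemma inverting_right:
  assumes "x \<in> Obj C" shows "inverting_functor C L W (\<lambda>y. coprod_ob C x y) (\<lambda>f. Q (coprod_map C (Ident C x) f))"
proof unfold_locales
  show "Q (coprod_map C (Ident C x) f) \<in> hom L (coprod_ob C x y) (coprod_ob C x z)" if "f \<in> hom C y z" for f y z
    using that assms by (intro loc_arr_hom) (auto simp: hom_def)
qed (use assms in \<open>auto simp: coprod_map_Ident loc_arr_Ident Q_comp coprod_map_comp intro!: Q_iso W_coprod\<close>)

lemma ext_id:
  assumes "u \<in> hom L x y" shows "loc_extend L (\<lambda>x. x) Q u = u"
proof -
  interpret F: inverting_functor C L W "\<lambda>x. x" Q by (rule inverting_id)
  show ?thesis using assms
  proof (induction rule: loc_induct)
    case (Ident x) then show ?case by (simp add: F.ext_Ident)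
  next
    case (Fwd x y z u f)
    then show ?case using F.ext_comp[OF Fwd(1) loc_arr_hom[OF Fwd(2)]] by (auto simp: F.ext_Q hom_def)
  next
    case (Bwd x y z u w)
    have "inv_arr L (Q w) \<in> hom L y z" using Bwd by (auto simp: hom_def)
    then show ?case using F.ext_comp[OF Bwd(1)] Bwd by (auto simp: F.ext_inv hom_def)
  qed
qed

lemma ext_const:
  assumes y: "y \<in> Obj C" and "u \<in> hom L a b" shows "loc_extend L (\<lambda>_. y) (\<lambda>_. Ident L y) u = Ident L y"
proof -
  interpret F: inverting_functor C L W "\<lambda>_. y" "\<lambda>_. Ident L y" by (rule inverting_const[OF y])
  have [simp]: "inv_arr L (Ident L y) = Ident L y"
    by (rule L.isoI[where x=y and y=y]) (use y L.Ident_arr[of y] in \<open>auto simp: hom_def\<close>)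
  show ?thesis using assms(2)
  proof (induction rule: loc_induct)
    case (Ident x) then show ?case by (simp add: F.ext_Ident)
  next
    case (Fwd a b z u f)
    then show ?case using F.ext_comp[OF Fwd(1) loc_arr_hom[OF Fwd(2)]] y by (auto simp: F.ext_Q hom_def)
  next
    case (Bwd a b z u w)
    have "inv_arr L (Q w) \<in> hom L b z" using Bwd by (auto simp: hom_def)
    then show ?case using F.ext_comp[OF Bwd(1)] Bwd y by (auto simp: F.ext_inv hom_def)
  qed
qed

section \<open>Coproducts as functors on the localization\<close>

definition lcop :: "'o \<Rightarrow> ('o, 'a) loc_arrow \<Rightarrow> ('o, 'a) loc_arrow" where
  "lcop y = loc_extend L (\<lambda>x. coprod_ob C x y) (\<lambda>f. Q (coprod_map C f (Ident C y)))"

definition rcop :: "'o \<Rightarrow> ('o, 'a) loc_arrow \<Rightarrow> ('o, 'a) loc_arrow" where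
  "rcop x = loc_extend L (\<lambda>y. coprod_ob C x y) (\<lambda>f. Q (coprod_map C (Ident C x) f))"

context
  notes [simp del] = L.comp_assoc
begin

lemma lcop_arr [simp]:
  assumes "y \<in> Obj C" "u \<in> Arr L"
  shows "lcop y u \<in> Arr L" "Dom L (lcop y u) = coprod_ob C (Dom L u) y" "Cod L (lcop y u) = coprod_ob C (Cod L u) y"
  using inverting_functor.ext_hom[OF inverting_left[OF assms(1)], of u "Dom L u" "Cod L u"] assms(2)
  by (auto simp: lcop_def hom_def)

lemma rcop_arr [simp]:
  assumes "x \<in> Obj C" "u \<in> Arr L"
  shows "rcop x u \<in> Arr L" "Dom L (rcop x u) = coprod_ob C x (Dom L u)" "Cod L (rcop x u) = coprod_ob C x (Cod L u)"
  using inverting_functor.ext_hom[OF inverting_right[OF assms(1)], of u "Dom L u" "Cod L u"] assms(2)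
  by (auto simp: rcop_def hom_def)

lemma lcop_comp: "y \<in> Obj C \<Longrightarrow> u \<in> Arr L \<Longrightarrow> v \<in> Arr L \<Longrightarrow> Dom L v = Cod L u \<Longrightarrow> lcop y (v \<cdot>\<^bsub>L\<^esub> u) = lcop y v \<cdot>\<^bsub>L\<^esub> lcop y u"
  unfolding lcop_def by (rule inverting_functor.ext_comp[OF inverting_left]) (auto simp: hom_def)

lemma rcop_comp: "y \<in> Obj C \<Longrightarrow> u \<in> Arr L \<Longrightarrow> v \<in> Arr L \<Longrightarrow> Dom L v = Cod L u \<Longrightarrow> rcop y (v \<cdot>\<^bsub>L\<^esub> u) = rcop y v \<cdot>\<^bsub>L\<^esub> rcop y u"
  unfolding rcop_def by (rule inverting_functor.ext_comp[OF inverting_right]) (auto simp: hom_def)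

lemma lcop_Q: "y \<in> Obj C \<Longrightarrow> f \<in> Arr C \<Longrightarrow> lcop y (Q f) = Q (coprod_map C f (Ident C y))"
  unfolding lcop_def by (rule inverting_functor.ext_Q[OF inverting_left])

lemma rcop_Q: "y \<in> Obj C \<Longrightarrow> f \<in> Arr C \<Longrightarrow> rcop y (Q f) = Q (coprod_map C (Ident C y) f)"
  unfolding rcop_def by (rule inverting_functor.ext_Q[OF inverting_right])

lemma lcop_in1:
  assumes "y \<in> Obj C" "u \<in> hom L a b"
  shows "lcop y u \<cdot>\<^bsub>L\<^esub> Q (in1 C a y) = Q (in1 C b y) \<cdot>\<^bsub>L\<^esub> u"
  using ext_natural[OF inverting_id inverting_left[OF assms(1)], of "\<lambda>x. Q (in1 C x y)" u a b] assms ext_id[OF assms(2)]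
  by (simp add: lcop_def loc_arr_hom Q_comp hom_def)

lemma lcop_in2:
  assumes "y \<in> Obj C" "u \<in> hom L a b"
  shows "lcop y u \<cdot>\<^bsub>L\<^esub> Q (in2 C a y) = Q (in2 C b y)"
  using ext_natural[OF inverting_const[OF assms(1)] inverting_left[OF assms(1)], of "\<lambda>x. Q (in2 C x y)" u a b] assms
    ext_const[OF assms] L.hom_obj[OF assms(2)]
  by (simp add: lcop_def loc_arr_hom Q_comp hom_def)

lemma rcop_in2:
  assumes "y \<in> Obj C" "u \<in> hom L a b"
  shows "rcop y u \<cdot>\<^bsub>L\<^esub> Q (in2 C y a) = Q (in2 C y b) \<cdot>\<^bsub>L\<^esub> u"
  using ext_natural[OF inverting_id inverting_right[OF assms(1)], of "\<lambda>x. Q (in2 C y x)" u a b] assms ext_id[OF assms(2)]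
  by (simp add: rcop_def loc_arr_hom Q_comp hom_def)

lemma rcop_in1:
  assumes "y \<in> Obj C" "u \<in> hom L a b"
  shows "rcop y u \<cdot>\<^bsub>L\<^esub> Q (in1 C y a) = Q (in1 C y b)"
  using ext_natural[OF inverting_const[OF assms(1)] inverting_right[OF assms(1)], of "\<lambda>x. Q (in1 C y x)" u a b] assms
    ext_const[OF assms] L.hom_obj[OF assms(2)]
  by (simp add: rcop_def loc_arr_hom Q_comp hom_def)

lemma interchange_Q:
  assumes "u \<in> hom L a b" "g \<in> hom C y z"
  shows "rcop b (Q g) \<cdot>\<^bsub>L\<^esub> lcop y u = lcop z u \<cdot>\<^bsub>L\<^esub> rcop a (Q g)"
proof -
  have o: "y \<in> Obj C" "z \<in> Obj C" "a \<in> Obj C" "b \<in> Obj C" using hom_obj[OF assms(2)] L.hom_obj[OF assms(1)] by auto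
  note g = homD[OF assms(2)]
  show ?thesis
    using ext_natural[OF inverting_left[OF o(1)] inverting_left[OF o(2)], of "\<lambda>x. Q (coprod_map C (Ident C x) g)" u a b]
      assms(1) o g by (simp add: lcop_def[symmetric] rcop_Q loc_arr_hom Q_comp hom_def coprod_map_comp)
qed

text \<open>Two rounds of \<open>ext_natural\<close>: for \<open>v\<close> coming from
  \<open>C\<close> this is naturality in \<open>u\<close>, and that case says in turn that the
  arrows \<open>lcop x u\<close> form a transformation natural over \<open>C\<close>, hence natural
  in every \<open>v\<close>.\<close>

lemma interchange:
  assumes u: "u \<in> hom L a b" and v: "v \<in> hom L y z"
  shows "rcop b v \<cdot>\<^bsub>L\<^esub> lcop y u = lcop z u \<cdot>\<^bsub>L\<^esub> rcop a v"
proof -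
  have o: "y \<in> Obj C" "z \<in> Obj C" "a \<in> Obj C" "b \<in> Obj C" using L.hom_obj[OF v] L.hom_obj[OF u] by auto
  have "lcop z u \<cdot>\<^bsub>L\<^esub> loc_extend L (coprod_ob C a) (\<lambda>f. Q (coprod_map C (Ident C a) f)) v
     = loc_extend L (coprod_ob C b) (\<lambda>f. Q (coprod_map C (Ident C b) f)) v \<cdot>\<^bsub>L\<^esub> lcop y u"
    using u v o interchange_Q[OF u]
    by (intro ext_natural[OF inverting_right[OF o(3)] inverting_right[OF o(4)], of "\<lambda>x. lcop x u" v y z])
      (auto simp: hom_def rcop_Q)
  then show ?thesis by (simp add: rcop_def)
qed

text \<open>The coproduct of \<open>u\<close> with itself, assembled from two functors of one
  variable, since extension to the localization is available in one variable at a time.\<close>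

definition both :: "('o, 'a) loc_arrow \<Rightarrow> ('o, 'a) loc_arrow" where
  "both u = rcop (Cod L u) u \<cdot>\<^bsub>L\<^esub> lcop (Dom L u) u"

lemma both_arr [simp]:
  assumes "u \<in> Arr L"
  shows "both u \<in> Arr L" "Dom L (both u) = coprod_ob C (Dom L u) (Dom L u)" "Cod L (both u) = coprod_ob C (Cod L u) (Cod L u)"
  using assms L.Dom_obj[OF assms] L.Cod_obj[OF assms] by (auto simp: both_def)

lemma both_comp:
  assumes u: "u \<in> hom L a b" and v: "v \<in> hom L b c"
  shows "both (v \<cdot>\<^bsub>L\<^esub> u) = both v \<cdot>\<^bsub>L\<^esub> both u"
proof -
  have o: "a \<in> Obj C" "b \<in> Obj C" "c \<in> Obj C" using L.hom_obj[OF v] L.hom_obj[OF u] by auto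
  have "both (v \<cdot>\<^bsub>L\<^esub> u) = rcop c v \<cdot>\<^bsub>L\<^esub> ((rcop c u \<cdot>\<^bsub>L\<^esub> lcop a v) \<cdot>\<^bsub>L\<^esub> lcop a u)"
    using u v o by (simp add: both_def hom_def rcop_comp lcop_comp L.comp_assoc)
  also have "\<dots> = rcop c v \<cdot>\<^bsub>L\<^esub> ((lcop b v \<cdot>\<^bsub>L\<^esub> rcop b u) \<cdot>\<^bsub>L\<^esub> lcop a u)"
    using interchange[OF v u] by simp
  also have "\<dots> = both v \<cdot>\<^bsub>L\<^esub> both u"
    using u v o by (simp add: both_def hom_def L.comp_assoc)
  finally show ?thesis .
qed

lemma codiagonal_arr [simp]: "x \<in> Obj C \<Longrightarrow> codiagonal C x \<in> Arr C"
  "x \<in> Obj C \<Longrightarrow> Dom C (codiagonal C x) = coprod_ob C x x" "x \<in> Obj C \<Longrightarrow> Cod C (codiagonal C x) = x"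
  by (simp_all add: codiagonal_def)

lemma both_Q:
  assumes "f \<in> Arr C" shows "both (Q f) = Q (coprod_map C f f)"
  using assms by (simp add: both_def rcop_Q lcop_Q Q_comp coprod_map_comp)

lemma codiagonal_Q:
  assumes "f \<in> hom C a b" shows "Q (codiagonal C b) \<cdot>\<^bsub>L\<^esub> both (Q f) = Q f \<cdot>\<^bsub>L\<^esub> Q (codiagonal C a)"
proof -
  have "codiagonal C b \<cdot>\<^bsub>C\<^esub> coprod_map C f f = f \<cdot>\<^bsub>C\<^esub> codiagonal C a"
    by (rule cotuple_eqI[of _ _ a a]) (use assms hom_obj[OF assms] in \<open>auto simp: hom_def codiagonal_def\<close>)
  then show ?thesis using assms hom_obj[OF assms] by (simp add: both_Q Q_comp hom_def)
qed

text \<open>\<open>both\<close> is not presented as an extension from \<open>C\<close>, so the proof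
  is by induction on the arrow. At an inverse, the square for \<open>w\<close> is conjugated; this
  uses that \<open>both\<close> respects composition, which is where \<open>interchange\<close>
  enters.\<close>

lemma codiagonal_natural:
  assumes "u \<in> hom L a b" shows "Q (codiagonal C b) \<cdot>\<^bsub>L\<^esub> both u = u \<cdot>\<^bsub>L\<^esub> Q (codiagonal C a)"
  using assms
proof (induction rule: loc_induct)
  case (Ident x)
  then show ?case using codiagonal_Q[of "Ident C x" x x] by (simp add: Q_Ident hom_def)
next
  case (Fwd x y z u f)
  note f = loc_arr_hom[OF Fwd(2), of W]
  have o: "x \<in> Obj C" "y \<in> Obj C" "z \<in> Obj C" using L.hom_obj[OF f] L.hom_obj[OF Fwd(1)] by auto
  have "Q (codiagonal C z) \<cdot>\<^bsub>L\<^esub> both (Q f \<cdot>\<^bsub>L\<^esub> u) = (Q (codiagonal C z) \<cdot>\<^bsub>L\<^esub> both (Q f)) \<cdot>\<^bsub>L\<^esub> both u"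
    using both_comp[OF Fwd(1) f] Fwd(1) f o by (simp add: L.comp_assoc hom_def)
  also have "\<dots> = Q f \<cdot>\<^bsub>L\<^esub> (Q (codiagonal C y) \<cdot>\<^bsub>L\<^esub> both u)"
    using codiagonal_Q[OF Fwd(2)] Fwd(1) f o by (simp add: L.comp_assoc hom_def)
  also have "\<dots> = (Q f \<cdot>\<^bsub>L\<^esub> u) \<cdot>\<^bsub>L\<^esub> Q (codiagonal C x)"
    using Fwd f o by (simp add: L.comp_assoc hom_def)
  finally show ?case .
next
  case (Bwd x y z u w)
  have w: "w \<in> W" "w \<in> hom C z y" using Bwd by auto
  note f = loc_arr_hom[OF w(2), of W]
  let ?v = "inv_arr L (Q w)"
  have v: "?v \<in> hom L y z" using w by (auto simp: hom_def)
  have o: "x \<in> Obj C" "y \<in> Obj C" "z \<in> Obj C" using L.hom_obj[OF f] L.hom_obj[OF Bwd(1)] by auto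
  have id: "?v \<cdot>\<^bsub>L\<^esub> Q w = Ident L z" "Q w \<cdot>\<^bsub>L\<^esub> ?v = Ident L y" using w by (auto simp: hom_def)
  have bid: "both (Q w) \<cdot>\<^bsub>L\<^esub> both ?v = Ident L (coprod_ob C y y)"
    using both_comp[OF v f] id o both_Q[of "Ident C y"] by (simp add: Q_Ident coprod_map_Ident)
  have "Q (codiagonal C z) \<cdot>\<^bsub>L\<^esub> both ?v = (?v \<cdot>\<^bsub>L\<^esub> Q w) \<cdot>\<^bsub>L\<^esub> (Q (codiagonal C z) \<cdot>\<^bsub>L\<^esub> both ?v)"
    using id v o by (simp add: hom_def)
  also have "\<dots> = ?v \<cdot>\<^bsub>L\<^esub> ((Q w \<cdot>\<^bsub>L\<^esub> Q (codiagonal C z)) \<cdot>\<^bsub>L\<^esub> both ?v)"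
    using v f o by (simp add: L.comp_assoc hom_def)
  also have "\<dots> = ?v \<cdot>\<^bsub>L\<^esub> ((Q (codiagonal C y) \<cdot>\<^bsub>L\<^esub> both (Q w)) \<cdot>\<^bsub>L\<^esub> both ?v)"
    using codiagonal_Q[OF w(2)] by simp
  also have "\<dots> = ?v \<cdot>\<^bsub>L\<^esub> (Q (codiagonal C y) \<cdot>\<^bsub>L\<^esub> (both (Q w) \<cdot>\<^bsub>L\<^esub> both ?v))"
    using v f o by (simp add: L.comp_assoc hom_def)
  also have "\<dots> = ?v \<cdot>\<^bsub>L\<^esub> Q (codiagonal C y)" using bid o by simp
  finally have n: "Q (codiagonal C z) \<cdot>\<^bsub>L\<^esub> both ?v = ?v \<cdot>\<^bsub>L\<^esub> Q (codiagonal C y)" .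
  have "Q (codiagonal C z) \<cdot>\<^bsub>L\<^esub> both (?v \<cdot>\<^bsub>L\<^esub> u) = (Q (codiagonal C z) \<cdot>\<^bsub>L\<^esub> both ?v) \<cdot>\<^bsub>L\<^esub> both u"
    using both_comp[OF Bwd(1) v] Bwd(1) v o by (simp add: L.comp_assoc hom_def)
  also have "\<dots> = ?v \<cdot>\<^bsub>L\<^esub> (Q (codiagonal C y) \<cdot>\<^bsub>L\<^esub> both u)"
    using n Bwd(1) v o by (simp add: L.comp_assoc hom_def)
  also have "\<dots> = (?v \<cdot>\<^bsub>L\<^esub> u) \<cdot>\<^bsub>L\<^esub> Q (codiagonal C x)"
    using Bwd(1) Bwd.IH v o by (simp add: L.comp_assoc hom_def)
  finally show ?case .
qed

text \<open>Existence of a map with given components comes from the coproduct functors followed by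
  the codiagonal, uniqueness from naturality of the codiagonal. The description of the coproduct map
  in \<open>copair_iso\<close> denotes the intended arrow because of this result.\<close>

theorem loc_coprod_chosen:
  assumes x: "x \<in> Obj C" and y: "y \<in> Obj C"
  shows "is_coprod L x y (coprod_ob C x y) (Q (in1 C x y)) (Q (in2 C x y))"
proof (rule L.coprodI)
  let ?p = "coprod_ob C x y"
  have i: "Q (in1 C x y) \<in> hom L x ?p" "Q (in2 C x y) \<in> hom L y ?p"
    using x y by (auto intro!: loc_arr_hom simp: hom_def)
  then show "Q (in1 C x y) \<in> hom L x ?p" "Q (in2 C x y) \<in> hom L y ?p" by auto
  show "x \<in> Obj L" "y \<in> Obj L" "?p \<in> Obj L" using x y by auto
  show "\<exists>u. u \<in> hom L ?p t \<and> u \<cdot>\<^bsub>L\<^esub> Q (in1 C x y) = f \<and> u \<cdot>\<^bsub>L\<^esub> Q (in2 C x y) = g"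
    if "t \<in> Obj L" and f: "f \<in> hom L x t" and g: "g \<in> hom L y t" for t f g
  proof -
    have t: "t \<in> Obj C" using that by simp
    let ?u = "Q (codiagonal C t) \<cdot>\<^bsub>L\<^esub> (rcop t g \<cdot>\<^bsub>L\<^esub> lcop y f)"
    note h = homD[OF f] homD[OF g]
    have "?u \<cdot>\<^bsub>L\<^esub> Q (in1 C x y) = Q (codiagonal C t) \<cdot>\<^bsub>L\<^esub> ((rcop t g \<cdot>\<^bsub>L\<^esub> Q (in1 C t y)) \<cdot>\<^bsub>L\<^esub> f)"
      using lcop_in1[OF y f] h t x y by (simp add: L.comp_assoc)
    also have "\<dots> = (Q (codiagonal C t) \<cdot>\<^bsub>L\<^esub> Q (in1 C t t)) \<cdot>\<^bsub>L\<^esub> f"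
      using rcop_in1[OF t g] h t x y by (simp add: L.comp_assoc)
    also have "\<dots> = f" using h t by (simp add: Q_comp codiagonal_def Q_Ident)
    finally have 1: "?u \<cdot>\<^bsub>L\<^esub> Q (in1 C x y) = f" .
    have "?u \<cdot>\<^bsub>L\<^esub> Q (in2 C x y) = Q (codiagonal C t) \<cdot>\<^bsub>L\<^esub> (rcop t g \<cdot>\<^bsub>L\<^esub> Q (in2 C t y))"
      using lcop_in2[OF y f] h t x y by (simp add: L.comp_assoc)
    also have "\<dots> = (Q (codiagonal C t) \<cdot>\<^bsub>L\<^esub> Q (in2 C t t)) \<cdot>\<^bsub>L\<^esub> g"
      using rcop_in2[OF t g] h t x y by (simp add: L.comp_assoc)
    also have "\<dots> = g" using h t by (simp add: Q_comp codiagonal_def Q_Ident)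
    finally show ?thesis using 1 h t x y by (intro exI[of _ ?u]) (auto simp: hom_def)
  qed
  show "u = v" if u: "u \<in> hom L ?p t" and v: "v \<in> hom L ?p t"
    and e: "u \<cdot>\<^bsub>L\<^esub> Q (in1 C x y) = v \<cdot>\<^bsub>L\<^esub> Q (in1 C x y)" "u \<cdot>\<^bsub>L\<^esub> Q (in2 C x y) = v \<cdot>\<^bsub>L\<^esub> Q (in2 C x y)" for t u v
  proof -
    \<comment> \<open>Every \<open>w\<close> is recovered from its two restrictions: write the
      identity of the coproduct as the codiagonal after the coproduct of the two inclusions, and
      move \<open>w\<close> past the codiagonal by naturality.\<close>
    have *: "w = Q (codiagonal C t) \<cdot>\<^bsub>L\<^esub> (rcop t (w \<cdot>\<^bsub>L\<^esub> Q (in2 C x y)) \<cdot>\<^bsub>L\<^esub> lcop y (w \<cdot>\<^bsub>L\<^esub> Q (in1 C x y)))"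
      if w: "w \<in> hom L ?p t" for w
    proof -
      have t: "t \<in> Obj C" using L.hom_obj[OF w] by simp
      note h = homD[OF w]
      have c: "codiagonal C ?p \<cdot>\<^bsub>C\<^esub> coprod_map C (in1 C x y) (in2 C x y) = Ident C ?p"
        by (rule cotuple_eqI[of _ _ x y]) (use x y in \<open>auto simp: codiagonal_def\<close>)
      have cm: "coprod_map C (Ident C ?p) (in2 C x y) \<cdot>\<^bsub>C\<^esub> coprod_map C (in1 C x y) (Ident C y) = coprod_map C (in1 C x y) (in2 C x y)"
        using x y by (simp add: coprod_map_comp)
      have "rcop t (w \<cdot>\<^bsub>L\<^esub> Q (in2 C x y)) \<cdot>\<^bsub>L\<^esub> lcop y (w \<cdot>\<^bsub>L\<^esub> Q (in1 C x y))
        = rcop t w \<cdot>\<^bsub>L\<^esub> ((rcop t (Q (in2 C x y)) \<cdot>\<^bsub>L\<^esub> lcop y w) \<cdot>\<^bsub>L\<^esub> lcop y (Q (in1 C x y)))"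
        using h x y t by (simp add: rcop_comp lcop_comp L.comp_assoc)
      also have "\<dots> = both w \<cdot>\<^bsub>L\<^esub> (rcop ?p (Q (in2 C x y)) \<cdot>\<^bsub>L\<^esub> lcop y (Q (in1 C x y)))"
        using interchange[OF w i(2)] h x y t by (simp add: both_def L.comp_assoc)
      also have "\<dots> = both w \<cdot>\<^bsub>L\<^esub> Q (coprod_map C (in1 C x y) (in2 C x y))"
        using x y cm by (simp add: rcop_Q lcop_Q Q_comp)
      finally have "Q (codiagonal C t) \<cdot>\<^bsub>L\<^esub> (rcop t (w \<cdot>\<^bsub>L\<^esub> Q (in2 C x y)) \<cdot>\<^bsub>L\<^esub> lcop y (w \<cdot>\<^bsub>L\<^esub> Q (in1 C x y)))
        = (Q (codiagonal C t) \<cdot>\<^bsub>L\<^esub> both w) \<cdot>\<^bsub>L\<^esub> Q (coprod_map C (in1 C x y) (in2 C x y))"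
        using h x y t by (simp add: L.comp_assoc)
      also have "\<dots> = w \<cdot>\<^bsub>L\<^esub> (Q (codiagonal C ?p) \<cdot>\<^bsub>L\<^esub> Q (coprod_map C (in1 C x y) (in2 C x y)))"
        using codiagonal_natural[OF w] h x y t by (simp add: L.comp_assoc)
      also have "\<dots> = w" using c h x y by (simp add: Q_comp Q_Ident)
      finally show ?thesis by simp
    qed
    show ?thesis using *[OF u] *[OF v] e by simp
  qed
qed

end
end

section \<open>Tensors with finite sets and the cylinder\<close>

context coprods begin

definition cop_map :: "'k set \<Rightarrow> 'a \<Rightarrow> 'a" where
  "cop_map S f = copower_desc C S (Dom C f) (copower_ob C S (Cod C f)) (\<lambda>k. copower_in C S (Cod C f) k \<cdot>\<^bsub>C\<^esub> f)"

lemma cop_map_simps [simp]: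
  assumes "finite S" "f \<in> Arr C"
  shows "cop_map S f \<in> Arr C" "Dom C (cop_map S f) = copower_ob C S (Dom C f)"
    "Cod C (cop_map S f) = copower_ob C S (Cod C f)"
    "k \<in> S \<Longrightarrow> x = Dom C f \<Longrightarrow> cop_map S f \<cdot>\<^bsub>C\<^esub> copower_in C S x k = copower_in C S (Cod C f) k \<cdot>\<^bsub>C\<^esub> f"
    "k \<in> S \<Longrightarrow> x = Dom C f \<Longrightarrow> g \<in> Arr C \<Longrightarrow> Cod C g = x \<Longrightarrow>
      cop_map S f \<cdot>\<^bsub>C\<^esub> (copower_in C S x k \<cdot>\<^bsub>C\<^esub> g) = copower_in C S (Cod C f) k \<cdot>\<^bsub>C\<^esub> (f \<cdot>\<^bsub>C\<^esub> g)"
proof -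
  have *: "copower_in C S (Cod C f) k \<cdot>\<^bsub>C\<^esub> f \<in> hom C (Dom C f) (copower_ob C S (Cod C f))" if "k \<in> S" for k
    using assms that by (simp add: hom_def)
  note D = copower_desc[OF assms(1) Dom_obj[OF assms(2)], of "copower_ob C S (Cod C f)", OF _ *]
  show "cop_map S f \<in> Arr C" "Dom C (cop_map S f) = copower_ob C S (Dom C f)"
    "Cod C (cop_map S f) = copower_ob C S (Cod C f)" unfolding cop_map_def by (rule D; simp add: assms)+
  show "k \<in> S \<Longrightarrow> x = Dom C f \<Longrightarrow> cop_map S f \<cdot>\<^bsub>C\<^esub> copower_in C S x k = copower_in C S (Cod C f) k \<cdot>\<^bsub>C\<^esub> f"
    unfolding cop_map_def using D(4) assms by simp
  show "k \<in> S \<Longrightarrow> x = Dom C f \<Longrightarrow> g \<in> Arr C \<Longrightarrow> Cod C g = x \<Longrightarrow>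
      cop_map S f \<cdot>\<^bsub>C\<^esub> (copower_in C S x k \<cdot>\<^bsub>C\<^esub> g) = copower_in C S (Cod C f) k \<cdot>\<^bsub>C\<^esub> (f \<cdot>\<^bsub>C\<^esub> g)"
    unfolding cop_map_def using D(5) assms by simp
qed

text \<open>A map out of a copower is a family of maps indexed by \<open>S\<close>, so a cocone on
  the copowers is a family of cocones on the original diagram, and the mediating arrows can be found
  one index at a time.\<close>

lemma copower_colim:
  assumes S: "finite S" and p: "is_colim C J D R p c"
  shows "is_colim C J (\<lambda>j. copower_ob C S (D j)) ((\<lambda>(j, f, k, g). (j, cop_map S f, k, cop_map S g)) ` R)
    (copower_ob C S p) (\<lambda>j. cop_map S (c j))"
proof (rule is_colimI)
  note P = is_colimD[OF p]
  have c: "c j \<in> Arr C" "Dom C (c j) = D j" "Cod C (c j) = p" if "j \<in> J" for j using P(5)[OF that] by (auto simp: hom_def)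
  have R: "j \<in> J" "k \<in> J" "f \<in> Arr C" "g \<in> Arr C" "Dom C f = Dom C g" "Cod C f = D j" "Cod C g = D k"
    "c j \<cdot>\<^bsub>C\<^esub> f = c k \<cdot>\<^bsub>C\<^esub> g" if "(j, f, k, g) \<in> R" for j f k g
    using P(1,3) that unfolding diagram_def cocone_def by blast+
  show "diagram C J (\<lambda>j. copower_ob C S (D j)) ((\<lambda>(j, f, k, g). (j, cop_map S f, k, cop_map S g)) ` R)"
    unfolding diagram_def
  proof (intro conjI ballI allI impI)
    show "copower_ob C S (D j) \<in> Obj C" if "j \<in> J" for j using P(4)[OF that] S by simp
  qed (use R S in auto)
  show "copower_ob C S p \<in> Obj C" using P(2) S by simp
  show "cocone C J (\<lambda>j. copower_ob C S (D j)) ((\<lambda>(j, f, k, g). (j, cop_map S f, k, cop_map S g)) ` R)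
    (copower_ob C S p) (\<lambda>j. cop_map S (c j))"
    unfolding cocone_def
  proof (intro conjI ballI allI impI)
    show "cop_map S (c j) \<in> hom C (copower_ob C S (D j)) (copower_ob C S p)" if "j \<in> J" for j
      using c[OF that] S by (auto simp: hom_def)
    fix j f k g assume "(j, f, k, g) \<in> (\<lambda>(j, f, k, g). (j, cop_map S f, k, cop_map S g)) ` R"
    then obtain f' g' where r: "(j, f', k, g') \<in> R" "f = cop_map S f'" "g = cop_map S g'" by auto
    note R' = R[OF r(1)]
    show "cop_map S (c j) \<cdot>\<^bsub>C\<^esub> f = cop_map S (c k) \<cdot>\<^bsub>C\<^esub> g"
      unfolding r(2,3)
      by (rule copower_eqI[OF S, of "Dom C g'"]) (simp_all add: R' c[OF R'(1)] c[OF R'(2)] S)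
  qed
  show "\<exists>u. u \<in> hom C (copower_ob C S p) t \<and> (\<forall>j\<in>J. u \<cdot>\<^bsub>C\<^esub> cop_map S (c j) = h j)"
    if t: "t \<in> Obj C" and h: "cocone C J (\<lambda>j. copower_ob C S (D j)) ((\<lambda>(j, f, k, g). (j, cop_map S f, k, cop_map S g)) ` R) t h"
    for t h
  proof -
    have hj: "h j \<in> Arr C" "Dom C (h j) = copower_ob C S (D j)" "Cod C (h j) = t" if "j \<in> J" for j
      using h that by (auto simp: cocone_def hom_def)
    have "\<exists>u. u \<in> hom C p t \<and> (\<forall>j\<in>J. u \<cdot>\<^bsub>C\<^esub> c j = h j \<cdot>\<^bsub>C\<^esub> copower_in C S (D j) k)" if k: "k \<in> S" for k
    proof -
      have "cocone C J D R t (\<lambda>j. h j \<cdot>\<^bsub>C\<^esub> copower_in C S (D j) k)"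
        unfolding cocone_def
      proof (intro conjI ballI allI impI)
        show "h j \<cdot>\<^bsub>C\<^esub> copower_in C S (D j) k \<in> hom C (D j) t" if "j \<in> J" for j
          using hj[OF that] S k P(4)[OF that] by (auto simp: hom_def)
        fix j f l g assume r: "(j, f, l, g) \<in> R"
        note R' = R[OF r]
        have "h j \<cdot>\<^bsub>C\<^esub> cop_map S f = h l \<cdot>\<^bsub>C\<^esub> cop_map S g"
          using h r unfolding cocone_def by force
        then have "(h j \<cdot>\<^bsub>C\<^esub> cop_map S f) \<cdot>\<^bsub>C\<^esub> copower_in C S (Dom C g) k = (h l \<cdot>\<^bsub>C\<^esub> cop_map S g) \<cdot>\<^bsub>C\<^esub> copower_in C S (Dom C g) k"
          by simp
        then show "(h j \<cdot>\<^bsub>C\<^esub> copower_in C S (D j) k) \<cdot>\<^bsub>C\<^esub> f = (h l \<cdot>\<^bsub>C\<^esub> copower_in C S (D l) k) \<cdot>\<^bsub>C\<^esub> g"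
          by (simp add: R' hj[OF R'(1)] hj[OF R'(2)] S k P(4)[OF R'(1)] P(4)[OF R'(2)])
      qed
      from colim_desc[OF p t this] show ?thesis by metis
    qed
    then obtain u where u: "\<And>k. k \<in> S \<Longrightarrow> u k \<in> hom C p t" "\<And>k j. k \<in> S \<Longrightarrow> j \<in> J \<Longrightarrow> u k \<cdot>\<^bsub>C\<^esub> c j = h j \<cdot>\<^bsub>C\<^esub> copower_in C S (D j) k"
      by metis
    note D = copower_desc[OF S P(2) t, of u, OF u(1)]
    have "copower_desc C S p t u \<cdot>\<^bsub>C\<^esub> cop_map S (c j) = h j" if j: "j \<in> J" for j
      by (rule copower_eqI[OF S P(4)[OF j]]) (simp_all add: c[OF j] hj[OF j] S u(2)[OF _ j] D P(2,4) P(4)[OF j])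
    then show ?thesis using D by (intro exI[of _ "copower_desc C S p t u"]) (auto simp: hom_def)
  qed
  show "u = v" if u: "u \<in> hom C (copower_ob C S p) t" and v: "v \<in> hom C (copower_ob C S p) t"
    and e: "\<And>j. j \<in> J \<Longrightarrow> u \<cdot>\<^bsub>C\<^esub> cop_map S (c j) = v \<cdot>\<^bsub>C\<^esub> cop_map S (c j)" for t u v
  proof (rule copower_eqI[OF S P(2)])
    note uv = homD[OF u] homD[OF v]
    show "u \<in> Arr C" "v \<in> Arr C" "Dom C u = copower_ob C S p" "Dom C v = copower_ob C S p" "Cod C u = Cod C v"
      by (simp_all add: uv)
    fix k assume k: "k \<in> S"
    show "u \<cdot>\<^bsub>C\<^esub> copower_in C S p k = v \<cdot>\<^bsub>C\<^esub> copower_in C S p k"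
    proof (rule colim_eqI[OF p, of _ t])
      show "u \<cdot>\<^bsub>C\<^esub> copower_in C S p k \<in> hom C p t" "v \<cdot>\<^bsub>C\<^esub> copower_in C S p k \<in> hom C p t"
        by (simp_all add: hom_def uv S k P(2))
      fix j assume j: "j \<in> J"
      have "(u \<cdot>\<^bsub>C\<^esub> cop_map S (c j)) \<cdot>\<^bsub>C\<^esub> copower_in C S (D j) k = (v \<cdot>\<^bsub>C\<^esub> cop_map S (c j)) \<cdot>\<^bsub>C\<^esub> copower_in C S (D j) k"
        using e[OF j] by simp
      then show "(u \<cdot>\<^bsub>C\<^esub> copower_in C S p k) \<cdot>\<^bsub>C\<^esub> c j = (v \<cdot>\<^bsub>C\<^esub> copower_in C S p k) \<cdot>\<^bsub>C\<^esub> c j"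
        by (simp add: uv S k P(2) P(4)[OF j] c[OF j])
    qed
  qed
qed

end

section \<open>Tensors with finite sets over a general index category\<close>

definition gten :: "('i, 'm) cat \<Rightarrow> ('o, 'a) cat \<Rightarrow> ('i \<Rightarrow> 'k set) \<Rightarrow> ('m \<Rightarrow> 'k \<Rightarrow> 'k) \<Rightarrow>
    ('i, 'm, 'o, 'a) fnctr \<Rightarrow> ('i, 'm, 'o, 'a) fnctr" where
  "gten A C S act X = \<lparr>FOb = (\<lambda>x. copower_ob C (S x) (FOb X x)),
     FAr = restrict (\<lambda>\<theta>. copower_desc C (S (Dom A \<theta>)) (FOb X (Dom A \<theta>)) (copower_ob C (S (Cod A \<theta>)) (FOb X (Cod A \<theta>)))
       (\<lambda>k. copower_in C (S (Cod A \<theta>)) (FOb X (Cod A \<theta>)) (act \<theta> k) \<cdot>\<^bsub>C\<^esub> FAr X \<theta>)) (Arr A)\<rparr>"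

text \<open>\<open>S\<close> and \<open>act\<close> amount to a functor from \<open>A\<close> to
  finite sets; it is covariant because \<open>A\<close> stands for an opposite simplex category.
  Leaving \<open>A\<close> general covers simplicial and bisimplicial objects at once.\<close>

locale gset = functors A C + C: coprods C
  for A :: "('i, 'm) cat" and C :: "('o, 'a) cat" +
  fixes S :: "'i \<Rightarrow> 'k set" and act :: "'m \<Rightarrow> 'k \<Rightarrow> 'k"
  assumes S_fin [simp]: "finite (S x)"
    and act_in [simp]: "\<theta> \<in> Arr A \<Longrightarrow> k \<in> S (Dom A \<theta>) \<Longrightarrow> act \<theta> k \<in> S (Cod A \<theta>)"
    and act_id [simp]: "k \<in> S x \<Longrightarrow> act (Ident A x) k = k"
    and act_comp: "\<theta> \<in> Arr A \<Longrightarrow> \<theta>' \<in> Arr A \<Longrightarrow> Dom A \<theta>' = Cod A \<theta> \<Longrightarrow> k \<in> S (Dom A \<theta>) \<Longrightarrow>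
       act (\<theta>' \<cdot>\<^bsub>A\<^esub> \<theta>) k = act \<theta>' (act \<theta> k)"
begin

abbreviation "ten \<equiv> gten A C S act"

lemma ten_ob [simp]: "FOb (ten X) x = copower_ob C (S x) (FOb X x)" by (simp add: gten_def)

lemma ten_arr:
  assumes X: "is_functor A C X" and th: "\<theta> \<in> Arr A"
  shows "FAr (ten X) \<theta> \<in> hom C (FOb (ten X) (Dom A \<theta>)) (FOb (ten X) (Cod A \<theta>))"
    "k \<in> S (Dom A \<theta>) \<Longrightarrow> x = Dom A \<theta> \<Longrightarrow> FAr (ten X) \<theta> \<cdot>\<^bsub>C\<^esub> copower_in C (S x) (FOb X x) k
       = copower_in C (S (Cod A \<theta>)) (FOb X (Cod A \<theta>)) (act \<theta> k) \<cdot>\<^bsub>C\<^esub> FAr X \<theta>"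
    "k \<in> S (Dom A \<theta>) \<Longrightarrow> x = Dom A \<theta> \<Longrightarrow> g \<in> Arr C \<Longrightarrow> Cod C g = FOb X x \<Longrightarrow>
      FAr (ten X) \<theta> \<cdot>\<^bsub>C\<^esub> (copower_in C (S x) (FOb X x) k \<cdot>\<^bsub>C\<^esub> g)
       = copower_in C (S (Cod A \<theta>)) (FOb X (Cod A \<theta>)) (act \<theta> k) \<cdot>\<^bsub>C\<^esub> (FAr X \<theta> \<cdot>\<^bsub>C\<^esub> g)"
proof -
  have *: "copower_in C (S (Cod A \<theta>)) (FOb X (Cod A \<theta>)) (act \<theta> k) \<cdot>\<^bsub>C\<^esub> FAr X \<theta>
      \<in> hom C (FOb X (Dom A \<theta>)) (copower_ob C (S (Cod A \<theta>)) (FOb X (Cod A \<theta>)))" if "k \<in> S (Dom A \<theta>)" for k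
    using X th that by (simp add: hom_def)
  note D = C.copower_desc[of "S (Dom A \<theta>)" "FOb X (Dom A \<theta>)" "copower_ob C (S (Cod A \<theta>)) (FOb X (Cod A \<theta>))"
    "\<lambda>k. copower_in C (S (Cod A \<theta>)) (FOb X (Cod A \<theta>)) (act \<theta> k) \<cdot>\<^bsub>C\<^esub> FAr X \<theta>", OF _ _ _ *]
  show 1: "FAr (ten X) \<theta> \<in> hom C (FOb (ten X) (Dom A \<theta>)) (FOb (ten X) (Cod A \<theta>))"
    using D(1-3) X th by (simp add: gten_def hom_def)
  show 2: "k \<in> S (Dom A \<theta>) \<Longrightarrow> x = Dom A \<theta> \<Longrightarrow> FAr (ten X) \<theta> \<cdot>\<^bsub>C\<^esub> copower_in C (S x) (FOb X x) k
       = copower_in C (S (Cod A \<theta>)) (FOb X (Cod A \<theta>)) (act \<theta> k) \<cdot>\<^bsub>C\<^esub> FAr X \<theta>" for k x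
    using D(4) X th by (simp add: gten_def)
  show "k \<in> S (Dom A \<theta>) \<Longrightarrow> x = Dom A \<theta> \<Longrightarrow> g \<in> Arr C \<Longrightarrow> Cod C g = FOb X x \<Longrightarrow>
      FAr (ten X) \<theta> \<cdot>\<^bsub>C\<^esub> (copower_in C (S x) (FOb X x) k \<cdot>\<^bsub>C\<^esub> g)
       = copower_in C (S (Cod A \<theta>)) (FOb X (Cod A \<theta>)) (act \<theta> k) \<cdot>\<^bsub>C\<^esub> (FAr X \<theta> \<cdot>\<^bsub>C\<^esub> g)"
    using C.comp_ext[OF 2, of k x g] X th homD[OF 1] by simp
qed

lemma ten_functor [simp]:
  assumes X: "is_functor A C X" shows "is_functor A C (ten X)"
proof (rule is_functorI)
  show "FOb (ten X) x \<in> Obj C" for x using X by simp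
  show "FAr (ten X) \<in> extensional (Arr A)" by (simp add: gten_def)
  show h: "FAr (ten X) \<theta> \<in> hom C (FOb (ten X) (Dom A \<theta>)) (FOb (ten X) (Cod A \<theta>))" if "\<theta> \<in> Arr A" for \<theta>
    by (rule ten_arr[OF X that])
  show "FAr (ten X) (Ident A x) = Ident C (FOb (ten X) x)" for x
  proof (rule C.copower_eqI[of "S x" "FOb X x"])
    show "FAr (ten X) (Ident A x) \<cdot>\<^bsub>C\<^esub> copower_in C (S x) (FOb X x) k = Ident C (FOb (ten X) x) \<cdot>\<^bsub>C\<^esub> copower_in C (S x) (FOb X x) k"
      if "k \<in> S x" for k using ten_arr(2)[OF X, of "Ident A x" k x] that X by simp
  qed (use h[of "Ident A x"] X in \<open>auto simp: hom_def\<close>)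
  fix \<theta> \<theta>' assume th: "\<theta> \<in> Arr A" "\<theta>' \<in> Arr A" "Dom A \<theta>' = Cod A \<theta>"
  note h' = homD[OF h[OF th(1)]] homD[OF h[OF th(2)]]
  show "FAr (ten X) (\<theta>' \<cdot>\<^bsub>A\<^esub> \<theta>) = FAr (ten X) \<theta>' \<cdot>\<^bsub>C\<^esub> FAr (ten X) \<theta>"
  proof (rule C.copower_eqI[of "S (Dom A \<theta>)" "FOb X (Dom A \<theta>)"])
    show "FAr (ten X) (\<theta>' \<cdot>\<^bsub>A\<^esub> \<theta>) \<cdot>\<^bsub>C\<^esub> copower_in C (S (Dom A \<theta>)) (FOb X (Dom A \<theta>)) k
      = (FAr (ten X) \<theta>' \<cdot>\<^bsub>C\<^esub> FAr (ten X) \<theta>) \<cdot>\<^bsub>C\<^esub> copower_in C (S (Dom A \<theta>)) (FOb X (Dom A \<theta>)) k"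
      if "k \<in> S (Dom A \<theta>)" for k
      using th that X h' by (simp add: ten_arr[OF X] act_comp functor_comp)
  qed (use h[of "\<theta>' \<cdot>\<^bsub>A\<^esub> \<theta>"] h' X th in \<open>auto simp: hom_def\<close>)
qed

definition desc :: "('i, 'm, 'o, 'a) fnctr \<Rightarrow> ('i, 'm, 'o, 'a) fnctr \<Rightarrow> ('i \<Rightarrow> 'k \<Rightarrow> 'a) \<Rightarrow> ('i, 'm, 'o, 'a) ntrans" where
  "desc X Y h = \<lparr>NSrc = ten X, NTgt = Y, NCmp = (\<lambda>x. copower_desc C (S x) (FOb X x) (FOb Y x) (h x))\<rparr>"

lemma desc_simps [simp]: "NSrc (desc X Y h) = ten X" "NTgt (desc X Y h) = Y" by (simp_all add: desc_def)

lemma desc_in: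
  assumes "is_functor A C X" "is_functor A C Y" "\<And>x k. k \<in> S x \<Longrightarrow> h x k \<in> hom C (FOb X x) (FOb Y x)" "k \<in> S x"
  shows "NCmp (desc X Y h) x \<cdot>\<^bsub>C\<^esub> copower_in C (S x) (FOb X x) k = h x k"
    "g \<in> Arr C \<Longrightarrow> Cod C g = FOb X x \<Longrightarrow> NCmp (desc X Y h) x \<cdot>\<^bsub>C\<^esub> (copower_in C (S x) (FOb X x) k \<cdot>\<^bsub>C\<^esub> g) = h x k \<cdot>\<^bsub>C\<^esub> g"
  using C.copower_desc(4,5)[of "S x" "FOb X x" "FOb Y x" "h x"] assms by (simp_all add: desc_def)

lemma desc_ntrans:
  assumes X: "is_functor A C X" and Y: "is_functor A C Y"
    and h: "\<And>x k. k \<in> S x \<Longrightarrow> h x k \<in> hom C (FOb X x) (FOb Y x)"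
    and nat: "\<And>\<theta> k. \<theta> \<in> Arr A \<Longrightarrow> k \<in> S (Dom A \<theta>) \<Longrightarrow> h (Cod A \<theta>) (act \<theta> k) \<cdot>\<^bsub>C\<^esub> FAr X \<theta> = FAr Y \<theta> \<cdot>\<^bsub>C\<^esub> h (Dom A \<theta>) k"
  shows "is_ntrans A C (desc X Y h)"
proof (rule is_ntransI)
  have D: "NCmp (desc X Y h) x \<in> Arr C" "Dom C (NCmp (desc X Y h) x) = copower_ob C (S x) (FOb X x)"
    "Cod C (NCmp (desc X Y h) x) = FOb Y x" for x
    using C.copower_desc(1-3)[of "S x" "FOb X x" "FOb Y x" "h x"] X Y h by (simp_all add: desc_def)
  then show "NCmp (desc X Y h) x \<in> hom C (FOb (NSrc (desc X Y h)) x) (FOb (NTgt (desc X Y h)) x)" for x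
    by (simp add: hom_def)
  fix \<theta> assume th: "\<theta> \<in> Arr A"
  show "NCmp (desc X Y h) (Cod A \<theta>) \<cdot>\<^bsub>C\<^esub> FAr (NSrc (desc X Y h)) \<theta> = FAr (NTgt (desc X Y h)) \<theta> \<cdot>\<^bsub>C\<^esub> NCmp (desc X Y h) (Dom A \<theta>)"
  proof (rule C.copower_eqI[of "S (Dom A \<theta>)" "FOb X (Dom A \<theta>)"])
    fix k assume k: "k \<in> S (Dom A \<theta>)"
    show "(NCmp (desc X Y h) (Cod A \<theta>) \<cdot>\<^bsub>C\<^esub> FAr (NSrc (desc X Y h)) \<theta>) \<cdot>\<^bsub>C\<^esub> copower_in C (S (Dom A \<theta>)) (FOb X (Dom A \<theta>)) k
      = (FAr (NTgt (desc X Y h)) \<theta> \<cdot>\<^bsub>C\<^esub> NCmp (desc X Y h) (Dom A \<theta>)) \<cdot>\<^bsub>C\<^esub> copower_in C (S (Dom A \<theta>)) (FOb X (Dom A \<theta>)) k"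
      using k th X Y D homD[OF ten_arr(1)[OF X th]] by (simp add: ten_arr[OF X] desc_in[OF X Y h] nat)
  qed (use X Y th D homD[OF ten_arr(1)[OF X th]] in simp_all)
qed (use X Y in simp_all)

lemma ten_eqI:
  assumes "is_functor A C X" "is_ntrans A C u" "is_ntrans A C v" "NSrc u = ten X" "NSrc v = ten X" "NTgt u = NTgt v"
    "\<And>x k. k \<in> S x \<Longrightarrow> NCmp u x \<cdot>\<^bsub>C\<^esub> copower_in C (S x) (FOb X x) k = NCmp v x \<cdot>\<^bsub>C\<^esub> copower_in C (S x) (FOb X x) k"
  shows "u = v"
proof (rule ntrans_eqI)
  show "NCmp u x = NCmp v x" for x
    by (rule C.copower_eqI[of "S x" "FOb X x"]) (use assms in simp_all)
qed (use assms in simp_all)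

definition tmap :: "('i, 'm, 'o, 'a) ntrans \<Rightarrow> ('i, 'm, 'o, 'a) ntrans" where
  "tmap f = \<lparr>NSrc = ten (NSrc f), NTgt = ten (NTgt f), NCmp = (\<lambda>x. C.cop_map (S x) (NCmp f x))\<rparr>"

lemma tmap_simps [simp]: "NSrc (tmap f) = ten (NSrc f)" "NTgt (tmap f) = ten (NTgt f)"
  "NCmp (tmap f) x = C.cop_map (S x) (NCmp f x)"
  by (simp_all add: tmap_def)

lemma tmap_ntrans [simp]:
  assumes f: "is_ntrans A C f" shows "is_ntrans A C (tmap f)"
proof -
  have *: "tmap f = desc (NSrc f) (ten (NTgt f)) (\<lambda>x k. copower_in C (S x) (FOb (NTgt f) x) k \<cdot>\<^bsub>C\<^esub> NCmp f x)"
    using f by (intro ntrans.equality) (auto simp: desc_def tmap_def C.cop_map_def fun_eq_iff)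
  show ?thesis unfolding *
  proof (rule desc_ntrans)
    fix \<theta> k assume th: "\<theta> \<in> Arr A" "k \<in> S (Dom A \<theta>)"
    show "(copower_in C (S (Cod A \<theta>)) (FOb (NTgt f) (Cod A \<theta>)) (act \<theta> k) \<cdot>\<^bsub>C\<^esub> NCmp f (Cod A \<theta>)) \<cdot>\<^bsub>C\<^esub> FAr (NSrc f) \<theta> =
           FAr (ten (NTgt f)) \<theta> \<cdot>\<^bsub>C\<^esub> (copower_in C (S (Dom A \<theta>)) (FOb (NTgt f) (Dom A \<theta>)) k \<cdot>\<^bsub>C\<^esub> NCmp f (Dom A \<theta>))"
      using f th ntrans_natural[OF f th(1)] by (simp add: ten_arr)
  qed (use f in \<open>auto simp: hom_def\<close>)
qed

lemma tmap_comp: "is_ntrans A C f \<Longrightarrow> is_ntrans A C g \<Longrightarrow> NSrc g = NTgt f \<Longrightarrow> tmap (g \<cdot>\<^bsub>E\<^esub> f) = tmap g \<cdot>\<^bsub>E\<^esub> tmap f"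
  by (rule ten_eqI[of "NSrc f"]) (simp_all add: ntrans_comp del: E_simps(7), simp)

lemma Ident_ntrans [simp]: "is_functor A C X \<Longrightarrow> is_ntrans A C (Ident E X)"
  using category.Ident_arr(1)[OF category_E, of X] by simp

lemma tmap_Ident: "is_functor A C X \<Longrightarrow> tmap (Ident E X) = Ident E (ten X)"
  by (rule ten_eqI[of X]) simp_all

text \<open>A compatible choice \<open>\<kappa>\<close> of one element in each \<open>S x\<close>
  selects one summand in every degree. The two ends of the cylinder are inclusions of this
  kind.\<close>

definition gin :: "('i \<Rightarrow> 'k) \<Rightarrow> ('i, 'm, 'o, 'a) fnctr \<Rightarrow> ('i, 'm, 'o, 'a) ntrans" where
  "gin \<kappa> X = \<lparr>NSrc = X, NTgt = ten X, NCmp = (\<lambda>x. copower_in C (S x) (FOb X x) (\<kappa> x))\<rparr>"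

lemma gin_simps [simp]: "NSrc (gin \<kappa> X) = X" "NTgt (gin \<kappa> X) = ten X" "NCmp (gin \<kappa> X) x = copower_in C (S x) (FOb X x) (\<kappa> x)"
  by (simp_all add: gin_def)

lemma gin_ntrans:
  assumes "is_functor A C X" "\<And>x. \<kappa> x \<in> S x" "\<And>\<theta>. \<theta> \<in> Arr A \<Longrightarrow> act \<theta> (\<kappa> (Dom A \<theta>)) = \<kappa> (Cod A \<theta>)"
  shows "is_ntrans A C (gin \<kappa> X)"
  by (rule is_ntransI) (use assms in \<open>simp_all add: hom_def ten_arr\<close>)

lemma ten_colim:
  assumes p: "is_colim E J D R p c" and pt: "\<And>x. \<exists>p c. is_colim C J (\<lambda>j. FOb (D j) x) (at_rel x R) p c"
  shows "is_colim E J (\<lambda>j. ten (D j)) ((\<lambda>(j, f, k, g). (j, tmap f, k, tmap g)) ` R) (ten p) (\<lambda>j. tmap (c j))"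
proof (rule colim_of_pointwise)
  note P = is_colimD[OF p]
  show "diagram E J (\<lambda>j. ten (D j)) ((\<lambda>(j, f, k, g). (j, tmap f, k, tmap g)) ` R)"
    using P(1) unfolding diagram_def by auto
  show "is_functor A C (ten p)" using P(2) by simp
  show "tmap (c j) \<in> hom E (ten (D j)) (ten p)" if "j \<in> J" for j using P(5)[OF that] by (auto simp: hom_def)
  have "at_rel x ((\<lambda>(j, f, k, g). (j, tmap f, k, tmap g)) ` R) =
      (\<lambda>(j, f, k, g). (j, C.cop_map (S x) f, k, C.cop_map (S x) g)) ` at_rel x R" for x
    by (simp add: at_rel_def image_image case_prod_unfold)
  then show "is_colim C J (\<lambda>j. FOb (ten (D j)) x) (at_rel x ((\<lambda>(j, f, k, g). (j, tmap f, k, tmap g)) ` R))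
    (FOb (ten p) x) (\<lambda>j. NCmp (tmap (c j)) x)" for x
    using C.copower_colim[OF S_fin[of x] colim_is_pointwise[OF p pt, of x]] by simp
qed

end

text \<open>
  An interval: \<open>m\<close> is a natural multiplication with unit \<open>e0\<close> and zero \<open>e1\<close>. For \<open>\<Delta>[1]\<close> it is the
  minimum, \<open>e0\<close> and \<open>e1\<close> being the constants 1 and 0, and it contracts the cylinder.
\<close>

locale interval = gset A C S act
  for A :: "('i, 'm) cat" and C :: "('o, 'a) cat" and S :: "'i \<Rightarrow> 'k set" and act +
  fixes e0 e1 :: "'i \<Rightarrow> 'k" and m :: "'k \<Rightarrow> 'k \<Rightarrow> 'k"
  assumes e_in [simp]: "e0 x \<in> S x" "e1 x \<in> S x" and e_neq: "e0 x \<noteq> e1 x"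
    and e_nat [simp]: "\<theta> \<in> Arr A \<Longrightarrow> act \<theta> (e0 (Dom A \<theta>)) = e0 (Cod A \<theta>)"
       "\<theta> \<in> Arr A \<Longrightarrow> act \<theta> (e1 (Dom A \<theta>)) = e1 (Cod A \<theta>)"
    and m_in [simp]: "k \<in> S x \<Longrightarrow> l \<in> S x \<Longrightarrow> m k l \<in> S x"
    and m_nat: "\<theta> \<in> Arr A \<Longrightarrow> k \<in> S (Dom A \<theta>) \<Longrightarrow> l \<in> S (Dom A \<theta>) \<Longrightarrow> act \<theta> (m k l) = m (act \<theta> k) (act \<theta> l)"
    and m_unit [simp]: "k \<in> S x \<Longrightarrow> m k (e0 x) = k" "k \<in> S x \<Longrightarrow> m (e0 x) k = k"
    and m_zero [simp]: "k \<in> S x \<Longrightarrow> m k (e1 x) = e1 x" "k \<in> S x \<Longrightarrow> m (e1 x) k = e1 x"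
begin

definition "d0 X = gin e0 X"
definition "d1 X = gin e1 X"
definition "sg X = desc X X (\<lambda>x _. Ident C (FOb X x))"
text \<open>On the summand indexed by \<open>k\<close> and \<open>l\<close> of the double tensor
  this is the inclusion of the summand \<open>m k l\<close>. It is a homotopy from the identity to
  the collapse onto the end \<open>e1\<close>, in either of the two cylinder directions.\<close>

definition "hh X = desc (ten X) (ten X) (\<lambda>x k. copower_desc C (S x) (FOb X x) (copower_ob C (S x) (FOb X x))
   (\<lambda>l. copower_in C (S x) (FOb X x) (m k l)))"

lemma d_simps [simp]: "NSrc (d0 X) = X" "NTgt (d0 X) = ten X" "NCmp (d0 X) x = copower_in C (S x) (FOb X x) (e0 x)"
  "NSrc (d1 X) = X" "NTgt (d1 X) = ten X" "NCmp (d1 X) x = copower_in C (S x) (FOb X x) (e1 x)"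
  "NSrc (sg X) = ten X" "NTgt (sg X) = X" "NSrc (hh X) = ten (ten X)" "NTgt (hh X) = ten X"
  by (simp_all add: d0_def d1_def sg_def hh_def)

lemma d_ntrans [simp]: "is_functor A C X \<Longrightarrow> is_ntrans A C (d0 X)" "is_functor A C X \<Longrightarrow> is_ntrans A C (d1 X)"
  by (simp_all add: d0_def d1_def gin_ntrans)

lemma sg_ntrans [simp]: "is_functor A C X \<Longrightarrow> is_ntrans A C (sg X)"
  unfolding sg_def by (rule desc_ntrans) (simp_all add: hom_def)

lemma sg_in:
  assumes "is_functor A C X" "k \<in> S x"
  shows "NCmp (sg X) x \<cdot>\<^bsub>C\<^esub> copower_in C (S x) (FOb X x) k = Ident C (FOb X x)"
   "g \<in> Arr C \<Longrightarrow> Cod C g = FOb X x \<Longrightarrow> NCmp (sg X) x \<cdot>\<^bsub>C\<^esub> (copower_in C (S x) (FOb X x) k \<cdot>\<^bsub>C\<^esub> g) = g"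
  unfolding sg_def using desc_in[of X X "\<lambda>x _. Ident C (FOb X x)" k x] assms by (simp_all add: hom_def)

context
  fixes X assumes X: "is_functor A C X"
begin

lemma mul_in:
  assumes "k \<in> S x"
  defines "u \<equiv> copower_desc C (S x) (FOb X x) (copower_ob C (S x) (FOb X x)) (\<lambda>l. copower_in C (S x) (FOb X x) (m k l))"
  shows "u \<in> Arr C" "Dom C u = copower_ob C (S x) (FOb X x)" "Cod C u = copower_ob C (S x) (FOb X x)"
   "l \<in> S x \<Longrightarrow> u \<cdot>\<^bsub>C\<^esub> copower_in C (S x) (FOb X x) l = copower_in C (S x) (FOb X x) (m k l)"
   "l \<in> S x \<Longrightarrow> f \<in> Arr C \<Longrightarrow> Cod C f = FOb X x \<Longrightarrow> u \<cdot>\<^bsub>C\<^esub> (copower_in C (S x) (FOb X x) l \<cdot>\<^bsub>C\<^esub> f)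
      = copower_in C (S x) (FOb X x) (m k l) \<cdot>\<^bsub>C\<^esub> f"
  unfolding u_def
  using C.copower_desc[of "S x" "FOb X x" "copower_ob C (S x) (FOb X x)" "\<lambda>l. copower_in C (S x) (FOb X x) (m k l)"] X assms(1)
  by (simp_all add: hom_def)

lemma hh_ntrans [simp]: "is_ntrans A C (hh X)"
  unfolding hh_def
proof (rule desc_ntrans)
  fix \<theta> k assume th: "\<theta> \<in> Arr A" and k: "k \<in> S (Dom A \<theta>)"
  note t = homD[OF ten_arr(1)[OF X th]]
  show "copower_desc C (S (Cod A \<theta>)) (FOb X (Cod A \<theta>)) (copower_ob C (S (Cod A \<theta>)) (FOb X (Cod A \<theta>)))
         (\<lambda>l. copower_in C (S (Cod A \<theta>)) (FOb X (Cod A \<theta>)) (m (act \<theta> k) l)) \<cdot>\<^bsub>C\<^esub> FAr (ten X) \<theta>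
     = FAr (ten X) \<theta> \<cdot>\<^bsub>C\<^esub> copower_desc C (S (Dom A \<theta>)) (FOb X (Dom A \<theta>)) (copower_ob C (S (Dom A \<theta>)) (FOb X (Dom A \<theta>)))
         (\<lambda>l. copower_in C (S (Dom A \<theta>)) (FOb X (Dom A \<theta>)) (m k l))"
    by (rule C.copower_eqI[of "S (Dom A \<theta>)" "FOb X (Dom A \<theta>)"])
      (simp_all add: X th k t mul_in ten_arr m_nat)
qed (use X in \<open>simp_all add: hom_def mul_in\<close>)

lemma hh_in:
  assumes "k \<in> S x"
  defines "u \<equiv> copower_desc C (S x) (FOb X x) (copower_ob C (S x) (FOb X x)) (\<lambda>l. copower_in C (S x) (FOb X x) (m k l))"
  shows "NCmp (hh X) x \<cdot>\<^bsub>C\<^esub> copower_in C (S x) (copower_ob C (S x) (FOb X x)) k = u"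
    "g \<in> Arr C \<Longrightarrow> Cod C g = copower_ob C (S x) (FOb X x) \<Longrightarrow> NCmp (hh X) x \<cdot>\<^bsub>C\<^esub> (copower_in C (S x) (copower_ob C (S x) (FOb X x)) k \<cdot>\<^bsub>C\<^esub> g) = u \<cdot>\<^bsub>C\<^esub> g"
  unfolding u_def hh_def
  using desc_in[of "ten X" "ten X" "\<lambda>x k. copower_desc C (S x) (FOb X x) (copower_ob C (S x) (FOb X x))
   (\<lambda>l. copower_in C (S x) (FOb X x) (m k l))" k x] X assms(1) by (simp_all add: hom_def mul_in)

lemma sg_d: "sg X \<cdot>\<^bsub>E\<^esub> d0 X = Ident E X" "sg X \<cdot>\<^bsub>E\<^esub> d1 X = Ident E X"
  by (rule ntrans_eqI; simp add: X sg_in)+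

text \<open>The identities express unit and zero of the multiplication, one pair for each way of
  including a single cylinder into the double one. Both pairs are used in contracting mapping
  cylinders and again for maps out of a cone over a map of cylinders.\<close>

lemma hh_d: "hh X \<cdot>\<^bsub>E\<^esub> d0 (ten X) = Ident E (ten X)" "hh X \<cdot>\<^bsub>E\<^esub> d1 (ten X) = d1 X \<cdot>\<^bsub>E\<^esub> sg X"
  "hh X \<cdot>\<^bsub>E\<^esub> tmap (d0 X) = Ident E (ten X)" "hh X \<cdot>\<^bsub>E\<^esub> tmap (d1 X) = d1 X \<cdot>\<^bsub>E\<^esub> sg X"
proof -
  interpret E: category E by (rule category_E)
  have n: "is_ntrans A C (hh X \<cdot>\<^bsub>E\<^esub> d0 (ten X))" "is_ntrans A C (hh X \<cdot>\<^bsub>E\<^esub> d1 (ten X))"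
     "is_ntrans A C (hh X \<cdot>\<^bsub>E\<^esub> tmap (d0 X))" "is_ntrans A C (hh X \<cdot>\<^bsub>E\<^esub> tmap (d1 X))"
     "is_ntrans A C (d1 X \<cdot>\<^bsub>E\<^esub> sg X)" "is_ntrans A C (Ident E (ten X))"
    using X E.Ident_arr(1)[of "ten X"] by (simp_all add: ntrans_comp del: E_simps(7))
  show "hh X \<cdot>\<^bsub>E\<^esub> d0 (ten X) = Ident E (ten X)"
    by (rule ten_eqI[OF X n(1,6)]) (simp_all add: X hh_in mul_in)
  show "hh X \<cdot>\<^bsub>E\<^esub> d1 (ten X) = d1 X \<cdot>\<^bsub>E\<^esub> sg X"
    by (rule ten_eqI[OF X n(2,5)]) (simp_all add: X hh_in mul_in sg_in)
  show "hh X \<cdot>\<^bsub>E\<^esub> tmap (d0 X) = Ident E (ten X)"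
    by (rule ten_eqI[OF X n(3,6)]) (simp_all add: X hh_in mul_in)
  show "hh X \<cdot>\<^bsub>E\<^esub> tmap (d1 X) = d1 X \<cdot>\<^bsub>E\<^esub> sg X"
    by (rule ten_eqI[OF X n(4,5)]) (simp_all add: X hh_in mul_in sg_in)
qed

end

lemma tmap_d:
  assumes f: "is_ntrans A C f"
  shows "tmap f \<cdot>\<^bsub>E\<^esub> d0 (NSrc f) = d0 (NTgt f) \<cdot>\<^bsub>E\<^esub> f" "tmap f \<cdot>\<^bsub>E\<^esub> d1 (NSrc f) = d1 (NTgt f) \<cdot>\<^bsub>E\<^esub> f"
  by (rule ntrans_eqI; simp add: f)+

lemma tmap_sg:
  assumes f: "is_ntrans A C f" shows "sg (NTgt f) \<cdot>\<^bsub>E\<^esub> tmap f = f \<cdot>\<^bsub>E\<^esub> sg (NSrc f)"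
proof -
  have n: "is_ntrans A C (sg (NTgt f) \<cdot>\<^bsub>E\<^esub> tmap f)" "is_ntrans A C (f \<cdot>\<^bsub>E\<^esub> sg (NSrc f))"
    using f by (simp_all add: ntrans_comp del: E_simps(7))
  show ?thesis by (rule ten_eqI[of "NSrc f", OF _ n]) (simp_all add: f sg_in)
qed

end

section \<open>Coprojections and pointwise constructions\<close>

lemma is_colim_cong:
  assumes p: "is_colim C J D R p c" and e: "\<And>j. j \<in> J \<Longrightarrow> c j = c' j"
  shows "is_colim C J D R p c'"
proof -
  have "cocone C J D R p c'"
    using is_colimD(1,3)[OF p] e unfolding cocone_def diagram_def by metis
  then show ?thesis using p e unfolding is_colim_def by auto
qed

text \<open>Being a summand inclusion, phrased without a chosen coproduct or a comparison
  isomorphism, so that universal properties can be used directly.\<close>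

definition coprojection :: "('o, 'a) cat \<Rightarrow> 'a \<Rightarrow> bool" where
  "coprojection C f \<longleftrightarrow> (\<exists>a j. is_coprod C (Dom C f) a (Cod C f) f j)"

context category begin

lemma coprod_sym:
  assumes "is_coprod C x y p i j" shows "is_coprod C y x p j i"
  by (rule coprodI) (use is_coprodD[OF assms] is_coprod_desc[OF assms] coprod_eqI[OF assms] in \<open>blast+\<close>)

lemma coprojectionI: "is_coprod C x a p i j \<Longrightarrow> coprojection C i"
  using is_coprodD(4)[of C x a p i j] unfolding coprojection_def by (auto simp: hom_def)

text \<open>Complements add up: the new second coprojection is \<open>j\<close> followed by
  \<open>g\<close> on the summand \<open>a\<close>, and \<open>k\<close> on the summand
  \<open>b\<close>.\<close>

lemma coprod_assoc:
  assumes p: "is_coprod C x a y f j" and q: "is_coprod C y b z g k" and s: "is_coprod C a b c l l'"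
  shows "\<exists>m. is_coprod C x c z (g \<cdot>\<^bsub>C\<^esub> f) m"
proof -
  note P = is_coprodD[OF p] and Q = is_coprodD[OF q] and S = is_coprodD[OF s]
  note h = homD[OF P(4)] homD[OF P(5)] homD[OF Q(4)] homD[OF Q(5)] homD[OF S(4)] homD[OF S(5)]
  obtain m where m: "m \<in> hom C c z" "m \<cdot>\<^bsub>C\<^esub> l = g \<cdot>\<^bsub>C\<^esub> j" "m \<cdot>\<^bsub>C\<^esub> l' = k"
    by (rule is_coprod_desc[OF s, of "g \<cdot>\<^bsub>C\<^esub> j" z k]) (use h Q in \<open>auto simp: hom_def\<close>)
  note hm = homD[OF m(1)]
  have "is_coprod C x c z (g \<cdot>\<^bsub>C\<^esub> f) m"
  proof (rule coprodI)
    show "g \<cdot>\<^bsub>C\<^esub> f \<in> hom C x z" by (simp add: hom_def h)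
    show "\<exists>u. u \<in> hom C z t \<and> u \<cdot>\<^bsub>C\<^esub> (g \<cdot>\<^bsub>C\<^esub> f) = v \<and> u \<cdot>\<^bsub>C\<^esub> m = w"
      if t: "t \<in> Obj C" and v: "v \<in> hom C x t" and w: "w \<in> hom C c t" for t v w
    proof -
      note hv = homD[OF v] homD[OF w]
      obtain r where r: "r \<in> hom C y t" "r \<cdot>\<^bsub>C\<^esub> f = v" "r \<cdot>\<^bsub>C\<^esub> j = w \<cdot>\<^bsub>C\<^esub> l"
        by (rule is_coprod_desc[OF p v, of "w \<cdot>\<^bsub>C\<^esub> l"]) (use h hv t in \<open>auto simp: hom_def\<close>)
      obtain u where u: "u \<in> hom C z t" "u \<cdot>\<^bsub>C\<^esub> g = r" "u \<cdot>\<^bsub>C\<^esub> k = w \<cdot>\<^bsub>C\<^esub> l'"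
        by (rule is_coprod_desc[OF q r(1), of "w \<cdot>\<^bsub>C\<^esub> l'"]) (use h hv t in \<open>auto simp: hom_def\<close>)
      note hu = homD[OF r(1)] homD[OF u(1)]
      have "u \<cdot>\<^bsub>C\<^esub> m = w"
        by (rule coprod_eqI[OF s, of _ t])
          (simp_all add: hom_def h hm hu hv m(2,3) u(3) comp_ext[OF u(2)] r(3))
      moreover have "u \<cdot>\<^bsub>C\<^esub> (g \<cdot>\<^bsub>C\<^esub> f) = v" by (simp add: comp_ext[OF u(2)] h hu r(2))
      ultimately show ?thesis using u(1) by blast
    qed
    show "u = v" if u: "u \<in> hom C z t" and v: "v \<in> hom C z t" and e1: "u \<cdot>\<^bsub>C\<^esub> (g \<cdot>\<^bsub>C\<^esub> f) = v \<cdot>\<^bsub>C\<^esub> (g \<cdot>\<^bsub>C\<^esub> f)"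
      and e2: "u \<cdot>\<^bsub>C\<^esub> m = v \<cdot>\<^bsub>C\<^esub> m" for t u v
    proof -
      note hu = homD[OF u] homD[OF v]
      have "(u \<cdot>\<^bsub>C\<^esub> m) \<cdot>\<^bsub>C\<^esub> l = (v \<cdot>\<^bsub>C\<^esub> m) \<cdot>\<^bsub>C\<^esub> l" "(u \<cdot>\<^bsub>C\<^esub> m) \<cdot>\<^bsub>C\<^esub> l' = (v \<cdot>\<^bsub>C\<^esub> m) \<cdot>\<^bsub>C\<^esub> l'" using e2 by simp_all
      then have e3: "u \<cdot>\<^bsub>C\<^esub> (g \<cdot>\<^bsub>C\<^esub> j) = v \<cdot>\<^bsub>C\<^esub> (g \<cdot>\<^bsub>C\<^esub> j)" "u \<cdot>\<^bsub>C\<^esub> k = v \<cdot>\<^bsub>C\<^esub> k" by (simp_all add: hu hm h m(2,3))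
      show ?thesis
      proof (rule coprod_eqI[OF q u v _ e3(2)])
        show "u \<cdot>\<^bsub>C\<^esub> g = v \<cdot>\<^bsub>C\<^esub> g"
          by (rule coprod_eqI[OF p, of _ t]) (simp_all add: hom_def hu h e1 e3)
      qed
    qed
  qed (use P Q S m in auto)
  then show ?thesis by blast
qed

text \<open>Pushing out a summand inclusion keeps its complement \<open>a\<close>, so the pushout is
  obtained from the coproduct of \<open>z\<close> and \<open>a\<close>. This is the source of all
  pushouts along cofibrations.\<close>

lemma pushout_coprojection:
  assumes p: "is_coprod C x a y f j" and g: "g \<in> hom C x z" and d: "is_coprod C z a d q j'"
  shows "\<exists>p. is_pushout C f g d p q \<and> p \<cdot>\<^bsub>C\<^esub> j = j'"
proof -
  note P = is_coprodD[OF p] and Q = is_coprodD[OF d]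
  note h = homD[OF P(4)] homD[OF P(5)] homD[OF Q(4)] homD[OF Q(5)] homD[OF g]
  obtain r where r: "r \<in> hom C y d" "r \<cdot>\<^bsub>C\<^esub> f = q \<cdot>\<^bsub>C\<^esub> g" "r \<cdot>\<^bsub>C\<^esub> j = j'"
    by (rule is_coprod_desc[OF p, of "q \<cdot>\<^bsub>C\<^esub> g" d j']) (use h Q in \<open>auto simp: hom_def\<close>)
  note hr = homD[OF r(1)]
  have "is_pushout C f g d r q"
  proof (rule pushoutI[OF P(4) g r(1) Q(4) r(2)])
    show "\<exists>u. u \<in> hom C d t \<and> u \<cdot>\<^bsub>C\<^esub> r = v \<and> u \<cdot>\<^bsub>C\<^esub> q = w"
      if t: "t \<in> Obj C" and v: "v \<in> hom C y t" and w: "w \<in> hom C z t" and e: "v \<cdot>\<^bsub>C\<^esub> f = w \<cdot>\<^bsub>C\<^esub> g" for t v w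
    proof -
      note hv = homD[OF v] homD[OF w]
      obtain u where u: "u \<in> hom C d t" "u \<cdot>\<^bsub>C\<^esub> q = w" "u \<cdot>\<^bsub>C\<^esub> j' = v \<cdot>\<^bsub>C\<^esub> j"
        by (rule is_coprod_desc[OF d w, of "v \<cdot>\<^bsub>C\<^esub> j"]) (use h hv t in \<open>auto simp: hom_def\<close>)
      note hu = homD[OF u(1)]
      have "u \<cdot>\<^bsub>C\<^esub> r = v"
        by (rule coprod_eqI[OF p, of _ t])
          (simp_all add: hom_def h hr hu hv r(2,3) u(3) comp_ext[OF u(2)] e)
      then show ?thesis using u by blast
    qed
    show "u = v" if u: "u \<in> hom C d t" and v: "v \<in> hom C d t" and e1: "u \<cdot>\<^bsub>C\<^esub> r = v \<cdot>\<^bsub>C\<^esub> r"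
      and e2: "u \<cdot>\<^bsub>C\<^esub> q = v \<cdot>\<^bsub>C\<^esub> q" for t u v
    proof (rule coprod_eqI[OF d u v e2])
      have "(u \<cdot>\<^bsub>C\<^esub> r) \<cdot>\<^bsub>C\<^esub> j = (v \<cdot>\<^bsub>C\<^esub> r) \<cdot>\<^bsub>C\<^esub> j" using e1 by simp
      then show "u \<cdot>\<^bsub>C\<^esub> j' = v \<cdot>\<^bsub>C\<^esub> j'" by (simp add: homD[OF u] homD[OF v] hr h r(3))
    qed
  qed
  then show ?thesis using r by blast
qed

lemma pushout_iso:
  assumes "is_pushout C f g d p q" "is_pushout C f g d' p' q'"
  obtains u where "u \<in> hom C d d'" "is_iso C u" "u \<cdot>\<^bsub>C\<^esub> p = p'" "u \<cdot>\<^bsub>C\<^esub> q = q'"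
proof -
  obtain u where "u \<in> hom C d d'" "is_iso C u" "\<And>b. b \<in> UNIV \<Longrightarrow> u \<cdot>\<^bsub>C\<^esub> case_bool p q b = case_bool p' q' b"
    using colim_iso assms unfolding pushout_iff_colim by blast
  then show thesis using that[of u] by (metis UNIV_I bool.case)
qed

lemma coprod_transport:
  assumes p: "is_coprod C x y p i j" and u: "u \<in> hom C p p'" "is_iso C u"
  shows "is_coprod C x y p' (u \<cdot>\<^bsub>C\<^esub> i) (u \<cdot>\<^bsub>C\<^esub> j)"
  unfolding coprod_iff_colim
  by (rule colim_transport[OF p[unfolded coprod_iff_colim] u]) (auto split: bool.splits)

end

context coprods begin

text \<open>Any given pushout is isomorphic to the one with complement \<open>a\<close>, and the
  coproduct structure is transported along that isomorphism.\<close>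

lemma coprod_of_pushout:
  assumes p: "is_coprod C x a y f j" and d: "is_pushout C f g d r q"
  shows "is_coprod C (Cod C g) a d q (r \<cdot>\<^bsub>C\<^esub> j)"
proof -
  note P = is_coprodD[OF p] and D = is_pushoutD[OF d]
  have g: "g \<in> hom C x (Cod C g)" using D P by (simp add: hom_def)
  note c = coprod_is[OF hom_obj(2)[OF g] P(2)]
  obtain r' where r': "is_pushout C f g (coprod_ob C (Cod C g) a) r' (in1 C (Cod C g) a)" "r' \<cdot>\<^bsub>C\<^esub> j = in2 C (Cod C g) a"
    using pushout_coprojection[OF p g c] by blast
  obtain u where u: "u \<in> hom C (coprod_ob C (Cod C g) a) d" "is_iso C u" "u \<cdot>\<^bsub>C\<^esub> r' = r" "u \<cdot>\<^bsub>C\<^esub> in1 C (Cod C g) a = q"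
    using pushout_iso[OF r'(1) d] by blast
  have "u \<cdot>\<^bsub>C\<^esub> in2 C (Cod C g) a = r \<cdot>\<^bsub>C\<^esub> j"
    using r'(2) comp_ext[OF u(3), of j] is_pushoutD(5)[OF r'(1)] P(4,5) u(1) by (simp add: hom_def)
  then show ?thesis using coprod_transport[OF c u(1,2)] u(4) by simp
qed

lemma coprojection_comp:
  assumes "coprojection C f" "coprojection C g" "Dom C g = Cod C f"
  shows "coprojection C (g \<cdot>\<^bsub>C\<^esub> f)"
proof -
  obtain a j b k where "is_coprod C (Dom C f) a (Cod C f) f j" "is_coprod C (Cod C f) b (Cod C g) g k"
    using assms unfolding coprojection_def by auto
  with coprod_assoc[OF this coprod_is[of a b]] is_coprodD(2) show ?thesis
    by (metis coprojectionI)
qed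

text \<open>The complement is an initial object.\<close>

lemma coprojection_iso:
  assumes "is_iso C f" shows "coprojection C f"
proof -
  obtain z where z: "is_initial C z" using fin by (auto simp: has_finite_coproducts_def)
  have f: "f \<in> Arr C" using assms by (rule iso_arr)
  obtain k where k: "k \<in> hom C z (Cod C f)" using z f unfolding is_initial_def by (metis Cod_obj)
  have zu: "u = v" if "u \<in> hom C z t" "v \<in> hom C z t" for u v t
    using z that hom_obj unfolding is_initial_def by blast
  have "is_coprod C (Dom C f) z (Cod C f) f k"
  proof (rule coprodI)
    show "\<exists>u. u \<in> hom C (Cod C f) t \<and> u \<cdot>\<^bsub>C\<^esub> f = g \<and> u \<cdot>\<^bsub>C\<^esub> k = h"
      if "g \<in> hom C (Dom C f) t" "h \<in> hom C z t" for t g h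
    proof (intro exI conjI)
      show 1: "g \<cdot>\<^bsub>C\<^esub> inv_arr C f \<in> hom C (Cod C f) t" "(g \<cdot>\<^bsub>C\<^esub> inv_arr C f) \<cdot>\<^bsub>C\<^esub> f = g"
        using that(1) assms f by (auto simp: hom_def)
      show "(g \<cdot>\<^bsub>C\<^esub> inv_arr C f) \<cdot>\<^bsub>C\<^esub> k = h"
        by (rule zu[OF _ that(2)]) (use 1(1) k in \<open>auto simp: hom_def\<close>)
    qed
    show "u = v" if "u \<in> hom C (Cod C f) t" "v \<in> hom C (Cod C f) t" "u \<cdot>\<^bsub>C\<^esub> f = v \<cdot>\<^bsub>C\<^esub> f" for t u v
      using iso_cancel_right[OF assms, of u v] that by (simp add: hom_def)
  qed (use f k z in \<open>auto simp: hom_def is_initial_def\<close>)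
  then show ?thesis by (rule coprojectionI)
qed

text \<open>Here the complement is the codomain itself, included by its identity.\<close>

lemma coprojection_initial:
  assumes z: "is_initial C z" and f: "f \<in> hom C z x" shows "coprojection C f"
proof -
  have x: "x \<in> Obj C" using hom_obj f by blast
  have zu: "u = v" if "u \<in> hom C z t" "v \<in> hom C z t" for u v t
    using z that hom_obj unfolding is_initial_def by blast
  have "is_coprod C z x x f (Ident C x)"
  proof (rule coprodI)
    show "\<exists>u. u \<in> hom C x t \<and> u \<cdot>\<^bsub>C\<^esub> f = g \<and> u \<cdot>\<^bsub>C\<^esub> Ident C x = h"
      if "g \<in> hom C z t" "h \<in> hom C x t" for t g h
    proof (intro exI conjI)
      show "h \<cdot>\<^bsub>C\<^esub> f = g" by (rule zu[OF _ that(1)]) (use f that in \<open>auto simp: hom_def\<close>)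
    qed (use that in \<open>auto simp: hom_def\<close>)
    show "u = v" if "u \<in> hom C x t" "v \<in> hom C x t" "u \<cdot>\<^bsub>C\<^esub> Ident C x = v \<cdot>\<^bsub>C\<^esub> Ident C x" for t u v
      using that by (simp add: hom_def)
  qed (use f z x in \<open>auto simp: hom_def is_initial_def\<close>)
  then show ?thesis by (rule coprojectionI)
qed

lemma pushout_coprojection_exists:
  assumes "coprojection C f" "g \<in> Arr C" "Dom C g = Dom C f"
  shows "\<exists>d p q. is_pushout C f g d p q"
proof -
  obtain a j where p: "is_coprod C (Dom C f) a (Cod C f) f j" using assms unfolding coprojection_def by auto
  have "g \<in> hom C (Dom C f) (Cod C g)" using assms by (simp add: hom_def)
  with pushout_coprojection[OF p this coprod_is] is_coprodD(2)[OF p] assms show ?thesis by (metis Cod_obj)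
qed

lemma coprojection_pushout:
  assumes "coprojection C f" "is_pushout C f g d p q" shows "coprojection C q"
proof -
  obtain a j where "is_coprod C (Dom C f) a (Cod C f) f j" using assms unfolding coprojection_def by auto
  from coprojectionI[OF coprod_of_pushout[OF this assms(2)]] show ?thesis .
qed

text \<open>The complement is the copower over the remaining indices. For the two constant simplices
  of the interval this makes the inclusion of both ends of a cylinder a termwise
  coprojection.\<close>

lemma coprojection_family:
  assumes S: "finite S" and T: "is_coprod_family C S (\<lambda>_. x) T i" and k: "k0 \<in> S" "k1 \<in> S" "k0 \<noteq> k1"
    and p: "is_coprod C x x p l l'" and u: "u \<in> hom C p T" "u \<cdot>\<^bsub>C\<^esub> l = i k0" "u \<cdot>\<^bsub>C\<^esub> l' = i k1"
  shows "coprojection C u"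
proof -
  let ?S = "S - {k0, k1}"
  note P = is_coprodD[OF p] and T' = is_coprod_familyD[OF T]
  have x: "x \<in> Obj C" using P by simp
  obtain a e where a: "is_coprod_family C ?S (\<lambda>_. x) a e" using family_exists[of ?S "\<lambda>_. x"] S x by auto
  note A = is_coprod_familyD[OF a]
  have i: "i k \<in> hom C x T" if "k \<in> S" for k using T'(3)[OF that] .
  have i': "i k \<in> hom C x T" if "k \<in> ?S" for k using i that by simp
  obtain v where v: "v \<in> hom C a T" "\<And>k. k \<in> ?S \<Longrightarrow> v \<cdot>\<^bsub>C\<^esub> e k = i k"
    using is_coprod_family_desc[OF a T'(1), of i, OF i'] by blast
  note h = homD[OF P(4)] homD[OF P(5)] homD[OF u(1)] homD[OF v(1)]
  have "is_coprod C p a T u v"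
  proof (rule coprodI[OF P(3) A(1) T'(1) u(1) v(1)])
    show "\<exists>w. w \<in> hom C T t \<and> w \<cdot>\<^bsub>C\<^esub> u = f \<and> w \<cdot>\<^bsub>C\<^esub> v = g"
      if t: "t \<in> Obj C" and f: "f \<in> hom C p t" and g: "g \<in> hom C a t" for t f g
    proof -
      let ?h = "\<lambda>k. if k = k0 then f \<cdot>\<^bsub>C\<^esub> l else if k = k1 then f \<cdot>\<^bsub>C\<^esub> l' else g \<cdot>\<^bsub>C\<^esub> e k"
      note hf = homD[OF f] homD[OF g]
      have "?h k \<in> hom C x t" if "k \<in> S" for k
        using A(3)[of k] that hf h by (auto simp: hom_def)
      then obtain w where w: "w \<in> hom C T t" "\<And>k. k \<in> S \<Longrightarrow> w \<cdot>\<^bsub>C\<^esub> i k = ?h k"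
        using is_coprod_family_desc[OF T t, of ?h] by blast
      note hw = homD[OF w(1)]
      have "w \<cdot>\<^bsub>C\<^esub> u = f"
        by (rule coprod_eqI[OF p, of _ t]) (use w(2)[OF k(1)] w(2)[OF k(2)] k(3) in \<open>simp_all add: hom_def h hf hw u\<close>)
      moreover have "w \<cdot>\<^bsub>C\<^esub> v = g"
      proof (rule family_eqI[OF a, of _ t])
        fix k assume kS: "k \<in> ?S"
        show "(w \<cdot>\<^bsub>C\<^esub> v) \<cdot>\<^bsub>C\<^esub> e k = g \<cdot>\<^bsub>C\<^esub> e k"
          using w(2)[of k] v(2)[OF kS] homD[OF A(3)[OF kS]] h hw kS by simp
      qed (simp_all add: hom_def h hf hw)
      ultimately show ?thesis using w by blast
    qed
    show "f = g" if f: "f \<in> hom C T t" and g: "g \<in> hom C T t" and e1: "f \<cdot>\<^bsub>C\<^esub> u = g \<cdot>\<^bsub>C\<^esub> u" and e2: "f \<cdot>\<^bsub>C\<^esub> v = g \<cdot>\<^bsub>C\<^esub> v" for t f g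
    proof (rule family_eqI[OF T f g])
      note hf = homD[OF f] homD[OF g]
      fix j assume j: "j \<in> S"
      have "(f \<cdot>\<^bsub>C\<^esub> u) \<cdot>\<^bsub>C\<^esub> l = (g \<cdot>\<^bsub>C\<^esub> u) \<cdot>\<^bsub>C\<^esub> l" "(f \<cdot>\<^bsub>C\<^esub> u) \<cdot>\<^bsub>C\<^esub> l' = (g \<cdot>\<^bsub>C\<^esub> u) \<cdot>\<^bsub>C\<^esub> l'" using e1 by simp_all
      then have 1: "f \<cdot>\<^bsub>C\<^esub> i k0 = g \<cdot>\<^bsub>C\<^esub> i k0" "f \<cdot>\<^bsub>C\<^esub> i k1 = g \<cdot>\<^bsub>C\<^esub> i k1" by (simp_all add: h hf u)
      show "f \<cdot>\<^bsub>C\<^esub> i j = g \<cdot>\<^bsub>C\<^esub> i j"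
      proof (cases "j \<in> ?S")
        case True
        have "(f \<cdot>\<^bsub>C\<^esub> v) \<cdot>\<^bsub>C\<^esub> e j = (g \<cdot>\<^bsub>C\<^esub> v) \<cdot>\<^bsub>C\<^esub> e j" using e2 by simp
        then show ?thesis using v(2)[OF True] homD[OF A(3)[OF True]] h hf by simp
      qed (use 1 j in auto)
    qed
  qed
  then show ?thesis by (rule coprojectionI)
qed

end

section \<open>Coproducts, pushouts and double pushouts of functors\<close>

locale fcop = functors A C + C: coprods C
  for A :: "('i, 'm) cat" and C :: "('o, 'a) cat"
begin

lemma colim_exists_E:
  assumes dia: "diagram E J D R" and pt: "\<And>x. \<exists>p c. is_colim C J (\<lambda>j. FOb (D j) x) (at_rel x R) p c"
  shows "\<exists>p c. is_colim E J D R p c"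
proof (rule pointwise_colim_exists[OF dia pt])
  fix p c assume "is_functor A C p" "\<And>j. j \<in> J \<Longrightarrow> c j \<in> hom E (D j) p"
    "\<And>x. is_colim C J (\<lambda>j. FOb (D j) x) (at_rel x R) (FOb p x) (\<lambda>j. NCmp (c j) x)"
  from colim_of_pointwise[OF dia this] show ?thesis by blast
qed

lemma initial_pointwise:
  assumes "is_initial E p" shows "is_initial C (FOb p x)"
proof -
  define D :: "bool \<Rightarrow> ('i, 'm, 'o, 'a) fnctr" where "D = undefined"
  interpret E: category E by (rule category_E)
  obtain z where "is_initial C z" using C.fin by (auto simp: has_finite_coproducts_def)
  then have pt: "\<exists>q c. is_colim C ({} :: bool set) (\<lambda>j. FOb (D j) x) (at_rel x {}) q c" for x
    using C.initial_iff_colim by (auto simp: at_rel_def)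
  show ?thesis
    using colim_is_pointwise[OF assms[unfolded E.initial_iff_colim[where D=D and c=undefined]] pt]
      C.initial_iff_colim by (metis at_rel_def image_empty)
qed

lemma E_initial: "\<exists>p. is_initial E p"
proof -
  define D :: "bool \<Rightarrow> ('i, 'm, 'o, 'a) fnctr" where "D = undefined"
  interpret E: category E by (rule category_E)
  obtain z where "is_initial C z" using C.fin by (auto simp: has_finite_coproducts_def)
  then have pt: "\<exists>q c. is_colim C ({} :: bool set) (\<lambda>j. FOb (D j) x) (at_rel x {}) q c" for x
    using C.initial_iff_colim by (auto simp: at_rel_def)
  have "\<exists>p c. is_colim E ({} :: bool set) D {} p c" by (rule colim_exists_E[OF _ pt]) (simp add: diagram_def)
  then show ?thesis using E.initial_iff_colim by blast
qed

lemma at_rel_simps [simp]: "at_rel x {} = {}"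
  "at_rel x (insert (j, f, k, g) R) = insert (j, NCmp f x, k, NCmp g x) (at_rel x R)"
  by (auto simp: at_rel_def)

lemma case_bool_at [simp]: "(\<lambda>b. FOb (case b of True \<Rightarrow> p | False \<Rightarrow> q) x) = case_bool (FOb p x) (FOb q x)"
  "(\<lambda>b. NCmp (case b of True \<Rightarrow> f | False \<Rightarrow> g) x) = case_bool (NCmp f x) (NCmp g x)"
  by (auto simp: fun_eq_iff split: bool.splits)

lemma coprod_exists_E:
  assumes "is_functor A C X" "is_functor A C Y"
  shows "\<exists>p i j. is_coprod E X Y p i j"
proof -
  interpret E: category E by (rule category_E)
  have d: "diagram E UNIV (case_bool X Y) {}" using assms by (auto simp: diagram_def split: bool.splits)
  have pt: "\<exists>p c. is_colim C UNIV (\<lambda>b. FOb (case_bool X Y b) x) (at_rel x {}) p c" for x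
    using C.coprod_is[of "FOb X x" "FOb Y x"] assms by (auto simp: C.coprod_iff_colim)
  obtain p c where "is_colim E UNIV (case_bool X Y) {} p c" using colim_exists_E[OF d pt] by blast
  then have "is_colim E UNIV (case_bool X Y) {} p (case_bool (c True) (c False))"
    by (rule is_colim_cong) (auto split: bool.splits)
  then show ?thesis unfolding E.coprod_iff_colim by blast
qed

lemma coprods_E: "coprods E"
proof -
  interpret E: category E by (rule category_E)
  obtain z where "is_initial C z" using C.fin by (auto simp: has_finite_coproducts_def)
  then have "has_finite_coproducts E"
    using E_initial coprod_exists_E unfolding has_finite_coproducts_def by simp
  then show ?thesis by unfold_locales
qed

lemma coprod_pointwise:
  assumes "is_coprod E X Y p i j"
  shows "is_coprod C (FOb X x) (FOb Y x) (FOb p x) (NCmp i x) (NCmp j x)"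
proof -
  interpret E: category E by (rule category_E)
  note P = is_coprodD[OF assms]
  have pt: "\<exists>p c. is_colim C UNIV (\<lambda>b. FOb (case_bool X Y b) x) (at_rel x {}) p c" for x
    using C.coprod_is[of "FOb X x" "FOb Y x"] P by (auto simp: C.coprod_iff_colim)
  show ?thesis using colim_is_pointwise[OF assms[unfolded E.coprod_iff_colim] pt] by (simp add: C.coprod_iff_colim)
qed

lemma coprod_of_pointwise:
  assumes "i \<in> hom E X p" "j \<in> hom E Y p"
    "\<And>x. is_coprod C (FOb X x) (FOb Y x) (FOb p x) (NCmp i x) (NCmp j x)"
  shows "is_coprod E X Y p i j"
proof -
  interpret E: category E by (rule category_E)
  have *: "is_functor A C X" "is_functor A C Y" "is_functor A C p"
    using E.hom_obj[OF assms(1)] E.hom_obj[OF assms(2)] by auto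
  show ?thesis unfolding E.coprod_iff_colim
    by (rule colim_of_pointwise) (use assms * in \<open>auto simp: diagram_def C.coprod_iff_colim split: bool.splits\<close>)
qed

text \<open>An instance of \<open>colim_is_pointwise\<close>. For termwise coprojections the
  degreewise existence comes from \<open>pushout_coprojection_exists\<close>.\<close>

lemma pushout_pointwise:
  assumes d: "is_pushout E f g d p q" and pt: "\<And>x. \<exists>d p q. is_pushout C (NCmp f x) (NCmp g x) d p q"
  shows "is_pushout C (NCmp f x) (NCmp g x) (FOb d x) (NCmp p x) (NCmp q x)"
proof -
  interpret E: category E by (rule category_E)
  note D = is_pushoutD[OF d]
  have pt': "\<exists>p c. is_colim C UNIV (\<lambda>b. FOb (case_bool (Cod E f) (Cod E g) b) x) (at_rel x {(True, f, False, g)}) p c" for x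
    using pt[of x] D(1,2) by (auto simp: C.pushout_iff_colim)
  have c: "is_colim E UNIV (case_bool (Cod E f) (Cod E g)) {(True, f, False, g)} d (case_bool p q)"
    using d unfolding E.pushout_iff_colim by blast
  show ?thesis using colim_is_pointwise[OF c pt', of x] D(1-3) by (simp add: C.pushout_iff_colim)
qed

lemma pushout_of_pointwise:
  assumes f: "f \<in> hom E X Y" and g: "g \<in> hom E X Z" and p: "p \<in> hom E Y d" and q: "q \<in> hom E Z d"
    and pt: "\<And>x. is_pushout C (NCmp f x) (NCmp g x) (FOb d x) (NCmp p x) (NCmp q x)"
  shows "is_pushout E f g d p q"
proof -
  interpret E: category E by (rule category_E)
  note h = homD[OF f] homD[OF g] homD[OF p] homD[OF q]
  have *: "is_functor A C d" using E.hom_obj[OF p] by auto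
  have "is_colim E UNIV (case_bool (Cod E f) (Cod E g)) {(True, f, False, g)} d (case_bool p q)"
  proof (rule colim_of_pointwise)
    show "diagram E UNIV (case_bool (Cod E f) (Cod E g)) {(True, f, False, g)}"
      using h by (auto simp: diagram_def split: bool.splits)
    show "is_colim C UNIV (\<lambda>b. FOb (case_bool (Cod E f) (Cod E g) b) x) (at_rel x {(True, f, False, g)})
      (FOb d x) (\<lambda>j. NCmp (case_bool p q j) x)" for x
      using pt[of x] h by (simp add: C.pushout_iff_colim)
  qed (use h * in \<open>auto simp: hom_def split: bool.splits\<close>)
  then show ?thesis unfolding E.pushout_iff_colim using h by auto
qed

lemma pushout_exists_E:
  assumes f: "f \<in> hom E X Y" and g: "g \<in> hom E X Z" and pt: "\<And>x. \<exists>d p q. is_pushout C (NCmp f x) (NCmp g x) d p q"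
  shows "\<exists>d p q. is_pushout E f g d p q"
proof -
  interpret E: category E by (rule category_E)
  note h = homD[OF f] homD[OF g]
  have d: "diagram E UNIV (case_bool (Cod E f) (Cod E g)) {(True, f, False, g)}"
    using h by (auto simp: diagram_def split: bool.splits)
  have pt': "\<exists>p c. is_colim C UNIV (\<lambda>b. FOb (case_bool (Cod E f) (Cod E g) b) x) (at_rel x {(True, f, False, g)}) p c" for x
    using pt[of x] h by (auto simp: C.pushout_iff_colim)
  obtain p c where "is_colim E UNIV (case_bool (Cod E f) (Cod E g)) {(True, f, False, g)} p c"
    using colim_exists_E[OF d pt'] by blast
  then have "is_colim E UNIV (case_bool (Cod E f) (Cod E g)) {(True, f, False, g)} p (case_bool (c True) (c False))"
    by (rule is_colim_cong) (auto split: bool.splits)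
  then show ?thesis unfolding E.pushout_iff_colim using h by auto
qed

abbreviation dD where "dD F G d0 j \<equiv> if j = (0::nat) then Cod E F else if j = 1 then Cod E G else Cod E d0"

text \<open>Settles once how the case distinctions that name the three objects of the gluing diagram
  behave under evaluation in degree \<open>x\<close>.\<close>

lemma dpo_at:
  assumes "is_ntrans A C F" "is_ntrans A C G" "is_ntrans A C d0"
  shows "is_dpo C (NCmp F x) (NCmp G x) (NCmp d0 x) (NCmp d1 x) k a b c \<longleftrightarrow>
    is_colim C {0, 1, 2} (\<lambda>j. FOb (dD F G d0 j) x) (at_rel x {(0, F, 2, d0), (1, G, 2, d1)}) k
      (\<lambda>j. if j = 0 then a else if j = 1 then b else c)"
  using assms by (simp add: is_dpo_def if_distrib[of "\<lambda>t. FOb t x"] cong: if_cong)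

lemma dpo_pointwise:
  assumes k: "is_dpo E F G d0 d1 k a b c"
    and pt: "\<And>x. \<exists>k a b c. is_dpo C (NCmp F x) (NCmp G x) (NCmp d0 x) (NCmp d1 x) k a b c"
  shows "is_dpo C (NCmp F x) (NCmp G x) (NCmp d0 x) (NCmp d1 x) (FOb k x) (NCmp a x) (NCmp b x) (NCmp c x)"
proof -
  note K = is_dpoD[OF k]
  note n = K(1)[simplified] K(2)[simplified] K(3)[simplified]
  have pt': "\<exists>p c. is_colim C {0, 1, 2} (\<lambda>j. FOb (dD F G d0 j) x) (at_rel x {(0, F, 2, d0), (1, G, 2, d1)}) p c" for x
    using pt[of x] unfolding dpo_at[OF n] by blast
  have "is_colim C {0, 1, 2} (\<lambda>j. FOb (dD F G d0 j) x) (at_rel x {(0, F, 2, d0), (1, G, 2, d1)}) (FOb k x)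
     (\<lambda>j. NCmp (if j = 0 then a else if j = 1 then b else c) x)"
    by (rule colim_is_pointwise[OF k[unfolded is_dpo_def] pt'])
  then show ?thesis unfolding dpo_at[OF n] by (simp add: if_distrib[of "\<lambda>t. NCmp t x"] cong: if_cong)
qed

lemma dpo_of_pointwise:
  assumes F: "F \<in> hom E X Y" and G: "G \<in> hom E X Z" and d: "d0 \<in> hom E X T" "d1 \<in> hom E X T"
    and a: "a \<in> hom E Y k" and b: "b \<in> hom E Z k" and c: "c \<in> hom E T k"
    and pt: "\<And>x. is_dpo C (NCmp F x) (NCmp G x) (NCmp d0 x) (NCmp d1 x) (FOb k x) (NCmp a x) (NCmp b x) (NCmp c x)"
  shows "is_dpo E F G d0 d1 k a b c"
  unfolding is_dpo_def
proof (rule colim_of_pointwise)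
  interpret E: category E by (rule category_E)
  note h = homD[OF F] homD[OF G] homD[OF d(1)] homD[OF d(2)] homD[OF a] homD[OF b] homD[OF c]
  show "diagram E {0, 1, 2} (dD F G d0) {(0, F, 2, d0), (1, G, 2, d1)}"
    using h by (auto simp: diagram_def)
  show "is_functor A C k" using E.hom_obj[OF a] by auto
  show "(if j = 0 then a else if j = 1 then b else c) \<in> hom E (dD F G d0 j) k" if "j \<in> {0, 1, 2}" for j
    using h by (auto simp: hom_def)
  show "is_colim C {0, 1, 2} (\<lambda>j. FOb (dD F G d0 j) x) (at_rel x {(0, F, 2, d0), (1, G, 2, d1)}) (FOb k x)
     (\<lambda>j. NCmp (if j = 0 then a else if j = 1 then b else c) x)" for x
    using pt[of x] h unfolding dpo_at[OF h(1)[simplified] h(4)[simplified] h(7)[simplified]]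
    by (simp add: if_distrib[of "\<lambda>t. NCmp t x"] cong: if_cong)
qed

lemma dpo_exists_E:
  assumes F: "F \<in> hom E X Y" and G: "G \<in> hom E X Z" and d: "d0 \<in> hom E X T" "d1 \<in> hom E X T"
    and pt: "\<And>x. \<exists>k a b c. is_dpo C (NCmp F x) (NCmp G x) (NCmp d0 x) (NCmp d1 x) k a b c"
  shows "\<exists>k a b c. is_dpo E F G d0 d1 k a b c"
proof -
  note h = homD[OF F] homD[OF G] homD[OF d(1)] homD[OF d(2)]
  have dia: "diagram E {0, 1, 2} (dD F G d0) {(0, F, 2, d0), (1, G, 2, d1)}"
    using h by (auto simp: diagram_def)
  have pt': "\<exists>p c. is_colim C {0, 1, 2} (\<lambda>j. FOb (dD F G d0 j) x) (at_rel x {(0, F, 2, d0), (1, G, 2, d1)}) p c" for x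
    using pt[of x] unfolding dpo_at[OF h(1)[simplified] h(4)[simplified] h(7)[simplified]] by blast
  obtain p c where "is_colim E {0, 1, 2} (dD F G d0) {(0, F, 2, d0), (1, G, 2, d1)} p c"
    using colim_exists_E[OF dia pt'] by blast
  then have "is_colim E {0, 1, 2} (dD F G d0) {(0, F, 2, d0), (1, G, 2, d1)} p
    (\<lambda>j. if j = 0 then c 0 else if j = 1 then c 1 else c 2)"
    by (rule is_colim_cong) auto
  then show ?thesis unfolding is_dpo_def by blast
qed

end

sublocale gset \<subseteq> fcop A C by unfold_locales

context interval begin

text \<open>In each degree the two ends are two distinct summands of a copower of \<open>X\<close>.
  The glued object is the coproduct in which these two copies have been exchanged for the values of
  \<open>Y\<close> and \<open>Z\<close>.\<close>

lemma cyl_dpo_at: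
  assumes F: "F \<in> hom E X Y" and G: "G \<in> hom E X Z"
  shows "\<exists>k a b c. is_dpo C (NCmp F x) (NCmp G x) (NCmp (d0 X) x) (NCmp (d1 X) x) k a b c"
proof -
  note h = homD[OF F] homD[OF G]
  have X: "is_functor A C X" "is_functor A C Y" "is_functor A C Z" using h by auto
  let ?D = "\<lambda>k. if k = e0 x then FOb Y x else if k = e1 x then FOb Z x else FOb X x"
  have "?D k \<in> Obj C" for k using X by simp
  then obtain p e where p: "is_coprod_family C (S x) ?D p e"
    using C.family_exists[of "S x" ?D] by auto
  have "NCmp F x \<in> hom C (FOb X x) (FOb Y x)" "NCmp G x \<in> hom C (FOb X x) (FOb Z x)"
    using h by (auto simp: hom_def)
  from C.dpo_of_family[OF C.copower_is[OF S_fin functor_simps(1)[OF X(1)]] e_in e_neq this p] show ?thesis by simp blast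
qed

lemma cyl_dpo_exists:
  assumes F: "F \<in> hom E X Y" and G: "G \<in> hom E X Z"
  shows "\<exists>k a b c. is_dpo E F G (d0 X) (d1 X) k a b c"
proof -
  have "is_functor A C X" using homD[OF F] by auto
  then show ?thesis using dpo_exists_E[OF F G _ _ cyl_dpo_at[OF F G]] by (simp add: hom_def)
qed

lemma cyl_dpo_pointwise:
  assumes k: "is_dpo E F G (d0 X) (d1 X) k a b c"
  shows "is_dpo C (NCmp F x) (NCmp G x) (NCmp (d0 X) x) (NCmp (d1 X) x) (FOb k x) (NCmp a x) (NCmp b x) (NCmp c x)"
proof (rule dpo_pointwise[OF k])
  note K = is_dpoD[OF k]
  have "F \<in> hom E X (NTgt F)" "G \<in> hom E X (NTgt G)" using K by (auto simp: hom_def)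
  from cyl_dpo_at[OF this] show "\<exists>k a b c. is_dpo C (NCmp F x) (NCmp G x) (NCmp (d0 X) x) (NCmp (d1 X) x) k a b c" for x .
qed

end

section \<open>The simplex category\<close>

lemma category_op_cat: "category A \<Longrightarrow> category (op_cat A)"
  unfolding category_def by (simp add: op_cat_def hom_def)

lemma op_cat_simps [simp]: "Obj (op_cat A) = Obj A" "Arr (op_cat A) = Arr A" "Dom (op_cat A) = Cod A" "Cod (op_cat A) = Dom A"
  "Ident (op_cat A) = Ident A" "g \<cdot>\<^bsub>op_cat A\<^esub> f = f \<cdot>\<^bsub>A\<^esub> g"
  by (simp_all add: op_cat_def)

lemma prod_cat_simps [simp]: "Obj (prod_cat A B) = Obj A \<times> Obj B" "Arr (prod_cat A B) = Arr A \<times> Arr B"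
  "Dom (prod_cat A B) (f, g) = (Dom A f, Dom B g)" "Cod (prod_cat A B) (f, g) = (Cod A f, Cod B g)"
  "Ident (prod_cat A B) (x, y) = (Ident A x, Ident B y)"
  "(f', g') \<cdot>\<^bsub>prod_cat A B\<^esub> (f, g) = (f' \<cdot>\<^bsub>A\<^esub> f, g' \<cdot>\<^bsub>B\<^esub> g)"
  by (simp_all add: prod_cat_def)

lemma category_prod_cat:
  assumes "category A" "category B" shows "category (prod_cat A B)"
proof -
  interpret A: category A by fact
  interpret B: category B by fact
  show ?thesis by unfold_locales (auto simp: hom_def)
qed

lemma Delta_simps [simp]: "Obj Delta = UNIV" "Dom Delta (m, n, f) = m" "Cod Delta (m, n, f) = n"
  "Ident Delta n = (n, n, restrict (\<lambda>i. i) {0..n})" "(n', p, g) \<cdot>\<^bsub>Delta\<^esub> (m, n, f) = (m, p, compose {0..m} g f)"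
  by (simp_all add: Delta_def)

lemma Delta_arr [simp]: "(m, n, f) \<in> Arr Delta \<longleftrightarrow> f \<in> {0..m} \<rightarrow>\<^sub>E {0..n} \<and> mono_on {0..m} f"
  by (simp add: Delta_def)

lemma Delta_hom: "\<sigma> \<in> hom Delta m n \<longleftrightarrow> (\<exists>f. \<sigma> = (m, n, f) \<and> f \<in> {0..m} \<rightarrow>\<^sub>E {0..n} \<and> mono_on {0..m} f)"
  by (cases \<sigma>) (auto simp: hom_def)

lemma compose_mono:
  fixes m n p :: nat
  assumes "f \<in> {0..m} \<rightarrow>\<^sub>E {0..n}" "mono_on {0..m} f" "g \<in> {0..n} \<rightarrow>\<^sub>E {0..p}" "mono_on {0..n} g"
  shows "compose {0..m} g f \<in> {0..m::nat} \<rightarrow>\<^sub>E {0..p::nat}" "mono_on {0..m} (compose {0..m} g f)"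
proof -
  have f: "f i \<le> n" if "i \<le> m" for i using PiE_mem[OF assms(1), of i] that by simp
  have g: "g i \<le> p" if "i \<le> n" for i using PiE_mem[OF assms(3), of i] that by simp
  show "compose {0..m} g f \<in> {0..m} \<rightarrow>\<^sub>E {0..p}" using f g by (auto simp: compose_def)
  show "mono_on {0..m} (compose {0..m} g f)"
    using f by (auto simp: compose_def mono_on_def intro!: mono_onD[OF assms(4)] mono_onD[OF assms(2)])
qed

lemma category_Delta: "category Delta"
proof
  show "Ident Delta n \<in> hom Delta n n" for n by (auto simp: Delta_hom mono_on_def)
  show "g \<cdot>\<^bsub>Delta\<^esub> f \<in> hom Delta x z" if "f \<in> hom Delta x y" "g \<in> hom Delta y z" for f g x y z
  proof -
    obtain f' g' where *: "f = (x, y, f')" "f' \<in> {0..x} \<rightarrow>\<^sub>E {0..y}" "mono_on {0..x} f'"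
      "g = (y, z, g')" "g' \<in> {0..y} \<rightarrow>\<^sub>E {0..z}" "mono_on {0..y} g'"
      using \<open>f \<in> hom Delta x y\<close> \<open>g \<in> hom Delta y z\<close> unfolding Delta_hom by blast
    show ?thesis using compose_mono[OF *(2,3) *(5,6)] *(1,4) by (simp add: Delta_hom)
  qed
  show "f \<cdot>\<^bsub>Delta\<^esub> Ident Delta x = f" "Ident Delta y \<cdot>\<^bsub>Delta\<^esub> f = f" if "f \<in> hom Delta x y" for f x y
    using that compose_Id[of _ "{0..x}" "{0..y}"] Id_compose[of _ "{0..x}" "{0..y}"] by (auto simp: Delta_hom PiE_iff)
  show "(h \<cdot>\<^bsub>Delta\<^esub> g) \<cdot>\<^bsub>Delta\<^esub> f = h \<cdot>\<^bsub>Delta\<^esub> (g \<cdot>\<^bsub>Delta\<^esub> f)"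
    if "f \<in> hom Delta w x" "g \<in> hom Delta x y" "h \<in> hom Delta y z" for f g h w x y z
    using that by (auto simp: Delta_hom compose_def restrict_def fun_eq_iff) (fastforce dest: PiE_mem)
qed auto

section \<open>The standard 1-simplex as an interval\<close>

definition dS :: "nat \<Rightarrow> simplex_map set" where "dS n = hom Delta n 1"
definition dact :: "simplex_map \<Rightarrow> simplex_map \<Rightarrow> simplex_map" where "dact \<theta> k = snd (snd (FAr (std_simplex 1) \<theta>)) k"
text \<open>The simplex at which \<open>scyl_d\<close> includes the end numbered \<open>i\<close>:
  the constant with value \<open>1 - i\<close>, so \<open>de 0\<close> is the constant 1 and
  \<open>de 1\<close> the constant 0.\<close>

definition de :: "nat \<Rightarrow> nat \<Rightarrow> simplex_map" where "de i n = coface01 i \<cdot>\<^bsub>Delta\<^esub> to_point n"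
definition dm :: "simplex_map \<Rightarrow> simplex_map \<Rightarrow> simplex_map" where
  "dm \<sigma> \<tau> = (fst \<sigma>, 1, restrict (\<lambda>i. min (snd (snd \<sigma>) i) (snd (snd \<tau>) i)) {0..fst \<sigma>})"

lemma dS_iff: "\<sigma> \<in> dS n \<longleftrightarrow> (\<exists>f. \<sigma> = (n, 1, f) \<and> f \<in> {0..n} \<rightarrow>\<^sub>E {0..1} \<and> mono_on {0..n} f)"
  unfolding dS_def Delta_hom by simp

lemma dact_eq: "(m, n, f) \<in> Arr Delta \<Longrightarrow> (n, 1, g) \<in> dS n \<Longrightarrow> dact (m, n, f) (n, 1, g) = (m, 1, compose {0..m} g f)"
  by (simp add: dact_def std_simplex_def dS_def)

lemma de_eq: "de i n = (n, 1, restrict (\<lambda>_. 1 - i) {0..n})"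
  by (auto simp: de_def coface01_def to_point_def compose_def restrict_def fun_eq_iff)

text \<open>\<open>dact\<close> is precomposition of monotone maps, and precomposition preserves
  constants and commutes with pointwise minima. All other conditions are facts about functions with
  values 0 and 1.\<close>

lemma interval_Delta:
  assumes "coprods C" shows "interval (op_cat Delta) C dS dact (de 0) (de 1) dm"
proof -
  interpret C: coprods C by fact
  interpret D: category "op_cat Delta" by (rule category_op_cat[OF category_Delta])
  have arr: "\<exists>m n f. \<theta> = (m, n, f) \<and> f \<in> {0..m} \<rightarrow>\<^sub>E {0..n} \<and> mono_on {0..m} f" if "\<theta> \<in> Arr Delta" for \<theta>
    using that by (cases \<theta>) auto
  show ?thesis
  proof unfold_locales
    show "finite (dS n)" for n
    proof (rule finite_subset)
      show "dS n \<subseteq> (\<lambda>f. (n, 1, f)) ` ({0..n} \<rightarrow>\<^sub>E {0..1})" by (auto simp: dS_iff)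
    qed (auto intro: finite_PiE)
    show "dact \<theta> k \<in> dS (Cod (op_cat Delta) \<theta>)" if th: "\<theta> \<in> Arr (op_cat Delta)" and k: "k \<in> dS (Dom (op_cat Delta) \<theta>)" for \<theta> k
    proof -
      obtain m n f where *: "\<theta> = (m, n, f)" "f \<in> {0..m} \<rightarrow>\<^sub>E {0..n}" "mono_on {0..m} f" using arr[of \<theta>] th by auto
      obtain g where g: "k = (n, 1, g)" "g \<in> {0..n} \<rightarrow>\<^sub>E {0..1}" "mono_on {0..n} g" using k * by (auto simp: dS_iff)
      show ?thesis using * g k dact_eq[of m n f g] compose_mono[of f m n g 1] by (simp add: dS_iff)
    qed
    show "dact (Ident (op_cat Delta) x) k = k" if "k \<in> dS x" for x k
    proof -
      obtain g where g: "k = (x, 1, g)" "g \<in> {0..x} \<rightarrow>\<^sub>E {0..1}" "mono_on {0..x} g" using \<open>k \<in> dS x\<close> by (auto simp: dS_iff)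
      have "Ident Delta x \<in> Arr Delta" using category.Ident_arr(1)[OF category_Delta] by simp
      then show ?thesis using that g dact_eq[of x x "restrict (\<lambda>i. i) {0..x}" g] compose_Id[of g "{0..x}" "{0..1}"]
        by (simp add: PiE_iff)
    qed
    show "dact (\<theta>' \<cdot>\<^bsub>op_cat Delta\<^esub> \<theta>) k = dact \<theta>' (dact \<theta> k)"
      if th: "\<theta> \<in> Arr (op_cat Delta)" "\<theta>' \<in> Arr (op_cat Delta)" "Dom (op_cat Delta) \<theta>' = Cod (op_cat Delta) \<theta>"
        and k: "k \<in> dS (Dom (op_cat Delta) \<theta>)" for \<theta> \<theta>' k
    proof -
      obtain m n f where *: "\<theta> = (m, n, f)" "f \<in> {0..m} \<rightarrow>\<^sub>E {0..n}" "mono_on {0..m} f" using arr[of \<theta>] th by auto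
      obtain l f' where f': "\<theta>' = (l, m, f')" "f' \<in> {0..l} \<rightarrow>\<^sub>E {0..m}" "mono_on {0..l} f'" using arr[of \<theta>'] th * by auto
      obtain g where g: "k = (n, 1, g)" "g \<in> {0..n} \<rightarrow>\<^sub>E {0..1}" "mono_on {0..n} g" using k * by (auto simp: dS_iff)
      note c = compose_mono[OF f'(2,3) *(2,3)] compose_mono[OF *(2,3) g(2,3)]
      have "(m, 1, compose {0..m} g f) \<in> dS m" using c by (simp add: dS_iff)
      moreover have "f' \<in> {0..l} \<rightarrow> {0..m}" using f' by (simp add: PiE_iff)
      ultimately show ?thesis
        using * f' g c k dact_eq[of m n f g] dact_eq[of l n "compose {0..l} f f'" g] dact_eq[of l m f' "compose {0..m} g f"]
        by (simp add: compose_assoc)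
    qed
    show "de 0 x \<in> dS x" "de 1 x \<in> dS x" for x by (auto simp: de_eq dS_iff mono_on_def)
    then have ee: "(x, 1, restrict (\<lambda>_. 1 - 0) {0..x}) \<in> dS x" "(x, 1, restrict (\<lambda>_. 1 - 1) {0..x}) \<in> dS x" for x
      by (simp_all add: de_eq)
    show "de 0 x \<noteq> de 1 x" for x by (auto simp: de_eq restrict_def fun_eq_iff)
    show "dact \<theta> (de 0 (Dom (op_cat Delta) \<theta>)) = de 0 (Cod (op_cat Delta) \<theta>)"
      "dact \<theta> (de 1 (Dom (op_cat Delta) \<theta>)) = de 1 (Cod (op_cat Delta) \<theta>)" if th: "\<theta> \<in> Arr (op_cat Delta)" for \<theta>
    proof -
      obtain m n f where *: "\<theta> = (m, n, f)" "f \<in> {0..m} \<rightarrow>\<^sub>E {0..n}" "mono_on {0..m} f" using arr[of \<theta>] th by auto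
      show "dact \<theta> (de 0 (Dom (op_cat Delta) \<theta>)) = de 0 (Cod (op_cat Delta) \<theta>)"
        "dact \<theta> (de 1 (Dom (op_cat Delta) \<theta>)) = de 1 (Cod (op_cat Delta) \<theta>)"
        using * ee[of n] dact_eq[of m n f]
        by (auto simp: de_eq compose_def restrict_def fun_eq_iff PiE_iff)
    qed
    show "dm k l \<in> dS x" if "k \<in> dS x" "l \<in> dS x" for k l x
      using that by (auto simp: dS_iff dm_def mono_on_def PiE_iff) (meson min.coboundedI1 min.coboundedI2 order_trans)+
    show "dact \<theta> (dm k l) = dm (dact \<theta> k) (dact \<theta> l)"
      if th: "\<theta> \<in> Arr (op_cat Delta)" and k: "k \<in> dS (Dom (op_cat Delta) \<theta>)" "l \<in> dS (Dom (op_cat Delta) \<theta>)" for \<theta> k l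
    proof -
      obtain m n f where *: "\<theta> = (m, n, f)" "f \<in> {0..m} \<rightarrow>\<^sub>E {0..n}" "mono_on {0..m} f" using arr[of \<theta>] th by auto
      obtain g where g: "k = (n, 1, g)" "g \<in> {0..n} \<rightarrow>\<^sub>E {0..1}" "mono_on {0..n} g" using k * by (auto simp: dS_iff)
      obtain h where h: "l = (n, 1, h)" "h \<in> {0..n} \<rightarrow>\<^sub>E {0..1}" "mono_on {0..n} h" using k * by (auto simp: dS_iff)
      have "dm k l \<in> dS n" using k * \<open>\<And>x k l. k \<in> dS x \<Longrightarrow> l \<in> dS x \<Longrightarrow> dm k l \<in> dS x\<close> by simp
      then show ?thesis
        using * g h k dact_eq[of m n f g] dact_eq[of m n f h] dact_eq[of m n f "restrict (\<lambda>i. min (g i) (h i)) {0..n}"]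
        by (auto simp: dm_def compose_def restrict_def fun_eq_iff PiE_iff)
    qed
    show "dm k (de 0 x) = k" "dm (de 0 x) k = k" if "k \<in> dS x" for k x
      using that by (auto simp: dS_iff dm_def de_eq restrict_def fun_eq_iff PiE_iff extensional_def min_def)
        (meson le_antisym atLeastAtMost_iff le0)+
    show "dm k (de 1 x) = de 1 x" "dm (de 1 x) k = de 1 x" if "k \<in> dS x" for k x
      using that by (auto simp: dS_iff dm_def de_eq restrict_def fun_eq_iff)
  qed auto
qed

text \<open>The interval acts in the first of two directions only. Applied to an object that is
  constant in this direction, the resulting bisimplicial tensor has the ordinary cylinder as its
  diagonal.\<close>

lemma interval_prod:
  assumes "interval A C S act e0 e1 m" "category B" "Obj B = UNIV"
  shows "interval (prod_cat A B) C (\<lambda>x. S (fst x)) (\<lambda>\<theta>. act (fst \<theta>)) (\<lambda>x. e0 (fst x)) (\<lambda>x. e1 (fst x)) m"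
proof -
  interpret I: interval A C S act e0 e1 m by fact
  interpret AB: category "prod_cat A B" by (rule category_prod_cat) (use assms in \<open>auto intro: I.A.category_axioms\<close>)
  show ?thesis
    by unfold_locales (use assms(3) in \<open>auto simp: I.act_comp I.m_nat I.e_neq I.Obj_UNIV\<close>)
qed

subsection \<open>Restriction of tensors\<close>

lemma gten_cong:
  "(\<And>x. S x = S' x) \<Longrightarrow> (\<And>\<theta>. \<theta> \<in> Arr A \<Longrightarrow> act \<theta> = act' \<theta>) \<Longrightarrow> gten A C S act X = gten A C S' act' X"
  by (auto simp: gten_def fun_eq_iff restrict_def)

text \<open>This is an equality and not merely an isomorphism, because both sides use the same
  chosen copowers.\<close>

lemma res_gten:
  assumes "\<And>\<theta>. \<theta> \<in> Arr A \<Longrightarrow> FAr P \<theta> \<in> Arr A2" "\<And>\<theta>. \<theta> \<in> Arr A \<Longrightarrow> Dom A2 (FAr P \<theta>) = FOb P (Dom A \<theta>)"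
    "\<And>\<theta>. \<theta> \<in> Arr A \<Longrightarrow> Cod A2 (FAr P \<theta>) = FOb P (Cod A \<theta>)"
  shows "res_ob A P (gten A2 C S act X) = gten A C (\<lambda>x. S (FOb P x)) (\<lambda>\<theta>. act (FAr P \<theta>)) (res_ob A P X)"
  using assms by (auto simp: gten_def res_ob_def fun_eq_iff restrict_def)

lemma res_res_id:
  assumes "is_functor A C X" "\<And>x. FOb Q (FOb P x) = x" "\<And>\<theta>. \<theta> \<in> Arr A \<Longrightarrow> FAr P \<theta> \<in> Arr A2"
    "\<And>\<theta>. \<theta> \<in> Arr A \<Longrightarrow> FAr Q (FAr P \<theta>) = \<theta>"
  shows "res_ob A P (res_ob A2 Q X) = X"
proof -
  have "FAr X \<in> extensional (Arr A)" using assms(1) by (simp add: is_functor_def)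
  then show ?thesis using assms(2-)
    by (intro fnctr.equality) (auto simp: res_ob_def fun_eq_iff restrict_def extensional_def)
qed

section \<open>Weak equivalences of simplicial objects\<close>

text \<open>From here on the opposite simplex category is an opaque index category; unfolding its
  domains and codomains would keep the lemmas on general index categories from matching.\<close>

declare op_cat_simps [simp del]

text \<open>Restriction merely reindexes components, so a gluing that is one in every degree remains
  one. For gluings along cylinders the degreewise hypothesis comes from
  \<open>cyl_dpo_pointwise\<close>.\<close>

lemma res_dpo:
  assumes "fcop A C" "fcop B C" "is_functor A B P"
    and k: "is_dpo (functor_cat B C) F G d0 d1 k a b c" and FG: "NSrc F = NSrc G"
    and pt: "\<And>x. is_dpo C (NCmp F x) (NCmp G x) (NCmp d0 x) (NCmp d1 x) (FOb k x) (NCmp a x) (NCmp b x) (NCmp c x)"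
  shows "is_dpo (functor_cat A C) (res_map A P F) (res_map A P G) (res_map A P d0) (res_map A P d1)
    (res_ob A P k) (res_map A P a) (res_map A P b) (res_map A P c)"
proof -
  interpret S: fcop A C by fact
  interpret T: fcop B C by fact
  interpret R: restriction A B C P by unfold_locales fact
  note K = is_dpoD[OF k]
  have n: "is_ntrans B C F" "is_ntrans B C G" "is_ntrans B C d0" "is_ntrans B C d1"
    "is_ntrans B C a" "is_ntrans B C b" "is_ntrans B C c" "NSrc F = NSrc d0" "NSrc G = NSrc d1" "NTgt d1 = NTgt d0"
    "NSrc a = NTgt F" "NSrc b = NTgt G" "NSrc c = NTgt d0" "NTgt a = k" "NTgt b = k" "NTgt c = k"
    using K by (auto simp: hom_def)
  have G: "NSrc d1 = NSrc d0" "NSrc G = NSrc d0" using n FG by auto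
  show ?thesis
    by (rule S.dpo_of_pointwise[where X="res_ob A P (NSrc d0)" and Y="res_ob A P (NTgt F)" and Z="res_ob A P (NTgt G)"
          and T="res_ob A P (NTgt d0)"]) (use n G pt in \<open>auto simp: hom_def\<close>)
qed

context interval begin

text \<open>The cylinder on a glued object is glued from the cylinders on its pieces. A homotopy on
  a double mapping cylinder may therefore be prescribed on the three pieces.\<close>

lemma ten_dpo:
  assumes k: "is_dpo E F G (d0 X) (d1 X) k a b c"
  shows "is_dpo E (tmap F) (tmap G) (tmap (d0 X)) (tmap (d1 X)) (ten k) (tmap a) (tmap b) (tmap c)"
proof -
  note K = is_dpoD[OF k]
  have n: "is_ntrans A C F" "is_ntrans A C G" "is_ntrans A C (d0 X)" using K by auto
  have "F \<in> hom E X (NTgt F)" "G \<in> hom E X (NTgt G)" using K by (auto simp: hom_def)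
  note pt = cyl_dpo_at[OF this]
  have pt': "\<exists>p c. is_colim C {0, 1, 2} (\<lambda>j. FOb (dD F G (d0 X) j) x) (at_rel x {(0, F, 2, d0 X), (1, G, 2, d1 X)}) p c" for x
    using pt[of x] unfolding dpo_at[OF n] by blast
  show ?thesis
    using ten_colim[OF k[unfolded is_dpo_def] pt'] K unfolding is_dpo_def
    by (simp add: if_distrib[of ten] if_distrib[of tmap] cong: if_cong)
qed

end

section \<open>Homotopy equivalences and mapping cylinders\<close>

locale closed_class = coprods C for C :: "('o, 'a) cat" +
  fixes W :: "('o, 'a) smap set"
  assumes closed: "Delta_closed C W"
begin

abbreviation "D \<equiv> op_cat Delta"
abbreviation "D2 \<equiv> prod_cat D D"
abbreviation "B \<equiv> functor_cat D C"

sublocale I: interval D C dS dact "de 0" "de (Suc 0)" dm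
  by (rule interval_Delta[unfolded One_nat_def]) (rule coprods_axioms)

sublocale I2: interval D2 C "\<lambda>x. dS (fst x)" "\<lambda>\<theta>. dact (fst \<theta>)" "\<lambda>x. de 0 (fst x)" "\<lambda>x. de (Suc 0) (fst x)" dm
  by (rule interval_prod[OF I.interval_axioms I.A.category_axioms I.Obj_UNIV])

lemma B_hom: "f \<in> hom B X Y \<longleftrightarrow> is_ntrans D C f \<and> NSrc f = X \<and> NTgt f = Y"
  by (simp add: hom_def)

lemma B_eq: "Simp C = B" "BiSimp C = functor_cat D2 C" by (simp_all add: Simp_def BiSimp_def)

text \<open>The given cylinder is literally the general tensor with \<open>dS\<close> and
  \<open>dact\<close>, chosen copowers included, so results about the latter hold for it without
  transport along isomorphisms.\<close>

lemma scyl_eq: "scyl C X = I.ten X"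
  by (simp add: scyl_def tensor_def gten_def op_cat_simps Let_def std_simplex_def dS_def dact_def[abs_def])

lemma scyl_d_eq: "scyl_d C 0 X = I.d0 X" "scyl_d C (Suc 0) X = I.d1 X"
  by (intro ntrans.equality; simp add: scyl_d_def scyl_eq de_def std_simplex_def dS_def fun_eq_iff)+

lemma scyl_s_eq: "scyl_s C X = I.sg X"
  by (simp add: scyl_s_def scyl_eq I.sg_def I.desc_def std_simplex_def dS_def)

lemma scyl_map_eq: "is_ntrans D C f \<Longrightarrow> scyl_map C f = I.tmap f"
proof -
  have "tensor C X (std_simplex 1) = I.ten X" for X using scyl_eq[of X] by (simp only: scyl_def)
  moreover have "FOb (std_simplex 1) n = dS n" for n by (simp only: std_simplex_def dS_def fnctr.simps)
  ultimately show "scyl_map C f = I.tmap f" if "is_ntrans D C f"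
    using that by (intro ntrans.equality) (simp_all add: scyl_map_def tensor_map_def fun_eq_iff cop_map_def del: One_nat_def)
qed

lemma closed':
  "W \<subseteq> Arr B" "two_out_of_three B W" "f \<in> W \<Longrightarrow> g \<in> W \<Longrightarrow> coprod_map B f g \<in> W"
  "simplicial_homotopy_equivalence C f \<Longrightarrow> f \<in> W"
  "F \<in> Arr (functor_cat D2 C) \<Longrightarrow> (\<forall>n. bi_row_map n F \<in> W) \<or> (\<forall>n. bi_col_map n F \<in> W) \<Longrightarrow> bi_diag_map F \<in> W"
  using closed unfolding Delta_closed_def B_eq by blast+

text \<open>A deformation retraction: one composite is an identity, with the constant homotopy, and
  \<open>H\<close> deals with the other. \<open>H\<close> runs from the identity to the composite,
  opposite to the order in \<open>simplicial_homotopy_equivalence\<close>; this is admissible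
  because homotopies in either direction count.\<close>

lemma homotopy_inverse_W:
  assumes f: "f \<in> hom B X Y" and g: "g \<in> hom B Y X" and gf: "g \<cdot>\<^bsub>B\<^esub> f = Ident B X"
    and H: "H \<in> hom B (I.ten Y) Y" "H \<cdot>\<^bsub>B\<^esub> I.d0 Y = Ident B Y" "H \<cdot>\<^bsub>B\<^esub> I.d1 Y = f \<cdot>\<^bsub>B\<^esub> g"
  shows "f \<in> W" "g \<in> W"
proof -
  have X: "is_functor D C X" "is_functor D C Y" using f by (auto simp: B_hom)
  note fg = f[unfolded B_hom] g[unfolded B_hom]
  have XX: "simplicially_homotopic C (Ident B X) (Ident B X)"
    unfolding simplicially_homotopic_def simplicial_homotopy_def B_eq One_nat_def scyl_d_eq scyl_eq
    by (intro exI[of _ "I.sg X"] disjI1) (simp add: B_hom X I.sg_d)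
  have YY: "simplicially_homotopic C (Ident B Y) (f \<cdot>\<^bsub>B\<^esub> g)" "simplicially_homotopic C (f \<cdot>\<^bsub>B\<^esub> g) (Ident B Y)"
    unfolding simplicially_homotopic_def simplicial_homotopy_def B_eq One_nat_def scyl_d_eq scyl_eq
    by (intro exI[of _ H], use H fg in \<open>simp add: B_hom\<close>)+
  have "simplicial_homotopy_equivalence C f" "simplicial_homotopy_equivalence C g"
    unfolding simplicial_homotopy_equivalence_def B_eq
    using fg gf XX YY bexI[OF _ f] bexI[OF _ g] by auto
  then show "f \<in> W" "g \<in> W" using closed'(4) by blast+
qed

sublocale B: weq B W
proof -
  interpret BB: coprods B by (rule I.coprods_E)
  show "weq B W"
  proof unfold_locales
    \<comment> \<open>Isomorphisms are homotopy equivalences by constant homotopies.\<close>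
    show "f \<in> W" if "is_iso B f" for f
    proof (rule homotopy_inverse_W(1)[where g="inv_arr B f" and H="I.sg (Cod B f)"])
      have f: "f \<in> Arr B" using that by (rule BB.iso_arr)
      show "f \<in> hom B (Dom B f) (Cod B f)" using f by (simp add: hom_def)
      show "inv_arr B f \<in> hom B (Cod B f) (Dom B f)" using BB.inv_arr_simps(1-3)[OF that] by (simp add: hom_def)
      show "inv_arr B f \<cdot>\<^bsub>B\<^esub> f = Ident B (Dom B f)" using that by (rule BB.inv_arr_simps(4))
      have Y: "is_functor D C (Cod B f)" using f by simp
      then show "I.sg (Cod B f) \<in> hom B (I.ten (Cod B f)) (Cod B f)" by (simp add: B_hom)
      show "I.sg (Cod B f) \<cdot>\<^bsub>B\<^esub> I.d0 (Cod B f) = Ident B (Cod B f)" using I.sg_d(1)[OF Y] .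
      show "I.sg (Cod B f) \<cdot>\<^bsub>B\<^esub> I.d1 (Cod B f) = f \<cdot>\<^bsub>B\<^esub> inv_arr B f" using I.sg_d(2)[OF Y] BB.inv_arr_simps(5)[OF that] by simp
    qed
  qed (use closed' in blast)+
qed

text \<open>\<open>hh\<close> contracts the cylinder to the end \<open>d1\<close>, so
  \<open>d1\<close> and \<open>sg\<close> form a deformation retraction. Then \<open>d0\<close>,
  being another section of \<open>sg\<close>, follows by 2-out-of-3.\<close>

lemma cyl_W:
  assumes X: "is_functor D C X" shows "I.d0 X \<in> W" "I.d1 X \<in> W" "I.sg X \<in> W"
proof -
  have *: "I.d1 X \<in> W" "I.sg X \<in> W"
    using homotopy_inverse_W[of "I.d1 X" X "I.ten X" "I.sg X" "I.hh X"] X I.sg_d[OF X] I.hh_d[OF X]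
    by (simp_all add: B_hom)
  then show "I.d1 X \<in> W" "I.sg X \<in> W" by auto
  show "I.d0 X \<in> W" by (rule B.W_section[OF I.sg_d(1)[OF X] *(2), of "I.ten X"]) (simp_all add: B_hom X)
qed

text \<open>\<open>k\<close> is the mapping cylinder of \<open>g\<close>, glued so that
  \<open>Z\<close> sits at the end towards which \<open>hh\<close> contracts; hence \<open>Z\<close>
  is a deformation retract of it.\<close>

lemma mapping_cylinder_W:
  assumes g: "g \<in> hom B X Z" and k: "is_dpo B (Ident B X) g (I.d0 X) (I.d1 X) k a b c"
    and p: "p \<in> hom B k Z" "p \<cdot>\<^bsub>B\<^esub> a = g" "p \<cdot>\<^bsub>B\<^esub> b = Ident B Z" "p \<cdot>\<^bsub>B\<^esub> c = g \<cdot>\<^bsub>B\<^esub> I.sg X"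
  shows "b \<in> W" "p \<in> W"
proof -
  have X: "is_functor D C X" "is_functor D C Z" using g by (auto simp: B_hom)
  note K = is_dpoD[OF k]
  have K': "is_ntrans D C a" "NSrc a = X" "NTgt a = k" "is_ntrans D C b" "NSrc b = Z" "NTgt b = k"
    "is_ntrans D C c" "NSrc c = I.ten X" "NTgt c = k" "is_functor D C k"
    "is_ntrans D C g" "NSrc g = X" "NTgt g = Z" "is_ntrans D C p" "NSrc p = k" "NTgt p = Z"
    using K g p(1) by (auto simp: B_hom)
  have e: "c \<cdot>\<^bsub>B\<^esub> I.d0 X = a" "c \<cdot>\<^bsub>B\<^esub> I.d1 X = b \<cdot>\<^bsub>B\<^esub> g" using K(12,13) K' B.comp_Ident[of a X] by auto
  note tk = I.ten_dpo[OF k]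
  \<comment> \<open>On the cylinder of \<open>k\<close> the homotopy is prescribed piecewise: the
    free end \<open>X\<close> travels along the cylinder, \<open>Z\<close> stays fixed, and the
    cylinder part is contracted by \<open>hh\<close>. The second pair of identities in
    \<open>hh_d\<close> makes the pieces fit together.\<close>
  obtain H where H: "H \<in> hom B (I.ten k) k" "H \<cdot>\<^bsub>B\<^esub> I.tmap a = c" "H \<cdot>\<^bsub>B\<^esub> I.tmap b = b \<cdot>\<^bsub>B\<^esub> I.sg Z" "H \<cdot>\<^bsub>B\<^esub> I.tmap c = c \<cdot>\<^bsub>B\<^esub> I.hh X"
  proof (rule is_dpo_desc[OF tk, of c k "b \<cdot>\<^bsub>B\<^esub> I.sg Z" "c \<cdot>\<^bsub>B\<^esub> I.hh X"])
    show "c \<cdot>\<^bsub>B\<^esub> I.tmap (Ident B X) = (c \<cdot>\<^bsub>B\<^esub> I.hh X) \<cdot>\<^bsub>B\<^esub> I.tmap (I.d0 X)"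
      using X K' I.hh_d(3)[OF X(1)] by (simp add: I.tmap_Ident)
    have "(b \<cdot>\<^bsub>B\<^esub> I.sg Z) \<cdot>\<^bsub>B\<^esub> I.tmap g = b \<cdot>\<^bsub>B\<^esub> (g \<cdot>\<^bsub>B\<^esub> I.sg X)"
      using I.tmap_sg[of g] X K' by simp
    also have "\<dots> = c \<cdot>\<^bsub>B\<^esub> (I.d1 X \<cdot>\<^bsub>B\<^esub> I.sg X)"
      using B.comp_ext2[OF e(2)[symmetric], of "I.sg X"] X K' by simp
    finally show "(b \<cdot>\<^bsub>B\<^esub> I.sg Z) \<cdot>\<^bsub>B\<^esub> I.tmap g = (c \<cdot>\<^bsub>B\<^esub> I.hh X) \<cdot>\<^bsub>B\<^esub> I.tmap (I.d1 X)"
      using X K' I.hh_d(4)[OF X(1)] by simp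
  qed (use X K' I.ntrans_comp in \<open>auto simp: B_hom simp del: I.E_simps(7)\<close>)
  note H' = H(1)[unfolded B_hom]
  have dk: "I.tmap a \<cdot>\<^bsub>B\<^esub> I.d0 X = I.d0 k \<cdot>\<^bsub>B\<^esub> a" "I.tmap a \<cdot>\<^bsub>B\<^esub> I.d1 X = I.d1 k \<cdot>\<^bsub>B\<^esub> a"
    "I.tmap b \<cdot>\<^bsub>B\<^esub> I.d0 Z = I.d0 k \<cdot>\<^bsub>B\<^esub> b" "I.tmap b \<cdot>\<^bsub>B\<^esub> I.d1 Z = I.d1 k \<cdot>\<^bsub>B\<^esub> b"
    "I.tmap c \<cdot>\<^bsub>B\<^esub> I.d0 (I.ten X) = I.d0 k \<cdot>\<^bsub>B\<^esub> c" "I.tmap c \<cdot>\<^bsub>B\<^esub> I.d1 (I.ten X) = I.d1 k \<cdot>\<^bsub>B\<^esub> c"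
    using I.tmap_d[of a] I.tmap_d[of b] I.tmap_d[of c] K' by simp_all
  have n: "is_ntrans D C (H \<cdot>\<^bsub>B\<^esub> I.d0 k)" "is_ntrans D C (H \<cdot>\<^bsub>B\<^esub> I.d1 k)" "is_ntrans D C (b \<cdot>\<^bsub>B\<^esub> p)"
    using H' K' by (auto intro: I.ntrans_comp)
  have L: "(H \<cdot>\<^bsub>B\<^esub> t) \<cdot>\<^bsub>B\<^esub> s = (H \<cdot>\<^bsub>B\<^esub> r) \<cdot>\<^bsub>B\<^esub> q"
    if "t \<cdot>\<^bsub>B\<^esub> s = r \<cdot>\<^bsub>B\<^esub> q" "is_ntrans D C t" "is_ntrans D C s" "is_ntrans D C r" "is_ntrans D C q"
      "NTgt t = I.ten k" "NTgt r = I.ten k" "NSrc t = NTgt s" "NSrc r = NTgt q" for t s r q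
    using that H' by simp
  \<comment> \<open>The first pair of identities in \<open>hh_d\<close> evaluates the homotopy at
    its two ends, first to the identity and then to \<open>p\<close> followed by
    \<open>b\<close>.\<close>
  have "H \<cdot>\<^bsub>B\<^esub> I.d0 k = Ident B k"
  proof (rule B.dpo_eqI[OF k])
    show "(H \<cdot>\<^bsub>B\<^esub> I.d0 k) \<cdot>\<^bsub>B\<^esub> a = Ident B k \<cdot>\<^bsub>B\<^esub> a" "(H \<cdot>\<^bsub>B\<^esub> I.d0 k) \<cdot>\<^bsub>B\<^esub> b = Ident B k \<cdot>\<^bsub>B\<^esub> b"
      "(H \<cdot>\<^bsub>B\<^esub> I.d0 k) \<cdot>\<^bsub>B\<^esub> c = Ident B k \<cdot>\<^bsub>B\<^esub> c"
      using L[OF dk(1)[symmetric]] L[OF dk(3)[symmetric]] L[OF dk(5)[symmetric]] K' X H(2-4) e I.sg_d(1)[of Z] I.hh_d(1)[OF X(1)]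
      by simp_all
  qed (use n H' K' in \<open>auto simp: B_hom simp del: I.E_simps(7)\<close>)
  moreover have "H \<cdot>\<^bsub>B\<^esub> I.d1 k = b \<cdot>\<^bsub>B\<^esub> p"
  proof (rule B.dpo_eqI[OF k])
    show "(H \<cdot>\<^bsub>B\<^esub> I.d1 k) \<cdot>\<^bsub>B\<^esub> a = (b \<cdot>\<^bsub>B\<^esub> p) \<cdot>\<^bsub>B\<^esub> a"
      using L[OF dk(2)[symmetric]] K' X H(2) e p(2) by simp
    show "(H \<cdot>\<^bsub>B\<^esub> I.d1 k) \<cdot>\<^bsub>B\<^esub> b = (b \<cdot>\<^bsub>B\<^esub> p) \<cdot>\<^bsub>B\<^esub> b"
      using L[OF dk(4)[symmetric]] K' X H(3) I.sg_d(2)[of Z] p(3) by simp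
    have "(H \<cdot>\<^bsub>B\<^esub> I.d1 k) \<cdot>\<^bsub>B\<^esub> c = c \<cdot>\<^bsub>B\<^esub> (I.d1 X \<cdot>\<^bsub>B\<^esub> I.sg X)"
      using L[OF dk(6)[symmetric]] K' X H(4) I.hh_d(2)[OF X(1)] by simp
    also have "\<dots> = (b \<cdot>\<^bsub>B\<^esub> p) \<cdot>\<^bsub>B\<^esub> c"
      using B.comp_ext2[OF e(2), of "I.sg X"] p(4) X K' by simp
    finally show "(H \<cdot>\<^bsub>B\<^esub> I.d1 k) \<cdot>\<^bsub>B\<^esub> c = (b \<cdot>\<^bsub>B\<^esub> p) \<cdot>\<^bsub>B\<^esub> c" .
  qed (use n H' K' in \<open>auto simp: B_hom simp del: I.E_simps(7)\<close>)
  ultimately show "b \<in> W" "p \<in> W"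
    using homotopy_inverse_W[of b Z k p H] p K' H by (auto simp: B_hom)
qed

end

subsection \<open>Bisimplicial objects\<close>

context category begin

lemma dpo_iso:
  assumes "is_dpo C F G d0 d1 k a b c" "is_dpo C F G d0 d1 k' a' b' c'"
  obtains u where "u \<in> hom C k k'" "is_iso C u" "u \<cdot>\<^bsub>C\<^esub> a = a'" "u \<cdot>\<^bsub>C\<^esub> b = b'" "u \<cdot>\<^bsub>C\<^esub> c = c'"
proof -
  obtain u where u: "u \<in> hom C k k'" "is_iso C u" "\<And>j. j \<in> {0, 1, 2 :: nat} \<Longrightarrow>
     u \<cdot>\<^bsub>C\<^esub> (if j = 0 then a else if j = 1 then b else c) = (if j = 0 then a' else if j = 1 then b' else c')"
    using colim_iso[OF assms[unfolded is_dpo_def]] by blast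
  show thesis using that[of u] u(1,2) u(3)[of 0] u(3)[of 1] u(3)[of 2] by simp
qed

end

context closed_class begin

section \<open>Rows, columns and diagonals as restrictions\<close>

definition pr2 :: "(nat \<times> nat, simplex_map \<times> simplex_map, nat, simplex_map) fnctr" where
  "pr2 = \<lparr>FOb = snd, FAr = restrict snd (Arr D2)\<rparr>"
definition rowF :: "nat \<Rightarrow> (nat, simplex_map, nat \<times> nat, simplex_map \<times> simplex_map) fnctr" where
  "rowF n = \<lparr>FOb = (\<lambda>m. (n, m)), FAr = restrict (\<lambda>\<theta>. (Ident D n, \<theta>)) (Arr D)\<rparr>"
definition colF :: "nat \<Rightarrow> (nat, simplex_map, nat \<times> nat, simplex_map \<times> simplex_map) fnctr" where
  "colF n = \<lparr>FOb = (\<lambda>m. (m, n)), FAr = restrict (\<lambda>\<theta>. (\<theta>, Ident D n)) (Arr D)\<rparr>"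
definition diagF :: "(nat, simplex_map, nat \<times> nat, simplex_map \<times> simplex_map) fnctr" where
  "diagF = \<lparr>FOb = (\<lambda>n. (n, n)), FAr = restrict (\<lambda>\<theta>. (\<theta>, \<theta>)) (Arr D)\<rparr>"

lemma index_functors: "is_functor D2 D pr2" "is_functor D D2 (rowF n)" "is_functor D D2 (colF n)" "is_functor D D2 diagF"
  using I.A.Ident_arr[of n] by (auto simp: is_functor_def pr2_def rowF_def colF_def diagF_def hom_def PiE_iff extensional_def)

lemma index_simps [simp]: "FOb pr2 = snd" "\<theta> \<in> Arr D2 \<Longrightarrow> FAr pr2 \<theta> = snd \<theta>" "FOb (rowF n) x = (n, x)" "FOb (colF n) x = (x, n)"
  "FOb diagF x = (x, x)" "\<theta>' \<in> Arr D \<Longrightarrow> FAr (rowF n) \<theta>' = (Ident D n, \<theta>')" "\<theta>' \<in> Arr D \<Longrightarrow> FAr (colF n) \<theta>' = (\<theta>', Ident D n)"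
  "\<theta>' \<in> Arr D \<Longrightarrow> FAr diagF \<theta>' = (\<theta>', \<theta>')"
  by (simp_all add: pr2_def rowF_def colF_def diagF_def)

lemma bi_eq: "bi_row_map n F = res_map D (rowF n) F" "bi_col_map n F = res_map D (colF n) F" "bi_diag_map F = res_map D diagF F"
  by (auto simp: bi_row_map_def bi_col_map_def bi_diag_map_def bi_row_def bi_col_def bi_diag_def res_map_def res_ob_def
      restrict_def fun_eq_iff op_cat_simps(2,5) rowF_def colF_def diagF_def)

text \<open>A simplicial object regarded as constant in the first direction. Its tensor with the
  interval in that direction has, in bidegree \<open>(n, m)\<close>, one copy of
  \<open>FOb X m\<close> for each element of \<open>dS n\<close>: rows are copowers of
  \<open>X\<close>, columns are cylinders of constant objects, and the diagonal is the cylinder of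
  \<open>X\<close>.\<close>

abbreviation "bX \<equiv> res_ob D2 pr2 :: ('o, 'a) sobj \<Rightarrow> _"
abbreviation "bF \<equiv> res_map D2 pr2 :: ('o, 'a) smap \<Rightarrow> _"
abbreviation "B2 \<equiv> functor_cat D2 C"

sublocale R2: restriction D2 D C pr2
  by unfold_locales (rule index_functors)

lemma row_restriction: "restriction D D2 C (rowF n)"
  and col_restriction: "restriction D D2 C (colF n)"
  and diag_restriction: "restriction D D2 C diagF"
  by unfold_locales (rule index_functors)+

lemma res_bX [simp]:
  assumes "is_functor D C X"
  shows "res_ob D (rowF n) (bX X) = X" "res_ob D diagF (bX X) = X"
  using I.A.Ident_arr[of n] by (auto intro!: res_res_id[OF assms, where ?A2.0=D2])

lemma res_bF [simp]:
  assumes "is_ntrans D C f"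
  shows "res_map D (rowF n) (bF f) = f" "res_map D diagF (bF f) = f"
  by (intro ntrans.equality; simp add: assms fun_eq_iff)+

lemma bF_hom: "f \<in> hom B X Y \<Longrightarrow> bF f \<in> hom B2 (bX X) (bX Y)"
  by (auto simp: hom_def)

text \<open>Columns and the diagonal retain the first coordinate, on which the interval acts, and so
  take bisimplicial cylinders to cylinders. In rows that coordinate is frozen; they are described by
  \<open>rin\<close> instead.\<close>

lemma res_cyl:
  assumes P: "is_functor D D2 P" "\<And>x. fst (FOb P x) = x" "\<And>\<theta>. \<theta> \<in> Arr D \<Longrightarrow> fst (FAr P \<theta>) = \<theta>"
  shows "res_ob D P (I2.ten Y) = I.ten (res_ob D P Y)" "res_map D P (I2.d0 Y) = I.d0 (res_ob D P Y)"
    "res_map D P (I2.d1 Y) = I.d1 (res_ob D P Y)" "res_map D P (I2.sg Y) = I.sg (res_ob D P Y)"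
    "res_map D P (I2.tmap f) = I.tmap (res_map D P f)"
proof -
  interpret RR: restriction D D2 C P by unfold_locales (rule P)
  have t: "res_ob D P (I2.ten Y) = I.ten (res_ob D P Y)" for Y
  proof -
    have "res_ob D P (I2.ten Y) = gten D C (\<lambda>x. dS (fst (FOb P x))) (\<lambda>\<theta>. dact (fst (FAr P \<theta>))) (res_ob D P Y)"
      by (rule res_gten) (rule RR.P_simps; assumption)+
    also have "\<dots> = I.ten (res_ob D P Y)" by (rule gten_cong) (simp_all only: P)
    finally show ?thesis .
  qed
  show "res_ob D P (I2.ten Y) = I.ten (res_ob D P Y)" by (rule t)
  show "res_map D P (I2.d0 Y) = I.d0 (res_ob D P Y)" "res_map D P (I2.d1 Y) = I.d1 (res_ob D P Y)"
    "res_map D P (I2.tmap f) = I.tmap (res_map D P f)"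
    by (intro ntrans.equality; simp add: t P fun_eq_iff)+
  show "res_map D P (I2.sg Y) = I.sg (res_ob D P Y)"
    by (intro ntrans.equality; simp add: t P fun_eq_iff) (simp add: I2.sg_def I2.desc_def I.sg_def I.desc_def P)
qed

lemmas res_cyl_diag [simp] = res_cyl[OF index_functors(4), simplified]
lemmas res_cyl_col [simp] = res_cyl[OF index_functors(3), simplified]

text \<open>The inclusion of the copy of \<open>X\<close> with index \<open>\<sigma>\<close> into
  row \<open>n\<close> of the bisimplicial cylinder.\<close>

definition rin :: "nat \<Rightarrow> ('o, 'a) sobj \<Rightarrow> simplex_map \<Rightarrow> ('o, 'a) smap" where
  "rin n X \<sigma> = \<lparr>NSrc = X, NTgt = res_ob D (rowF n) (I2.ten (bX X)), NCmp = (\<lambda>m. copower_in C (dS n) (FOb X m) \<sigma>)\<rparr>"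

lemma rin_simps [simp]: "NSrc (rin n X \<sigma>) = X" "NTgt (rin n X \<sigma>) = res_ob D (rowF n) (I2.ten (bX X))"
  "NCmp (rin n X \<sigma>) m = copower_in C (dS n) (FOb X m) \<sigma>"
  by (simp_all add: rin_def)

lemma rin_ntrans:
  assumes X: "is_functor D C X" and s: "\<sigma> \<in> dS n" shows "is_ntrans D C (rin n X \<sigma>)"
proof -
  interpret R: restriction D D2 C "rowF n" by (rule row_restriction)
  note i = I.A.Ident_arr[OF I.obj_A, of n]
  have f: "is_functor D2 C (bX X)" using X by simp
  show ?thesis
  proof (rule I.is_ntransI)
    fix \<theta> assume th: "\<theta> \<in> Arr D"
    have m: "(Ident D n, \<theta>) \<in> Arr D2" using i(1) th by simp
    have b: "FAr (bX X) (Ident D n, \<theta>) = FAr X \<theta>" by (simp only: res_simps(5)[OF m] index_simps(2)[OF m] snd_conv)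
    have a: "dact (Ident D n) \<sigma> = \<sigma>" using I.act_id[OF s] .
    have "FAr (I2.ten (bX X)) (Ident D n, \<theta>) \<cdot>\<^bsub>C\<^esub> copower_in C (dS (fst (n, Dom D \<theta>))) (FOb (bX X) (n, Dom D \<theta>)) \<sigma>
      = copower_in C (dS (fst (Cod D2 (Ident D n, \<theta>)))) (FOb (bX X) (Cod D2 (Ident D n, \<theta>)))
          (dact (fst (Ident D n, \<theta>)) \<sigma>) \<cdot>\<^bsub>C\<^esub> FAr (bX X) (Ident D n, \<theta>)"
      by (rule I2.ten_arr(2)[OF f m]) (simp_all only: prod_cat_simps i s fst_conv)
    then have "FAr (I2.ten (bX X)) (Ident D n, \<theta>) \<cdot>\<^bsub>C\<^esub> copower_in C (dS n) (FOb X (Dom D \<theta>)) \<sigma>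
      = copower_in C (dS n) (FOb X (Cod D \<theta>)) \<sigma> \<cdot>\<^bsub>C\<^esub> FAr X \<theta>"
      by (simp only: prod_cat_simps i fst_conv snd_conv res_simps index_simps a b)
    then show "NCmp (rin n X \<sigma>) (Cod D \<theta>) \<cdot>\<^bsub>C\<^esub> FAr (NSrc (rin n X \<sigma>)) \<theta> = FAr (NTgt (rin n X \<sigma>)) \<theta> \<cdot>\<^bsub>C\<^esub> NCmp (rin n X \<sigma>) (Dom D \<theta>)"
      by (simp only: rin_simps res_simps index_simps th)
  qed (use X s in \<open>simp_all add: hom_def\<close>)
qed

lemma rin_family:
  assumes X: "is_functor D C X"
  shows "is_coprod_family B (dS n) (\<lambda>_. X) (res_ob D (rowF n) (I2.ten (bX X))) (rin n X)"
proof -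
  interpret R: restriction D D2 C "rowF n" by (rule row_restriction)
  have c: "is_colim C (dS n) (\<lambda>_. FOb X m) {} (copower_ob C (dS n) (FOb X m)) (copower_in C (dS n) (FOb X m))" for m
    using copower_is[of "dS n" "FOb X m"] X by (simp add: family_iff_colim)
  have "is_colim B (dS n) (\<lambda>_. X) {} (res_ob D (rowF n) (I2.ten (bX X))) (rin n X)"
  proof (rule I.colim_of_pointwise)
    show "is_colim C (dS n) (\<lambda>_. FOb X m) (at_rel m {}) (FOb (res_ob D (rowF n) (I2.ten (bX X))) m) (\<lambda>\<sigma>. NCmp (rin n X \<sigma>) m)" for m
      using c[of m] by simp
  qed (use X rin_ntrans[OF X] in \<open>auto simp: diagram_def hom_def\<close>)
  then show ?thesis by (simp only: B.family_iff_colim)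
qed

lemma rin_d: "is_functor D C X \<Longrightarrow> res_map D (rowF n) (I2.d0 (bX X)) = rin n X (de 0 n)"
  "is_functor D C X \<Longrightarrow> res_map D (rowF n) (I2.d1 (bX X)) = rin n X (de (Suc 0) n)"
  by (intro ntrans.equality; simp add: fun_eq_iff)+

lemma rin_tmap:
  assumes f: "is_ntrans D C f" and s: "\<sigma> \<in> dS n"
  shows "res_map D (rowF n) (I2.tmap (bF f)) \<cdot>\<^bsub>B\<^esub> rin n (NSrc f) \<sigma> = rin n (NTgt f) \<sigma> \<cdot>\<^bsub>B\<^esub> f"
  by (rule I.ntrans_eqI) (use f s in simp_all)

text \<open>Rows are the right direction here: in row \<open>n\<close> the induced map is a
  coproduct, over the elements of \<open>dS n\<close>, of one copy of \<open>y\<close>, one of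
  \<open>z\<close> and copies of \<open>x\<close>, so that \<open>family_W\<close> applies.\<close>

lemma K_W:
  assumes F: "F \<in> hom B X Y" and G: "G \<in> hom B X Z" and F': "F' \<in> hom B X' Y'" and G': "G' \<in> hom B X' Z'"
    and k: "is_dpo B F G (I.d0 X) (I.d1 X) k a b c" and k': "is_dpo B F' G' (I.d0 X') (I.d1 X') k' a' b' c'"
    and x: "x \<in> hom B X X'" "x \<in> W" and y: "y \<in> hom B Y Y'" "y \<in> W" and z: "z \<in> hom B Z Z'" "z \<in> W"
    and sq: "y \<cdot>\<^bsub>B\<^esub> F = F' \<cdot>\<^bsub>B\<^esub> x" "z \<cdot>\<^bsub>B\<^esub> G = G' \<cdot>\<^bsub>B\<^esub> x"
    and u: "u \<in> hom B k k'" "u \<cdot>\<^bsub>B\<^esub> a = a' \<cdot>\<^bsub>B\<^esub> y" "u \<cdot>\<^bsub>B\<^esub> b = b' \<cdot>\<^bsub>B\<^esub> z" "u \<cdot>\<^bsub>B\<^esub> c = c' \<cdot>\<^bsub>B\<^esub> I.tmap x"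
  shows "u \<in> W"
proof -
  interpret B2: category B2 by (rule I2.category_E)
  note h = F[unfolded B_hom] G[unfolded B_hom] F'[unfolded B_hom] G'[unfolded B_hom] x(1)[unfolded B_hom]
    y(1)[unfolded B_hom] z(1)[unfolded B_hom]
  have X: "is_functor D C X" "is_functor D C Y" "is_functor D C Z" "is_functor D C X'" "is_functor D C Y'" "is_functor D C Z'"
    using h by auto
  obtain \<kappa> \<alpha> \<beta> \<gamma> where K: "is_dpo B2 (bF F) (bF G) (I2.d0 (bX X)) (I2.d1 (bX X)) \<kappa> \<alpha> \<beta> \<gamma>"
    using I2.cyl_dpo_exists[OF bF_hom[OF F] bF_hom[OF G]] by blast
  obtain \<kappa>' \<alpha>' \<beta>' \<gamma>' where K': "is_dpo B2 (bF F') (bF G') (I2.d0 (bX X')) (I2.d1 (bX X')) \<kappa>' \<alpha>' \<beta>' \<gamma>'"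
    using I2.cyl_dpo_exists[OF bF_hom[OF F'] bF_hom[OF G']] by blast
  note D = is_dpoD[OF K] and D' = is_dpoD[OF K']
  have d: "is_ntrans D2 C \<alpha>" "NSrc \<alpha> = bX Y" "NTgt \<alpha> = \<kappa>" "is_ntrans D2 C \<beta>" "NSrc \<beta> = bX Z" "NTgt \<beta> = \<kappa>"
     "is_ntrans D2 C \<gamma>" "NSrc \<gamma> = I2.ten (bX X)" "NTgt \<gamma> = \<kappa>"
     "is_ntrans D2 C \<alpha>'" "NSrc \<alpha>' = bX Y'" "NTgt \<alpha>' = \<kappa>'" "is_ntrans D2 C \<beta>'" "NSrc \<beta>' = bX Z'" "NTgt \<beta>' = \<kappa>'"
     "is_ntrans D2 C \<gamma>'" "NSrc \<gamma>' = I2.ten (bX X')" "NTgt \<gamma>' = \<kappa>'" "is_functor D2 C \<kappa>" "is_functor D2 C \<kappa>'"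
    using D(8-11) D'(8-11) h by (auto simp: hom_def)
  have sq2: "bF y \<cdot>\<^bsub>B2\<^esub> bF F = bF F' \<cdot>\<^bsub>B2\<^esub> bF x" "bF z \<cdot>\<^bsub>B2\<^esub> bF G = bF G' \<cdot>\<^bsub>B2\<^esub> bF x"
    using sq by (simp_all add: R2.res_map_comp[symmetric])
  note td = I2.tmap_d[of "bF x"]
  \<comment> \<open>The bisimplicial counterpart of \<open>u\<close>, defined by the universal
    property before any restriction is taken.\<close>
  obtain \<upsilon> where v: "\<upsilon> \<in> hom B2 \<kappa> \<kappa>'" "\<upsilon> \<cdot>\<^bsub>B2\<^esub> \<alpha> = \<alpha>' \<cdot>\<^bsub>B2\<^esub> bF y" "\<upsilon> \<cdot>\<^bsub>B2\<^esub> \<beta> = \<beta>' \<cdot>\<^bsub>B2\<^esub> bF z"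
    "\<upsilon> \<cdot>\<^bsub>B2\<^esub> \<gamma> = \<gamma>' \<cdot>\<^bsub>B2\<^esub> I2.tmap (bF x)"
  proof (rule is_dpo_desc[OF K, of "\<alpha>' \<cdot>\<^bsub>B2\<^esub> bF y" \<kappa>' "\<beta>' \<cdot>\<^bsub>B2\<^esub> bF z" "\<gamma>' \<cdot>\<^bsub>B2\<^esub> I2.tmap (bF x)"])
    show "(\<alpha>' \<cdot>\<^bsub>B2\<^esub> bF y) \<cdot>\<^bsub>B2\<^esub> bF F = (\<gamma>' \<cdot>\<^bsub>B2\<^esub> I2.tmap (bF x)) \<cdot>\<^bsub>B2\<^esub> I2.d0 (bX X)"
      using B2.comp_ext2[OF D'(12), of "bF x"] h d X sq2 td by simp
    show "(\<beta>' \<cdot>\<^bsub>B2\<^esub> bF z) \<cdot>\<^bsub>B2\<^esub> bF G = (\<gamma>' \<cdot>\<^bsub>B2\<^esub> I2.tmap (bF x)) \<cdot>\<^bsub>B2\<^esub> I2.d1 (bX X)"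
      using B2.comp_ext2[OF D'(13), of "bF x"] h d X sq2 td by simp
  qed (use h d X in \<open>auto simp: hom_def intro!: I2.ntrans_comp simp del: I2.E_simps(7)\<close>)
  note hv = homD[OF v(1), simplified]
  have row: "res_map D (rowF n) \<upsilon> \<in> W" for n
  proof -
    interpret R: restriction D D2 C "rowF n" by (rule row_restriction)
    let ?r = "res_map D (rowF n)"
    have k1: "is_dpo B F G (rin n X (de 0 n)) (rin n X (de (Suc 0) n)) (res_ob D (rowF n) \<kappa>) (?r \<alpha>) (?r \<beta>) (?r \<gamma>)"
      using res_dpo[OF I.fcop_axioms I2.fcop_axioms index_functors(2)[of n] K _ I2.cyl_dpo_pointwise[OF K]] h X
      by (simp add: rin_d)
    have k2: "is_dpo B F' G' (rin n X' (de 0 n)) (rin n X' (de (Suc 0) n)) (res_ob D (rowF n) \<kappa>') (?r \<alpha>') (?r \<beta>') (?r \<gamma>')"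
      using res_dpo[OF I.fcop_axioms I2.fcop_axioms index_functors(2)[of n] K' _ I2.cyl_dpo_pointwise[OF K']] h X
      by (simp add: rin_d)
    \<comment> \<open>The two constant simplices index the summands at which \<open>Y\<close> and
      \<open>Z\<close> are glued in; every other summand is still a copy of
      \<open>X\<close>.\<close>
    let ?w = "\<lambda>\<sigma>. if \<sigma> = de 0 n then y else if \<sigma> = de (Suc 0) n then z else x"
    note fam = B.family_of_dpo[OF rin_family[OF X(1)] I.e_in I.e_neq F G k1]
      B.family_of_dpo[OF rin_family[OF X(4)] I.e_in I.e_neq F' G' k2]
    show ?thesis
    proof (rule B.family_W[OF I.S_fin fam, where w="?w"])
      show "?w \<sigma> \<in> W" "?w \<sigma> \<in> hom B (if \<sigma> = de 0 n then Y else if \<sigma> = de (Suc 0) n then Z else X)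
         (if \<sigma> = de 0 n then Y' else if \<sigma> = de (Suc 0) n then Z' else X')" for \<sigma>
        using x y z by auto
      show "?r \<upsilon> \<in> hom B (res_ob D (rowF n) \<kappa>) (res_ob D (rowF n) \<kappa>')" using hv by (auto simp: B_hom)
      fix \<sigma> assume s: "\<sigma> \<in> dS n"
      have r: "?r \<upsilon> \<cdot>\<^bsub>B\<^esub> ?r \<alpha> = ?r \<alpha>' \<cdot>\<^bsub>B\<^esub> y" "?r \<upsilon> \<cdot>\<^bsub>B\<^esub> ?r \<beta> = ?r \<beta>' \<cdot>\<^bsub>B\<^esub> z"
        "?r \<upsilon> \<cdot>\<^bsub>B\<^esub> ?r \<gamma> = ?r \<gamma>' \<cdot>\<^bsub>B\<^esub> ?r (I2.tmap (bF x))"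
        using arg_cong[OF v(2), of ?r] arg_cong[OF v(3), of ?r] arg_cong[OF v(4), of ?r] h
        by (simp_all add: R.res_map_comp)
      have "?r \<upsilon> \<cdot>\<^bsub>B\<^esub> (?r \<gamma> \<cdot>\<^bsub>B\<^esub> rin n X \<sigma>) = ?r \<gamma>' \<cdot>\<^bsub>B\<^esub> (?r (I2.tmap (bF x)) \<cdot>\<^bsub>B\<^esub> rin n X \<sigma>)"
        using B.comp_ext2[OF r(3), of "rin n X \<sigma>"] rin_ntrans[OF X(1) s] hv d h by simp
      also have "\<dots> = (?r \<gamma>' \<cdot>\<^bsub>B\<^esub> rin n X' \<sigma>) \<cdot>\<^bsub>B\<^esub> x"
        using rin_tmap[of x \<sigma> n] rin_ntrans[OF X(4) s] s d h by simp
      finally show "?r \<upsilon> \<cdot>\<^bsub>B\<^esub> (if \<sigma> = de 0 n then ?r \<alpha> else if \<sigma> = de (Suc 0) n then ?r \<beta> else ?r \<gamma> \<cdot>\<^bsub>B\<^esub> rin n X \<sigma>)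
         = (if \<sigma> = de 0 n then ?r \<alpha>' else if \<sigma> = de (Suc 0) n then ?r \<beta>' else ?r \<gamma>' \<cdot>\<^bsub>B\<^esub> rin n X' \<sigma>) \<cdot>\<^bsub>B\<^esub> ?w \<sigma>"
        using r by simp
    qed
  qed
  interpret R: restriction D D2 C diagF by (rule diag_restriction)
  let ?d = "res_map D diagF"
  have dW: "?d \<upsilon> \<in> W"
    using closed'(5)[of \<upsilon>] hv row by (auto simp: bi_eq)
  have k1: "is_dpo B F G (I.d0 X) (I.d1 X) (res_ob D diagF \<kappa>) (?d \<alpha>) (?d \<beta>) (?d \<gamma>)"
    using res_dpo[OF I.fcop_axioms I2.fcop_axioms index_functors(4) K _ I2.cyl_dpo_pointwise[OF K]] h X by simp
  have k2: "is_dpo B F' G' (I.d0 X') (I.d1 X') (res_ob D diagF \<kappa>') (?d \<alpha>') (?d \<beta>') (?d \<gamma>')"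
    using res_dpo[OF I.fcop_axioms I2.fcop_axioms index_functors(4) K' _ I2.cyl_dpo_pointwise[OF K']] h X by simp
  \<comment> \<open>The diagonals of the bisimplicial gluings are gluings of the original data,
    hence isomorphic to \<open>k\<close> and \<open>k'\<close>. Under these isomorphisms the
    diagonal of \<open>\<upsilon>\<close> becomes \<open>u\<close>.\<close>
  obtain \<phi> where p: "\<phi> \<in> hom B (res_ob D diagF \<kappa>) k" "is_iso B \<phi>" "\<phi> \<cdot>\<^bsub>B\<^esub> ?d \<alpha> = a" "\<phi> \<cdot>\<^bsub>B\<^esub> ?d \<beta> = b" "\<phi> \<cdot>\<^bsub>B\<^esub> ?d \<gamma> = c"
    using B.dpo_iso[OF k1 k] .
  obtain \<psi> where q: "\<psi> \<in> hom B (res_ob D diagF \<kappa>') k'" "is_iso B \<psi>" "\<psi> \<cdot>\<^bsub>B\<^esub> ?d \<alpha>' = a'" "\<psi> \<cdot>\<^bsub>B\<^esub> ?d \<beta>' = b'" "\<psi> \<cdot>\<^bsub>B\<^esub> ?d \<gamma>' = c'"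
    using B.dpo_iso[OF k2 k'] .
  have r: "?d \<upsilon> \<cdot>\<^bsub>B\<^esub> ?d \<alpha> = ?d \<alpha>' \<cdot>\<^bsub>B\<^esub> y" "?d \<upsilon> \<cdot>\<^bsub>B\<^esub> ?d \<beta> = ?d \<beta>' \<cdot>\<^bsub>B\<^esub> z"
    "?d \<upsilon> \<cdot>\<^bsub>B\<^esub> ?d \<gamma> = ?d \<gamma>' \<cdot>\<^bsub>B\<^esub> I.tmap x"
    using arg_cong[OF v(2), of ?d] arg_cong[OF v(3), of ?d] arg_cong[OF v(4), of ?d] h
    by (simp_all add: R.res_map_comp)
  note pq = p(1)[unfolded B_hom] q(1)[unfolded B_hom] u(1)[unfolded B_hom]
  have "u \<cdot>\<^bsub>B\<^esub> \<phi> = \<psi> \<cdot>\<^bsub>B\<^esub> ?d \<upsilon>"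
  proof (rule B.dpo_eqI[OF k1])
    show "u \<cdot>\<^bsub>B\<^esub> \<phi> \<in> hom B (res_ob D diagF \<kappa>) k'" "\<psi> \<cdot>\<^bsub>B\<^esub> ?d \<upsilon> \<in> hom B (res_ob D diagF \<kappa>) k'"
      using pq hv by (auto simp: B_hom intro!: I.ntrans_comp simp del: I.E_simps(7))
    show "(u \<cdot>\<^bsub>B\<^esub> \<phi>) \<cdot>\<^bsub>B\<^esub> ?d \<alpha> = (\<psi> \<cdot>\<^bsub>B\<^esub> ?d \<upsilon>) \<cdot>\<^bsub>B\<^esub> ?d \<alpha>"
      using pq hv d h p(3) r(1) u(2) B.comp_ext[OF q(3), of y] X by simp
    show "(u \<cdot>\<^bsub>B\<^esub> \<phi>) \<cdot>\<^bsub>B\<^esub> ?d \<beta> = (\<psi> \<cdot>\<^bsub>B\<^esub> ?d \<upsilon>) \<cdot>\<^bsub>B\<^esub> ?d \<beta>"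
      using pq hv d h p(4) r(2) u(3) B.comp_ext[OF q(4), of z] X by simp
    show "(u \<cdot>\<^bsub>B\<^esub> \<phi>) \<cdot>\<^bsub>B\<^esub> ?d \<gamma> = (\<psi> \<cdot>\<^bsub>B\<^esub> ?d \<upsilon>) \<cdot>\<^bsub>B\<^esub> ?d \<gamma>"
      using pq hv d h p(5) r(3) u(4) B.comp_ext[OF q(5), of "I.tmap x"] X by simp
  qed
  moreover have "\<psi> \<cdot>\<^bsub>B\<^esub> ?d \<upsilon> \<in> W" by (rule B.W_comp[OF dW B.W_iso[OF q(2)]]) (use pq hv in simp)
  ultimately have "u \<cdot>\<^bsub>B\<^esub> \<phi> \<in> W" by simp
  from B.W_cancel_right[OF B.W_iso[OF p(2)] this] show ?thesis using pq by simp
qed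

end

lemma is_dpo_ex:
  assumes "is_dpo C F G d0 d1 k a b c" "y \<in> hom C (Cod C F) t" "z \<in> hom C (Cod C G) t" "h \<in> hom C (Cod C d0) t"
    "t \<in> Obj C" "y \<cdot>\<^bsub>C\<^esub> F = h \<cdot>\<^bsub>C\<^esub> d0" "z \<cdot>\<^bsub>C\<^esub> G = h \<cdot>\<^bsub>C\<^esub> d1"
  shows "\<exists>u. u \<in> hom C k t \<and> u \<cdot>\<^bsub>C\<^esub> a = y \<and> u \<cdot>\<^bsub>C\<^esub> b = z \<and> u \<cdot>\<^bsub>C\<^esub> c = h"
  using is_dpo_desc[OF assms] by blast

lemma is_coprod_ex:
  assumes "is_coprod C x y p i j" "f \<in> hom C x t" "g \<in> hom C y t" "t \<in> Obj C"
  shows "\<exists>u. u \<in> hom C p t \<and> u \<cdot>\<^bsub>C\<^esub> i = f \<and> u \<cdot>\<^bsub>C\<^esub> j = g"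
  using is_coprod_desc[OF assms] by blast

section \<open>Double mapping cylinders along split coprojections\<close>

context closed_class begin

text \<open>When \<open>i\<close> splits as a simplicial map with complement \<open>A\<close>, the
  double mapping cylinder is the mapping cylinder of \<open>g\<close> plus \<open>A\<close>, and the
  pushout is \<open>Z\<close> plus \<open>A\<close>. The comparison is then the coproduct of a
  mapping cylinder projection with an identity.\<close>

lemma K_coprod_W:
  assumes i: "is_coprod B X A Y i j" and g: "g \<in> hom B X Z" and P: "is_pushout B i g P p q"
    and k: "is_dpo B i g (I.d0 X) (I.d1 X) k a b c"
    and r: "\<rho> \<in> hom B k P" "\<rho> \<cdot>\<^bsub>B\<^esub> a = p" "\<rho> \<cdot>\<^bsub>B\<^esub> b = q" "\<rho> \<cdot>\<^bsub>B\<^esub> c = (q \<cdot>\<^bsub>B\<^esub> g) \<cdot>\<^bsub>B\<^esub> I.sg X"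
  shows "\<rho> \<in> W"
proof -
  note I' = is_coprodD[OF i] and P' = is_pushoutD[OF P] and K = is_dpoD[OF k]
  have X: "is_functor D C X" "is_functor D C A" "is_functor D C Y" "is_functor D C Z" "is_functor D C P" "is_functor D C k"
    using I' B.hom_obj(2)[OF g] P' K by auto
  have h: "is_ntrans D C i" "NSrc i = X" "NTgt i = Y" "is_ntrans D C j" "NSrc j = A" "NTgt j = Y"
    "is_ntrans D C g" "NSrc g = X" "NTgt g = Z" "is_ntrans D C p" "NSrc p = Y" "NTgt p = P" "is_ntrans D C q" "NSrc q = Z" "NTgt q = P"
    "is_ntrans D C a" "NSrc a = Y" "NTgt a = k" "is_ntrans D C b" "NSrc b = Z" "NTgt b = k"
    "is_ntrans D C c" "NSrc c = I.ten X" "NTgt c = k" "is_ntrans D C \<rho>" "NSrc \<rho> = k" "NTgt \<rho> = P"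
    using I' P' K g r(1) by (auto simp: B_hom)
  have Id: "Ident B X \<in> hom B X X" using X by (simp add: B_hom)
  obtain k1 a1 b1 c1 where k1: "is_dpo B (Ident B X) g (I.d0 X) (I.d1 X) k1 a1 b1 c1"
    using I.cyl_dpo_exists[OF Id g] by blast
  note K1 = is_dpoD[OF k1]
  have h1: "is_ntrans D C a1" "NSrc a1 = X" "NTgt a1 = k1" "is_ntrans D C b1" "NSrc b1 = Z" "NTgt b1 = k1"
    "is_ntrans D C c1" "NSrc c1 = I.ten X" "NTgt c1 = k1" "is_functor D C k1"
    using K1 h by (auto simp: B_hom)
  have e1: "c1 \<cdot>\<^bsub>B\<^esub> I.d0 X = a1" "c1 \<cdot>\<^bsub>B\<^esub> I.d1 X = b1 \<cdot>\<^bsub>B\<^esub> g" using K1(12,13) h1 X B.comp_Ident[of a1 X] by auto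
  have e: "a \<cdot>\<^bsub>B\<^esub> i = c \<cdot>\<^bsub>B\<^esub> I.d0 X" "b \<cdot>\<^bsub>B\<^esub> g = c \<cdot>\<^bsub>B\<^esub> I.d1 X" by (rule K(12,13))+
  have "\<exists>\<pi>. \<pi> \<in> hom B k1 Z \<and> \<pi> \<cdot>\<^bsub>B\<^esub> a1 = g \<and> \<pi> \<cdot>\<^bsub>B\<^esub> b1 = Ident B Z \<and> \<pi> \<cdot>\<^bsub>B\<^esub> c1 = g \<cdot>\<^bsub>B\<^esub> I.sg X"
  proof (rule is_dpo_ex[OF k1, of g Z "Ident B Z" "g \<cdot>\<^bsub>B\<^esub> I.sg X"])
    show "g \<cdot>\<^bsub>B\<^esub> Ident B X = (g \<cdot>\<^bsub>B\<^esub> I.sg X) \<cdot>\<^bsub>B\<^esub> I.d0 X" "Ident B Z \<cdot>\<^bsub>B\<^esub> g = (g \<cdot>\<^bsub>B\<^esub> I.sg X) \<cdot>\<^bsub>B\<^esub> I.d1 X"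
      using h X I.sg_d[OF X(1)] by simp_all
  qed (simp_all add: B_hom h X I.ntrans_comp del: I.E_simps(7))
  then obtain \<pi> where p: "\<pi> \<in> hom B k1 Z" "\<pi> \<cdot>\<^bsub>B\<^esub> a1 = g" "\<pi> \<cdot>\<^bsub>B\<^esub> b1 = Ident B Z" "\<pi> \<cdot>\<^bsub>B\<^esub> c1 = g \<cdot>\<^bsub>B\<^esub> I.sg X"
    by blast
  have pW: "\<pi> \<in> W" by (rule mapping_cylinder_W[OF g k1 p])
  have "\<exists>\<kappa>. \<kappa> \<in> hom B k1 k \<and> \<kappa> \<cdot>\<^bsub>B\<^esub> a1 = a \<cdot>\<^bsub>B\<^esub> i \<and> \<kappa> \<cdot>\<^bsub>B\<^esub> b1 = b \<and> \<kappa> \<cdot>\<^bsub>B\<^esub> c1 = c"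
    by (rule is_dpo_ex[OF k1, of "a \<cdot>\<^bsub>B\<^esub> i" k b c]) (simp_all add: B_hom h X e I.ntrans_comp del: I.E_simps(7))
  then obtain \<kappa> where ka: "\<kappa> \<in> hom B k1 k" "\<kappa> \<cdot>\<^bsub>B\<^esub> a1 = a \<cdot>\<^bsub>B\<^esub> i" "\<kappa> \<cdot>\<^bsub>B\<^esub> b1 = b" "\<kappa> \<cdot>\<^bsub>B\<^esub> c1 = c" by blast
  note hp = p(1)[unfolded B_hom] ka(1)[unfolded B_hom]
  \<comment> \<open>A map out of \<open>k\<close> restricts to \<open>Y\<close>, hence to
    \<open>X\<close> and to \<open>A\<close>; the part on \<open>X\<close> is already recorded by
    the mapping cylinder \<open>k1\<close>. Conversely, maps on \<open>k1\<close> and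
    \<open>A\<close> determine one on \<open>Y\<close> and so one on \<open>k\<close>.\<close>
  have cop: "is_coprod B k1 A k \<kappa> (a \<cdot>\<^bsub>B\<^esub> j)"
  proof (rule B.coprodI)
    show "\<exists>u. u \<in> hom B k T \<and> u \<cdot>\<^bsub>B\<^esub> \<kappa> = f \<and> u \<cdot>\<^bsub>B\<^esub> (a \<cdot>\<^bsub>B\<^esub> j) = l"
      if T: "T \<in> Obj B" and f: "f \<in> hom B k1 T" and l: "l \<in> hom B A T" for T f l
    proof -
      note hf = f[unfolded B_hom] l[unfolded B_hom]
      have "\<exists>y. y \<in> hom B Y T \<and> y \<cdot>\<^bsub>B\<^esub> i = f \<cdot>\<^bsub>B\<^esub> a1 \<and> y \<cdot>\<^bsub>B\<^esub> j = l"
        by (rule is_coprod_ex[OF i _ l T]) (simp add: B_hom hf h1 X I.ntrans_comp del: I.E_simps(7))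
      then obtain y where y: "y \<in> hom B Y T" "y \<cdot>\<^bsub>B\<^esub> i = f \<cdot>\<^bsub>B\<^esub> a1" "y \<cdot>\<^bsub>B\<^esub> j = l" by blast
      note hy = y(1)[unfolded B_hom]
      have cc1: "y \<cdot>\<^bsub>B\<^esub> i = (f \<cdot>\<^bsub>B\<^esub> c1) \<cdot>\<^bsub>B\<^esub> I.d0 X" "(f \<cdot>\<^bsub>B\<^esub> b1) \<cdot>\<^bsub>B\<^esub> g = (f \<cdot>\<^bsub>B\<^esub> c1) \<cdot>\<^bsub>B\<^esub> I.d1 X"
        using y(2) hf h1 h X e1 by simp_all
      have "\<exists>u. u \<in> hom B k T \<and> u \<cdot>\<^bsub>B\<^esub> a = y \<and> u \<cdot>\<^bsub>B\<^esub> b = f \<cdot>\<^bsub>B\<^esub> b1 \<and> u \<cdot>\<^bsub>B\<^esub> c = f \<cdot>\<^bsub>B\<^esub> c1"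
        by (rule is_dpo_ex[OF k _ _ _ T cc1]) (simp_all add: B_hom hf h h1 X hy I.ntrans_comp del: I.E_simps(7))
      then obtain u where u: "u \<in> hom B k T" "u \<cdot>\<^bsub>B\<^esub> a = y" "u \<cdot>\<^bsub>B\<^esub> b = f \<cdot>\<^bsub>B\<^esub> b1" "u \<cdot>\<^bsub>B\<^esub> c = f \<cdot>\<^bsub>B\<^esub> c1"
        by blast
      note hu = u(1)[unfolded B_hom]
      have "u \<cdot>\<^bsub>B\<^esub> \<kappa> = f"
      proof (rule B.dpo_eqI[OF k1 _ f])
        show "u \<cdot>\<^bsub>B\<^esub> \<kappa> \<in> hom B k1 T" by (simp_all add: B_hom hu hp I.ntrans_comp del: I.E_simps(7))
        show "(u \<cdot>\<^bsub>B\<^esub> \<kappa>) \<cdot>\<^bsub>B\<^esub> a1 = f \<cdot>\<^bsub>B\<^esub> a1" using hu hp h1 h ka(2) B.comp_ext[OF u(2), of i] y(2) by simp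
        show "(u \<cdot>\<^bsub>B\<^esub> \<kappa>) \<cdot>\<^bsub>B\<^esub> b1 = f \<cdot>\<^bsub>B\<^esub> b1" "(u \<cdot>\<^bsub>B\<^esub> \<kappa>) \<cdot>\<^bsub>B\<^esub> c1 = f \<cdot>\<^bsub>B\<^esub> c1"
          using hu hp h1 h ka u by simp_all
      qed
      moreover have "u \<cdot>\<^bsub>B\<^esub> (a \<cdot>\<^bsub>B\<^esub> j) = l" by (simp add: B.comp_ext[OF u(2)] hu h y(3))
      ultimately show ?thesis using u by blast
    qed
    show "u = v" if u: "u \<in> hom B k T" and v: "v \<in> hom B k T" and e1: "u \<cdot>\<^bsub>B\<^esub> \<kappa> = v \<cdot>\<^bsub>B\<^esub> \<kappa>"
      and e2: "u \<cdot>\<^bsub>B\<^esub> (a \<cdot>\<^bsub>B\<^esub> j) = v \<cdot>\<^bsub>B\<^esub> (a \<cdot>\<^bsub>B\<^esub> j)" for T u v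
    proof -
      note hu = u[unfolded B_hom] v[unfolded B_hom]
      have e4: "(u \<cdot>\<^bsub>B\<^esub> \<kappa>) \<cdot>\<^bsub>B\<^esub> a1 = (v \<cdot>\<^bsub>B\<^esub> \<kappa>) \<cdot>\<^bsub>B\<^esub> a1" "(u \<cdot>\<^bsub>B\<^esub> \<kappa>) \<cdot>\<^bsub>B\<^esub> b1 = (v \<cdot>\<^bsub>B\<^esub> \<kappa>) \<cdot>\<^bsub>B\<^esub> b1" "(u \<cdot>\<^bsub>B\<^esub> \<kappa>) \<cdot>\<^bsub>B\<^esub> c1 = (v \<cdot>\<^bsub>B\<^esub> \<kappa>) \<cdot>\<^bsub>B\<^esub> c1"
        by (simp_all only: e1)
      have e3: "u \<cdot>\<^bsub>B\<^esub> (a \<cdot>\<^bsub>B\<^esub> i) = v \<cdot>\<^bsub>B\<^esub> (a \<cdot>\<^bsub>B\<^esub> i)" "u \<cdot>\<^bsub>B\<^esub> b = v \<cdot>\<^bsub>B\<^esub> b" "u \<cdot>\<^bsub>B\<^esub> c = v \<cdot>\<^bsub>B\<^esub> c"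
        using e4 by (simp_all add: hu hp h1 h ka)
      show ?thesis
      proof (rule B.dpo_eqI[OF k u v _ e3(2,3)])
        show "u \<cdot>\<^bsub>B\<^esub> a = v \<cdot>\<^bsub>B\<^esub> a"
        proof (rule B.coprod_eqI[OF i])
          show "u \<cdot>\<^bsub>B\<^esub> a \<in> hom B Y T" "v \<cdot>\<^bsub>B\<^esub> a \<in> hom B Y T"
            by (simp_all add: B_hom hu h I.ntrans_comp del: I.E_simps(7))
        qed (simp_all add: e2 e3 hu h)
      qed
    qed
  qed (simp_all add: B_hom h X h1 hp I.ntrans_comp del: I.E_simps(7))
  have "is_coprod B Z A P q (p \<cdot>\<^bsub>B\<^esub> j)" using B.coprod_of_pushout[OF i P] h by simp
  then show ?thesis
  proof (rule B.coprod_W[OF cop _ pW p(1)])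
    show "Ident B A \<in> W" "Ident B A \<in> hom B A A" using X by (auto simp: B_hom intro!: B.W_Ident)
    show "\<rho> \<in> hom B k P" by (rule r)
    show "\<rho> \<cdot>\<^bsub>B\<^esub> \<kappa> = q \<cdot>\<^bsub>B\<^esub> \<pi>"
    proof (rule B.dpo_eqI[OF k1])
      show "\<rho> \<cdot>\<^bsub>B\<^esub> \<kappa> \<in> hom B k1 P" "q \<cdot>\<^bsub>B\<^esub> \<pi> \<in> hom B k1 P"
        by (simp_all add: B_hom h hp I.ntrans_comp del: I.E_simps(7))
      show "(\<rho> \<cdot>\<^bsub>B\<^esub> \<kappa>) \<cdot>\<^bsub>B\<^esub> a1 = (q \<cdot>\<^bsub>B\<^esub> \<pi>) \<cdot>\<^bsub>B\<^esub> a1"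
        by (simp add: h hp h1 ka(2) p(2) B.comp_ext[OF r(2)] P'(7))
      show "(\<rho> \<cdot>\<^bsub>B\<^esub> \<kappa>) \<cdot>\<^bsub>B\<^esub> b1 = (q \<cdot>\<^bsub>B\<^esub> \<pi>) \<cdot>\<^bsub>B\<^esub> b1" "(\<rho> \<cdot>\<^bsub>B\<^esub> \<kappa>) \<cdot>\<^bsub>B\<^esub> c1 = (q \<cdot>\<^bsub>B\<^esub> \<pi>) \<cdot>\<^bsub>B\<^esub> c1"
        by (simp_all add: h hp h1 ka(3,4) p(3,4) r(3,4) X)
    qed
    show "\<rho> \<cdot>\<^bsub>B\<^esub> (a \<cdot>\<^bsub>B\<^esub> j) = (p \<cdot>\<^bsub>B\<^esub> j) \<cdot>\<^bsub>B\<^esub> Ident B A"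
      by (simp add: B.comp_ext[OF r(2)] h X I.ntrans_comp del: I.E_simps(7))
  qed
qed

end

section \<open>Termwise coprojections\<close>

text \<open>
  What the comparison of triangles needs to know about simplicial objects: a Brown category with a
  functorial cylinder \<^term>\<open>T\<close> whose end \<^term>\<open>e1\<close> is a deformation retract, such that the double
  mapping cylinders are homotopy invariant and compute pushouts along cofibrations.
\<close>

locale brown_cylinder = weq B W for B :: "('p, 'b) cat" and W :: "'b set" +
  fixes Cof :: "'b set" and T :: "'p \<Rightarrow> 'p" and tm :: "'b \<Rightarrow> 'b" and e0 e1 sg hh :: "'p \<Rightarrow> 'b"
  assumes brown: "brown_cofibrant_category B W Cof"
    and T_obj: "X \<in> Obj B \<Longrightarrow> T X \<in> Obj B"
    and e_hom: "X \<in> Obj B \<Longrightarrow> e0 X \<in> hom B X (T X)" "X \<in> Obj B \<Longrightarrow> e1 X \<in> hom B X (T X)"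
    and sg_hom: "X \<in> Obj B \<Longrightarrow> sg X \<in> hom B (T X) X"
    and hh_hom: "X \<in> Obj B \<Longrightarrow> hh X \<in> hom B (T (T X)) (T X)"
    and tm_hom: "f \<in> hom B X Y \<Longrightarrow> tm f \<in> hom B (T X) (T Y)"
    and sg_e: "X \<in> Obj B \<Longrightarrow> sg X \<cdot>\<^bsub>B\<^esub> e0 X = Ident B X" "X \<in> Obj B \<Longrightarrow> sg X \<cdot>\<^bsub>B\<^esub> e1 X = Ident B X"
    and hh_e: "X \<in> Obj B \<Longrightarrow> hh X \<cdot>\<^bsub>B\<^esub> e0 (T X) = Ident B (T X)" "X \<in> Obj B \<Longrightarrow> hh X \<cdot>\<^bsub>B\<^esub> e1 (T X) = e1 X \<cdot>\<^bsub>B\<^esub> sg X"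
      "X \<in> Obj B \<Longrightarrow> hh X \<cdot>\<^bsub>B\<^esub> tm (e0 X) = Ident B (T X)" "X \<in> Obj B \<Longrightarrow> hh X \<cdot>\<^bsub>B\<^esub> tm (e1 X) = e1 X \<cdot>\<^bsub>B\<^esub> sg X"
    and tm_e: "f \<in> hom B X Y \<Longrightarrow> tm f \<cdot>\<^bsub>B\<^esub> e0 X = e0 Y \<cdot>\<^bsub>B\<^esub> f" "f \<in> hom B X Y \<Longrightarrow> tm f \<cdot>\<^bsub>B\<^esub> e1 X = e1 Y \<cdot>\<^bsub>B\<^esub> f"
    and tm_sg: "f \<in> hom B X Y \<Longrightarrow> sg Y \<cdot>\<^bsub>B\<^esub> tm f = f \<cdot>\<^bsub>B\<^esub> sg X"
    and tm_comp: "f \<in> hom B X Y \<Longrightarrow> g \<in> hom B Y Z \<Longrightarrow> tm (g \<cdot>\<^bsub>B\<^esub> f) = tm g \<cdot>\<^bsub>B\<^esub> tm f"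
    and tm_Ident: "X \<in> Obj B \<Longrightarrow> tm (Ident B X) = Ident B (T X)"
    and cyl_cof: "X \<in> Obj B \<Longrightarrow> cotuple B (e0 X) (e1 X) \<in> Cof"
    and sg_W: "X \<in> Obj B \<Longrightarrow> sg X \<in> W"
    and dpo_W: "F \<in> hom B X Y \<Longrightarrow> G \<in> hom B X Z \<Longrightarrow> F' \<in> hom B X' Y' \<Longrightarrow> G' \<in> hom B X' Z' \<Longrightarrow>
      is_dpo B F G (e0 X) (e1 X) k a b c \<Longrightarrow> is_dpo B F' G' (e0 X') (e1 X') k' a' b' c' \<Longrightarrow>
      x \<in> hom B X X' \<Longrightarrow> x \<in> W \<Longrightarrow> y \<in> hom B Y Y' \<Longrightarrow> y \<in> W \<Longrightarrow> z \<in> hom B Z Z' \<Longrightarrow> z \<in> W \<Longrightarrow>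
      y \<cdot>\<^bsub>B\<^esub> F = F' \<cdot>\<^bsub>B\<^esub> x \<Longrightarrow> z \<cdot>\<^bsub>B\<^esub> G = G' \<cdot>\<^bsub>B\<^esub> x \<Longrightarrow>
      u \<in> hom B k k' \<Longrightarrow> u \<cdot>\<^bsub>B\<^esub> a = a' \<cdot>\<^bsub>B\<^esub> y \<Longrightarrow> u \<cdot>\<^bsub>B\<^esub> b = b' \<cdot>\<^bsub>B\<^esub> z \<Longrightarrow> u \<cdot>\<^bsub>B\<^esub> c = c' \<cdot>\<^bsub>B\<^esub> tm x \<Longrightarrow> u \<in> W"
    and dpo_cof_W: "i \<in> hom B X Y \<Longrightarrow> i \<in> Cof \<Longrightarrow> G \<in> hom B X Z \<Longrightarrow> is_pushout B i G P p q \<Longrightarrow>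
      is_dpo B i G (e0 X) (e1 X) k a b c \<Longrightarrow>
      u \<in> hom B k P \<Longrightarrow> u \<cdot>\<^bsub>B\<^esub> a = p \<Longrightarrow> u \<cdot>\<^bsub>B\<^esub> b = q \<Longrightarrow> u \<cdot>\<^bsub>B\<^esub> c = (q \<cdot>\<^bsub>B\<^esub> G) \<cdot>\<^bsub>B\<^esub> sg X \<Longrightarrow> u \<in> W"

context coprods begin

text \<open>\<open>termwise_coprojections\<close> speaks of a chosen coproduct and an isomorphism
  onto it, whereas the closure properties are proved for the choice-free
  \<open>coprojection\<close>.\<close>

lemma coprojection_iff_chosen:
  assumes "f \<in> hom C x y"
  shows "coprojection C f \<longleftrightarrow> (\<exists>a\<in>Obj C. \<exists>\<phi>\<in>hom C y (coprod_ob C x a). is_iso C \<phi> \<and> \<phi> \<cdot>\<^bsub>C\<^esub> f = in1 C x a)"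
proof
  note f = homD[OF assms]
  assume "coprojection C f"
  then obtain a j where p: "is_coprod C x a y f j" using f by (auto simp: coprojection_def)
  note P = is_coprodD[OF p]
  obtain \<phi> where u: "\<phi> \<in> hom C y (coprod_ob C x a)" "is_iso C \<phi>"
    "\<And>b. b \<in> UNIV \<Longrightarrow> \<phi> \<cdot>\<^bsub>C\<^esub> case_bool f j b = case_bool (in1 C x a) (in2 C x a) b"
    using colim_iso[OF p[unfolded coprod_iff_colim] coprod_is[OF P(1,2), unfolded coprod_iff_colim]] by blast
  then show "\<exists>a\<in>Obj C. \<exists>\<phi>\<in>hom C y (coprod_ob C x a). is_iso C \<phi> \<and> \<phi> \<cdot>\<^bsub>C\<^esub> f = in1 C x a"
    using P(2) u(3)[of True] by auto
next
  note f = homD[OF assms]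
  assume "\<exists>a\<in>Obj C. \<exists>\<phi>\<in>hom C y (coprod_ob C x a). is_iso C \<phi> \<and> \<phi> \<cdot>\<^bsub>C\<^esub> f = in1 C x a"
  then obtain a \<phi> where a: "a \<in> Obj C" and \<phi>: "\<phi> \<in> hom C y (coprod_ob C x a)" "is_iso C \<phi>" "\<phi> \<cdot>\<^bsub>C\<^esub> f = in1 C x a" by blast
  note h = homD[OF \<phi>(1)]
  have "inv_arr C \<phi> \<cdot>\<^bsub>C\<^esub> in1 C x a = inv_arr C \<phi> \<cdot>\<^bsub>C\<^esub> (\<phi> \<cdot>\<^bsub>C\<^esub> f)" by (simp only: \<phi>(3))
  also have "\<dots> = f" by (simp add: comp_ext[OF inv_arr_simps(4)[OF \<phi>(2)]] h f \<phi>(2))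
  finally have "inv_arr C \<phi> \<cdot>\<^bsub>C\<^esub> in1 C x a = f" .
  moreover have "inv_arr C \<phi> \<in> hom C (coprod_ob C x a) y" using \<phi>(2) h by (simp add: hom_def)
  ultimately have "is_coprod C x a y f (inv_arr C \<phi> \<cdot>\<^bsub>C\<^esub> in2 C x a)"
    using coprod_transport[OF coprod_is[OF hom_obj(1)[OF assms] a] _ iso_inv[OF \<phi>(2)]] by metis
  then show "coprojection C f" by (rule coprojectionI)
qed

end

context closed_class begin

abbreviation "Cof \<equiv> termwise_coprojections C"

lemma Cof_iff: "f \<in> Cof \<longleftrightarrow> is_ntrans D C f \<and> (\<forall>n. coprojection C (NCmp f n))"
proof -
  have "coprojection C (NCmp f n) \<longleftrightarrow> (\<exists>a\<in>Obj C. \<exists>\<phi>\<in>hom C (FOb (NTgt f) n) (coprod_ob C (FOb (NSrc f) n) a).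
      is_iso C \<phi> \<and> \<phi> \<cdot>\<^bsub>C\<^esub> NCmp f n = in1 C (FOb (NSrc f) n) a)" if "is_ntrans D C f" for n
    by (rule coprojection_iff_chosen) (use that in \<open>simp add: hom_def\<close>)
  then show ?thesis unfolding termwise_coprojections_def B_eq by auto
qed

text \<open>Constant simplicial objects serve as complements inside columns and, later, as the zero
  object.\<close>

definition constF :: "'o \<Rightarrow> ('o, 'a) sobj" where
  "constF A = \<lparr>FOb = (\<lambda>_. A), FAr = restrict (\<lambda>_. Ident C A) (Arr D)\<rparr>"

lemma constF: "A \<in> Obj C \<Longrightarrow> is_functor D C (constF A)"
  by (rule I.is_functorI) (auto simp: constF_def hom_def)

text \<open>The complements of \<open>i\<close> in different degrees need not fit together, so
  \<open>i\<close> may fail to split as a simplicial map. Fixing the second index removes this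
  obstruction: the columns of \<open>bF i\<close> are maps of constant simplicial objects, which
  split with the complement found in the single degree \<open>m\<close>.\<close>

lemma K_cof_W:
  assumes i: "i \<in> hom B X Y" "i \<in> Cof" and g: "g \<in> hom B X Z" and P: "is_pushout B i g P p q"
    and k: "is_dpo B i g (I.d0 X) (I.d1 X) k a b c"
    and r: "\<rho> \<in> hom B k P" "\<rho> \<cdot>\<^bsub>B\<^esub> a = p" "\<rho> \<cdot>\<^bsub>B\<^esub> b = q" "\<rho> \<cdot>\<^bsub>B\<^esub> c = (q \<cdot>\<^bsub>B\<^esub> g) \<cdot>\<^bsub>B\<^esub> I.sg X"
  shows "\<rho> \<in> W"
proof -
  interpret B2: category B2 by (rule I2.category_E)
  note P' = is_pushoutD[OF P]
  have h: "is_ntrans D C i" "NSrc i = X" "NTgt i = Y" "is_ntrans D C g" "NSrc g = X" "NTgt g = Z"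
    "is_ntrans D C p" "NSrc p = Y" "NTgt p = P" "is_ntrans D C q" "NSrc q = Z" "NTgt q = P" "is_ntrans D C \<rho>" "NSrc \<rho> = k" "NTgt \<rho> = P"
    using i g P' r(1) by (auto simp: B_hom)
  have X: "is_functor D C X" "is_functor D C Y" "is_functor D C Z" "is_functor D C P"
    using I.ntrans_simps(1,2)[OF h(1)] I.ntrans_simps(1,2)[OF h(10)] h(2,3,11,12) by auto
  \<comment> \<open>Pushouts of coprojections exist in \<open>C\<close>; this is what makes
    \<open>P\<close> a pushout in every degree.\<close>
  have pt: "\<exists>d p q. is_pushout C (NCmp i n) (NCmp g n) d p q" for n
    by (rule pushout_coprojection_exists) (use i(2) h in \<open>simp_all add: Cof_iff\<close>)
  note Pn = I.pushout_pointwise[OF P pt]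
  obtain \<kappa> \<alpha> \<beta> \<gamma> where K: "is_dpo B2 (bF i) (bF g) (I2.d0 (bX X)) (I2.d1 (bX X)) \<kappa> \<alpha> \<beta> \<gamma>"
    using I2.cyl_dpo_exists[OF bF_hom[OF i(1)] bF_hom[OF g]] by blast
  note K' = is_dpoD[OF K]
  have d: "is_ntrans D2 C \<alpha>" "NSrc \<alpha> = bX Y" "NTgt \<alpha> = \<kappa>" "is_ntrans D2 C \<beta>" "NSrc \<beta> = bX Z" "NTgt \<beta> = \<kappa>"
     "is_ntrans D2 C \<gamma>" "NSrc \<gamma> = I2.ten (bX X)" "NTgt \<gamma> = \<kappa>" "is_functor D2 C \<kappa>"
    using K'(8-11) h by (auto simp: hom_def)
  have bP: "bF p \<cdot>\<^bsub>B2\<^esub> bF i = bF q \<cdot>\<^bsub>B2\<^esub> bF g" using P'(7) by (simp add: R2.res_map_comp[symmetric])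
  have bX': "is_functor D2 C (bX X)" using X(1) by simp
  have f2: "is_ntrans D2 C (bF q \<cdot>\<^bsub>B2\<^esub> bF g)" "NSrc (bF q \<cdot>\<^bsub>B2\<^esub> bF g) = bX X"
    by (simp_all add: h I2.ntrans_comp del: I2.E_simps(7))
  have sg2: "((bF q \<cdot>\<^bsub>B2\<^esub> bF g) \<cdot>\<^bsub>B2\<^esub> I2.sg (bX X)) \<cdot>\<^bsub>B2\<^esub> I2.d0 (bX X) = bF q \<cdot>\<^bsub>B2\<^esub> bF g"
    "((bF q \<cdot>\<^bsub>B2\<^esub> bF g) \<cdot>\<^bsub>B2\<^esub> I2.sg (bX X)) \<cdot>\<^bsub>B2\<^esub> I2.d1 (bX X) = bF q \<cdot>\<^bsub>B2\<^esub> bF g"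
    using B2.comp_assoc[of "I2.d0 (bX X)" "I2.sg (bX X)" "bF q \<cdot>\<^bsub>B2\<^esub> bF g"]
      B2.comp_assoc[of "I2.d1 (bX X)" "I2.sg (bX X)" "bF q \<cdot>\<^bsub>B2\<^esub> bF g"]
      B2.comp_Ident[of "bF q \<cdot>\<^bsub>B2\<^esub> bF g" "bX X"] f2 bX' I2.sg_d[OF bX']
    by (simp_all only: I2.E_simps mem_Collect_eq I2.d_simps I2.sg_ntrans I2.d_ntrans)
  \<comment> \<open>The comparison with the pushout is set up bisimplicially, its target being
    constant in the first direction; the cylinder part is collapsed there.\<close>
  have "\<exists>\<upsilon>. \<upsilon> \<in> hom B2 \<kappa> (bX P) \<and> \<upsilon> \<cdot>\<^bsub>B2\<^esub> \<alpha> = bF p \<and> \<upsilon> \<cdot>\<^bsub>B2\<^esub> \<beta> = bF q \<and>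
    \<upsilon> \<cdot>\<^bsub>B2\<^esub> \<gamma> = (bF q \<cdot>\<^bsub>B2\<^esub> bF g) \<cdot>\<^bsub>B2\<^esub> I2.sg (bX X)"
  proof (rule is_dpo_ex[OF K])
    show "bF p \<cdot>\<^bsub>B2\<^esub> bF i = ((bF q \<cdot>\<^bsub>B2\<^esub> bF g) \<cdot>\<^bsub>B2\<^esub> I2.sg (bX X)) \<cdot>\<^bsub>B2\<^esub> I2.d0 (bX X)"
      "bF q \<cdot>\<^bsub>B2\<^esub> bF g = ((bF q \<cdot>\<^bsub>B2\<^esub> bF g) \<cdot>\<^bsub>B2\<^esub> I2.sg (bX X)) \<cdot>\<^bsub>B2\<^esub> I2.d1 (bX X)"
      by (simp_all only: bP sg2)
  qed (simp_all add: hom_def h X I2.ntrans_comp del: I2.E_simps(7))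
  then obtain \<upsilon> where v: "\<upsilon> \<in> hom B2 \<kappa> (bX P)" "\<upsilon> \<cdot>\<^bsub>B2\<^esub> \<alpha> = bF p" "\<upsilon> \<cdot>\<^bsub>B2\<^esub> \<beta> = bF q"
    "\<upsilon> \<cdot>\<^bsub>B2\<^esub> \<gamma> = (bF q \<cdot>\<^bsub>B2\<^esub> bF g) \<cdot>\<^bsub>B2\<^esub> I2.sg (bX X)" by blast
  note hv = homD[OF v(1), simplified]
  have col: "res_map D (colF m) \<upsilon> \<in> W" for m
  proof -
    interpret R: restriction D D2 C "colF m" by (rule col_restriction)
    let ?c = "res_map D (colF m)" and ?C = "res_ob D (colF m)"
    have k1: "is_dpo B (?c (bF i)) (?c (bF g)) (I.d0 (?C (bX X))) (I.d1 (?C (bX X))) (?C \<kappa>) (?c \<alpha>) (?c \<beta>) (?c \<gamma>)"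
      using res_dpo[OF I.fcop_axioms I2.fcop_axioms index_functors(3)[of m] K _ I2.cyl_dpo_pointwise[OF K]]
      by (simp add: h)
    have "coprojection C (NCmp i m)" using i(2) by (simp add: Cof_iff)
    then obtain A j where A: "is_coprod C (FOb X m) A (FOb Y m) (NCmp i m) j"
      unfolding coprojection_def by (auto simp: h)
    note A' = is_coprodD[OF A]
    \<comment> \<open>The complement of the one component \<open>NCmp i m\<close>, repeated in all
      degrees of column \<open>m\<close>.\<close>
    define J where "J = \<lparr>NSrc = constF A, NTgt = ?C (bX Y), NCmp = (\<lambda>_. j)\<rparr>"
    have Id: "Ident D m \<in> Arr D" "Dom D (Ident D m) = m" "Cod D (Ident D m) = m" using I.A.Ident_arr[OF I.obj_A, of m] by auto
    \<comment> \<open>In a column of \<open>bX Y\<close> every operator acts as the identity of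
      \<open>FOb Y m\<close>, so the constant family \<open>J\<close> is natural.\<close>
    have FC: "FAr (?C (bX Y)) \<theta> = Ident C (FOb Y m)" if "\<theta> \<in> Arr D" for \<theta>
    proof -
      have "(\<theta>, Ident D m) \<in> Arr D2" using that Id by simp
      then have "FAr (bX Y) (\<theta>, Ident D m) = FAr Y (Ident D m)" by (simp only: res_simps index_simps snd_conv)
      then show ?thesis using that I.functor_simps(5)[OF X(2), of m] by (simp only: res_simps index_simps)
    qed
    have J: "is_ntrans D C J"
    proof (rule I.is_ntransI)
      show "NCmp J (Cod D \<theta>) \<cdot>\<^bsub>C\<^esub> FAr (NSrc J) \<theta> = FAr (NTgt J) \<theta> \<cdot>\<^bsub>C\<^esub> NCmp J (Dom D \<theta>)" if "\<theta> \<in> Arr D" for \<theta>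
        using FC[OF that] homD[OF A'(5)] that by (simp add: J_def constF_def)
    qed (simp_all add: J_def constF A'(2) X, simp add: constF_def A'(5))
    have cop: "is_coprod B (?C (bX X)) (constF A) (?C (bX Y)) (?c (bF i)) J"
    proof (rule I.coprod_of_pointwise)
      show "?c (bF i) \<in> hom B (?C (bX X)) (?C (bX Y))" by (simp add: B_hom h)
      show "J \<in> hom B (constF A) (?C (bX Y))" using J by (simp add: B_hom) (simp add: J_def)
    qed (simp add: J_def constF_def A)
    have gC: "?c (bF g) \<in> hom B (?C (bX X)) (?C (bX Z))" by (simp add: B_hom h)
    have po: "is_pushout B (?c (bF i)) (?c (bF g)) (?C (bX P)) (?c (bF p)) (?c (bF q))"
      by (rule I.pushout_of_pointwise[OF _ gC, of _ "?C (bX Y)"]) (simp_all add: B_hom h Pn)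
    show ?thesis
    proof (rule K_coprod_W[OF cop gC po k1])
      show "?c \<upsilon> \<in> hom B (?C \<kappa>) (?C (bX P))" by (simp add: B_hom hv)
      show "?c \<upsilon> \<cdot>\<^bsub>B\<^esub> ?c \<alpha> = ?c (bF p)" "?c \<upsilon> \<cdot>\<^bsub>B\<^esub> ?c \<beta> = ?c (bF q)"
        by (simp_all only: R.res_map_comp[symmetric] v)
      show "?c \<upsilon> \<cdot>\<^bsub>B\<^esub> ?c \<gamma> = (?c (bF q) \<cdot>\<^bsub>B\<^esub> ?c (bF g)) \<cdot>\<^bsub>B\<^esub> I.sg (?C (bX X))"
        by (simp only: R.res_map_comp[symmetric] v res_cyl_col[symmetric])
    qed
  qed
  interpret R: restriction D D2 C diagF by (rule diag_restriction)
  let ?d = "res_map D diagF"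
  have dW: "?d \<upsilon> \<in> W"
    using closed'(5)[of \<upsilon>] hv col by (auto simp: bi_eq)
  have k1: "is_dpo B i g (I.d0 X) (I.d1 X) (res_ob D diagF \<kappa>) (?d \<alpha>) (?d \<beta>) (?d \<gamma>)"
    using res_dpo[OF I.fcop_axioms I2.fcop_axioms index_functors(4) K _ I2.cyl_dpo_pointwise[OF K]] by (simp add: h X)
  obtain \<phi> where p: "\<phi> \<in> hom B (res_ob D diagF \<kappa>) k" "is_iso B \<phi>" "\<phi> \<cdot>\<^bsub>B\<^esub> ?d \<alpha> = a" "\<phi> \<cdot>\<^bsub>B\<^esub> ?d \<beta> = b" "\<phi> \<cdot>\<^bsub>B\<^esub> ?d \<gamma> = c"
    using B.dpo_iso[OF k1 k] .
  note hp = p(1)[unfolded B_hom]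
  have dv: "?d \<upsilon> \<cdot>\<^bsub>B\<^esub> ?d \<alpha> = p" "?d \<upsilon> \<cdot>\<^bsub>B\<^esub> ?d \<beta> = q" "?d \<upsilon> \<cdot>\<^bsub>B\<^esub> ?d \<gamma> = (q \<cdot>\<^bsub>B\<^esub> g) \<cdot>\<^bsub>B\<^esub> I.sg X"
    by (simp_all only: R.res_map_comp[symmetric] v) (simp_all add: R.res_map_comp h X)
  have "\<rho> \<cdot>\<^bsub>B\<^esub> \<phi> = ?d \<upsilon>"
  proof (rule B.dpo_eqI[OF k1])
    show "\<rho> \<cdot>\<^bsub>B\<^esub> \<phi> \<in> hom B (res_ob D diagF \<kappa>) P" "?d \<upsilon> \<in> hom B (res_ob D diagF \<kappa>) P"
      by (simp_all add: B_hom h hp hv X I.ntrans_comp del: I.E_simps(7))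
    show "(\<rho> \<cdot>\<^bsub>B\<^esub> \<phi>) \<cdot>\<^bsub>B\<^esub> ?d \<alpha> = ?d \<upsilon> \<cdot>\<^bsub>B\<^esub> ?d \<alpha>" "(\<rho> \<cdot>\<^bsub>B\<^esub> \<phi>) \<cdot>\<^bsub>B\<^esub> ?d \<beta> = ?d \<upsilon> \<cdot>\<^bsub>B\<^esub> ?d \<beta>"
      "(\<rho> \<cdot>\<^bsub>B\<^esub> \<phi>) \<cdot>\<^bsub>B\<^esub> ?d \<gamma> = ?d \<upsilon> \<cdot>\<^bsub>B\<^esub> ?d \<gamma>"
      unfolding dv by (simp_all add: h hp d p r X)
  qed
  then have "\<rho> \<cdot>\<^bsub>B\<^esub> \<phi> \<in> W" using dW by simp
  from B.W_cancel_right[OF B.W_iso[OF p(2)] this] show ?thesis by (simp add: h hp)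
qed

text \<open>\<open>q\<close> factors through the double mapping cylinder of \<open>i\<close> and
  \<open>g\<close>, whose projection to the pushout is covered by \<open>K_cof_W\<close>. The
  inclusion \<open>b\<close> of \<open>Z\<close> into it is a weak equivalence by comparison with
  the mapping cylinder of \<open>g\<close>: the two differ only by \<open>i\<close>, so
  \<open>K_W\<close> applies, and \<open>Z\<close> is a deformation retract of the mapping
  cylinder.\<close>

lemma trivial_pushout_W:
  assumes i: "i \<in> Cof" "i \<in> W" and P: "is_pushout B i g P p q"
  shows "q \<in> W"
proof -
  note P' = is_pushoutD[OF P]
  define X where "X = NSrc i"
  define Y where "Y = NTgt i"
  define Z where "Z = NTgt g"
  have h: "is_ntrans D C i" "NSrc i = X" "NTgt i = Y" "is_ntrans D C g" "NSrc g = X" "NTgt g = Z"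
    "is_ntrans D C p" "NSrc p = Y" "NTgt p = P" "is_ntrans D C q" "NSrc q = Z" "NTgt q = P"
    using P' by (auto simp: B_hom X_def Y_def Z_def)
  have X: "is_functor D C X" "is_functor D C Y" "is_functor D C Z" "is_functor D C P"
    using I.ntrans_simps(1,2)[OF h(1)] I.ntrans_simps(1,2)[OF h(10)] h(2,3,11,12) by auto
  have ih: "i \<in> hom B X Y" "g \<in> hom B X Z" "Ident B X \<in> hom B X X" "Ident B Z \<in> hom B Z Z"
    by (simp_all add: B_hom h X)
  obtain k a b c where k: "is_dpo B i g (I.d0 X) (I.d1 X) k a b c" using I.cyl_dpo_exists[OF ih(1,2)] by blast
  obtain k1 a1 b1 c1 where k1: "is_dpo B (Ident B X) g (I.d0 X) (I.d1 X) k1 a1 b1 c1" using I.cyl_dpo_exists[OF ih(3,2)] by blast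
  note K = is_dpoD[OF k] and K1 = is_dpoD[OF k1]
  have d: "is_ntrans D C a" "NSrc a = Y" "NTgt a = k" "is_ntrans D C b" "NSrc b = Z" "NTgt b = k"
     "is_ntrans D C c" "NSrc c = I.ten X" "NTgt c = k" "is_functor D C k"
     "is_ntrans D C a1" "NSrc a1 = X" "NTgt a1 = k1" "is_ntrans D C b1" "NSrc b1 = Z" "NTgt b1 = k1"
     "is_ntrans D C c1" "NSrc c1 = I.ten X" "NTgt c1 = k1" "is_functor D C k1"
    using K(8-11) K1(8-11) h by (auto simp: hom_def)
  have sg: "(f \<cdot>\<^bsub>B\<^esub> I.sg X) \<cdot>\<^bsub>B\<^esub> I.d0 X = f" "(f \<cdot>\<^bsub>B\<^esub> I.sg X) \<cdot>\<^bsub>B\<^esub> I.d1 X = f" if "is_ntrans D C f" "NSrc f = X" for f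
    by (simp_all add: that X I.sg_d[OF X(1)])
  have "\<exists>\<pi>. \<pi> \<in> hom B k1 Z \<and> \<pi> \<cdot>\<^bsub>B\<^esub> a1 = g \<and> \<pi> \<cdot>\<^bsub>B\<^esub> b1 = Ident B Z \<and> \<pi> \<cdot>\<^bsub>B\<^esub> c1 = g \<cdot>\<^bsub>B\<^esub> I.sg X"
    by (rule is_dpo_ex[OF k1]) (simp_all add: B_hom h X sg I.ntrans_comp del: I.E_simps(7) B.comp_assoc)
  then have b1: "b1 \<in> W" using mapping_cylinder_W(1)[OF ih(2) k1] by blast
  have e: "a \<cdot>\<^bsub>B\<^esub> i = c \<cdot>\<^bsub>B\<^esub> I.d0 X" "b \<cdot>\<^bsub>B\<^esub> g = c \<cdot>\<^bsub>B\<^esub> I.d1 X" by (rule K(12,13))+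
  have "\<exists>u. u \<in> hom B k1 k \<and> u \<cdot>\<^bsub>B\<^esub> a1 = a \<cdot>\<^bsub>B\<^esub> i \<and> u \<cdot>\<^bsub>B\<^esub> b1 = b \<cdot>\<^bsub>B\<^esub> Ident B Z \<and> u \<cdot>\<^bsub>B\<^esub> c1 = c \<cdot>\<^bsub>B\<^esub> I.tmap (Ident B X)"
    by (rule is_dpo_ex[OF k1]) (simp_all add: B_hom h X d e I.tmap_Ident I.ntrans_comp del: I.E_simps(7))
  then obtain u where u: "u \<in> hom B k1 k" "u \<cdot>\<^bsub>B\<^esub> a1 = a \<cdot>\<^bsub>B\<^esub> i" "u \<cdot>\<^bsub>B\<^esub> b1 = b \<cdot>\<^bsub>B\<^esub> Ident B Z" "u \<cdot>\<^bsub>B\<^esub> c1 = c \<cdot>\<^bsub>B\<^esub> I.tmap (Ident B X)"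
    by blast
  note hu = u(1)[unfolded B_hom]
  have "u \<in> W"
    by (rule K_W[OF ih(3,2,1,2) k1 k ih(3) _ ih(1) i(2) ih(4) _ _ _ u]) (simp_all add: h X)
  then have "u \<cdot>\<^bsub>B\<^esub> b1 \<in> W" using B.W_comp[OF b1] hu d by simp
  then have bW: "b \<in> W" using u(3) d X by simp
  have "\<exists>\<rho>. \<rho> \<in> hom B k P \<and> \<rho> \<cdot>\<^bsub>B\<^esub> a = p \<and> \<rho> \<cdot>\<^bsub>B\<^esub> b = q \<and> \<rho> \<cdot>\<^bsub>B\<^esub> c = (q \<cdot>\<^bsub>B\<^esub> g) \<cdot>\<^bsub>B\<^esub> I.sg X"
    by (rule is_dpo_ex[OF k]) (simp_all add: B_hom h X P'(7) sg I.ntrans_comp del: I.E_simps(7) B.comp_assoc)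
  then obtain \<rho> where r: "\<rho> \<in> hom B k P" "\<rho> \<cdot>\<^bsub>B\<^esub> a = p" "\<rho> \<cdot>\<^bsub>B\<^esub> b = q" "\<rho> \<cdot>\<^bsub>B\<^esub> c = (q \<cdot>\<^bsub>B\<^esub> g) \<cdot>\<^bsub>B\<^esub> I.sg X" by blast
  have "\<rho> \<in> W" by (rule K_cof_W[OF ih(1) i(1) ih(2) P k r])
  then have "\<rho> \<cdot>\<^bsub>B\<^esub> b \<in> W" using B.W_comp[OF bW] r(1) d by (simp add: B_hom)
  then show "q \<in> W" by (simp only: r(3))
qed

lemma B_cotuple [simp]:
  assumes "is_ntrans D C f" "is_ntrans D C g" "NTgt f = NTgt g"
  shows "is_ntrans D C (cotuple B f g)" "NSrc (cotuple B f g) = coprod_ob B (NSrc f) (NSrc g)" "NTgt (cotuple B f g) = NTgt g"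
  using B.cotuple_simps(1-3)[of f g] assms by simp_all

lemma B_in [simp]:
  assumes "is_functor D C X" "is_functor D C Y"
  shows "is_ntrans D C (in1 B X Y)" "NSrc (in1 B X Y) = X" "NTgt (in1 B X Y) = coprod_ob B X Y"
    "is_ntrans D C (in2 B X Y)" "NSrc (in2 B X Y) = Y" "NTgt (in2 B X Y) = coprod_ob B X Y"
  using B.coprod_simps(2-)[of X Y] assms by simp_all

lemma cyl_cof:
  assumes X: "is_functor D C X" shows "cotuple B (I.d0 X) (I.d1 X) \<in> Cof"
  unfolding Cof_iff
proof (intro conjI allI)
  have o: "X \<in> Obj B" using X by simp
  note d = I.d_ntrans[OF X]
  have c: "cotuple B (I.d0 X) (I.d1 X) \<in> Arr B" "Dom B (cotuple B (I.d0 X) (I.d1 X)) = coprod_ob B X X"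
    "Cod B (cotuple B (I.d0 X) (I.d1 X)) = I.ten X"
    "cotuple B (I.d0 X) (I.d1 X) \<cdot>\<^bsub>B\<^esub> in1 B X X = I.d0 X" "cotuple B (I.d0 X) (I.d1 X) \<cdot>\<^bsub>B\<^esub> in2 B X X = I.d1 X"
    using B.cotuple_simps[of "I.d0 X" "I.d1 X"] d by simp_all
  show "is_ntrans D C (cotuple B (I.d0 X) (I.d1 X))" using c(1) by simp
  fix n
  show "coprojection C (NCmp (cotuple B (I.d0 X) (I.d1 X)) n)"
  proof (rule coprojection_family[OF I.S_fin copower_is[OF I.S_fin I.functor_simps(1)[OF X]] I.e_in I.e_neq
        I.coprod_pointwise[OF B.coprod_is[OF o o]]])
    show "NCmp (cotuple B (I.d0 X) (I.d1 X)) n \<in> hom C (FOb (coprod_ob B X X) n) (copower_ob C (dS n) (FOb X n))"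
      using c(1-3) by (simp add: hom_def)
    show "NCmp (cotuple B (I.d0 X) (I.d1 X)) n \<cdot>\<^bsub>C\<^esub> NCmp (in1 B X X) n = copower_in C (dS n) (FOb X n) (de 0 n)"
      "NCmp (cotuple B (I.d0 X) (I.d1 X)) n \<cdot>\<^bsub>C\<^esub> NCmp (in2 B X X) n = copower_in C (dS n) (FOb X n) (de (Suc 0) n)"
      using arg_cong[OF c(4), of "\<lambda>t. NCmp t n"] arg_cong[OF c(5), of "\<lambda>t. NCmp t n"] by simp_all
  qed
qed

theorem brown_B: "brown_cofibrant_category B W Cof"
  unfolding brown_cofibrant_category_def
proof (intro conjI ballI allI impI)
  show "category B" by (rule I.category_E)
  show "has_finite_coproducts B" by (rule B.fin)
  show "W \<subseteq> Arr B" "two_out_of_three B W" by (rule B.W_arr, rule B.W_23)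
  show "Cof \<subseteq> Arr B" by (auto simp: Cof_iff)
  show "f \<in> W" if "is_iso B f" for f using that by (rule B.W_iso)
  show "g \<cdot>\<^bsub>B\<^esub> f \<in> Cof" if "f \<in> Cof" "g \<in> Cof" "Dom B g = Cod B f" for f g
    using that by (auto simp: Cof_iff I.ntrans_comp intro!: coprojection_comp)
  show "f \<in> Cof" if "is_iso B f" for f
    using B.iso_arr[OF that] I.ntrans_iso[OF that] by (simp add: Cof_iff coprojection_iso)
  show "\<exists>d p q. is_pushout B f g d p q" if "f \<in> Cof" "g \<in> Arr B" "Dom B g = Dom B f" for f g
  proof (rule I.pushout_exists_E)
    show "f \<in> hom B (NSrc f) (NTgt f)" "g \<in> hom B (NSrc f) (NTgt g)" using that by (auto simp: Cof_iff B_hom)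
    show "\<exists>d p q. is_pushout C (NCmp f n) (NCmp g n) d p q" for n
      by (rule pushout_coprojection_exists) (use that in \<open>auto simp: Cof_iff\<close>)
  qed
  show po: "q \<in> Cof" if "f \<in> Cof" "is_pushout B f g d p q" for f g d p q
  proof -
    note P = is_pushoutD[OF that(2)]
    have pt: "\<exists>d p q. is_pushout C (NCmp f n) (NCmp g n) d p q" for n
      by (rule pushout_coprojection_exists) (use that(1) P in \<open>auto simp: Cof_iff\<close>)
    have "coprojection C (NCmp q n)" for n
      by (rule coprojection_pushout[OF _ I.pushout_pointwise[OF that(2) pt]]) (use that(1) in \<open>simp add: Cof_iff\<close>)
    then show ?thesis using P(6) by (simp add: Cof_iff B_hom)
  qed
  show "q \<in> Cof \<inter> W" if "f \<in> Cof \<inter> W" "is_pushout B f g d p q" for f g d p q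
    using po[of f g d p q] trivial_pushout_W[of f g d p q] that by blast
  show "\<exists>c e0 e1 s. is_cylinder B W Cof X c e0 e1 s" if "X \<in> Obj B" for X
  proof (intro exI)
    have X: "is_functor D C X" using that by simp
    have "I.sg X \<cdot>\<^bsub>B\<^esub> cotuple B (I.d0 X) (I.d1 X) = codiagonal B X"
      by (rule B.cotuple_eqI[of _ _ X X]) (simp_all add: X codiagonal_def I.sg_d[OF X] I.ntrans_comp del: I.E_simps(7))
    then show "is_cylinder B W Cof X (I.ten X) (I.d0 X) (I.d1 X) (I.sg X)"
      by (simp add: is_cylinder_def B_hom X cyl_cof cyl_W)
  qed
  show "f \<in> Cof" if "is_initial B z \<and> f \<in> Arr B \<and> Dom B f = z" for z f
  proof -
    have "coprojection C (NCmp f n)" for n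
      by (rule coprojection_initial[OF I.initial_pointwise[of z], of _ n "FOb (NTgt f) n"]) (use that in \<open>auto simp: hom_def\<close>)
    then show ?thesis using that by (simp add: Cof_iff)
  qed
qed

text \<open>This is the interface between the two halves of the proof: what follows relies on these
  axioms, and bisimplicial objects do not appear again.\<close>

theorem brown_cylinder_Simp:
  "brown_cylinder (Simp C) W Cof (scyl C) (scyl_map C) (scyl_d C 0) (scyl_d C 1) (scyl_s C) I.hh"
  unfolding B_eq One_nat_def scyl_eq[abs_def] scyl_d_eq[abs_def] scyl_s_eq[abs_def]
proof unfold_locales
  show "brown_cofibrant_category B W Cof" by (rule brown_B)
  fix X assume "X \<in> Obj B"
  then have X: "is_functor D C X" by simp
  show "I.ten X \<in> Obj B" "I.d0 X \<in> hom B X (I.ten X)" "I.d1 X \<in> hom B X (I.ten X)" "I.sg X \<in> hom B (I.ten X) X"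
    "I.hh X \<in> hom B (I.ten (I.ten X)) (I.ten X)" using X by (simp_all add: B_hom)
  show "I.sg X \<cdot>\<^bsub>B\<^esub> I.d0 X = Ident B X" "I.sg X \<cdot>\<^bsub>B\<^esub> I.d1 X = Ident B X" by (rule I.sg_d[OF X])+
  have d: "scyl_map C (I.d0 X) = I.tmap (I.d0 X)" "scyl_map C (I.d1 X) = I.tmap (I.d1 X)"
    using X by (simp_all add: scyl_map_eq)
  show "I.hh X \<cdot>\<^bsub>B\<^esub> I.d0 (I.ten X) = Ident B (I.ten X)" "I.hh X \<cdot>\<^bsub>B\<^esub> I.d1 (I.ten X) = I.d1 X \<cdot>\<^bsub>B\<^esub> I.sg X"
    "I.hh X \<cdot>\<^bsub>B\<^esub> scyl_map C (I.d0 X) = Ident B (I.ten X)" "I.hh X \<cdot>\<^bsub>B\<^esub> scyl_map C (I.d1 X) = I.d1 X \<cdot>\<^bsub>B\<^esub> I.sg X"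
    unfolding d by (rule I.hh_d[OF X])+
  show "scyl_map C (Ident B X) = Ident B (I.ten X)" using X by (simp add: scyl_map_eq I.tmap_Ident)
  show "cotuple B (I.d0 X) (I.d1 X) \<in> Cof" by (rule cyl_cof[OF X])
  show "I.sg X \<in> W" by (rule cyl_W[OF X])
next
  fix f X Y assume f: "f \<in> hom B X Y"
  note h = f[unfolded B_hom]
  show "scyl_map C f \<in> hom B (I.ten X) (I.ten Y)" using h by (auto simp: scyl_map_eq B_hom)
  show "scyl_map C f \<cdot>\<^bsub>B\<^esub> I.d0 X = I.d0 Y \<cdot>\<^bsub>B\<^esub> f" "scyl_map C f \<cdot>\<^bsub>B\<^esub> I.d1 X = I.d1 Y \<cdot>\<^bsub>B\<^esub> f"
    using I.tmap_d[of f] h by (auto simp: scyl_map_eq)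
  show "I.sg Y \<cdot>\<^bsub>B\<^esub> scyl_map C f = f \<cdot>\<^bsub>B\<^esub> I.sg X" using I.tmap_sg[of f] h by (auto simp: scyl_map_eq)
next
  fix f X Y g Z assume "f \<in> hom B X Y" "g \<in> hom B Y Z"
  then show "scyl_map C (g \<cdot>\<^bsub>B\<^esub> f) = scyl_map C g \<cdot>\<^bsub>B\<^esub> scyl_map C f"
    by (auto simp: B_hom scyl_map_eq I.tmap_comp I.ntrans_comp simp del: I.E_simps(7))
next
  fix F X Y G Z F' X' Y' G' Z' k a b c k' a' b' c' x y z u
  assume "F \<in> hom B X Y" "G \<in> hom B X Z" "F' \<in> hom B X' Y'" "G' \<in> hom B X' Z'" "is_dpo B F G (I.d0 X) (I.d1 X) k a b c"
    "is_dpo B F' G' (I.d0 X') (I.d1 X') k' a' b' c'" "x \<in> hom B X X'" "x \<in> W" "y \<in> hom B Y Y'" "y \<in> W"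
    "z \<in> hom B Z Z'" "z \<in> W" "y \<cdot>\<^bsub>B\<^esub> F = F' \<cdot>\<^bsub>B\<^esub> x" "z \<cdot>\<^bsub>B\<^esub> G = G' \<cdot>\<^bsub>B\<^esub> x" "u \<in> hom B k k'" "u \<cdot>\<^bsub>B\<^esub> a = a' \<cdot>\<^bsub>B\<^esub> y"
    "u \<cdot>\<^bsub>B\<^esub> b = b' \<cdot>\<^bsub>B\<^esub> z" "u \<cdot>\<^bsub>B\<^esub> c = c' \<cdot>\<^bsub>B\<^esub> scyl_map C x"
  then show "u \<in> W" using K_W[of F X Y G Z F' X' Y' G' Z' k a b c k' a' b' c' x y z u] scyl_map_eq[of x] unfolding B_hom by metis
next
  fix i X Y G Z P p q k a b c u
  assume "i \<in> hom B X Y" "i \<in> Cof" "G \<in> hom B X Z" "is_pushout B i G P p q" "is_dpo B i G (I.d0 X) (I.d1 X) k a b c"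
    "u \<in> hom B k P" "u \<cdot>\<^bsub>B\<^esub> a = p" "u \<cdot>\<^bsub>B\<^esub> b = q" "u \<cdot>\<^bsub>B\<^esub> c = (q \<cdot>\<^bsub>B\<^esub> G) \<cdot>\<^bsub>B\<^esub> I.sg X"
  then show "u \<in> W" by (rule K_cof_W)
qed

end

section \<open>Cones, suspensions and coactions\<close>

context brown_cylinder begin

lemma Cof_arr [simp]: "f \<in> Cof \<Longrightarrow> f \<in> Arr B"
  and Cof_comp: "f \<in> Cof \<Longrightarrow> g \<in> Cof \<Longrightarrow> Dom B g = Cod B f \<Longrightarrow> g \<cdot>\<^bsub>B\<^esub> f \<in> Cof"
  and Cof_pushout_exists: "f \<in> Cof \<Longrightarrow> g \<in> Arr B \<Longrightarrow> Dom B g = Dom B f \<Longrightarrow> \<exists>d p q. is_pushout B f g d p q"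
  and Cof_pushout: "f \<in> Cof \<Longrightarrow> is_pushout B f g d p q \<Longrightarrow> q \<in> Cof"
  and Cof_W_pushout: "f \<in> Cof \<Longrightarrow> f \<in> W \<Longrightarrow> is_pushout B f g d p q \<Longrightarrow> q \<in> W"
  and Cof_initial: "is_initial B z \<Longrightarrow> f \<in> Arr B \<Longrightarrow> Dom B f = z \<Longrightarrow> f \<in> Cof"
  using brown unfolding brown_cofibrant_category_def by blast+

lemma cyl_arrs [simp]:
  assumes "X \<in> Obj B"
  shows "T X \<in> Obj B" "e0 X \<in> Arr B" "Dom B (e0 X) = X" "Cod B (e0 X) = T X"
    "e1 X \<in> Arr B" "Dom B (e1 X) = X" "Cod B (e1 X) = T X"
    "sg X \<in> Arr B" "Dom B (sg X) = T X" "Cod B (sg X) = X"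
    "hh X \<in> Arr B" "Dom B (hh X) = T (T X)" "Cod B (hh X) = T X"
    "sg X \<cdot>\<^bsub>B\<^esub> e0 X = Ident B X" "sg X \<cdot>\<^bsub>B\<^esub> e1 X = Ident B X"
    "hh X \<cdot>\<^bsub>B\<^esub> e0 (T X) = Ident B (T X)" "hh X \<cdot>\<^bsub>B\<^esub> e1 (T X) = e1 X \<cdot>\<^bsub>B\<^esub> sg X"
    "hh X \<cdot>\<^bsub>B\<^esub> tm (e0 X) = Ident B (T X)" "hh X \<cdot>\<^bsub>B\<^esub> tm (e1 X) = e1 X \<cdot>\<^bsub>B\<^esub> sg X" "tm (Ident B X) = Ident B (T X)"
  using assms T_obj e_hom[OF assms] sg_hom[OF assms] hh_hom[OF assms] sg_e hh_e tm_Ident by (simp_all add: hom_def)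

lemma tm_arr [simp]:
  assumes "f \<in> Arr B" shows "tm f \<in> Arr B" "Dom B (tm f) = T (Dom B f)" "Cod B (tm f) = T (Cod B f)"
  using tm_hom[of f "Dom B f" "Cod B f"] assms by (simp_all add: hom_def)

lemma e_W: "X \<in> Obj B \<Longrightarrow> e0 X \<in> W"
  using W_section[OF cyl_arrs(14) sg_W] by (simp add: hom_def)

text \<open>A summand inclusion is the pushout of the map from an initial object to its complement,
  and that map is a cofibration. Only the Brown axioms enter, not the concrete form of the
  cofibrations.\<close>

lemma coprojection_Cof:
  assumes p: "is_coprod B x y p i j" and z: "is_initial B z" shows "i \<in> Cof"
proof -
  note P = is_coprodD[OF p]
  note h = homD[OF P(4)] homD[OF P(5)]
  have zu: "u = v" if "u \<in> hom B z t" "v \<in> hom B z t" for u v t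
    using z that hom_obj unfolding is_initial_def by blast
  obtain a b where a: "a \<in> hom B z x" and b: "b \<in> hom B z y" using z P(1,2) unfolding is_initial_def by blast
  note ab = homD[OF a] homD[OF b]
  have "is_pushout B b a p j i"
  proof (rule pushoutI[OF b a P(5) P(4)])
    show "j \<cdot>\<^bsub>B\<^esub> b = i \<cdot>\<^bsub>B\<^esub> a" by (rule zu[of _ p]) (simp_all add: hom_def h ab)
    show "\<exists>u. u \<in> hom B p t \<and> u \<cdot>\<^bsub>B\<^esub> j = v \<and> u \<cdot>\<^bsub>B\<^esub> i = w" if "t \<in> Obj B" "v \<in> hom B y t" "w \<in> hom B x t" for t v w
      using is_coprod_ex[OF p that(3,2,1)] by blast
    show "u = v" if "u \<in> hom B p t" "v \<in> hom B p t" "u \<cdot>\<^bsub>B\<^esub> j = v \<cdot>\<^bsub>B\<^esub> j" "u \<cdot>\<^bsub>B\<^esub> i = v \<cdot>\<^bsub>B\<^esub> i" for t u v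
      by (rule coprod_eqI[OF p that(1,2,4,3)])
  qed
  moreover have "b \<in> Cof" by (rule Cof_initial[OF z]) (simp_all add: ab)
  ultimately show ?thesis using Cof_pushout by blast
qed

lemma in_Cof: "x \<in> Obj B \<Longrightarrow> y \<in> Obj B \<Longrightarrow> in1 B x y \<in> Cof" "x \<in> Obj B \<Longrightarrow> y \<in> Obj B \<Longrightarrow> in2 B x y \<in> Cof"
proof -
  obtain z where "is_initial B z" using fin by (auto simp: has_finite_coproducts_def)
  then show "x \<in> Obj B \<Longrightarrow> y \<in> Obj B \<Longrightarrow> in1 B x y \<in> Cof" "x \<in> Obj B \<Longrightarrow> y \<in> Obj B \<Longrightarrow> in2 B x y \<in> Cof"
    using coprojection_Cof[OF coprod_is] coprojection_Cof[OF coprod_sym[OF coprod_is]] by blast+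
qed

lemma e0_Cof: assumes "X \<in> Obj B" shows "e0 X \<in> Cof"
proof -
  have "cotuple B (e0 X) (e1 X) \<cdot>\<^bsub>B\<^esub> in1 B X X \<in> Cof"
    by (rule Cof_comp) (use assms cyl_cof in_Cof in simp_all)
  then show ?thesis using assms by simp
qed

end

text \<open>\<open>K_ob\<close> and the cones are defined for simplicial objects, so the abstract
  cylinder is specialised to \<open>scyl\<close>. The contraction \<open>hh\<close> stays a
  parameter governed by the axioms alone. The index is written \<open>Suc 0\<close> because the
  simplifier rewrites 1 to this form.\<close>

locale simplicial_brown = brown_cylinder "Simp C" W "termwise_coprojections C" "scyl C" "scyl_map C"
    "scyl_d C 0" "scyl_d C (Suc 0)" "scyl_s C" hh
  for C :: "('o, 'a) cat" and W :: "('o, 'a) smap set" and hh :: "('o, 'a) sobj \<Rightarrow> ('o, 'a) smap" +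
  assumes pointed: "pointed (Simp C)"
begin

abbreviation "B \<equiv> Simp C"
abbreviation "Cof \<equiv> termwise_coprojections C"
abbreviation "T \<equiv> scyl C"
abbreviation "tm \<equiv> scyl_map C"
abbreviation "d0 \<equiv> scyl_d C 0"
abbreviation "d1 \<equiv> scyl_d C (Suc 0)"
abbreviation "sg \<equiv> scyl_s C"
abbreviation "z0 \<equiv> zero_ob (Simp C)"
abbreviation "tz \<equiv> to_zero (Simp C)"
abbreviation "fz \<equiv> from_zero (Simp C)"
abbreviation "zr \<equiv> zero_arr (Simp C)"
abbreviation comp_B (infixl "\<triangleleft>" 70) where "g \<triangleleft> f \<equiv> g \<cdot>\<^bsub>Simp C\<^esub> f"
abbreviation comp_L (infixl "\<star>" 70) where "g \<star> f \<equiv> g \<cdot>\<^bsub>localization (Simp C) W\<^esub> f"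

text \<open>The definitions of cones and cylinders speak of \<open>NSrc\<close> and
  \<open>NTgt\<close>, the lemmas on categories of \<open>Dom\<close> and \<open>Cod\<close>; the
  latter are the normal form from here on.\<close>

lemma NSrc_Dom [simp]: "NSrc f = Dom B f" "NTgt f = Cod B f" for f :: "('o, 'a) smap"
  by (simp_all add: Simp_def functor_cat_def)

lemma zero_is: "is_zero B z0"
  using pointed unfolding pointed_def zero_ob_def by (rule someI_ex)

lemma z0_obj [simp]: "z0 \<in> Obj B"
  using zero_is by (simp add: is_zero_def is_initial_def)

lemma tz_props:
  assumes "X \<in> Obj B" shows "tz X \<in> hom B X z0" "f \<in> hom B X z0 \<Longrightarrow> f = tz X"
proof -
  have ex: "\<exists>!f. f \<in> hom B X z0" using zero_is assms by (simp add: is_zero_def is_terminal_def)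
  then show "tz X \<in> hom B X z0" unfolding to_zero_def by (rule theI')
  then show "f \<in> hom B X z0 \<Longrightarrow> f = tz X" using ex by blast
qed

lemma fz_props:
  assumes "X \<in> Obj B" shows "fz X \<in> hom B z0 X" "f \<in> hom B z0 X \<Longrightarrow> f = fz X"
proof -
  have ex: "\<exists>!f. f \<in> hom B z0 X" using zero_is assms by (simp add: is_zero_def is_initial_def)
  then show "fz X \<in> hom B z0 X" unfolding from_zero_def by (rule theI')
  then show "f \<in> hom B z0 X \<Longrightarrow> f = fz X" using ex by blast
qed

lemma zero_arrs [simp]:
  assumes "X \<in> Obj B"
  shows "tz X \<in> Arr B" "Dom B (tz X) = X" "Cod B (tz X) = z0" "fz X \<in> Arr B" "Dom B (fz X) = z0" "Cod B (fz X) = X"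
  using tz_props(1)[OF assms] fz_props(1)[OF assms] by (simp_all add: hom_def)

lemma fz_comp_tz [simp]: "fz Y \<triangleleft> tz X = zr X Y" by (simp add: zero_arr_def)

lemma zr_arr [simp]:
  assumes "X \<in> Obj B" "Y \<in> Obj B"
  shows "zr X Y \<in> Arr B" "Dom B (zr X Y) = X" "Cod B (zr X Y) = Y"
  using assms by (simp_all add: zero_arr_def del: fz_comp_tz)

lemma tz_eq [simp]: "f \<in> Arr B \<Longrightarrow> Dom B f = X \<Longrightarrow> tz (Cod B f) \<triangleleft> f = tz X"
  by (rule tz_props(2)) (auto simp: hom_def)

lemma fz_eq [simp]: "f \<in> Arr B \<Longrightarrow> Dom B f = X \<Longrightarrow> f \<triangleleft> fz X = fz (Cod B f)"
  by (rule fz_props(2)) (auto simp: hom_def)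

lemma tz_eq' [simp]: "f \<in> Arr B \<Longrightarrow> Cod B f = X \<Longrightarrow> tz X \<triangleleft> f = tz (Dom B f)"
  by (rule tz_props(2)) (auto simp: hom_def)

lemma zr_comp [simp]:
  "f \<in> Arr B \<Longrightarrow> Dom B f = Y \<Longrightarrow> X \<in> Obj B \<Longrightarrow> f \<triangleleft> zr X Y = zr X (Cod B f)"
  "f \<in> Arr B \<Longrightarrow> Cod B f = Y \<Longrightarrow> Z \<in> Obj B \<Longrightarrow> zr Y Z \<triangleleft> f = zr (Dom B f) Z"
proof -
  show "f \<triangleleft> zr X Y = zr X (Cod B f)" if "f \<in> Arr B" "Dom B f = Y" "X \<in> Obj B"
    using that comp_ext[OF fz_eq[OF that(1,2)], of "tz X"] Dom_obj[OF that(1)] by (simp add: zero_arr_def del: fz_comp_tz)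
  show "zr Y Z \<triangleleft> f = zr (Dom B f) Z" if "f \<in> Arr B" "Cod B f = Y" "Z \<in> Obj B"
    using that Cod_obj[OF that(1)] by (simp add: zero_arr_def del: fz_comp_tz)
qed

lemma from_z0: "f \<in> Arr B \<Longrightarrow> g \<in> Arr B \<Longrightarrow> Dom B f = z0 \<Longrightarrow> Dom B g = z0 \<Longrightarrow> Cod B f = Cod B g \<Longrightarrow> f = g"
  using fz_props(2)[of "Cod B g" f] fz_props(2)[of "Cod B g" g] by (simp add: hom_def)

lemma tz_z0 [simp]: "tz z0 = Ident B z0" "fz z0 = Ident B z0"
  using tz_props(2)[of z0 "Ident B z0"] fz_props(2)[of z0 "Ident B z0"] by (simp_all add: hom_def)

subsection \<open>The objects \<^term>\<open>K_ob C F G\<close>\<close>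

text \<open>The pushout exists for arbitrary \<open>F\<close> and \<open>G\<close> because the other
  leg, the inclusion of both ends of the cylinder, is a cofibration.\<close>

lemma K_pushout_is:
  assumes "F \<in> hom B X Y" "G \<in> hom B X Z"
  shows "is_pushout B (coprod_map B F G) (cotuple B (d0 X) (d1 X)) (K_ob C F G) (fst (snd (K_pushout C F G))) (K_incyl C F G)"
proof -
  have o: "X \<in> Obj B" "Y \<in> Obj B" "Z \<in> Obj B" using assms hom_obj by auto
  note h = homD[OF assms(1)] homD[OF assms(2)]
  have "\<exists>d p q. is_pushout B (cotuple B (d0 X) (d1 X)) (coprod_map B F G) d p q"
    by (rule Cof_pushout_exists) (simp_all add: o h cyl_cof)
  then obtain d p q where "is_pushout B (coprod_map B F G) (cotuple B (d0 X) (d1 X)) d q p" using pushout_sym by blast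
  then have ex: "\<exists>t. case t of (d, p, q) \<Rightarrow> is_pushout B (coprod_map B F G) (cotuple B (d0 X) (d1 X)) d p q" by auto
  have n: "NSrc F = X" by (simp add: h)
  from someI_ex[OF ex] show ?thesis
    unfolding K_ob_def K_incyl_def K_pushout_def pushout_def One_nat_def n by (simp only: case_prod_unfold)
qed

lemma K_dpo:
  assumes "F \<in> hom B X Y" "G \<in> hom B X Z"
  shows "is_dpo B F G (d0 X) (d1 X) (K_ob C F G) (K_in1 C F G) (K_in2 C F G) (K_incyl C F G)"
proof -
  have "X \<in> Obj B" using assms hom_obj by auto
  then show ?thesis
    using dpo_of_pushout[OF K_pushout_is[OF assms] assms e_hom] homD[OF assms(1)] homD[OF assms(2)]
    by (simp add: K_in1_def K_in2_def)
qed

lemma K_simps [simp]: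
  assumes "F \<in> Arr B" "G \<in> Arr B" "Dom B F = Dom B G"
  shows "K_ob C F G \<in> Obj B" "K_in1 C F G \<in> Arr B" "Dom B (K_in1 C F G) = Cod B F" "Cod B (K_in1 C F G) = K_ob C F G"
    "K_in2 C F G \<in> Arr B" "Dom B (K_in2 C F G) = Cod B G" "Cod B (K_in2 C F G) = K_ob C F G"
    "K_incyl C F G \<in> Arr B" "Dom B (K_incyl C F G) = T (Dom B G)" "Cod B (K_incyl C F G) = K_ob C F G"
    "X = Dom B G \<Longrightarrow> K_incyl C F G \<triangleleft> d0 X = K_in1 C F G \<triangleleft> F"
    "X = Dom B G \<Longrightarrow> K_incyl C F G \<triangleleft> d1 X = K_in2 C F G \<triangleleft> G"
  using is_dpoD[OF K_dpo[of F "Dom B G" "Cod B F" G "Cod B G"]] assms by (simp_all add: hom_def)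

lemma K_eqI:
  assumes "F \<in> Arr B" "G \<in> Arr B" "Dom B F = Dom B G" "u \<in> Arr B" "v \<in> Arr B" "Dom B u = K_ob C F G" "Dom B v = K_ob C F G"
    "Cod B u = Cod B v" "u \<triangleleft> K_in1 C F G = v \<triangleleft> K_in1 C F G" "u \<triangleleft> K_in2 C F G = v \<triangleleft> K_in2 C F G"
    "u \<triangleleft> K_incyl C F G = v \<triangleleft> K_incyl C F G"
  shows "u = v"
  by (rule dpo_eqI[OF K_dpo[of F "Dom B G" "Cod B F" G "Cod B G"], of _ "Cod B v"]) (simp_all add: hom_def assms)

lemma K_desc:
  assumes "F \<in> Arr B" "G \<in> Arr B" "Dom B F = Dom B G" "y \<in> Arr B" "z \<in> Arr B" "h \<in> Arr B"
    "Dom B y = Cod B F" "Dom B z = Cod B G" "Dom B h = T (Dom B G)" "Cod B y = Cod B h" "Cod B z = Cod B h"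
    "y \<triangleleft> F = h \<triangleleft> d0 (Dom B G)" "z \<triangleleft> G = h \<triangleleft> d1 (Dom B G)"
  shows "K_desc C F G y z h \<in> Arr B" "Dom B (K_desc C F G y z h) = K_ob C F G" "Cod B (K_desc C F G y z h) = Cod B h"
    "K_desc C F G y z h \<triangleleft> K_in1 C F G = y" "K_desc C F G y z h \<triangleleft> K_in2 C F G = z" "K_desc C F G y z h \<triangleleft> K_incyl C F G = h"
    "k \<in> Arr B \<Longrightarrow> Cod B k = Cod B F \<Longrightarrow> K_desc C F G y z h \<triangleleft> (K_in1 C F G \<triangleleft> k) = y \<triangleleft> k"
    "k \<in> Arr B \<Longrightarrow> Cod B k = Cod B G \<Longrightarrow> K_desc C F G y z h \<triangleleft> (K_in2 C F G \<triangleleft> k) = z \<triangleleft> k"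
    "k \<in> Arr B \<Longrightarrow> Cod B k = T (Dom B G) \<Longrightarrow> K_desc C F G y z h \<triangleleft> (K_incyl C F G \<triangleleft> k) = h \<triangleleft> k"
proof -
  let ?P = "\<lambda>u. u \<in> hom B (K_ob C F G) (Cod B h) \<and> u \<triangleleft> K_in1 C F G = y \<and> u \<triangleleft> K_in2 C F G = z \<and> u \<triangleleft> K_incyl C F G = h"
  have "\<exists>u. ?P u"
    by (rule is_dpo_ex[OF K_dpo[of F "Dom B G" "Cod B F" G "Cod B G"]]) (simp_all add: hom_def assms)
  moreover have "u = v" if "?P u" "?P v" for u v
    by (rule K_eqI[OF assms(1-3)]) (use that in \<open>simp_all add: hom_def\<close>)
  ultimately have "\<exists>!u. ?P u" by blast
  from theI'[OF this] have *: "?P (K_desc C F G y z h)" unfolding K_desc_def by simp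
  then show 1: "K_desc C F G y z h \<in> Arr B" "Dom B (K_desc C F G y z h) = K_ob C F G" "Cod B (K_desc C F G y z h) = Cod B h"
    "K_desc C F G y z h \<triangleleft> K_in1 C F G = y" "K_desc C F G y z h \<triangleleft> K_in2 C F G = z" "K_desc C F G y z h \<triangleleft> K_incyl C F G = h"
    by (auto simp: hom_def)
  show "k \<in> Arr B \<Longrightarrow> Cod B k = Cod B F \<Longrightarrow> K_desc C F G y z h \<triangleleft> (K_in1 C F G \<triangleleft> k) = y \<triangleleft> k"
    "k \<in> Arr B \<Longrightarrow> Cod B k = Cod B G \<Longrightarrow> K_desc C F G y z h \<triangleleft> (K_in2 C F G \<triangleleft> k) = z \<triangleleft> k"
    "k \<in> Arr B \<Longrightarrow> Cod B k = T (Dom B G) \<Longrightarrow> K_desc C F G y z h \<triangleleft> (K_incyl C F G \<triangleleft> k) = h \<triangleleft> k"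
    using comp_ext[OF 1(4)] comp_ext[OF 1(5)] comp_ext[OF 1(6)] 1(1-3) assms(1-3) by simp_all
qed

text \<open>The clauses with \<open>k\<close> restate the values on the generators for right-nested
  composites; the last clause is the homotopy invariance \<open>dpo_W\<close>.\<close>

lemma K_map:
  assumes FG: "F \<in> Arr B" "G \<in> Arr B" "Dom B F = Dom B G" "F' \<in> Arr B" "G' \<in> Arr B" "Dom B F' = Dom B G'"
    and xyz: "x \<in> Arr B" "y \<in> Arr B" "z \<in> Arr B" "Dom B x = Dom B G" "Cod B x = Dom B G'"
    "Dom B y = Cod B F" "Cod B y = Cod B F'" "Dom B z = Cod B G" "Cod B z = Cod B G'"
    "y \<triangleleft> F = F' \<triangleleft> x" "z \<triangleleft> G = G' \<triangleleft> x"
  defines "u \<equiv> K_map C F G F' G' x y z"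
  shows "u \<in> Arr B" "Dom B u = K_ob C F G" "Cod B u = K_ob C F' G'"
    "u \<triangleleft> K_in1 C F G = K_in1 C F' G' \<triangleleft> y" "u \<triangleleft> K_in2 C F G = K_in2 C F' G' \<triangleleft> z" "u \<triangleleft> K_incyl C F G = K_incyl C F' G' \<triangleleft> tm x"
    "k \<in> Arr B \<Longrightarrow> Cod B k = Cod B F \<Longrightarrow> u \<triangleleft> (K_in1 C F G \<triangleleft> k) = K_in1 C F' G' \<triangleleft> (y \<triangleleft> k)"
    "k \<in> Arr B \<Longrightarrow> Cod B k = Cod B G \<Longrightarrow> u \<triangleleft> (K_in2 C F G \<triangleleft> k) = K_in2 C F' G' \<triangleleft> (z \<triangleleft> k)"
    "k \<in> Arr B \<Longrightarrow> Cod B k = T (Dom B G) \<Longrightarrow> u \<triangleleft> (K_incyl C F G \<triangleleft> k) = K_incyl C F' G' \<triangleleft> (tm x \<triangleleft> k)"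
    "x \<in> W \<Longrightarrow> y \<in> W \<Longrightarrow> z \<in> W \<Longrightarrow> u \<in> W"
proof -
  have xh: "x \<in> hom B (Dom B G) (Dom B G')" by (simp add: hom_def xyz)
  note t = tm_e(1)[OF xh] tm_e(2)[OF xh]
  have 1: "(K_in1 C F' G' \<triangleleft> y) \<triangleleft> F = (K_incyl C F' G' \<triangleleft> tm x) \<triangleleft> d0 (Dom B G)"
    by (simp add: FG xyz t) (simp add: comp_ext[OF K_simps(11)[OF FG(4-6) refl]] FG xyz)
  have 2: "(K_in2 C F' G' \<triangleleft> z) \<triangleleft> G = (K_incyl C F' G' \<triangleleft> tm x) \<triangleleft> d1 (Dom B G)"
    by (simp add: FG xyz t) (simp add: comp_ext[OF K_simps(12)[OF FG(4-6) refl]] FG xyz)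
  note D = K_desc[OF FG(1-3) _ _ _ _ _ _ _ _ 1 2, folded K_map_def, folded u_def]
  show *: "u \<in> Arr B" "Dom B u = K_ob C F G" "Cod B u = K_ob C F' G'"
    "u \<triangleleft> K_in1 C F G = K_in1 C F' G' \<triangleleft> y" "u \<triangleleft> K_in2 C F G = K_in2 C F' G' \<triangleleft> z" "u \<triangleleft> K_incyl C F G = K_incyl C F' G' \<triangleleft> tm x"
    using D(1-6) by (simp_all add: FG xyz)
  show "k \<in> Arr B \<Longrightarrow> Cod B k = Cod B F \<Longrightarrow> u \<triangleleft> (K_in1 C F G \<triangleleft> k) = K_in1 C F' G' \<triangleleft> (y \<triangleleft> k)"
    "k \<in> Arr B \<Longrightarrow> Cod B k = Cod B G \<Longrightarrow> u \<triangleleft> (K_in2 C F G \<triangleleft> k) = K_in2 C F' G' \<triangleleft> (z \<triangleleft> k)"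
    "k \<in> Arr B \<Longrightarrow> Cod B k = T (Dom B G) \<Longrightarrow> u \<triangleleft> (K_incyl C F G \<triangleleft> k) = K_incyl C F' G' \<triangleleft> (tm x \<triangleleft> k)"
    using D(7-9) by (simp_all add: FG xyz)
  have H: "F \<in> hom B (Dom B G) (Cod B F)" "G \<in> hom B (Dom B G) (Cod B G)" "F' \<in> hom B (Dom B G') (Cod B F')"
    "G' \<in> hom B (Dom B G') (Cod B G')" "y \<in> hom B (Cod B F) (Cod B F')" "z \<in> hom B (Cod B G) (Cod B G')"
    "u \<in> hom B (K_ob C F G) (K_ob C F' G')"
    by (simp_all add: hom_def FG xyz *)
  show "x \<in> W \<Longrightarrow> y \<in> W \<Longrightarrow> z \<in> W \<Longrightarrow> u \<in> W"
    by (rule dpo_W[OF H(1-4) K_dpo[OF H(1,2)] K_dpo[OF H(3,4)] xh _ H(5) _ H(6) _ xyz(10,11) H(7) *(4-6)])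
qed

end

context simplicial_brown begin

section \<open>Mapping cylinders and cones by generators\<close>

definition "Cyl_in1 F = K_in1 C F (Ident B (Dom B F))"
definition "Cyl_incyl F = K_incyl C F (Ident B (Dom B F))"
definition "Cone_incyl F = K_incyl C F (tz (Dom B F))"
definition "Cone_desc F y h = K_desc C F (tz (Dom B F)) y (fz (Cod B y)) h"

lemma Cone_eq: "Cone C F = K_ob C F (tz (Dom B F))" "Cone_in C F = K_in1 C F (tz (Dom B F))"
  "Cyl C F = K_ob C F (Ident B (Dom B F))" "Cyl_in C F = K_in2 C F (Ident B (Dom B F))"
  "Cyl_proj C F = K_desc C F (Ident B (Dom B F)) (Ident B (Cod B F)) F (F \<triangleleft> sg (Dom B F))"
  "Cone_map C F F' x y = K_map C F (tz (Dom B F)) F' (tz (Dom B F')) x y (Ident B z0)"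
  "Lambda C X = K_ob C (tz X) (tz X)" "Lambda_incyl C X = K_incyl C (tz X) (tz X)"
  by (simp_all add: Cone_def Cone_in_def Cyl_def Cyl_in_def Cyl_proj_def Cone_map_def Lambda_def Lambda_incyl_def)

lemmas Cone_unfold = Cone_eq Cyl_in1_def Cyl_incyl_def Cone_incyl_def

text \<open>The leg from the apex starts at a zero object and so carries no information. Maps out of
  a cone are thus determined by their values on \<open>Y\<close> and on the cylinder, as
  \<open>Cone_desc\<close> and \<open>Cone_eqI\<close> exploit.\<close>

lemma Cone_in2:
  assumes "F \<in> Arr B" shows "K_in2 C F (tz (Dom B F)) = fz (Cone C F)"
  by (rule from_z0) (use assms in \<open>simp_all add: Cone_eq(1)\<close>)

lemma Cone_simps [simp]:
  assumes "F \<in> Arr B"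
  shows "Cone C F \<in> Obj B" "Cone_in C F \<in> Arr B" "Dom B (Cone_in C F) = Cod B F" "Cod B (Cone_in C F) = Cone C F"
    "Cone_incyl F \<in> Arr B" "Dom B (Cone_incyl F) = T (Dom B F)" "Cod B (Cone_incyl F) = Cone C F"
    "X = Dom B F \<Longrightarrow> Cone_incyl F \<triangleleft> d0 X = Cone_in C F \<triangleleft> F"
    "X = Dom B F \<Longrightarrow> Cone_incyl F \<triangleleft> d1 X = zr X (Cone C F)"
proof -
  have o: "Dom B F \<in> Obj B" "Cod B F \<in> Obj B" using assms by simp_all
  note K = K_simps[of F "tz (Dom B F)"]
  show 1: "Cone C F \<in> Obj B" "Cone_in C F \<in> Arr B" "Dom B (Cone_in C F) = Cod B F" "Cod B (Cone_in C F) = Cone C F"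
    "Cone_incyl F \<in> Arr B" "Dom B (Cone_incyl F) = T (Dom B F)" "Cod B (Cone_incyl F) = Cone C F"
    unfolding Cone_unfold by (simp_all add: K(1-10) assms o)
  show "X = Dom B F \<Longrightarrow> Cone_incyl F \<triangleleft> d0 X = Cone_in C F \<triangleleft> F"
    unfolding Cone_unfold by (simp add: K(11) assms o)
  show "X = Dom B F \<Longrightarrow> Cone_incyl F \<triangleleft> d1 X = zr X (Cone C F)"
    unfolding Cone_incyl_def using K(12)[of X] Cone_in2[OF assms] by (simp add: assms o)
qed

lemma Cyl_simps [simp]:
  assumes "F \<in> Arr B"
  shows "Cyl C F \<in> Obj B" "Cyl_in C F \<in> Arr B" "Dom B (Cyl_in C F) = Dom B F" "Cod B (Cyl_in C F) = Cyl C F"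
    "Cyl_in1 F \<in> Arr B" "Dom B (Cyl_in1 F) = Cod B F" "Cod B (Cyl_in1 F) = Cyl C F"
    "Cyl_incyl F \<in> Arr B" "Dom B (Cyl_incyl F) = T (Dom B F)" "Cod B (Cyl_incyl F) = Cyl C F"
    "X = Dom B F \<Longrightarrow> Cyl_incyl F \<triangleleft> d0 X = Cyl_in1 F \<triangleleft> F"
    "X = Dom B F \<Longrightarrow> Cyl_incyl F \<triangleleft> d1 X = Cyl_in C F"
proof -
  have o: "Dom B F \<in> Obj B" "Cod B F \<in> Obj B" using assms by simp_all
  note K = K_simps[of F "Ident B (Dom B F)"]
  show "Cyl C F \<in> Obj B" "Cyl_in C F \<in> Arr B" "Dom B (Cyl_in C F) = Dom B F" "Cod B (Cyl_in C F) = Cyl C F"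
    "Cyl_in1 F \<in> Arr B" "Dom B (Cyl_in1 F) = Cod B F" "Cod B (Cyl_in1 F) = Cyl C F"
    "Cyl_incyl F \<in> Arr B" "Dom B (Cyl_incyl F) = T (Dom B F)" "Cod B (Cyl_incyl F) = Cyl C F"
    unfolding Cone_unfold by (simp_all add: K(1-10) assms o)
  show "X = Dom B F \<Longrightarrow> Cyl_incyl F \<triangleleft> d0 X = Cyl_in1 F \<triangleleft> F"
    "X = Dom B F \<Longrightarrow> Cyl_incyl F \<triangleleft> d1 X = Cyl_in C F"
    unfolding Cone_unfold by (simp_all add: K assms o)
qed

lemma Cyl_desc:
  assumes "F \<in> Arr B" "y \<in> Arr B" "z \<in> Arr B" "h \<in> Arr B" "Dom B y = Cod B F" "Dom B z = Dom B F" "Dom B h = T (Dom B F)"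
    "Cod B y = Cod B h" "Cod B z = Cod B h" "y \<triangleleft> F = h \<triangleleft> d0 (Dom B F)" "z = h \<triangleleft> d1 (Dom B F)"
  defines "u \<equiv> K_desc C F (Ident B (Dom B F)) y z h"
  shows "u \<in> Arr B" "Dom B u = Cyl C F" "Cod B u = Cod B h" "u \<triangleleft> Cyl_in1 F = y" "u \<triangleleft> Cyl_in C F = z" "u \<triangleleft> Cyl_incyl F = h"
proof -
  have o: "Dom B F \<in> Obj B" using assms by simp
  note D = K_desc[of F "Ident B (Dom B F)" y z h, folded u_def]
  show "u \<in> Arr B" "Dom B u = Cyl C F" "Cod B u = Cod B h" "u \<triangleleft> Cyl_in1 F = y" "u \<triangleleft> Cyl_in C F = z" "u \<triangleleft> Cyl_incyl F = h"
    unfolding Cone_unfold by (rule D; simp add: assms(1-11) o)+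
qed

text \<open>\<open>Cyl_in\<close> is the end \<open>d1\<close> of the cylinder part, so agreement on
  it follows from agreement on that part.\<close>

lemma Cyl_eqI:
  assumes "F \<in> Arr B" "u \<in> Arr B" "w \<in> Arr B" "Dom B u = Cyl C F" "Dom B w = Cyl C F" "Cod B u = Cod B w"
    "u \<triangleleft> Cyl_in1 F = w \<triangleleft> Cyl_in1 F" "u \<triangleleft> Cyl_incyl F = w \<triangleleft> Cyl_incyl F"
  shows "u = w"
proof (rule K_eqI[of F "Ident B (Dom B F)"])
  have "(u \<triangleleft> Cyl_incyl F) \<triangleleft> d1 (Dom B F) = (w \<triangleleft> Cyl_incyl F) \<triangleleft> d1 (Dom B F)" by (simp only: assms)
  then show "u \<triangleleft> K_in2 C F (Ident B (Dom B F)) = w \<triangleleft> K_in2 C F (Ident B (Dom B F))"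
    unfolding Cone_eq(4)[symmetric] by (simp add: assms(1-6))
  show "u \<triangleleft> K_in1 C F (Ident B (Dom B F)) = w \<triangleleft> K_in1 C F (Ident B (Dom B F))"
    "u \<triangleleft> K_incyl C F (Ident B (Dom B F)) = w \<triangleleft> K_incyl C F (Ident B (Dom B F))"
    using assms(7,8) unfolding Cyl_in1_def Cyl_incyl_def by simp_all
qed (use assms(1-6) in \<open>simp_all add: Cone_eq(3)\<close>)

lemma Cyl_proj_simps [simp]:
  assumes "F \<in> Arr B"
  shows "Cyl_proj C F \<in> Arr B" "Dom B (Cyl_proj C F) = Cyl C F" "Cod B (Cyl_proj C F) = Cod B F"
    "Cyl_proj C F \<triangleleft> Cyl_in1 F = Ident B (Cod B F)" "Cyl_proj C F \<triangleleft> Cyl_in C F = F"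
    "Cyl_proj C F \<triangleleft> Cyl_incyl F = F \<triangleleft> sg (Dom B F)"
proof -
  have o: "Dom B F \<in> Obj B" "Cod B F \<in> Obj B" using assms by simp_all
  note D = Cyl_desc[of F "Ident B (Cod B F)" F "F \<triangleleft> sg (Dom B F)", folded Cone_eq(5)]
  show "Cyl_proj C F \<in> Arr B" "Dom B (Cyl_proj C F) = Cyl C F"
    "Cyl_proj C F \<triangleleft> Cyl_in1 F = Ident B (Cod B F)" "Cyl_proj C F \<triangleleft> Cyl_in C F = F"
    "Cyl_proj C F \<triangleleft> Cyl_incyl F = F \<triangleleft> sg (Dom B F)"
    by (rule D; simp add: assms o)+
  show "Cod B (Cyl_proj C F) = Cod B F" by (subst D(3); simp add: assms o)
qed

text \<open>Once the identity leg is absorbed, the mapping cylinder is the pushout of the end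
  \<open>d0\<close> along \<open>F\<close>. That end is a trivial cofibration, and
  \<open>Cyl_in1 F\<close> is the pushed out map.\<close>

lemma Cyl_in1_W:
  assumes F: "F \<in> Arr B" shows "Cyl_in1 F \<in> W"
proof -
  let ?X = "Dom B F" and ?K = "Cyl C F"
  have o: "?X \<in> Obj B" "Cod B F \<in> Obj B" using F by simp_all
  have "is_pushout B (d0 ?X) F ?K (Cyl_incyl F) (Cyl_in1 F)"
  proof (rule pushoutI[where x="?X" and y="T ?X" and z="Cod B F"])
    show "\<exists>u. u \<in> hom B ?K t \<and> u \<triangleleft> Cyl_incyl F = h \<and> u \<triangleleft> Cyl_in1 F = l"
      if "t \<in> Obj B" and h: "h \<in> hom B (T ?X) t" and l: "l \<in> hom B (Cod B F) t" and e: "h \<triangleleft> d0 ?X = l \<triangleleft> F" for t h l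
    proof -
      note hl = homD[OF h] homD[OF l]
      have "h \<triangleleft> d1 ?X \<in> Arr B" "Dom B (h \<triangleleft> d1 ?X) = ?X" "Cod B (h \<triangleleft> d1 ?X) = t" by (simp_all add: hl o)
      note D = Cyl_desc[OF F hl(4) this(1) hl(1,5) this(2) hl(2) _ _ e[symmetric] refl, unfolded this(3) hl(3,6), OF refl refl]
      show ?thesis
        by (intro exI[of _ "K_desc C F (Ident B ?X) l (h \<triangleleft> d1 ?X) h"] conjI) (simp_all add: hom_def D)
    qed
    show "u = w" if u: "u \<in> hom B ?K t" "w \<in> hom B ?K t" and e: "u \<triangleleft> Cyl_incyl F = w \<triangleleft> Cyl_incyl F"
      "u \<triangleleft> Cyl_in1 F = w \<triangleleft> Cyl_in1 F" for t u w
      using Cyl_eqI[OF F homD(1)[OF u(1)] homD(1)[OF u(2)] homD(2)[OF u(1)] homD(2)[OF u(2)] _ e(2,1)] homD(3)[OF u(1)] homD(3)[OF u(2)]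
      by simp
  qed (use F o in \<open>simp_all add: hom_def\<close>)
  then show ?thesis using Cof_W_pushout[OF e0_Cof e_W] o(1) by blast
qed

lemma Cyl_proj_W: "F \<in> Arr B \<Longrightarrow> Cyl_proj C F \<in> W"
  using W_retract[OF Cyl_proj_simps(4) Cyl_in1_W, of F "Cyl C F"] by (simp add: hom_def)

text \<open>The leg of the defining pushout from the coproduct of the two targets is a pushout of
  the inclusion of both ends of the cylinder, hence a cofibration. Preceding it by the inclusion of
  the second summand gives \<open>Cyl_in C F\<close>.\<close>

lemma Cyl_in_Cof:
  assumes F: "F \<in> Arr B" shows "Cyl_in C F \<in> Cof"
proof -
  let ?X = "Dom B F"
  let ?p = "fst (snd (K_pushout C F (Ident B ?X)))"
  have o: "?X \<in> Obj B" "Cod B F \<in> Obj B" using F by simp_all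
  have "is_pushout B (coprod_map B F (Ident B ?X)) (cotuple B (d0 ?X) (d1 ?X)) (K_ob C F (Ident B ?X)) ?p (K_incyl C F (Ident B ?X))"
    by (rule K_pushout_is[of _ _ "Cod B F" _ ?X]) (use F in \<open>simp_all add: hom_def\<close>)
  note p = pushout_sym[OF this]
  have pC: "?p \<in> Cof" by (rule Cof_pushout[OF cyl_cof[OF o(1)] p])
  have pd: "Dom B ?p = coprod_ob B (Cod B F) ?X" using is_pushoutD(6)[OF p] F o by (simp add: hom_def)
  have "in2 B (Cod B F) ?X \<in> Cof" by (rule in_Cof(2)) (rule o)+
  then have "?p \<triangleleft> in2 B (Cod B F) ?X \<in> Cof" by (rule Cof_comp[OF _ pC]) (simp add: pd o)
  moreover have "Cyl_in C F = ?p \<triangleleft> in2 B (Cod B F) ?X" using F o by (simp add: Cone_eq(4) K_in2_def)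
  ultimately show ?thesis by simp
qed

lemma Cone_desc:
  assumes F: "F \<in> Arr B" "y \<in> Arr B" "h \<in> Arr B" "Dom B y = Cod B F" "Dom B h = T (Dom B F)" "Cod B y = Cod B h"
    "y \<triangleleft> F = h \<triangleleft> d0 (Dom B F)" "h \<triangleleft> d1 (Dom B F) = zr (Dom B F) (Cod B h)"
  shows "Cone_desc F y h \<in> Arr B" "Dom B (Cone_desc F y h) = Cone C F" "Cod B (Cone_desc F y h) = Cod B h"
    "Cone_desc F y h \<triangleleft> Cone_in C F = y" "Cone_desc F y h \<triangleleft> Cone_incyl F = h"
    "k \<in> Arr B \<Longrightarrow> Cod B k = Cod B F \<Longrightarrow> Cone_desc F y h \<triangleleft> (Cone_in C F \<triangleleft> k) = y \<triangleleft> k"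
    "k \<in> Arr B \<Longrightarrow> Cod B k = T (Dom B F) \<Longrightarrow> Cone_desc F y h \<triangleleft> (Cone_incyl F \<triangleleft> k) = h \<triangleleft> k"
proof -
  have o: "Dom B F \<in> Obj B" "Cod B h \<in> Obj B" using F by simp_all
  note D = K_desc[of F "tz (Dom B F)" y "fz (Cod B y)" h, folded Cone_desc_def]
  show 1: "Cone_desc F y h \<in> Arr B" "Dom B (Cone_desc F y h) = Cone C F" "Cod B (Cone_desc F y h) = Cod B h"
    "Cone_desc F y h \<triangleleft> Cone_in C F = y" "Cone_desc F y h \<triangleleft> Cone_incyl F = h"
    unfolding Cone_unfold by (rule D; simp add: F o)+
  show "k \<in> Arr B \<Longrightarrow> Cod B k = Cod B F \<Longrightarrow> Cone_desc F y h \<triangleleft> (Cone_in C F \<triangleleft> k) = y \<triangleleft> k"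
    "k \<in> Arr B \<Longrightarrow> Cod B k = T (Dom B F) \<Longrightarrow> Cone_desc F y h \<triangleleft> (Cone_incyl F \<triangleleft> k) = h \<triangleleft> k"
    using comp_ext[OF 1(4)] comp_ext[OF 1(5)] by (simp_all add: 1(1-3) F(1))
qed

lemma Cone_eqI:
  assumes "F \<in> Arr B" "u \<in> Arr B" "w \<in> Arr B" "Dom B u = Cone C F" "Dom B w = Cone C F" "Cod B u = Cod B w"
    "u \<triangleleft> Cone_in C F = w \<triangleleft> Cone_in C F" "u \<triangleleft> Cone_incyl F = w \<triangleleft> Cone_incyl F"
  shows "u = w"
proof (rule K_eqI[of F "tz (Dom B F)"])
  show "u \<triangleleft> K_in2 C F (tz (Dom B F)) = w \<triangleleft> K_in2 C F (tz (Dom B F))"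
    unfolding Cone_in2[OF assms(1)] by (simp add: assms(1-6))
  show "u \<triangleleft> K_in1 C F (tz (Dom B F)) = w \<triangleleft> K_in1 C F (tz (Dom B F))"
    "u \<triangleleft> K_incyl C F (tz (Dom B F)) = w \<triangleleft> K_incyl C F (tz (Dom B F))"
    using assms(7,8) unfolding Cone_unfold by simp_all
qed (use assms(1-6) in \<open>simp_all add: Cone_eq(1)\<close>)

lemma Cone_map:
  assumes F: "F \<in> Arr B" "F' \<in> Arr B" "x \<in> Arr B" "y \<in> Arr B" "Dom B x = Dom B F" "Cod B x = Dom B F'"
    "Dom B y = Cod B F" "Cod B y = Cod B F'" "y \<triangleleft> F = F' \<triangleleft> x"
  shows "Cone_map C F F' x y \<in> Arr B" "Dom B (Cone_map C F F' x y) = Cone C F" "Cod B (Cone_map C F F' x y) = Cone C F'"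
    "Cone_map C F F' x y \<triangleleft> Cone_in C F = Cone_in C F' \<triangleleft> y"
    "Cone_map C F F' x y \<triangleleft> Cone_incyl F = Cone_incyl F' \<triangleleft> tm x"
    "k \<in> Arr B \<Longrightarrow> Cod B k = Cod B F \<Longrightarrow> Cone_map C F F' x y \<triangleleft> (Cone_in C F \<triangleleft> k) = Cone_in C F' \<triangleleft> (y \<triangleleft> k)"
    "k \<in> Arr B \<Longrightarrow> Cod B k = T (Dom B F) \<Longrightarrow> Cone_map C F F' x y \<triangleleft> (Cone_incyl F \<triangleleft> k) = Cone_incyl F' \<triangleleft> (tm x \<triangleleft> k)"
    "x \<in> W \<Longrightarrow> y \<in> W \<Longrightarrow> Cone_map C F F' x y \<in> W"
proof -
  have o: "Dom B F \<in> Obj B" "Dom B F' \<in> Obj B" using F(1,2) by simp_all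
  have xt: "Dom B x \<in> Obj B" by (simp add: F)
  have z: "Ident B z0 \<triangleleft> tz (Dom B F) = tz (Dom B F') \<triangleleft> x" by (simp add: F(3,5,6) o)
  note M = K_map[OF F(1) _ _ F(2) _ _ F(3,4) _ _ _ F(7,8) _ _ F(9) z, folded Cone_eq(6)]
  show "Cone_map C F F' x y \<in> Arr B" "Dom B (Cone_map C F F' x y) = Cone C F" "Cod B (Cone_map C F F' x y) = Cone C F'"
    "Cone_map C F F' x y \<triangleleft> Cone_in C F = Cone_in C F' \<triangleleft> y"
    "Cone_map C F F' x y \<triangleleft> Cone_incyl F = Cone_incyl F' \<triangleleft> tm x"
    unfolding Cone_eq(1,2) Cone_incyl_def by (rule M; simp add: F(1-8) o)+
  show "Cone_map C F F' x y \<triangleleft> (Cone_in C F \<triangleleft> k) = Cone_in C F' \<triangleleft> (y \<triangleleft> k)" if "k \<in> Arr B" "Cod B k = Cod B F" for k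
    unfolding Cone_eq(1,2) Cone_incyl_def by (rule M; simp add: F(1-8) o that)
  show "Cone_map C F F' x y \<triangleleft> (Cone_incyl F \<triangleleft> k) = Cone_incyl F' \<triangleleft> (tm x \<triangleleft> k)" if "k \<in> Arr B" "Cod B k = T (Dom B F)" for k
    unfolding Cone_eq(1,2) Cone_incyl_def by (rule M; simp add: F(1-8) o that)
  show "Cone_map C F F' x y \<in> W" if "x \<in> W" "y \<in> W"
    by (rule M; simp add: F(1-8) o that)
qed

text \<open>The generators of \<open>\<Theta>(F)\<close>: \<open>Y\<close> and the two cylinders.\<close>

definition "Theta_in F = Cone_in C (Cyl_in C F) \<triangleleft> Cyl_in1 F"
definition "Theta_incyl F = Cone_in C (Cyl_in C F) \<triangleleft> Cyl_incyl F"
definition "Theta_incone F = Cone_incyl (Cyl_in C F)"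

lemma Theta_in_simps [simp]:
  assumes "F \<in> Arr B"
  shows "Theta_in F \<in> Arr B" "Dom B (Theta_in F) = Cod B F" "Cod B (Theta_in F) = Cone C (Cyl_in C F)"
    "Theta_incyl F \<in> Arr B" "Dom B (Theta_incyl F) = T (Dom B F)" "Cod B (Theta_incyl F) = Cone C (Cyl_in C F)"
    "Theta_incone F \<in> Arr B" "Dom B (Theta_incone F) = T (Dom B F)" "Cod B (Theta_incone F) = Cone C (Cyl_in C F)"
  unfolding Theta_in_def Theta_incyl_def Theta_incone_def by (simp_all add: assms)

lemma Theta_eqI:
  assumes F: "F \<in> Arr B" and u: "u \<in> Arr B" "w \<in> Arr B" "Dom B u = Cone C (Cyl_in C F)" "Dom B w = Cone C (Cyl_in C F)"
    "Cod B u = Cod B w" and e: "u \<triangleleft> Theta_in F = w \<triangleleft> Theta_in F" "u \<triangleleft> Theta_incyl F = w \<triangleleft> Theta_incyl F" "u \<triangleleft> Theta_incone F = w \<triangleleft> Theta_incone F"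
  shows "u = w"
proof (rule Cone_eqI[of "Cyl_in C F"])
  let ?I = "Cone_in C (Cyl_in C F)"
  show "u \<triangleleft> ?I = w \<triangleleft> ?I"
  proof (rule Cyl_eqI[of F])
    show "(u \<triangleleft> ?I) \<triangleleft> Cyl_in1 F = (w \<triangleleft> ?I) \<triangleleft> Cyl_in1 F"
      using e(1) by (simp add: Theta_in_def F u)
    show "(u \<triangleleft> ?I) \<triangleleft> Cyl_incyl F = (w \<triangleleft> ?I) \<triangleleft> Cyl_incyl F"
      using e(2) by (simp add: Theta_incyl_def F u)
  qed (simp_all add: F u)
  show "u \<triangleleft> Cone_incyl (Cyl_in C F) = w \<triangleleft> Cone_incyl (Cyl_in C F)"
    using e(3) by (simp add: Theta_incone_def F)
qed (simp_all add: F u)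

lemma Theta_map:
  assumes F: "F \<in> Arr B" "G \<in> Arr B" "x \<in> Arr B" "y \<in> Arr B" "Dom B x = Dom B F" "Cod B x = Dom B G"
    "Dom B y = Cyl C F" "Cod B y = Cod B G" "y \<triangleleft> Cyl_in C F = G \<triangleleft> x"
  shows "Cone_map C (Cyl_in C F) G x y \<in> Arr B" "Dom B (Cone_map C (Cyl_in C F) G x y) = Cone C (Cyl_in C F)"
    "Cod B (Cone_map C (Cyl_in C F) G x y) = Cone C G"
    "Cone_map C (Cyl_in C F) G x y \<triangleleft> Theta_in F = Cone_in C G \<triangleleft> (y \<triangleleft> Cyl_in1 F)"
    "Cone_map C (Cyl_in C F) G x y \<triangleleft> Theta_incyl F = Cone_in C G \<triangleleft> (y \<triangleleft> Cyl_incyl F)"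
    "Cone_map C (Cyl_in C F) G x y \<triangleleft> Theta_incone F = Cone_incyl G \<triangleleft> tm x"
proof -
  note M = Cone_map[of "Cyl_in C F" G x y]
  show "Cone_map C (Cyl_in C F) G x y \<in> Arr B" "Dom B (Cone_map C (Cyl_in C F) G x y) = Cone C (Cyl_in C F)"
    "Cod B (Cone_map C (Cyl_in C F) G x y) = Cone C G"
    "Cone_map C (Cyl_in C F) G x y \<triangleleft> Theta_in F = Cone_in C G \<triangleleft> (y \<triangleleft> Cyl_in1 F)"
    "Cone_map C (Cyl_in C F) G x y \<triangleleft> Theta_incyl F = Cone_in C G \<triangleleft> (y \<triangleleft> Cyl_incyl F)"
    "Cone_map C (Cyl_in C F) G x y \<triangleleft> Theta_incone F = Cone_incyl G \<triangleleft> tm x"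
    unfolding Theta_in_def Theta_incyl_def Theta_incone_def by (rule M; use F in \<open>simp only: Cyl_simps\<close>)+
qed

text \<open>The inner cylinder, the one in \<open>Cyl C F\<close>, is collapsed and the outer one,
  of the cone, is kept. The map is induced by an identity and the weak equivalence
  \<open>Cyl_proj C F\<close>, so homotopy invariance makes it a weak equivalence.\<close>

lemma Theta_alpha [simp]:
  assumes F: "F \<in> Arr B"
  shows "Theta_alpha C F \<in> Arr B" "Dom B (Theta_alpha C F) = Cone C (Cyl_in C F)" "Cod B (Theta_alpha C F) = Cone C F"
    "Theta_alpha C F \<triangleleft> Theta_in F = Cone_in C F"
    "Theta_alpha C F \<triangleleft> Theta_incyl F = Cone_in C F \<triangleleft> (F \<triangleleft> sg (Dom B F))"
    "Theta_alpha C F \<triangleleft> Theta_incone F = Cone_incyl F" "Theta_alpha C F \<in> W"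
proof -
  have o: "Dom B F \<in> Obj B" "Cod B F \<in> Obj B" using F by simp_all
  have a: "Theta_alpha C F = Cone_map C (Cyl_in C F) F (Ident B (Dom B F)) (Cyl_proj C F)"
    by (simp add: Theta_alpha_def)
  note M = Theta_map[of F F "Ident B (Dom B F)" "Cyl_proj C F"]
  show "Theta_alpha C F \<in> Arr B" "Dom B (Theta_alpha C F) = Cone C (Cyl_in C F)" "Cod B (Theta_alpha C F) = Cone C F"
    "Theta_alpha C F \<triangleleft> Theta_in F = Cone_in C F"
    "Theta_alpha C F \<triangleleft> Theta_incyl F = Cone_in C F \<triangleleft> (F \<triangleleft> sg (Dom B F))"
    "Theta_alpha C F \<triangleleft> Theta_incone F = Cone_incyl F"
    unfolding a by (simp_all add: M F o)
  show "Theta_alpha C F \<in> W" unfolding a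
    by (rule Cone_map(8)) (simp_all add: F o Cyl_proj_W)
qed

section \<open>Suspension and the map to the cone plus the suspension\<close>

lemma Lambda_in:
  assumes "X \<in> Obj B"
  shows "K_in1 C (tz X) (tz X) = fz (Lambda C X)" "K_in2 C (tz X) (tz X) = fz (Lambda C X)"
  unfolding Cone_eq(7) by (rule from_z0; simp add: assms)+

lemma Lambda_simps [simp]:
  assumes "X \<in> Obj B"
  shows "Lambda C X \<in> Obj B" "Lambda_incyl C X \<in> Arr B" "Dom B (Lambda_incyl C X) = T X" "Cod B (Lambda_incyl C X) = Lambda C X"
    "Lambda_incyl C X \<triangleleft> d0 X = zr X (Lambda C X)" "Lambda_incyl C X \<triangleleft> d1 X = zr X (Lambda C X)"
proof -
  note K = K_simps[of "tz X" "tz X"]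
  show "Lambda C X \<in> Obj B" "Lambda_incyl C X \<in> Arr B" "Dom B (Lambda_incyl C X) = T X" "Cod B (Lambda_incyl C X) = Lambda C X"
    unfolding Cone_eq(7,8) by (simp_all add: assms)
  show "Lambda_incyl C X \<triangleleft> d0 X = zr X (Lambda C X)" "Lambda_incyl C X \<triangleleft> d1 X = zr X (Lambda C X)"
    unfolding Cone_eq(8) by (simp_all add: assms Lambda_in)
qed

lemma Cyl_to_Cone:
  assumes F: "F \<in> Arr B"
  shows "Cyl_to_Cone C F \<in> Arr B" "Dom B (Cyl_to_Cone C F) = Cyl C F" "Cod B (Cyl_to_Cone C F) = Cone C F"
    "Cyl_to_Cone C F \<triangleleft> Cyl_in1 F = Cone_in C F" "Cyl_to_Cone C F \<triangleleft> Cyl_in C F = zr (Dom B F) (Cone C F)"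
    "Cyl_to_Cone C F \<triangleleft> Cyl_incyl F = Cone_incyl F"
proof -
  have o: "Dom B F \<in> Obj B" "Cod B F \<in> Obj B" using F by simp_all
  have a: "Cyl_to_Cone C F = K_map C F (Ident B (Dom B F)) F (tz (Dom B F)) (Ident B (Dom B F)) (Ident B (Cod B F)) (tz (Dom B F))"
    by (simp add: Cyl_to_Cone_def)
  note M = K_map[of F "Ident B (Dom B F)" F "tz (Dom B F)" "Ident B (Dom B F)" "Ident B (Cod B F)" "tz (Dom B F)", folded a]
  show "Cyl_to_Cone C F \<in> Arr B" "Dom B (Cyl_to_Cone C F) = Cyl C F" "Cod B (Cyl_to_Cone C F) = Cone C F"
    unfolding Cone_eq(1,3) by (rule M; simp add: F o)+
  show "Cyl_to_Cone C F \<triangleleft> Cyl_in1 F = Cone_in C F" unfolding Cyl_in1_def by (subst M(4)) (simp_all add: F o Cone_eq(2))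
  show "Cyl_to_Cone C F \<triangleleft> Cyl_incyl F = Cone_incyl F" unfolding Cyl_incyl_def by (subst M(6)) (simp_all add: F o Cone_incyl_def)
  show "Cyl_to_Cone C F \<triangleleft> Cyl_in C F = zr (Dom B F) (Cone C F)" unfolding Cone_eq(4)
    by (subst M(5)) (simp_all add: F o Cone_in2)
qed

lemma Cone_zero_iso:
  assumes o: "X \<in> Obj B" "Z \<in> Obj B"
  shows "Cone_zero_iso C X Z \<in> Arr B" "Dom B (Cone_zero_iso C X Z) = Cone C (zr X Z)"
    "Cod B (Cone_zero_iso C X Z) = coprod_ob B Z (Lambda C X)"
    "Cone_zero_iso C X Z \<triangleleft> Cone_in C (zr X Z) = in1 B Z (Lambda C X)"
    "Cone_zero_iso C X Z \<triangleleft> Cone_incyl (zr X Z) = in2 B Z (Lambda C X) \<triangleleft> Lambda_incyl C X"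
    "k \<in> Arr B \<Longrightarrow> Cod B k = Z \<Longrightarrow> Cone_zero_iso C X Z \<triangleleft> (Cone_in C (zr X Z) \<triangleleft> k) = in1 B Z (Lambda C X) \<triangleleft> k"
proof -
  have a: "Cone_zero_iso C X Z = Cone_desc (zr X Z) (in1 B Z (Lambda C X)) (in2 B Z (Lambda C X) \<triangleleft> Lambda_incyl C X)"
    using o by (simp add: Cone_zero_iso_def Cone_desc_def)
  note D = Cone_desc[of "zr X Z" "in1 B Z (Lambda C X)" "in2 B Z (Lambda C X) \<triangleleft> Lambda_incyl C X", folded a]
  show "Cone_zero_iso C X Z \<in> Arr B" "Dom B (Cone_zero_iso C X Z) = Cone C (zr X Z)"
    "Cone_zero_iso C X Z \<triangleleft> Cone_in C (zr X Z) = in1 B Z (Lambda C X)"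
    "Cone_zero_iso C X Z \<triangleleft> Cone_incyl (zr X Z) = in2 B Z (Lambda C X) \<triangleleft> Lambda_incyl C X"
    by (rule D; simp add: o)+
  show "Cod B (Cone_zero_iso C X Z) = coprod_ob B Z (Lambda C X)" by (subst D(3)) (simp_all add: o)
  show "Cone_zero_iso C X Z \<triangleleft> (Cone_in C (zr X Z) \<triangleleft> k) = in1 B Z (Lambda C X) \<triangleleft> k" if "k \<in> Arr B" "Cod B k = Z" for k
    by (rule D; simp add: o that)
qed

text \<open>Complementary to \<open>Theta_alpha\<close>: the inner cylinder is kept and becomes the
  cone of \<open>F\<close>, while the outer cylinder becomes the suspension because the copy of
  \<open>X\<close> on which it stands is sent to zero.\<close>

lemma Theta_beta [simp]:
  assumes F: "F \<in> Arr B"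
  shows "Theta_beta C F \<in> Arr B" "Dom B (Theta_beta C F) = Cone C (Cyl_in C F)"
    "Cod B (Theta_beta C F) = coprod_ob B (Cone C F) (Lambda C (Dom B F))"
    "Theta_beta C F \<triangleleft> Theta_in F = in1 B (Cone C F) (Lambda C (Dom B F)) \<triangleleft> Cone_in C F"
    "Theta_beta C F \<triangleleft> Theta_incyl F = in1 B (Cone C F) (Lambda C (Dom B F)) \<triangleleft> Cone_incyl F"
    "Theta_beta C F \<triangleleft> Theta_incone F = in2 B (Cone C F) (Lambda C (Dom B F)) \<triangleleft> Lambda_incyl C (Dom B F)"
proof -
  let ?Z = "zr (Dom B F) (Cone C F)"
  have o: "Dom B F \<in> Obj B" "Cod B F \<in> Obj B" "?Z \<in> Arr B" "Dom B ?Z = Dom B F" "Cod B ?Z = Cone C F" using F by simp_all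
  let ?M = "Cone_map C (Cyl_in C F) ?Z (Ident B (Dom B F)) (Cyl_to_Cone C F)"
  note Cz = Cyl_to_Cone[OF F]
  have M: "?M \<in> Arr B" "Dom B ?M = Cone C (Cyl_in C F)" "Cod B ?M = Cone C ?Z"
    "?M \<triangleleft> Theta_in F = Cone_in C ?Z \<triangleleft> Cone_in C F" "?M \<triangleleft> Theta_incyl F = Cone_in C ?Z \<triangleleft> Cone_incyl F" "?M \<triangleleft> Theta_incone F = Cone_incyl ?Z"
    using Theta_map[of F ?Z "Ident B (Dom B F)" "Cyl_to_Cone C F"] by (simp_all add: F Cz o)
  note I = Cone_zero_iso[of "Dom B F" "Cone C F"]
  have b: "Theta_beta C F = Cone_zero_iso C (Dom B F) (Cone C F) \<triangleleft> ?M" by (simp add: Theta_beta_def)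
  show "Theta_beta C F \<in> Arr B" "Dom B (Theta_beta C F) = Cone C (Cyl_in C F)"
    "Cod B (Theta_beta C F) = coprod_ob B (Cone C F) (Lambda C (Dom B F))"
    "Theta_beta C F \<triangleleft> Theta_in F = in1 B (Cone C F) (Lambda C (Dom B F)) \<triangleleft> Cone_in C F"
    "Theta_beta C F \<triangleleft> Theta_incyl F = in1 B (Cone C F) (Lambda C (Dom B F)) \<triangleleft> Cone_incyl F"
    "Theta_beta C F \<triangleleft> Theta_incone F = in2 B (Cone C F) (Lambda C (Dom B F)) \<triangleleft> Lambda_incyl C (Dom B F)"
    unfolding b by (simp_all add: M F I o)
qed

lemma Lambda_eqI:
  assumes "X \<in> Obj B" "u \<in> Arr B" "w \<in> Arr B" "Dom B u = Lambda C X" "Dom B w = Lambda C X" "Cod B u = Cod B w"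
    "u \<triangleleft> Lambda_incyl C X = w \<triangleleft> Lambda_incyl C X"
  shows "u = w"
proof (rule K_eqI[of "tz X" "tz X"])
  show "u \<triangleleft> K_in1 C (tz X) (tz X) = w \<triangleleft> K_in1 C (tz X) (tz X)" "u \<triangleleft> K_in2 C (tz X) (tz X) = w \<triangleleft> K_in2 C (tz X) (tz X)"
    by (rule from_z0; use assms Cone_eq in simp)+
qed (use assms Cone_eq in simp_all)

lemma Lambda_map:
  assumes x: "x \<in> Arr B"
  shows "Lambda_map C x \<in> Arr B" "Dom B (Lambda_map C x) = Lambda C (Dom B x)" "Cod B (Lambda_map C x) = Lambda C (Cod B x)"
    "X = Dom B x \<Longrightarrow> Lambda_map C x \<triangleleft> Lambda_incyl C X = Lambda_incyl C (Cod B x) \<triangleleft> tm x"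
    "x \<in> W \<Longrightarrow> Lambda_map C x \<in> W"
proof -
  have o: "Dom B x \<in> Obj B" "Cod B x \<in> Obj B" using x by simp_all
  have a: "Lambda_map C x = K_map C (tz (Dom B x)) (tz (Dom B x)) (tz (Cod B x)) (tz (Cod B x)) x (Ident B z0) (Ident B z0)"
    by (simp add: Lambda_map_def)
  note M = K_map[of "tz (Dom B x)" "tz (Dom B x)" "tz (Cod B x)" "tz (Cod B x)" x "Ident B z0" "Ident B z0", folded a]
  show "Lambda_map C x \<in> Arr B" "Dom B (Lambda_map C x) = Lambda C (Dom B x)" "Cod B (Lambda_map C x) = Lambda C (Cod B x)"
    unfolding Cone_eq(7) by (rule M; simp add: o x)+
  show "X = Dom B x \<Longrightarrow> Lambda_map C x \<triangleleft> Lambda_incyl C X = Lambda_incyl C (Cod B x) \<triangleleft> tm x"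
    unfolding Cone_eq(8) by (simp only:) (rule M; simp add: o x)
  show "x \<in> W \<Longrightarrow> Lambda_map C x \<in> W" by (rule M; simp add: o x)
qed

text \<open>Suspension of arrows of the localization is defined by evaluating zigzags. Functoriality
  of \<open>Lambda_map\<close>, together with its homotopy invariance, makes this evaluation well
  defined and functorial.\<close>

lemma Lambda_inverting: "inverting_functor B L W (Lambda C) (\<lambda>x. Q (Lambda_map C x))"
proof unfold_locales
  show "Lambda C X \<in> Obj L" if "X \<in> Obj B" for X using that by simp
  show "Q (Lambda_map C f) \<in> hom L (Lambda C X) (Lambda C Y)" if "f \<in> hom B X Y" for f X Y
    using Lambda_map(1-3)[OF homD(1)[OF that]] homD(2,3)[OF that] by (intro loc_arr_hom) (simp add: hom_def)
  show "Q (Lambda_map C (Ident B X)) = Ident L (Lambda C X)" if X: "X \<in> Obj B" for X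
  proof -
    have i: "Ident B X \<in> Arr B" "Dom B (Ident B X) = X" "Cod B (Ident B X) = X" using X by simp_all
    note M = Lambda_map[OF i(1), unfolded i(2,3)]
    have "Lambda_map C (Ident B X) = Ident B (Lambda C X)"
      by (rule Lambda_eqI[OF X]) (simp_all add: M(1-3) M(4)[OF refl] X)
    then show ?thesis using X by (simp add: Q_Ident)
  qed
  show "Q (Lambda_map C (g \<triangleleft> f)) = Q (Lambda_map C g) \<star> Q (Lambda_map C f)"
    if fg: "f \<in> Arr B" "g \<in> Arr B" "Dom B g = Cod B f" for f g
  proof -
    have c: "g \<triangleleft> f \<in> Arr B" "Dom B (g \<triangleleft> f) = Dom B f" "Cod B (g \<triangleleft> f) = Cod B g" using fg by simp_all
    note Mf = Lambda_map[OF fg(1)] and Mg = Lambda_map[OF fg(2), unfolded fg(3)] and M = Lambda_map[OF c(1), unfolded c(2,3)]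
    have o: "Dom B f \<in> Obj B" "Cod B f \<in> Obj B" "Cod B g \<in> Obj B" using fg by simp_all
    have t: "tm (g \<triangleleft> f) = tm g \<triangleleft> tm f" using tm_comp[of f "Dom B f" "Cod B f" g "Cod B g"] fg by (simp add: hom_def)
    have tt: "tm f \<in> Arr B" "Dom B (tm f) = T (Dom B f)" "Cod B (tm f) = T (Cod B f)"
      "tm g \<in> Arr B" "Dom B (tm g) = T (Cod B f)" "Cod B (tm g) = T (Cod B g)"
      using tm_arr[of f] tm_arr[of g] fg by simp_all
    have "Lambda_map C (g \<triangleleft> f) = Lambda_map C g \<triangleleft> Lambda_map C f"
    proof (rule Lambda_eqI[of "Dom B f"])
      have "(Lambda_map C g \<triangleleft> Lambda_map C f) \<triangleleft> Lambda_incyl C (Dom B f) = Lambda_map C g \<triangleleft> (Lambda_map C f \<triangleleft> Lambda_incyl C (Dom B f))"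
        by (rule comp_assoc) (simp_all add: Mf(1-3) Mg(1-3) o)
      also have "\<dots> = Lambda_map C g \<triangleleft> (Lambda_incyl C (Cod B f) \<triangleleft> tm f)" by (simp only: Mf(4)[OF refl])
      also have "\<dots> = (Lambda_map C g \<triangleleft> Lambda_incyl C (Cod B f)) \<triangleleft> tm f"
        by (rule comp_assoc[symmetric]) (simp_all add: Mf(1-3) Mg(1-3) o tt)
      also have "\<dots> = (Lambda_incyl C (Cod B g) \<triangleleft> tm g) \<triangleleft> tm f" by (simp only: Mg(4)[OF refl])
      also have "\<dots> = Lambda_incyl C (Cod B g) \<triangleleft> (tm g \<triangleleft> tm f)"
        by (rule comp_assoc) (simp_all add: o tt)
      finally show "Lambda_map C (g \<triangleleft> f) \<triangleleft> Lambda_incyl C (Dom B f) = (Lambda_map C g \<triangleleft> Lambda_map C f) \<triangleleft> Lambda_incyl C (Dom B f)"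
        by (simp only: M(4)[OF refl] t)
    qed (simp_all add: Mf(1-3) Mg(1-3) M(1-3) o)
    then show ?thesis using Mf(1-3) Mg(1-3) by (simp add: Q_comp)
  qed
  show "is_iso L (Q (Lambda_map C w))" if "w \<in> W" "w \<in> Arr B" for w
    using Lambda_map(1,5)[OF that(2)] that(1) by simp
qed

text \<open>Attaching a zero object at each end of the cylinder is the same as collapsing both ends
  to one zero object, since maps out of a zero object are unique. So \<open>Lambda C X\<close> is
  the Brown suspension formed with this cylinder.\<close>

lemma Lambda_cofiber:
  assumes X: "X \<in> Obj B" shows "is_cofiber B (cotuple B (d0 X) (d1 X)) (Lambda_incyl C X)"
proof -
  let ?c = "cotuple B (d0 X) (d1 X)"
  have "is_pushout B ?c (tz (coprod_ob B X X)) (Lambda C X) (Lambda_incyl C X) (fz (Lambda C X))"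
  proof (rule pushoutI[where x="coprod_ob B X X" and y="T X" and z=z0])
    show "Lambda_incyl C X \<triangleleft> ?c = fz (Lambda C X) \<triangleleft> tz (coprod_ob B X X)"
      by (rule cotuple_eqI[of _ _ X X]) (simp_all add: X)
    show "\<exists>u. u \<in> hom B (Lambda C X) t \<and> u \<triangleleft> Lambda_incyl C X = h \<and> u \<triangleleft> fz (Lambda C X) = l"
      if t: "t \<in> Obj B" and h: "h \<in> hom B (T X) t" and l: "l \<in> hom B z0 t" and e: "h \<triangleleft> ?c = l \<triangleleft> tz (coprod_ob B X X)" for t h l
    proof -
      note hl = homD[OF h] homD[OF l]
      have lz: "l = fz t" by (rule from_z0) (simp_all add: hl t)
      have "(h \<triangleleft> ?c) \<triangleleft> in1 B X X = zr X t" "(h \<triangleleft> ?c) \<triangleleft> in2 B X X = zr X t" unfolding e lz by (simp_all add: X t)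
      then have z: "h \<triangleleft> d0 X = zr X t" "h \<triangleleft> d1 X = zr X t" by (simp_all add: X hl)
      let ?u = "K_desc C (tz X) (tz X) (fz t) (fz t) h"
      note D = K_desc[of "tz X" "tz X" "fz t" "fz t" h, folded Cone_eq(7,8)]
      have 1: "?u \<in> Arr B" "Dom B ?u = Lambda C X" "?u \<triangleleft> Lambda_incyl C X = h" by (rule D; simp add: X t hl z)+
      have 2: "Cod B ?u = t" by (subst D(3)) (simp_all add: X t hl z)
      show ?thesis
        by (intro exI[of _ ?u] conjI) (simp_all add: hom_def 1 2 X lz)
    qed
    show "u = w" if "u \<in> hom B (Lambda C X) t" "w \<in> hom B (Lambda C X) t" "u \<triangleleft> Lambda_incyl C X = w \<triangleleft> Lambda_incyl C X" for t u w
      by (rule Lambda_eqI[OF X]) (use that in \<open>simp_all add: hom_def\<close>)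
  qed (simp_all add: hom_def X)
  then show ?thesis by (simp add: is_cofiber_def X)
qed

end

section \<open>The two coactions of a single cofibration\<close>

lemma is_pushout_ex:
  assumes "is_pushout C f g d p q" "h \<in> hom C (Cod C f) t" "k \<in> hom C (Cod C g) t" "t \<in> Obj C" "h \<cdot>\<^bsub>C\<^esub> f = k \<cdot>\<^bsub>C\<^esub> g"
  shows "\<exists>u. u \<in> hom C d t \<and> u \<cdot>\<^bsub>C\<^esub> p = h \<and> u \<cdot>\<^bsub>C\<^esub> q = k"
  using is_pushout_desc[OF assms] by metis

text \<open>One choice of data as in \<open>brown_coaction\<close>, with the pushouts along
  coproduct maps replaced by double pushouts: \<open>m1\<close>, \<open>m2\<close> and
  \<open>j0\<close>, \<open>j1\<close> are the components of the corresponding legs, and the cofiber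
  is spelled out as a pushout.\<close>

locale coaction_data = simplicial_brown C W hh
  for C :: "('o, 'a) cat" and W :: "('o, 'a) smap set" and hh :: "('o, 'a) sobj \<Rightarrow> ('o, 'a) smap" +
  fixes X Y Z c M P :: "('o, 'a) sobj" and i p \<epsilon>0 \<epsilon>1 s u m1 m2 m' v j0 j1 q k :: "('o, 'a) smap"
  assumes i_hom: "i \<in> hom B X Y" and i_Cof: "i \<in> Cof" and p_push: "is_pushout B i (tz X) Z p (fz Z)"
    and eps_hom: "\<epsilon>0 \<in> hom B Y c" "\<epsilon>1 \<in> hom B Y c" and s_hom: "s \<in> hom B c Y" and s_W: "s \<in> W"
    and s_eps: "s \<triangleleft> \<epsilon>0 = Ident B Y" "s \<triangleleft> \<epsilon>1 = Ident B Y"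
    and u_hom: "u \<in> hom B (T X) c" and u_d: "u \<triangleleft> d0 X = \<epsilon>0 \<triangleleft> i" "u \<triangleleft> d1 X = \<epsilon>1 \<triangleleft> i" and s_u: "s \<triangleleft> u = i \<triangleleft> sg X"
    and M_dpo: "is_dpo B i i (d0 X) (d1 X) M m1 m2 m'"
    and v_hom: "v \<in> hom B M c" and v_m: "v \<triangleleft> m1 = \<epsilon>0" "v \<triangleleft> m2 = \<epsilon>1" "v \<triangleleft> m' = u" and v_Cof: "v \<in> Cof"
    and P_dpo: "is_dpo B p p \<epsilon>0 \<epsilon>1 P j0 j1 q"
    and k_hom: "k \<in> hom B (Lambda C X) P" and k_incyl: "k \<triangleleft> Lambda_incyl C X = q \<triangleleft> u"
begin

lemma objs [simp]: "X \<in> Obj B" "Y \<in> Obj B" "Z \<in> Obj B" "c \<in> Obj B" "P \<in> Obj B" "M \<in> Obj B"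
  using hom_obj[OF i_hom] is_pushoutD(4)[OF p_push] hom_obj[OF s_hom] hom_obj[OF k_hom] hom_obj[OF v_hom] by auto

lemma p_hom: "p \<in> hom B Y Z"
  using is_pushoutD(5)[OF p_push] i_hom by (simp add: hom_def)

lemma arrs [simp]:
  "i \<in> Arr B" "Dom B i = X" "Cod B i = Y" "p \<in> Arr B" "Dom B p = Y" "Cod B p = Z"
  "\<epsilon>0 \<in> Arr B" "Dom B \<epsilon>0 = Y" "Cod B \<epsilon>0 = c" "\<epsilon>1 \<in> Arr B" "Dom B \<epsilon>1 = Y" "Cod B \<epsilon>1 = c"
  "s \<in> Arr B" "Dom B s = c" "Cod B s = Y" "u \<in> Arr B" "Dom B u = T X" "Cod B u = c"
  "v \<in> Arr B" "Dom B v = M" "Cod B v = c" "k \<in> Arr B" "Dom B k = Lambda C X" "Cod B k = P"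
  using i_hom p_hom eps_hom s_hom u_hom v_hom k_hom by (simp_all add: hom_def)

lemma arrs' [simp]:
  "m1 \<in> Arr B" "Dom B m1 = Y" "Cod B m1 = M" "m2 \<in> Arr B" "Dom B m2 = Y" "Cod B m2 = M"
  "m' \<in> Arr B" "Dom B m' = T X" "Cod B m' = M"
  "j0 \<in> Arr B" "Dom B j0 = Z" "Cod B j0 = P" "j1 \<in> Arr B" "Dom B j1 = Z" "Cod B j1 = P"
  "q \<in> Arr B" "Dom B q = c" "Cod B q = P"
  using is_dpoD(9-11)[OF M_dpo] is_dpoD(9-11)[OF P_dpo] by (simp_all add: hom_def)

lemma rels:
  "p \<triangleleft> i = zr X Z" "q \<triangleleft> \<epsilon>0 = j0 \<triangleleft> p" "q \<triangleleft> \<epsilon>1 = j1 \<triangleleft> p" "m' \<triangleleft> d0 X = m1 \<triangleleft> i" "m' \<triangleleft> d1 X = m2 \<triangleleft> i"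
  using is_pushoutD(7)[OF p_push] is_dpoD(12,13)[OF M_dpo] is_dpoD(12,13)[OF P_dpo] by simp_all

text \<open>Each relation is included also in a form that applies in front of a further arrow, so
  that the simplifier can decide equalities of right-nested composites in this diagram.\<close>

lemmas comps [simp] = rels s_eps u_d s_u v_m k_incyl[symmetric]
  comp_ext[OF rels(1)] comp_ext2[OF rels(2)] comp_ext2[OF rels(3)] comp_ext2[OF rels(4)] comp_ext2[OF rels(5)]
  comp_ext[OF s_eps(1)] comp_ext[OF s_eps(2)] comp_ext2[OF u_d(1)] comp_ext2[OF u_d(2)] comp_ext2[OF s_u]
  comp_ext[OF v_m(1)] comp_ext[OF v_m(2)] comp_ext[OF v_m(3)] comp_ext2[OF k_incyl[symmetric]]
  comp_ext[OF Lambda_simps(5)[OF objs(1)]] comp_ext[OF Lambda_simps(6)[OF objs(1)]]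

text \<open>\<open>p\<close> is an epimorphism: the other leg of its pushout starts at a zero
  object.\<close>

lemma p_eqI:
  assumes "f \<in> hom B Z t" "g \<in> hom B Z t" "f \<triangleleft> p = g \<triangleleft> p" shows "f = g"
  by (rule pushout_eqI[OF p_push assms(1,2,3)])
     (use hom_obj[OF assms(1)] homD[OF assms(1)] homD[OF assms(2)] in simp)

abbreviation "jk \<equiv> cotuple B j0 k"

text \<open>The map is a pushout of a trivial cofibration. Let \<open>N\<close> be \<open>Y\<close>
  with the cylinder of \<open>X\<close> attached at the end \<open>d0\<close>. The composite from
  \<open>N\<close> through \<open>M\<close> to \<open>c\<close> is a cofibration and restricts to
  \<open>\<epsilon>0\<close> on \<open>Y\<close>, so it is trivial; its pushout along the collapse
  of \<open>N\<close> onto \<open>Z\<close> plus the suspension has vertex \<open>P\<close>.\<close>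

lemma jk_W: "jk \<in> W"
proof -
  have "\<exists>d a b. is_pushout B i (d0 X) d a b" by (rule Cof_pushout_exists[OF i_Cof]) simp_all
  then obtain N n n' where N: "is_pushout B i (d0 X) N n n'" by blast
  have No [simp]: "N \<in> Obj B" using is_pushoutD(4)[OF N] .
  have n [simp]: "n \<in> Arr B" "Dom B n = Y" "Cod B n = N" "n' \<in> Arr B" "Dom B n' = T X" "Cod B n' = N"
    using is_pushoutD(5,6)[OF N] by (simp_all add: hom_def)
  have ni: "n \<triangleleft> i = n' \<triangleleft> d0 X" using is_pushoutD(7)[OF N] .
  have nW: "n \<in> W" by (rule Cof_W_pushout[OF e0_Cof e_W pushout_sym[OF N]]) simp_all
  have "\<exists>\<mu>. \<mu> \<in> hom B N M \<and> \<mu> \<triangleleft> n = m1 \<and> \<mu> \<triangleleft> n' = m'" by (rule is_pushout_ex[OF N]) (simp_all add: hom_def)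
  then obtain \<mu> where \<mu>_hom: "\<mu> \<in> hom B N M" and \<mu>n: "\<mu> \<triangleleft> n = m1" "\<mu> \<triangleleft> n' = m'" by blast
  have \<mu> [simp]: "\<mu> \<in> Arr B" "Dom B \<mu> = N" "Cod B \<mu> = M" using \<mu>_hom by (simp_all add: hom_def)
  \<comment> \<open>\<open>M\<close> arises from \<open>N\<close> by attaching the second copy of
    \<open>Y\<close> along \<open>i\<close> at the end \<open>d1\<close>, so the map from
    \<open>N\<close> to \<open>M\<close> is a cofibration.\<close>
  have "is_pushout B i (n' \<triangleleft> d1 X) M m2 \<mu>"
  proof (rule pushoutI[where x=X and y=Y and z=N])
    show "\<exists>w. w \<in> hom B M t \<and> w \<triangleleft> m2 = h \<and> w \<triangleleft> \<mu> = l"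
      if t: "t \<in> Obj B" and h: "h \<in> hom B Y t" and l: "l \<in> hom B N t" and e: "h \<triangleleft> i = l \<triangleleft> (n' \<triangleleft> d1 X)" for t h l
    proof -
      note hl = homD[OF h] homD[OF l]
      have e0: "(l \<triangleleft> n) \<triangleleft> i = (l \<triangleleft> n') \<triangleleft> d0 X" by (simp add: hl ni)
      have e1: "h \<triangleleft> i = (l \<triangleleft> n') \<triangleleft> d1 X" by (simp add: hl e)
      have "\<exists>w. w \<in> hom B M t \<and> w \<triangleleft> m1 = l \<triangleleft> n \<and> w \<triangleleft> m2 = h \<and> w \<triangleleft> m' = l \<triangleleft> n'"
        by (rule is_dpo_ex[OF M_dpo _ _ _ t e0 e1]) (simp_all add: hom_def hl)
      then obtain w where w: "w \<in> hom B M t" "w \<triangleleft> m1 = l \<triangleleft> n" "w \<triangleleft> m2 = h" "w \<triangleleft> m' = l \<triangleleft> n'" by blast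
      note wh = homD[OF w(1)]
      have "w \<triangleleft> \<mu> = l"
        by (rule pushout_eqI[OF N, of _ t]) (simp_all add: hom_def wh hl \<mu>n w(2-4))
      then show ?thesis using w(1,3) by blast
    qed
    show "w = w'" if w: "w \<in> hom B M t" "w' \<in> hom B M t" and e: "w \<triangleleft> m2 = w' \<triangleleft> m2" "w \<triangleleft> \<mu> = w' \<triangleleft> \<mu>" for t w w'
    proof -
      note wh = homD[OF w(1)] homD[OF w(2)]
      have "(w \<triangleleft> \<mu>) \<triangleleft> n = (w' \<triangleleft> \<mu>) \<triangleleft> n" "(w \<triangleleft> \<mu>) \<triangleleft> n' = (w' \<triangleleft> \<mu>) \<triangleleft> n'" by (simp_all only: e)
      then have "w \<triangleleft> m1 = w' \<triangleleft> m1" "w \<triangleleft> m' = w' \<triangleleft> m'" by (simp_all add: wh \<mu>n)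
      then show ?thesis by (rule dpo_eqI[OF M_dpo w _ e(1)])
    qed
  qed (simp_all add: hom_def comp_ext[OF \<mu>n(2)])
  then have "\<mu> \<in> Cof" by (rule Cof_pushout[OF i_Cof])
  then have wC: "v \<triangleleft> \<mu> \<in> Cof" by (rule Cof_comp[OF _ v_Cof]) simp
  have wn: "(v \<triangleleft> \<mu>) \<triangleleft> n = \<epsilon>0" "(v \<triangleleft> \<mu>) \<triangleleft> n' = u" by (simp_all add: \<mu>n)
  have "\<epsilon>0 \<in> W" by (rule W_section[OF s_eps(1) s_W]) (simp_all add: hom_def)
  then have wW: "v \<triangleleft> \<mu> \<in> W" using W_cancel_right[OF nW, of "v \<triangleleft> \<mu>"] wn by simp
  let ?S = "coprod_ob B Z (Lambda C X)" and ?i1 = "in1 B Z (Lambda C X)" and ?i2 = "in2 B Z (Lambda C X)"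
  \<comment> \<open>Collapse \<open>Y\<close> to \<open>Z\<close> and the cylinder to the
    suspension; on the copy of \<open>X\<close> where they are glued both maps are zero.\<close>
  have "\<exists>\<theta>. \<theta> \<in> hom B N ?S \<and> \<theta> \<triangleleft> n = ?i1 \<triangleleft> p \<and> \<theta> \<triangleleft> n' = ?i2 \<triangleleft> Lambda_incyl C X"
    by (rule is_pushout_ex[OF N]) (simp_all add: hom_def)
  then obtain \<theta> where \<theta>_hom: "\<theta> \<in> hom B N ?S" and \<theta>n: "\<theta> \<triangleleft> n = ?i1 \<triangleleft> p" "\<theta> \<triangleleft> n' = ?i2 \<triangleleft> Lambda_incyl C X" by blast
  have \<theta> [simp]: "\<theta> \<in> Arr B" "Dom B \<theta> = N" "Cod B \<theta> = ?S" using \<theta>_hom by (simp_all add: hom_def)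
  have "is_pushout B (v \<triangleleft> \<mu>) \<theta> P q jk"
  proof (rule pushoutI[where x=N and y=c and z="?S"])
    show "q \<triangleleft> (v \<triangleleft> \<mu>) = jk \<triangleleft> \<theta>"
      by (rule pushout_eqI[OF N, of _ P]) (simp_all add: hom_def \<mu>n \<theta>n)
    show "\<exists>w. w \<in> hom B P t \<and> w \<triangleleft> q = h \<and> w \<triangleleft> jk = l"
      if t: "t \<in> Obj B" and h: "h \<in> hom B c t" and l: "l \<in> hom B ?S t" and e: "h \<triangleleft> (v \<triangleleft> \<mu>) = l \<triangleleft> \<theta>" for t h l
    proof -
      note hl = homD[OF h] homD[OF l]
      have "(h \<triangleleft> (v \<triangleleft> \<mu>)) \<triangleleft> n = (l \<triangleleft> \<theta>) \<triangleleft> n" "(h \<triangleleft> (v \<triangleleft> \<mu>)) \<triangleleft> n' = (l \<triangleleft> \<theta>) \<triangleleft> n'" by (simp_all only: e)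
      then have e0: "(l \<triangleleft> ?i1) \<triangleleft> p = h \<triangleleft> \<epsilon>0" and eu: "h \<triangleleft> u = l \<triangleleft> (?i2 \<triangleleft> Lambda_incyl C X)" by (simp_all add: hl \<mu>n \<theta>n)
      \<comment> \<open>The component on the second copy of \<open>Z\<close> is not given and has to
        be produced: \<open>\<epsilon>1\<close> followed by \<open>h\<close> vanishes on
        \<open>X\<close>, because on the cylinder \<open>h\<close> passes through the suspension,
        and so it factors through \<open>p\<close>.\<close>
      have "h \<triangleleft> (\<epsilon>1 \<triangleleft> i) = (h \<triangleleft> u) \<triangleleft> d1 X" by (simp add: hl)
      also have "\<dots> = zr X t" unfolding eu by (simp add: hl t)
      finally have ze: "(h \<triangleleft> \<epsilon>1) \<triangleleft> i = fz t \<triangleleft> tz X" by (simp add: hl)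
      have "\<exists>l1. l1 \<in> hom B Z t \<and> l1 \<triangleleft> p = h \<triangleleft> \<epsilon>1 \<and> l1 \<triangleleft> fz Z = fz t"
        by (rule is_pushout_ex[OF p_push _ _ t ze]) (simp_all add: hom_def hl t)
      then obtain l1 where l1: "l1 \<in> hom B Z t" "l1 \<triangleleft> p = h \<triangleleft> \<epsilon>1" by blast
      have "\<exists>w. w \<in> hom B P t \<and> w \<triangleleft> j0 = l \<triangleleft> ?i1 \<and> w \<triangleleft> j1 = l1 \<and> w \<triangleleft> q = h"
        by (rule is_dpo_ex[OF P_dpo _ _ _ t e0 l1(2)]) (simp_all add: hom_def hl homD[OF l1(1)])
      then obtain w where w: "w \<in> hom B P t" "w \<triangleleft> j0 = l \<triangleleft> ?i1" "w \<triangleleft> q = h" by blast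
      note wh = homD[OF w(1)]
      have "w \<triangleleft> k = l \<triangleleft> ?i2"
      proof (rule Lambda_eqI[of X])
        have "(w \<triangleleft> k) \<triangleleft> Lambda_incyl C X = w \<triangleleft> (q \<triangleleft> u)" unfolding k_incyl[symmetric] by (rule comp_assoc) (simp_all add: wh)
        also have "\<dots> = (w \<triangleleft> q) \<triangleleft> u" by (rule comp_assoc[symmetric]) (simp_all add: wh)
        also have "\<dots> = (l \<triangleleft> ?i2) \<triangleleft> Lambda_incyl C X" by (simp add: w(3) eu hl)
        finally show "(w \<triangleleft> k) \<triangleleft> Lambda_incyl C X = (l \<triangleleft> ?i2) \<triangleleft> Lambda_incyl C X" .
      qed (simp_all add: wh hl)
      then have "w \<triangleleft> jk = l" by - (rule chosen_eqI[of _ Z "Lambda C X" t]; simp add: hom_def wh hl w(2))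
      then show ?thesis using w(1,3) by blast
    qed
    show "w = w'" if w: "w \<in> hom B P t" "w' \<in> hom B P t" and e: "w \<triangleleft> q = w' \<triangleleft> q" "w \<triangleleft> jk = w' \<triangleleft> jk" for t w w'
    proof -
      note wh = homD[OF w(1)] homD[OF w(2)]
      have "(w \<triangleleft> jk) \<triangleleft> ?i1 = (w' \<triangleleft> jk) \<triangleleft> ?i1" by (simp only: e)
      then have 0: "w \<triangleleft> j0 = w' \<triangleleft> j0" by (simp add: wh)
      have "(w \<triangleleft> q) \<triangleleft> \<epsilon>1 = (w' \<triangleleft> q) \<triangleleft> \<epsilon>1" by (simp only: e)
      then have "(w \<triangleleft> j1) \<triangleleft> p = (w' \<triangleleft> j1) \<triangleleft> p" by (simp add: wh)
      then have "w \<triangleleft> j1 = w' \<triangleleft> j1" by - (rule p_eqI[of _ t]; simp add: hom_def wh)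
      then show ?thesis by (rule dpo_eqI[OF P_dpo w 0 _ e(1)])
    qed
  qed (simp_all add: hom_def)
  then show ?thesis by (rule Cof_W_pushout[OF wC wW])
qed

definition "\<pi> = Cone_desc i p (zr (T X) Z)"

lemma pi [simp]: "\<pi> \<in> Arr B" "Dom B \<pi> = Cone C i" "Cod B \<pi> = Z" "\<pi> \<triangleleft> Cone_in C i = p" "\<pi> \<triangleleft> Cone_incyl i = zr (T X) Z"
  using Cone_desc[of i p "zr (T X) Z"] by (simp_all add: \<pi>_def)

lemma pi_W [simp]: "\<pi> \<in> W"
proof (rule dpo_cof_W[OF i_hom i_Cof tz_props(1) p_push])
  show "is_dpo B i (tz X) (d0 X) (d1 X) (Cone C i) (Cone_in C i) (K_in2 C i (tz X)) (Cone_incyl i)"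
    unfolding Cone_eq Cone_incyl_def arrs by (rule K_dpo[OF i_hom tz_props(1)]) simp
  have "K_in2 C i (tz X) = fz (Cone C i)" using Cone_in2[of i] by simp
  then show "\<pi> \<triangleleft> K_in2 C i (tz X) = fz Z" by simp
qed (simp_all add: hom_def)

lemma Q_homotopy:
  defines "\<phi> \<equiv> Cone_desc i (j0 \<triangleleft> p) (k \<triangleleft> Lambda_incyl C X)"
  shows "\<phi> \<in> Arr B" "Dom B \<phi> = Cone C i" "Cod B \<phi> = P" "\<phi> \<triangleleft> Cone_in C i = j0 \<triangleleft> p" "\<phi> \<triangleleft> Cone_incyl i = k \<triangleleft> Lambda_incyl C X"
    "Q \<phi> = Q (j1 \<triangleleft> \<pi>)"
proof -
  show \<phi> [simp]: "\<phi> \<in> Arr B" "Dom B \<phi> = Cone C i" "Cod B \<phi> = P" "\<phi> \<triangleleft> Cone_in C i = j0 \<triangleleft> p" "\<phi> \<triangleleft> Cone_incyl i = k \<triangleleft> Lambda_incyl C X"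
    using Cone_desc[of i "j0 \<triangleleft> p" "k \<triangleleft> Lambda_incyl C X"] by (simp_all add: \<phi>_def)
  \<comment> \<open>Extends \<open>q\<close> over the cone of \<open>u\<close>. In the outer
    direction \<open>hh\<close> is the identity at the end \<open>d0\<close>, which matches
    \<open>q\<close> on the cylinder of \<open>X\<close>; at the end \<open>d1\<close> it collapses
    to an end of that cylinder, which \<open>Lambda_incyl\<close> sends to zero.\<close>
  let ?h = "k \<triangleleft> (Lambda_incyl C X \<triangleleft> hh X)"
  let ?\<chi> = "Cone_desc u q ?h"
  have \<chi>: "?\<chi> \<in> Arr B" "Dom B ?\<chi> = Cone C u" "Cod B ?\<chi> = P"
    "\<And>x. x \<in> Arr B \<Longrightarrow> Cod B x = c \<Longrightarrow> ?\<chi> \<triangleleft> (Cone_in C u \<triangleleft> x) = q \<triangleleft> x"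
    "\<And>x. x \<in> Arr B \<Longrightarrow> Cod B x = T (T X) \<Longrightarrow> ?\<chi> \<triangleleft> (Cone_incyl u \<triangleleft> x) = ?h \<triangleleft> x"
    by (simp_all add: Cone_desc[of u q ?h])
  let ?A0 = "Cone_map C i u (d0 X) \<epsilon>0" and ?A1 = "Cone_map C i u (d1 X) \<epsilon>1" and ?\<sigma> = "Cone_map C u i (sg X) s"
  note A0 = Cone_map[of i u "d0 X" \<epsilon>0] and A1 = Cone_map[of i u "d1 X" \<epsilon>1] and S = Cone_map[of u i "sg X" s]
  have A: "?A0 \<in> Arr B" "Dom B ?A0 = Cone C i" "Cod B ?A0 = Cone C u" "?A1 \<in> Arr B" "Dom B ?A1 = Cone C i" "Cod B ?A1 = Cone C u"
    "?A0 \<triangleleft> Cone_in C i = Cone_in C u \<triangleleft> \<epsilon>0" "?A1 \<triangleleft> Cone_in C i = Cone_in C u \<triangleleft> \<epsilon>1"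
    "?A0 \<triangleleft> Cone_incyl i = Cone_incyl u \<triangleleft> tm (d0 X)" "?A1 \<triangleleft> Cone_incyl i = Cone_incyl u \<triangleleft> tm (d1 X)"
    by (simp_all add: A0(1-5) A1(1-5))
  have Sg: "?\<sigma> \<in> Arr B" "Dom B ?\<sigma> = Cone C u" "Cod B ?\<sigma> = Cone C i"
     "\<And>x. x \<in> Arr B \<Longrightarrow> Cod B x = c \<Longrightarrow> ?\<sigma> \<triangleleft> (Cone_in C u \<triangleleft> x) = Cone_in C i \<triangleleft> (s \<triangleleft> x)"
    "\<And>x. x \<in> Arr B \<Longrightarrow> Cod B x = T (T X) \<Longrightarrow> ?\<sigma> \<triangleleft> (Cone_incyl u \<triangleleft> x) = Cone_incyl i \<triangleleft> (tm (sg X) \<triangleleft> x)"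
    by (simp_all add: S(1-7))
  have SW: "?\<sigma> \<in> W" by (rule S(8)) (simp_all add: sg_W s_W)
  have tsg: "tm (sg X) \<triangleleft> tm (d0 X) = Ident B (T X)" "tm (sg X) \<triangleleft> tm (d1 X) = Ident B (T X)"
    using tm_comp[of "d0 X" X "T X" "sg X" X] tm_comp[of "d1 X" X "T X" "sg X" X] by (simp_all add: hom_def)
  \<comment> \<open>\<open>s\<close> retracts \<open>\<epsilon>0\<close> and
    \<open>\<epsilon>1\<close>, and \<open>sg\<close> retracts \<open>d0\<close> and
    \<open>d1\<close>, so both maps of cones are sections of \<open>?\<sigma>\<close>.\<close>
  have 1: "?\<sigma> \<triangleleft> ?A0 = Ident B (Cone C i)" "?\<sigma> \<triangleleft> ?A1 = Ident B (Cone C i)"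
    by (rule Cone_eqI[of i]; simp add: A Sg tsg)+
  \<comment> \<open>Now \<open>hh\<close> is evaluated in the inner direction. At \<open>d0\<close>
    it is the identity and leaves \<open>\<phi>\<close>; at \<open>d1\<close> it is a collapse, so
    in the next line the cone part becomes zero, as it does under \<open>\<pi>\<close>.\<close>
  have 2: "?\<chi> \<triangleleft> ?A0 = \<phi>" by (rule Cone_eqI[of i]; simp add: A \<chi>)
  have 3: "?\<chi> \<triangleleft> ?A1 = j1 \<triangleleft> \<pi>" by (rule Cone_eqI[of i]; simp add: A \<chi>)
  have "Q ?\<sigma> \<star> Q ?A0 = Q ?\<sigma> \<star> Q ?A1" by (simp add: Q_comp A Sg 1)
  then have "Q ?A0 = Q ?A1" by - (rule L.iso_cancel_left[OF Q_iso[OF SW]]; simp add: A Sg)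
  then have "Q ?\<chi> \<star> Q ?A0 = Q ?\<chi> \<star> Q ?A1" by simp
  then show "Q \<phi> = Q (j1 \<triangleleft> \<pi>)" by (simp add: Q_comp A \<chi>(1-3) 2 3)
qed

lemma coaction_eq:
  "Q (coprod_map B \<pi> (Ident B (Lambda C X))) \<star> simplicial_coaction C W i = (inv_arr L (Q jk) \<star> Q j1) \<star> Q \<pi>"
proof -
  let ?D = "coprod_map B \<pi> (Ident B (Lambda C X))"
  let ?\<phi> = "Cone_desc i (j0 \<triangleleft> p) (k \<triangleleft> Lambda_incyl C X)"
  note H = Q_homotopy
  have D: "?D \<in> Arr B" "Dom B ?D = coprod_ob B (Cone C i) (Lambda C X)" "Cod B ?D = coprod_ob B Z (Lambda C X)" by simp_all
  have ab: "Theta_alpha C i \<in> Arr B" "Dom B (Theta_alpha C i) = Cone C (Cyl_in C i)" "Cod B (Theta_alpha C i) = Cone C i"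
    "Theta_beta C i \<in> Arr B" "Dom B (Theta_beta C i) = Cone C (Cyl_in C i)"
    "Cod B (Theta_beta C i) = coprod_ob B (Cone C i) (Lambda C X)" by simp_all
  have t: "Theta_in i \<in> Arr B" "Dom B (Theta_in i) = Y" "Cod B (Theta_in i) = Cone C (Cyl_in C i)"
    "Theta_incyl i \<in> Arr B" "Dom B (Theta_incyl i) = T X" "Cod B (Theta_incyl i) = Cone C (Cyl_in C i)"
    "Theta_incone i \<in> Arr B" "Dom B (Theta_incone i) = T X" "Cod B (Theta_incone i) = Cone C (Cyl_in C i)" by simp_all
  \<comment> \<open>Checked on the generators: on \<open>Y\<close> both sides are \<open>p\<close>
    followed by \<open>j0\<close>. On the inner cylinder both vanish, on the left because
    \<open>\<pi>\<close> kills the cone part, on the right because \<open>p\<close> kills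
    \<open>X\<close>. On the outer cylinder both are \<open>Lambda_incyl C X\<close> followed by
    \<open>k\<close>.\<close>
  have strict: "jk \<triangleleft> (?D \<triangleleft> Theta_beta C i) = ?\<phi> \<triangleleft> Theta_alpha C i"
    by (rule Theta_eqI[of i]) (simp_all add: H(1-5) comp_ext[OF H(4)])
  have "Q jk \<star> (Q ?D \<star> Q (Theta_beta C i)) = Q ?\<phi> \<star> Q (Theta_alpha C i)"
    by (simp add: Q_comp D ab strict H(1-3) del: coprod_map_simps comp_assoc)
  also have "\<dots> = (Q j1 \<star> Q \<pi>) \<star> Q (Theta_alpha C i)" unfolding H(6) by (simp add: Q_comp)
  finally have e: "Q jk \<star> (Q ?D \<star> Q (Theta_beta C i)) = (Q j1 \<star> Q \<pi>) \<star> Q (Theta_alpha C i)" .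
  have Ja: "is_iso L (Q jk)" "is_iso L (Q (Theta_alpha C i))" using jk_W by (simp_all add: Q_iso)
  have J: "inv_arr L (Q jk) \<in> Arr L" "Dom L (inv_arr L (Q jk)) = P" "Cod L (inv_arr L (Q jk)) = coprod_ob B Z (Lambda C X)"
    "inv_arr L (Q jk) \<star> Q jk = Ident L (coprod_ob B Z (Lambda C X))"
    using L.inv_arr_simps[OF Ja(1)] by simp_all
  have I: "inv_arr L (Q (Theta_alpha C i)) \<in> Arr L" "Dom L (inv_arr L (Q (Theta_alpha C i))) = Cone C i"
    "Cod L (inv_arr L (Q (Theta_alpha C i))) = Cone C (Cyl_in C i)"
    "Q (Theta_alpha C i) \<star> inv_arr L (Q (Theta_alpha C i)) = Ident L (Cone C i)"
    using L.inv_arr_simps[OF Ja(2)] by simp_all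
  have q: "Q jk \<in> Arr L" "Dom L (Q jk) = coprod_ob B Z (Lambda C X)" "Cod L (Q jk) = P"
    "Q ?D \<in> Arr L" "Dom L (Q ?D) = coprod_ob B (Cone C i) (Lambda C X)" "Cod L (Q ?D) = coprod_ob B Z (Lambda C X)"
    "Q (Theta_beta C i) \<in> Arr L" "Dom L (Q (Theta_beta C i)) = Cone C (Cyl_in C i)"
    "Cod L (Q (Theta_beta C i)) = coprod_ob B (Cone C i) (Lambda C X)"
    "Q (Theta_alpha C i) \<in> Arr L" "Dom L (Q (Theta_alpha C i)) = Cone C (Cyl_in C i)" "Cod L (Q (Theta_alpha C i)) = Cone C i"
    "Q j1 \<in> Arr L" "Dom L (Q j1) = Z" "Cod L (Q j1) = P" "Q \<pi> \<in> Arr L" "Dom L (Q \<pi>) = Cone C i" "Cod L (Q \<pi>) = Z"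
    by simp_all
  have "Q ?D \<star> (Q (Theta_beta C i) \<star> inv_arr L (Q (Theta_alpha C i))) =
    inv_arr L (Q jk) \<star> ((Q jk \<star> (Q ?D \<star> Q (Theta_beta C i))) \<star> inv_arr L (Q (Theta_alpha C i)))"
    using L.comp_ext[OF J(4), of "Q ?D \<star> (Q (Theta_beta C i) \<star> inv_arr L (Q (Theta_alpha C i)))"] by (simp add: q I J(1-3))
  also have "\<dots> = inv_arr L (Q jk) \<star> (Q j1 \<star> Q \<pi>)" unfolding e by (simp add: q I J(1-3))
  finally show ?thesis by (simp add: simplicial_coaction_def Let_def q J(1-3))
qed

end

section \<open>Isomorphisms of pairs\<close>

context simplicial_brown begin

abbreviation "S \<equiv> simplicial_suspension C W"

lemma S_simps [simp]: "cyl S = T" "cyl0 S = d0" "cyl1 S = d1" "cylp S = sg" "sus S = Lambda C" "susq S = Lambda_incyl C"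
  by (simp_all add: simplicial_suspension_def)

lemma susl_hom:
  assumes "\<xi> \<in> hom L X Y" shows "susl S \<xi> \<in> hom L (Lambda C X) (Lambda C Y)"
  using inverting_functor.ext_hom[OF Lambda_inverting assms] by (simp add: simplicial_suspension_def)

text \<open>Composes an isomorphism of pairs with one that is the identity on \<open>X\<close>. The
  suspension component is then unchanged, and the two maps of coproducts need comparing on each
  summand only, because these coproducts are coproducts in the localization.\<close>

lemma copair_iso_transfer:
  assumes iso: "copair_iso B W S A A1" and A2: "is_copair B W S A2" and X: "PX A2 = PX A1"
    and \<eta>: "\<eta> \<in> hom L (PY A1) (PY A2)" "is_iso L \<eta>" and \<zeta>: "\<zeta> \<in> hom L (PZ A1) (PZ A2)" "is_iso L \<zeta>"
    and \<omega>: "\<omega> \<in> hom L (coprod_ob B (PZ A1) (Lambda C (PX A1))) (coprod_ob B (PZ A2) (Lambda C (PX A1)))"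
    and eq: "\<eta> \<star> Pf A1 = Pf A2" "\<zeta> \<star> Pg A1 = Pg A2 \<star> \<eta>" "\<omega> \<star> Ph A1 = Ph A2 \<star> \<zeta>"
      "\<omega> \<star> Q (in1 B (PZ A1) (Lambda C (PX A1))) = Q (in1 B (PZ A2) (Lambda C (PX A1))) \<star> \<zeta>"
      "\<omega> \<star> Q (in2 B (PZ A1) (Lambda C (PX A1))) = Q (in2 B (PZ A2) (Lambda C (PX A1)))"
  shows "copair_iso B W S A A2"
proof -
  let ?om = "\<lambda>\<zeta>2 \<xi> A2. cotuple_along L
                   (Q (in1 B (PZ A) (Lambda C (PX A)))) (Q (in2 B (PZ A) (Lambda C (PX A))))
                   (Q (in1 B (PZ A2) (Lambda C (PX A2))) \<star> \<zeta>2)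
                   (Q (in2 B (PZ A2) (Lambda C (PX A2))) \<star> susl S \<xi>)"
  have "\<exists>\<xi>0 \<eta>0 \<zeta>0. \<xi>0 \<in> hom L (PX A) (PX A1) \<and> \<eta>0 \<in> hom L (PY A) (PY A1) \<and> \<zeta>0 \<in> hom L (PZ A) (PZ A1) \<and>
      is_iso L \<xi>0 \<and> is_iso L \<eta>0 \<and> is_iso L \<zeta>0 \<and> \<eta>0 \<star> Pf A = Pf A1 \<star> \<xi>0 \<and> \<zeta>0 \<star> Pg A = Pg A1 \<star> \<eta>0 \<and>
      ?om \<zeta>0 \<xi>0 A1 \<star> Ph A = Ph A1 \<star> \<zeta>0"
    using iso unfolding copair_iso_def Let_def S_simps by blast
  then obtain \<xi>0 \<eta>0 \<zeta>0 where 0: "\<xi>0 \<in> hom L (PX A) (PX A1)" "\<eta>0 \<in> hom L (PY A) (PY A1)" "\<zeta>0 \<in> hom L (PZ A) (PZ A1)"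
    "is_iso L \<xi>0" "is_iso L \<eta>0" "is_iso L \<zeta>0" "\<eta>0 \<star> Pf A = Pf A1 \<star> \<xi>0" "\<zeta>0 \<star> Pg A = Pg A1 \<star> \<eta>0"
    "?om \<zeta>0 \<xi>0 A1 \<star> Ph A = Ph A1 \<star> \<zeta>0" by blast
  have cp: "is_copair B W S A" "is_copair B W S A1" using iso by (simp_all add: copair_iso_def Let_def)
  have o: "PX A \<in> Obj B" "PY A \<in> Obj B" "PZ A \<in> Obj B" "PX A1 \<in> Obj B" "PY A1 \<in> Obj B" "PZ A1 \<in> Obj B" "PZ A2 \<in> Obj B"
    using cp A2 by (simp_all add: is_copair_def Let_def)
  have h: "Pf A \<in> hom L (PX A) (PY A)" "Pg A \<in> hom L (PY A) (PZ A)" "Ph A \<in> hom L (PZ A) (coprod_ob B (PZ A) (Lambda C (PX A)))"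
    "Pf A1 \<in> hom L (PX A1) (PY A1)" "Pg A1 \<in> hom L (PY A1) (PZ A1)" "Ph A1 \<in> hom L (PZ A1) (coprod_ob B (PZ A1) (Lambda C (PX A1)))"
    "Pf A2 \<in> hom L (PX A1) (PY A2)" "Pg A2 \<in> hom L (PY A2) (PZ A2)" "Ph A2 \<in> hom L (PZ A2) (coprod_ob B (PZ A2) (Lambda C (PX A1)))"
    using cp A2 by (simp_all add: is_copair_def Let_def X)
  note hs = h[THEN homD(1)] h[THEN homD(2)] h[THEN homD(3)]
    0(1-3)[THEN homD(1)] 0(1-3)[THEN homD(2)] 0(1-3)[THEN homD(3)] homD[OF \<eta>(1)] homD[OF \<zeta>(1)] homD[OF \<omega>]
  note sl = homD[OF susl_hom[OF 0(1)]]
  let ?o1 = "?om \<zeta>0 \<xi>0 A1" and ?o2 = "?om (\<zeta> \<star> \<zeta>0) \<xi>0 A2"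
  have cop: "is_coprod L (PZ A) (Lambda C (PX A)) (coprod_ob B (PZ A) (Lambda C (PX A)))
     (Q (in1 B (PZ A) (Lambda C (PX A)))) (Q (in2 B (PZ A) (Lambda C (PX A))))"
    by (rule loc_coprod_chosen) (simp_all add: o)
  have o1: "?o1 \<in> hom L (coprod_ob B (PZ A) (Lambda C (PX A))) (coprod_ob B (PZ A1) (Lambda C (PX A1)))"
      "?o1 \<star> Q (in1 B (PZ A) (Lambda C (PX A))) = Q (in1 B (PZ A1) (Lambda C (PX A1))) \<star> \<zeta>0"
      "?o1 \<star> Q (in2 B (PZ A) (Lambda C (PX A))) = Q (in2 B (PZ A1) (Lambda C (PX A1))) \<star> susl S \<xi>0"
    by (rule L.cotuple_along[OF cop]; simp add: hom_def o hs sl)+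
  have o2: "?o2 \<in> hom L (coprod_ob B (PZ A) (Lambda C (PX A))) (coprod_ob B (PZ A2) (Lambda C (PX A1)))"
      "?o2 \<star> Q (in1 B (PZ A) (Lambda C (PX A))) = Q (in1 B (PZ A2) (Lambda C (PX A1))) \<star> (\<zeta> \<star> \<zeta>0)"
      "?o2 \<star> Q (in2 B (PZ A) (Lambda C (PX A))) = Q (in2 B (PZ A2) (Lambda C (PX A1))) \<star> susl S \<xi>0"
    unfolding X by (rule L.cotuple_along[OF cop]; simp add: hom_def o hs sl)+
  note oh = homD[OF o1(1)] homD[OF o2(1)]
  have "?o2 = \<omega> \<star> ?o1"
  proof (rule L.coprod_eqI[OF cop o2(1)])
    show "?o2 \<star> Q (in1 B (PZ A) (Lambda C (PX A))) = (\<omega> \<star> ?o1) \<star> Q (in1 B (PZ A) (Lambda C (PX A)))"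
      by (simp add: oh o hs o2(2) o1(2) L.comp_ext2[OF eq(4)])
    show "?o2 \<star> Q (in2 B (PZ A) (Lambda C (PX A))) = (\<omega> \<star> ?o1) \<star> Q (in2 B (PZ A) (Lambda C (PX A)))"
      by (simp add: oh o hs o2(3) o1(3) L.comp_ext[OF eq(5)] sl)
  qed (simp add: hom_def oh hs)
  then have "?o2 \<star> Ph A = Ph A2 \<star> (\<zeta> \<star> \<zeta>0)"
    by (simp add: oh hs 0(9) L.comp_ext2[OF eq(3)])
  moreover have "(\<eta> \<star> \<eta>0) \<star> Pf A = Pf A2 \<star> \<xi>0" "(\<zeta> \<star> \<zeta>0) \<star> Pg A = Pg A2 \<star> (\<eta> \<star> \<eta>0)"
    by (simp_all add: hs 0(7,8) L.comp_ext[OF eq(1)] L.comp_ext2[OF eq(2)])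
  moreover have "\<eta> \<star> \<eta>0 \<in> hom L (PY A) (PY A2)" "\<zeta> \<star> \<zeta>0 \<in> hom L (PZ A) (PZ A2)" by (simp_all add: hom_def hs)
  moreover have "is_iso L (\<eta> \<star> \<eta>0)" "is_iso L (\<zeta> \<star> \<zeta>0)" by (simp_all add: L.iso_comp 0(4-6) \<eta>(2) \<zeta>(2) hs)
  ultimately show ?thesis
    unfolding copair_iso_def Let_def S_simps using cp(1) A2 0(1,4) X by metis
qed

lemma (in category) iso_square:
  assumes "is_iso C a" "is_iso C b" "f \<in> Arr C" "g \<in> Arr C" "Dom C a = Cod C f" "Dom C g = Cod C b" "Dom C f = Dom C b" "Cod C a = Cod C g"
    "a \<cdot>\<^bsub>C\<^esub> f = g \<cdot>\<^bsub>C\<^esub> b"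
  shows "inv_arr C a \<cdot>\<^bsub>C\<^esub> g = f \<cdot>\<^bsub>C\<^esub> inv_arr C b"
proof -
  have ab: "a \<in> Arr C" "b \<in> Arr C" using assms(1,2) iso_arr by auto
  note A = inv_arr_simps[OF assms(1)] and I = inv_arr_simps[OF assms(2)]
  have "inv_arr C a \<cdot>\<^bsub>C\<^esub> ((a \<cdot>\<^bsub>C\<^esub> f) \<cdot>\<^bsub>C\<^esub> inv_arr C b) = f \<cdot>\<^bsub>C\<^esub> inv_arr C b"
    using comp_ext[OF A(4), of "f \<cdot>\<^bsub>C\<^esub> inv_arr C b"] by (simp add: A(1-3) I(1-3) ab assms(3-8))
  then show ?thesis unfolding assms(9) by (simp add: A(1-3) I ab assms(3-8))
qed

text \<open>Isomorphisms of pairs that are the identity on \<open>X\<close> and come from actual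
  weak equivalences on \<open>Y\<close> and \<open>Z\<close>. The comparisons of triangles below all
  have this shape.\<close>

definition w_related where
  "w_related A1 A2 \<longleftrightarrow> is_copair B W S A1 \<and> is_copair B W S A2 \<and> PX A2 = PX A1 \<and>
     (\<exists>y w. y \<in> W \<and> w \<in> W \<and> y \<in> hom B (PY A1) (PY A2) \<and> w \<in> hom B (PZ A1) (PZ A2) \<and>
        Q y \<star> Pf A1 = Pf A2 \<and> Q w \<star> Pg A1 = Pg A2 \<star> Q y \<and>
        Q (coprod_map B w (Ident B (Lambda C (PX A1)))) \<star> Ph A1 = Ph A2 \<star> Q w)"

text \<open>Forwards, the weak equivalences are composed with the given isomorphism. Backwards, all
  squares are inverted in the localization by \<open>iso_square\<close>, and the same composition
  lemma applies.\<close>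

lemma w_related_iso:
  assumes "w_related A1 A2" shows "copair_iso B W S A A1 \<longleftrightarrow> copair_iso B W S A A2"
proof -
  have cp: "is_copair B W S A1" "is_copair B W S A2" and X: "PX A2 = PX A1" using assms by (simp_all add: w_related_def)
  obtain y w where yw: "y \<in> W" "w \<in> W" "y \<in> hom B (PY A1) (PY A2)" "w \<in> hom B (PZ A1) (PZ A2)"
    and e: "Q y \<star> Pf A1 = Pf A2" "Q w \<star> Pg A1 = Pg A2 \<star> Q y"
      "Q (coprod_map B w (Ident B (Lambda C (PX A1)))) \<star> Ph A1 = Ph A2 \<star> Q w"
    using assms unfolding w_related_def by blast
  let ?\<Lambda> = "Lambda C (PX A1)"
  let ?D = "coprod_map B w (Ident B ?\<Lambda>)"
  have o: "PX A1 \<in> Obj B" "PY A1 \<in> Obj B" "PZ A1 \<in> Obj B" "PY A2 \<in> Obj B" "PZ A2 \<in> Obj B" "?\<Lambda> \<in> Obj B"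
    using cp by (simp_all add: is_copair_def Let_def)
  have h: "Pf A1 \<in> hom L (PX A1) (PY A1)" "Pg A1 \<in> hom L (PY A1) (PZ A1)" "Ph A1 \<in> hom L (PZ A1) (coprod_ob B (PZ A1) ?\<Lambda>)"
    "Pf A2 \<in> hom L (PX A1) (PY A2)" "Pg A2 \<in> hom L (PY A2) (PZ A2)" "Ph A2 \<in> hom L (PZ A2) (coprod_ob B (PZ A2) ?\<Lambda>)"
    using cp by (simp_all add: is_copair_def Let_def X)
  note hs = h[THEN homD(1)] h[THEN homD(2)] h[THEN homD(3)] homD[OF yw(3)] homD[OF yw(4)]
  have D: "?D \<in> W" "?D \<in> Arr B" "Dom B ?D = coprod_ob B (PZ A1) ?\<Lambda>" "Cod B ?D = coprod_ob B (PZ A2) ?\<Lambda>"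
    by (simp_all add: W_coprod yw(1,2) hs o)
  have q: "Q y \<in> hom L (PY A1) (PY A2)" "Q w \<in> hom L (PZ A1) (PZ A2)"
    "Q ?D \<in> hom L (coprod_ob B (PZ A1) ?\<Lambda>) (coprod_ob B (PZ A2) ?\<Lambda>)"
    by (rule loc_arr_hom; simp add: hom_def hs D)+
  note qs = q[THEN homD(1)] q[THEN homD(2)] q[THEN homD(3)]
  note I = Q_iso[OF yw(1)] Q_iso[OF yw(2)] Q_iso[OF D(1)]
  have inW: "Q ?D \<star> Q (in1 B (PZ A1) ?\<Lambda>) = Q (in1 B (PZ A2) ?\<Lambda>) \<star> Q w" "Q ?D \<star> Q (in2 B (PZ A1) ?\<Lambda>) = Q (in2 B (PZ A2) ?\<Lambda>)"
    by (simp_all add: Q_comp D hs o)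
  show ?thesis
  proof
    assume "copair_iso B W S A A1"
    then show "copair_iso B W S A A2"
      by (rule copair_iso_transfer[OF _ cp(2) X q(1) I(1) q(2) I(2) q(3) e inW])
  next
    assume A: "copair_iso B W S A A2"
    note v = L.inv_arr_simps[OF I(1)] L.inv_arr_simps[OF I(2)] L.inv_arr_simps[OF I(3)]
    have 1: "inv_arr L (Q y) \<star> Pf A2 = Pf A1"
      using L.comp_ext[OF v(4), of "Pf A1"] by (simp add: e(1) v(1-3) qs hs)
    have 2: "inv_arr L (Q w) \<star> Pg A2 = Pg A1 \<star> inv_arr L (Q y)"
      by (rule L.iso_square[OF I(2,1) _ _ _ _ _ _ e(2)]) (simp_all add: qs hs)
    have 3: "inv_arr L (Q ?D) \<star> Ph A2 = Ph A1 \<star> inv_arr L (Q w)"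
      by (rule L.iso_square[OF I(3,2) _ _ _ _ _ _ e(3)]) (simp_all add: qs hs)
    have 4: "inv_arr L (Q ?D) \<star> Q (in1 B (PZ A2) ?\<Lambda>) = Q (in1 B (PZ A1) ?\<Lambda>) \<star> inv_arr L (Q w)"
      by (rule L.iso_square[OF I(3,2) _ _ _ _ _ _ inW(1)]) (simp_all add: qs hs o)
    have 5: "inv_arr L (Q ?D) \<star> Q (in2 B (PZ A2) ?\<Lambda>) = Q (in2 B (PZ A1) ?\<Lambda>)"
      using L.comp_ext[OF v(14), of "Q (in2 B (PZ A1) ?\<Lambda>)"] by (simp add: inW(2) v(11-13) qs hs o)
    show "copair_iso B W S A A1"
      by (rule copair_iso_transfer[OF A cp(1), of "inv_arr L (Q y)" "inv_arr L (Q w)" "inv_arr L (Q ?D)"])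
         (simp_all add: X 1 2 3 4 5 hom_def v(1-3,6-8,11-13) qs I L.iso_inv)
  qed
qed

definition cone_triangle where
  "cone_triangle F = \<lparr>PX = Dom B F, PY = Cod B F, PZ = Cone C F, Pf = Q F, Pg = Q (Cone_in C F), Ph = simplicial_coaction C W F\<rparr>"

lemma coaction_hom:
  assumes F: "F \<in> Arr B" shows "simplicial_coaction C W F \<in> hom L (Cone C F) (coprod_ob B (Cone C F) (Lambda C (Dom B F)))"
  using Theta_alpha(1-3)[OF F] Theta_beta(1-3)[OF F] L.inv_arr_simps(1-3)[OF Q_iso[OF Theta_alpha(7)[OF F]]]
  by (simp add: simplicial_coaction_def Let_def hom_def)

lemma cone_triangle_copair: "F \<in> Arr B \<Longrightarrow> is_copair B W S (cone_triangle F)"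
  using coaction_hom[of F] loc_arr_hom[of F "Dom B F" "Cod B F"] loc_arr_hom[of "Cone_in C F" "Cod B F" "Cone C F"]
  by (simp add: cone_triangle_def is_copair_def Let_def hom_def)

text \<open>Both maps out of \<open>\<Theta>\<close> are strictly natural in the target of
  \<open>F\<close>. With \<open>Cyl_in C F\<close> and \<open>Cyl_proj C F\<close> in the roles of
  \<open>F\<close> and \<open>y\<close> this replaces an arbitrary map by a cofibration.\<close>

lemma cone_triangle_comp:
  assumes F: "F \<in> Arr B" and y: "y \<in> W" "Dom B y = Cod B F"
  shows "w_related (cone_triangle F) (cone_triangle (y \<triangleleft> F))"
proof -
  let ?F = "y \<triangleleft> F" and ?X = "Dom B F"
  have o: "?X \<in> Obj B" "Cod B F \<in> Obj B" "Cod B y \<in> Obj B" "y \<in> Arr B" using F y by simp_all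
  have F': "?F \<in> Arr B" "Dom B ?F = ?X" "Cod B ?F = Cod B y" using F y o by simp_all
  note f' [simp] = Cone_simps[OF F'(1), unfolded F'(2,3)] Cyl_simps[OF F'(1), unfolded F'(2,3)]
    Theta_in_simps[OF F'(1), unfolded F'(2,3)] Theta_alpha[OF F'(1), unfolded F'(2,3)] Theta_beta[OF F'(1), unfolded F'(2,3)]
  let ?E = "Cone_map C F ?F (Ident B ?X) y"
  note Em = Cone_map[of F ?F "Ident B ?X" y]
  have E: "?E \<in> Arr B" "Dom B ?E = Cone C F" "Cod B ?E = Cone C ?F" "?E \<triangleleft> Cone_in C F = Cone_in C ?F \<triangleleft> y"
    "?E \<triangleleft> Cone_incyl F = Cone_incyl ?F" "?E \<in> W"
    "\<And>k. k \<in> Arr B \<Longrightarrow> Cod B k = Cod B F \<Longrightarrow> ?E \<triangleleft> (Cone_in C F \<triangleleft> k) = Cone_in C ?F \<triangleleft> (y \<triangleleft> k)"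
    by (simp_all add: Em F y o)
  let ?Y = "K_desc C F (Ident B ?X) (Cyl_in1 ?F \<triangleleft> y) (Cyl_in C ?F) (Cyl_incyl ?F)"
  note Yd = Cyl_desc[of F "Cyl_in1 ?F \<triangleleft> y" "Cyl_in C ?F" "Cyl_incyl ?F"]
  have Y: "?Y \<in> Arr B" "Dom B ?Y = Cyl C F" "Cod B ?Y = Cyl C ?F" "?Y \<triangleleft> Cyl_in1 F = Cyl_in1 ?F \<triangleleft> y" "?Y \<triangleleft> Cyl_in C F = Cyl_in C ?F"
    "?Y \<triangleleft> Cyl_incyl F = Cyl_incyl ?F"
    by (simp_all add: Yd F y o)
  let ?T = "Cone_map C (Cyl_in C F) (Cyl_in C ?F) (Ident B ?X) ?Y"
  note Tm = Theta_map[of F "Cyl_in C ?F" "Ident B ?X" ?Y]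
  have T: "?T \<in> Arr B" "Dom B ?T = Cone C (Cyl_in C F)" "Cod B ?T = Cone C (Cyl_in C ?F)"
    "?T \<triangleleft> Theta_in F = Theta_in ?F \<triangleleft> y" "?T \<triangleleft> Theta_incyl F = Theta_incyl ?F" "?T \<triangleleft> Theta_incone F = Theta_incone ?F"
    by (simp_all add: Tm F y o Y Theta_in_def[of ?F] Theta_incyl_def[of ?F] Theta_incone_def[of ?F])
  let ?D = "coprod_map B ?E (Ident B (Lambda C ?X))"
  have a: "Theta_alpha C ?F \<triangleleft> ?T = ?E \<triangleleft> Theta_alpha C F"
    by (rule Theta_eqI[OF F]; simp add: F y o E T comp_ext[OF f'(34)])
  have b: "Theta_beta C ?F \<triangleleft> ?T = ?D \<triangleleft> Theta_beta C F"
    by (rule Theta_eqI[OF F]; simp add: F y o E T comp_ext[OF f'(41)])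
  have D: "?D \<in> Arr B" "Dom B ?D = coprod_ob B (Cone C F) (Lambda C ?X)" "Cod B ?D = coprod_ob B (Cone C ?F) (Lambda C ?X)"
    by (simp_all add: E o)
  have ai: "is_iso L (Q (Theta_alpha C F))" "is_iso L (Q (Theta_alpha C ?F))" using F F'(1) by simp_all
  note v = L.inv_arr_simps[OF ai(1)] L.inv_arr_simps[OF ai(2)]
  have ths: "Theta_alpha C F \<in> Arr B" "Dom B (Theta_alpha C F) = Cone C (Cyl_in C F)" "Cod B (Theta_alpha C F) = Cone C F"
    "Theta_beta C F \<in> Arr B" "Dom B (Theta_beta C F) = Cone C (Cyl_in C F)" "Cod B (Theta_beta C F) = coprod_ob B (Cone C F) (Lambda C ?X)"
    "Theta_alpha C ?F \<in> Arr B" "Dom B (Theta_alpha C ?F) = Cone C (Cyl_in C ?F)" "Cod B (Theta_alpha C ?F) = Cone C ?F"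
    "Theta_beta C ?F \<in> Arr B" "Dom B (Theta_beta C ?F) = Cone C (Cyl_in C ?F)"
    "Cod B (Theta_beta C ?F) = coprod_ob B (Cone C ?F) (Lambda C ?X)"
    using F by simp_all
  have "Q (Theta_alpha C ?F) \<star> Q ?T = Q ?E \<star> Q (Theta_alpha C F)" using a by (simp add: Q_comp ths T(1-3) E(1-3))
  then have c: "inv_arr L (Q (Theta_alpha C ?F)) \<star> Q ?E = Q ?T \<star> inv_arr L (Q (Theta_alpha C F))"
    by (intro L.iso_square[OF ai(2,1)]) (simp_all add: ths T(1-3) E(1-3))
  have d: "Q (Theta_beta C ?F) \<star> Q ?T = Q ?D \<star> Q (Theta_beta C F)" using b by (simp add: Q_comp ths T(1-3) D)
  have "Q ?D \<star> (Q (Theta_beta C F) \<star> inv_arr L (Q (Theta_alpha C F))) = (Q (Theta_beta C ?F) \<star> inv_arr L (Q (Theta_alpha C ?F))) \<star> Q ?E"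
    using L.comp_ext2[OF d, of "inv_arr L (Q (Theta_alpha C F))"] by (simp add: ths T(1-3) D E(1-3) v(1-3,6-8) c)
  then have h: "Q ?D \<star> simplicial_coaction C W F = simplicial_coaction C W ?F \<star> Q ?E"
    by (simp add: simplicial_coaction_def Let_def)
  have "Q y \<star> Q F = Q ?F" "Q ?E \<star> Q (Cone_in C F) = Q (Cone_in C ?F) \<star> Q y" by (simp_all add: Q_comp F y o E)
  then show ?thesis using h cone_triangle_copair[OF F] cone_triangle_copair[OF F'(1)] y(1) E(6)
    unfolding w_related_def cone_triangle_def copair.simps F'(2,3)
    by (intro conjI exI[of _ y] exI[of _ ?E]) (simp_all add: hom_def o y E(1-3))
qed

end

lemma (in coaction_data) related:
  "w_related (cone_triangle i) \<lparr>PX = X, PY = Y, PZ = Z, Pf = Q i, Pg = Q p, Ph = inv_arr L (Q jk) \<star> Q j1\<rparr>"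
proof -
  have "inv_arr L (Q jk) \<star> Q j1 \<in> hom L Z (coprod_ob B Z (Lambda C X))"
    using L.inv_arr_simps(1-3)[OF Q_iso[OF jk_W]] by (simp add: hom_def)
  moreover have "Q i \<in> hom L X Y" "Q p \<in> hom L Y Z" by (rule loc_arr_hom; simp add: hom_def)+
  ultimately have cp: "is_copair B W S \<lparr>PX = X, PY = Y, PZ = Z, Pf = Q i, Pg = Q p, Ph = inv_arr L (Q jk) \<star> Q j1\<rparr>"
    by (simp add: is_copair_def Let_def)
  have "Q (Ident B Y) \<star> Q i = Q i" "Q \<pi> \<star> Q (Cone_in C i) = Q p \<star> Q (Ident B Y)"
    by (simp_all add: Q_comp)
  then show ?thesis using coaction_eq cone_triangle_copair[of i] cp pi_W pi(1-3)
    unfolding w_related_def cone_triangle_def copair.simps arrs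
    by (intro conjI exI[of _ "Ident B Y"] exI[of _ \<pi>]) (simp_all add: hom_def)
qed

section \<open>Brown coactions: comparison and existence\<close>

context simplicial_brown begin

lemma scyl_cylinder: "X \<in> Obj B \<Longrightarrow> is_cylinder B W Cof X (T X) (d0 X) (d1 X) (sg X)"
proof -
  assume X: "X \<in> Obj B"
  have "sg X \<triangleleft> cotuple B (d0 X) (d1 X) = codiagonal B X"
    by (rule cotuple_eqI[of _ _ X X]) (simp_all add: X codiagonal_def)
  then show ?thesis using X by (simp add: is_cylinder_def hom_def cyl_cof sg_W)
qed

text \<open>Holds for every admissible choice of cylinder, map of cylinders and pushout, so all
  these choices yield pairs isomorphic to one and the same cone triangle.\<close>

lemma brown_coaction_related:
  assumes br: "brown_coaction B W Cof S i p b"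
  shows "w_related (cone_triangle i) \<lparr>PX = Dom B i, PY = Cod B i, PZ = Cod B p, Pf = Q i, Pg = Q p, Ph = b\<rparr>"
proof -
  let ?X = "Dom B i" and ?Y = "Cod B i" and ?Z = "Cod B p"
  have i: "i \<in> Cof" and pc: "is_cofiber B i p"
    using br by (simp_all add: brown_coaction_def Let_def)
  have ia: "i \<in> Arr B" "?X \<in> Obj B" "?Y \<in> Obj B" using i by simp_all
  have "\<exists>c e0 e1 s u M m m' v P r q k.
         is_cylinder B W Cof ?Y c e0 e1 s \<and>
         u \<in> hom B (T ?X) c \<and>
         u \<triangleleft> d0 ?X = e0 \<triangleleft> i \<and> u \<triangleleft> d1 ?X = e1 \<triangleleft> i \<and>
         s \<triangleleft> u = i \<triangleleft> sg ?X \<and>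
         is_pushout B (coprod_map B i i) (cotuple B (d0 ?X) (d1 ?X)) M m m' \<and>
         v \<in> hom B M c \<and> v \<triangleleft> m = cotuple B e0 e1 \<and> v \<triangleleft> m' = u \<and> v \<in> Cof \<and>
         is_pushout B (coprod_map B p p) (cotuple B e0 e1) P r q \<and>
         k \<in> hom B (Lambda C ?X) P \<and> k \<triangleleft> Lambda_incyl C ?X = q \<triangleleft> u \<and>
         b = inv_arr L (Q (cotuple B (r \<triangleleft> in1 B ?Z ?Z) k)) \<star> Q (r \<triangleleft> in2 B ?Z ?Z)"
    using br unfolding brown_coaction_def Let_def S_simps by blast
  then obtain c e0 e1 s u M m m' v P r q k where
    cyl: "is_cylinder B W Cof ?Y c e0 e1 s" and u: "u \<in> hom B (T ?X) c"
      "u \<triangleleft> d0 ?X = e0 \<triangleleft> i" "u \<triangleleft> d1 ?X = e1 \<triangleleft> i" "s \<triangleleft> u = i \<triangleleft> sg ?X"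
    and M: "is_pushout B (coprod_map B i i) (cotuple B (d0 ?X) (d1 ?X)) M m m'"
    and v: "v \<in> hom B M c" "v \<triangleleft> m = cotuple B e0 e1" "v \<triangleleft> m' = u" "v \<in> Cof"
    and P: "is_pushout B (coprod_map B p p) (cotuple B e0 e1) P r q"
    and k: "k \<in> hom B (Lambda C ?X) P" "k \<triangleleft> Lambda_incyl C ?X = q \<triangleleft> u"
    and b: "b = inv_arr L (Q (cotuple B (r \<triangleleft> in1 B ?Z ?Z) k)) \<star> Q (r \<triangleleft> in2 B ?Z ?Z)" by blast
  have e: "e0 \<in> hom B ?Y c" "e1 \<in> hom B ?Y c" "s \<in> hom B c ?Y" "s \<in> W" "s \<triangleleft> cotuple B e0 e1 = codiagonal B ?Y"
    using cyl by (simp_all add: is_cylinder_def)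
  note eh = homD[OF e(1)] homD[OF e(2)] homD[OF e(3)]
  have pp: "is_pushout B i (tz ?X) ?Z p (fz ?Z)" using pc by (simp add: is_cofiber_def)
  have p: "p \<in> hom B ?Y ?Z" using is_pushoutD(5)[OF pp] .
  note ph = homD[OF p]
  have o: "c \<in> Obj B" "?Z \<in> Obj B" using hom_obj[OF e(1)] hom_obj[OF p] by simp_all
  have "(s \<triangleleft> cotuple B e0 e1) \<triangleleft> in1 B ?Y ?Y = Ident B ?Y" "(s \<triangleleft> cotuple B e0 e1) \<triangleleft> in2 B ?Y ?Y = Ident B ?Y"
    unfolding e(5) codiagonal_def by (simp_all add: ia)
  then have se: "s \<triangleleft> e0 = Ident B ?Y" "s \<triangleleft> e1 = Ident B ?Y" by (simp_all add: eh ia)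
  have mh: "m \<in> Arr B" "Dom B m = coprod_ob B ?Y ?Y" "Cod B m = M"
    using is_pushoutD(5)[OF M] by (simp_all add: hom_def ia)
  note vh = homD[OF v(1)]
  have vm: "v \<triangleleft> (m \<triangleleft> in1 B ?Y ?Y) = e0" "v \<triangleleft> (m \<triangleleft> in2 B ?Y ?Y) = e1"
    using comp_ext[OF v(2) mh(1) vh(1), of "in1 B ?Y ?Y"] comp_ext[OF v(2) mh(1) vh(1), of "in2 B ?Y ?Y"]
    by (simp_all add: mh vh eh ia)
  have "coaction_data C W hh ?X ?Y ?Z c M P i p e0 e1 s u (m \<triangleleft> in1 B ?Y ?Y) (m \<triangleleft> in2 B ?Y ?Y) m' v
    (r \<triangleleft> in1 B ?Z ?Z) (r \<triangleleft> in2 B ?Z ?Z) q k"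
  proof (intro coaction_data.intro simplicial_brown_axioms coaction_data_axioms.intro)
    show "is_dpo B i i (d0 ?X) (d1 ?X) M (m \<triangleleft> in1 B ?Y ?Y) (m \<triangleleft> in2 B ?Y ?Y) m'"
      by (rule dpo_of_pushout[OF M, of ?X _ _ "T ?X"]) (simp_all add: hom_def ia)
    show "is_dpo B p p e0 e1 P (r \<triangleleft> in1 B ?Z ?Z) (r \<triangleleft> in2 B ?Z ?Z) q"
      by (rule dpo_of_pushout[OF P p p e(1,2)])
  qed (fact pp i e u v k se vm | simp add: hom_def ia)+
  from coaction_data.related[OF this] show ?thesis unfolding b .
qed

text \<open>The axioms do not say that \<open>M\<close> maps to the cylinder \<open>T\<close> of the
  target by a cofibration. Instead the fold map \<open>g\<close> from \<open>M\<close> is factored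
  through its mapping cylinder, which gives a cylinder of the target that receives \<open>M\<close>
  by a cofibration from the start.\<close>

lemma brown_coaction_exists:
  assumes i: "i \<in> Cof"
  shows "\<exists>p b. brown_coaction B W Cof S i p b"
proof -
  let ?X = "Dom B i" and ?Y = "Cod B i"
  have ia: "i \<in> Arr B" "?X \<in> Obj B" "?Y \<in> Obj B" using i by simp_all
  have "\<exists>d p q. is_pushout B i (tz ?X) d p q" by (rule Cof_pushout_exists[OF i]) (simp_all add: ia)
  then obtain Z p z where pz: "is_pushout B i (tz ?X) Z p z" by blast
  have p: "p \<in> hom B ?Y Z" and Z: "Z \<in> Obj B" using is_pushoutD(4,5)[OF pz] by simp_all
  note ph = homD[OF p]
  have "z = fz Z" by (rule from_z0) (use is_pushoutD(6)[OF pz] in \<open>simp_all add: hom_def ia Z\<close>)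
  then have pp: "is_pushout B i (tz ?X) Z p (fz Z)" using pz by simp
  have "p \<triangleleft> i = zr ?X Z" using is_pushoutD(7)[OF pp] by simp
  note pi = this comp_ext[OF this]
  let ?d = "cotuple B (d0 ?X) (d1 ?X)"
  have "\<exists>d a b. is_pushout B ?d (coprod_map B i i) d a b"
    by (rule Cof_pushout_exists[OF cyl_cof]) (simp_all add: ia)
  then obtain M m m' where M': "is_pushout B ?d (coprod_map B i i) M m' m" by blast
  note M = pushout_sym[OF M']
  have mC: "m \<in> Cof" by (rule Cof_pushout[OF cyl_cof M']) (rule ia)
  have mh: "m \<in> Arr B" "Dom B m = coprod_ob B ?Y ?Y" "Cod B m = M" "m' \<in> Arr B" "Dom B m' = T ?X" "Cod B m' = M" "M \<in> Obj B"
    "m \<triangleleft> coprod_map B i i = m' \<triangleleft> ?d"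
    using is_pushoutD(4-7)[OF M] by (simp_all add: hom_def ia)
  have "codiagonal B ?Y \<triangleleft> coprod_map B i i = (i \<triangleleft> sg ?X) \<triangleleft> ?d"
    by (rule cotuple_eqI[of _ _ ?X ?X]) (simp_all add: ia codiagonal_def)
  then have "\<exists>g. g \<in> hom B M ?Y \<and> g \<triangleleft> m = codiagonal B ?Y \<and> g \<triangleleft> m' = i \<triangleleft> sg ?X"
    by (intro is_pushout_ex[OF M]) (simp_all add: hom_def ia)
  then obtain g where g: "g \<in> hom B M ?Y" "g \<triangleleft> m = codiagonal B ?Y" "g \<triangleleft> m' = i \<triangleleft> sg ?X" by blast
  note gh = homD[OF g(1)]
  \<comment> \<open>The new cylinder of the target of \<open>i\<close>: its ends and the map from
    the cylinder of \<open>X\<close> are restrictions of \<open>?v\<close>, so compatibility with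
    \<open>i\<close> is inherited from \<open>M\<close>, and its projection \<open>?s\<close> is a
    weak equivalence.\<close>
  let ?c = "Cyl C g" and ?v = "Cyl_in C g" and ?s = "Cyl_proj C g"
  have vC: "?v \<in> Cof" by (rule Cyl_in_Cof[OF gh(1)])
  have vh: "?v \<in> Arr B" "Dom B ?v = M" "Cod B ?v = ?c" "?s \<in> Arr B" "Dom B ?s = ?c" "Cod B ?s = ?Y" "?s \<triangleleft> ?v = g"
    using gh by simp_all
  define e0 e1 u where def: "e0 = ?v \<triangleleft> (m \<triangleleft> in1 B ?Y ?Y)" "e1 = ?v \<triangleleft> (m \<triangleleft> in2 B ?Y ?Y)" "u = ?v \<triangleleft> m'"
  have e: "e0 \<in> Arr B" "Dom B e0 = ?Y" "Cod B e0 = ?c" "e1 \<in> Arr B" "Dom B e1 = ?Y" "Cod B e1 = ?c"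
    "u \<in> Arr B" "Dom B u = T ?X" "Cod B u = ?c"
    by (simp_all add: def vh mh ia)
  have c: "?c \<in> Obj B" using Cod_obj[OF e(1)] e(3) by simp
  have ce: "?v \<triangleleft> m = cotuple B e0 e1"
    by (rule cotuple_eqI[of _ _ ?Y ?Y]) (simp_all add: e vh mh(1-7) ia, simp_all add: def vh mh(1-7) ia)
  have eC: "cotuple B e0 e1 \<in> Cof" unfolding ce[symmetric] by (rule Cof_comp[OF mC vC]) (simp add: vh mh)
  have "?s \<triangleleft> (?v \<triangleleft> m) = codiagonal B ?Y" using comp_ext[OF vh(7), of m] by (simp add: vh mh(1-7) g)
  then have cyl: "is_cylinder B W Cof ?Y ?c e0 e1 ?s"
    using eC Cyl_proj_W[OF gh(1)] unfolding ce by (simp add: is_cylinder_def hom_def e vh)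
  have su: "?s \<triangleleft> u = i \<triangleleft> sg ?X" using comp_ext[OF vh(7), of m'] by (simp add: def vh mh(1-7) g)
  have "m' \<triangleleft> d0 ?X = (m' \<triangleleft> ?d) \<triangleleft> in1 B ?X ?X" "m' \<triangleleft> d1 ?X = (m' \<triangleleft> ?d) \<triangleleft> in2 B ?X ?X" by (simp_all add: mh(1-7) ia)
  then have "m' \<triangleleft> d0 ?X = m \<triangleleft> (in1 B ?Y ?Y \<triangleleft> i)" "m' \<triangleleft> d1 ?X = m \<triangleleft> (in2 B ?Y ?Y \<triangleleft> i)"
    unfolding mh(8)[symmetric] by (simp_all add: mh(1-7) ia)
  then have ud: "u \<triangleleft> d0 ?X = e0 \<triangleleft> i" "u \<triangleleft> d1 ?X = e1 \<triangleleft> i" by (simp_all add: def mh(1-7) vh ia)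
  have "\<exists>d a b. is_pushout B (cotuple B e0 e1) (coprod_map B p p) d a b"
    by (rule Cof_pushout_exists[OF eC]) (simp_all add: ph e)
  then obtain P r q where P': "is_pushout B (cotuple B e0 e1) (coprod_map B p p) P q r" by blast
  note P = pushout_sym[OF P']
  have dp: "is_dpo B p p e0 e1 P (r \<triangleleft> in1 B Z Z) (r \<triangleleft> in2 B Z Z) q"
    by (rule dpo_of_pushout[OF P p p]) (simp_all add: hom_def e)
  have qh: "q \<in> Arr B" "Dom B q = ?c" "Cod B q = P" "r \<in> Arr B" "Dom B r = coprod_ob B Z Z" "Cod B r = P" "P \<in> Obj B"
    using is_pushoutD(4-6)[OF P] by (simp_all add: hom_def ph e)
  have qe: "q \<triangleleft> e0 = r \<triangleleft> (in1 B Z Z \<triangleleft> p)" "q \<triangleleft> e1 = r \<triangleleft> (in2 B Z Z \<triangleleft> p)"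
    using is_dpoD(12,13)[OF dp] by (simp_all add: qh ph Z)
  have "(q \<triangleleft> e0) \<triangleleft> i = zr ?X P" "(q \<triangleleft> e1) \<triangleleft> i = zr ?X P"
    unfolding qe by (simp_all add: qh ph Z ia pi)
  then have qz: "q \<triangleleft> (e0 \<triangleleft> i) = zr ?X P" "q \<triangleleft> (e1 \<triangleleft> i) = zr ?X P" by (simp_all add: qh e ia)
  \<comment> \<open>In \<open>P\<close> both ends of the cylinder of \<open>X\<close> pass through
    \<open>p\<close> after \<open>i\<close> and vanish, so \<open>q\<close> after \<open>u\<close>
    descends to the suspension; this yields \<open>k\<close>.\<close>
  have "(q \<triangleleft> u) \<triangleleft> ?d = fz P \<triangleleft> tz (coprod_ob B ?X ?X)"
    by (rule cotuple_eqI[of _ _ ?X ?X]) (simp_all add: qh e ia ud qz)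
  moreover have "is_pushout B ?d (tz (coprod_ob B ?X ?X)) (Lambda C ?X) (Lambda_incyl C ?X) (fz (Lambda C ?X))"
    using Lambda_cofiber[OF ia(2)] by (simp add: is_cofiber_def ia)
  ultimately have "\<exists>k. k \<in> hom B (Lambda C ?X) P \<and> k \<triangleleft> Lambda_incyl C ?X = q \<triangleleft> u \<and> k \<triangleleft> fz (Lambda C ?X) = fz P"
    by (intro is_pushout_ex[of B ?d "tz (coprod_ob B ?X ?X)"]) (simp_all add: hom_def ia qh e)
  then obtain k where k: "k \<in> hom B (Lambda C ?X) P" "k \<triangleleft> Lambda_incyl C ?X = q \<triangleleft> u" by blast
  have "brown_coaction B W Cof S i p (inv_arr L (Q (cotuple B (r \<triangleleft> in1 B Z Z) k)) \<star> Q (r \<triangleleft> in2 B Z Z))"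
    unfolding brown_coaction_def Let_def S_simps ph
  proof (intro conjI)
    show "is_cofiber B i p" using pp by (simp add: is_cofiber_def ph)
    show "\<exists>c' e0 e1 s u M m m' v P' r' q k'.
         is_cylinder B W Cof ?Y c' e0 e1 s \<and>
         u \<in> hom B (T ?X) c' \<and>
         u \<triangleleft> d0 ?X = e0 \<triangleleft> i \<and> u \<triangleleft> d1 ?X = e1 \<triangleleft> i \<and>
         s \<triangleleft> u = i \<triangleleft> sg ?X \<and>
         is_pushout B (coprod_map B i i) (cotuple B (d0 ?X) (d1 ?X)) M m m' \<and>
         v \<in> hom B M c' \<and> v \<triangleleft> m = cotuple B e0 e1 \<and> v \<triangleleft> m' = u \<and> v \<in> Cof \<and>
         is_pushout B (coprod_map B p p) (cotuple B e0 e1) P' r' q \<and>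
         k' \<in> hom B (Lambda C ?X) P' \<and> k' \<triangleleft> Lambda_incyl C ?X = q \<triangleleft> u \<and>
         inv_arr L (Q (cotuple B (r \<triangleleft> in1 B Z Z) k)) \<star> Q (r \<triangleleft> in2 B Z Z) =
         inv_arr L (Q (cotuple B (r' \<triangleleft> in1 B Z Z) k')) \<star> Q (r' \<triangleleft> in2 B Z Z)"
      by (rule exI[of _ ?c], rule exI[of _ e0], rule exI[of _ e1], rule exI[of _ ?s], rule exI[of _ u], rule exI[of _ M],
          rule exI[of _ m], rule exI[of _ m'], rule exI[of _ ?v], rule exI[of _ P], rule exI[of _ r], rule exI[of _ q],
          rule exI[of _ k], intro conjI cyl ud su M ce vC P k refl) (simp_all add: hom_def e vh def(3)[symmetric])
  qed (use i scyl_cylinder[OF ia(2)] Lambda_cofiber[OF ia(2)] in \<open>simp_all add: hom_def ia\<close>)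
  then show ?thesis by blast
qed

text \<open>Both notions are defined by isomorphism to a standard pair, so it suffices to move
  between standard pairs by \<open>w_related_iso\<close>; only the forward direction has to replace
  the map by a cofibration first.\<close>

theorem triangle_iff_cofibration_sequence:
  "simplicial_distinguished_triangle C W A \<longleftrightarrow> brown_cofibration_sequence B W Cof S A"
proof
  assume "simplicial_distinguished_triangle C W A"
  then obtain F where F: "F \<in> Arr B" and A: "copair_iso B W S A (cone_triangle F)"
    unfolding simplicial_distinguished_triangle_def NSrc_Dom cone_triangle_def by blast
  have "w_related (cone_triangle (Cyl_in C F)) (cone_triangle F)"
    using cone_triangle_comp[of "Cyl_in C F" "Cyl_proj C F"] Cyl_proj_W[OF F] F by simp
  with A have A': "copair_iso B W S A (cone_triangle (Cyl_in C F))" by (simp add: w_related_iso)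
  obtain p b where br: "brown_coaction B W Cof S (Cyl_in C F) p b"
    using brown_coaction_exists[OF Cyl_in_Cof[OF F]] by blast
  show "brown_cofibration_sequence B W Cof S A"
    unfolding brown_cofibration_sequence_def
    using A' w_related_iso[OF brown_coaction_related[OF br]] br by blast
next
  assume "brown_cofibration_sequence B W Cof S A"
  then obtain i p b where br: "brown_coaction B W Cof S i p b"
    and A: "copair_iso B W S A \<lparr>PX = Dom B i, PY = Cod B i, PZ = Cod B p, Pf = Q i, Pg = Q p, Ph = b\<rparr>"
    unfolding brown_cofibration_sequence_def by blast
  have "i \<in> Arr B" using br by (simp add: brown_coaction_def Let_def)
  moreover have "copair_iso B W S A (cone_triangle i)" using A w_related_iso[OF brown_coaction_related[OF br]] by blast
  ultimately show "simplicial_distinguished_triangle C W A"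
    unfolding simplicial_distinguished_triangle_def NSrc_Dom cone_triangle_def by blast
qed

end

section \<open>The zero object of simplicial objects\<close>

context closed_class begin

text \<open>The constant object at a zero object of \<open>C\<close> works: components of maps from
  it and to it are unique in each degree, and the same uniqueness makes them natural.\<close>

lemma pointed_B:
  assumes "pointed C" shows "pointed B"
proof -
  obtain z where z: "is_initial C z" "is_terminal C z" using assms by (auto simp: pointed_def is_zero_def)
  have zo: "z \<in> Obj C" using z(1) by (simp add: is_initial_def)
  have ini: "\<exists>f. f \<in> hom C z x" "\<And>f g. f \<in> hom C z x \<Longrightarrow> g \<in> hom C z x \<Longrightarrow> f = g" if "x \<in> Obj C" for x
    using z(1) that unfolding is_initial_def by blast+
  have ter: "\<exists>f. f \<in> hom C x z" "\<And>f g. f \<in> hom C x z \<Longrightarrow> g \<in> hom C x z \<Longrightarrow> f = g" if "x \<in> Obj C" for x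
    using z(2) that unfolding is_terminal_def by blast+
  have Z: "is_functor D C (constF z)" by (rule constF[OF zo])
  have cz: "FOb (constF z) n = z" for n by (simp add: constF_def)
  have "is_initial B (constF z)" unfolding is_initial_def
  proof (intro conjI ballI ex_ex1I)
    show "constF z \<in> Obj B" using Z by simp
    fix X assume "X \<in> Obj B"
    then have X: "is_functor D C X" by simp
    have Xo: "FOb X n \<in> Obj C" for n using X by simp
    define a where "a n = (SOME f. f \<in> hom C z (FOb X n))" for n
    have a: "a n \<in> hom C z (FOb X n)" for n unfolding a_def by (rule someI_ex[OF ini(1)[OF Xo]])
    have "is_ntrans D C \<lparr>NSrc = constF z, NTgt = X, NCmp = a\<rparr>"
    proof (rule I.is_ntransI)
      fix \<theta> assume th: "\<theta> \<in> Arr D"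
      have "a (Cod D \<theta>) \<cdot>\<^bsub>C\<^esub> FAr (constF z) \<theta> = FAr X \<theta> \<cdot>\<^bsub>C\<^esub> a (Dom D \<theta>)"
        by (rule ini(2)[OF Xo[of "Cod D \<theta>"]])
          (use homD[OF a] X th zo in \<open>auto simp: hom_def constF_def\<close>)
      then show "NCmp \<lparr>NSrc = constF z, NTgt = X, NCmp = a\<rparr> (Cod D \<theta>) \<cdot>\<^bsub>C\<^esub> FAr (NSrc \<lparr>NSrc = constF z, NTgt = X, NCmp = a\<rparr>) \<theta> =
        FAr (NTgt \<lparr>NSrc = constF z, NTgt = X, NCmp = a\<rparr>) \<theta> \<cdot>\<^bsub>C\<^esub> NCmp \<lparr>NSrc = constF z, NTgt = X, NCmp = a\<rparr> (Dom D \<theta>)" by simp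
    qed (use X Z a in \<open>simp_all add: cz\<close>)
    then show "\<exists>f. f \<in> hom B (constF z) X" by (intro exI[of _ "\<lparr>NSrc = constF z, NTgt = X, NCmp = a\<rparr>"]) (simp add: B_hom)
    fix f g assume fg: "f \<in> hom B (constF z) X" "g \<in> hom B (constF z) X"
    show "f = g"
    proof (rule I.ntrans_eqI)
      show "NCmp f n = NCmp g n" for n
        by (rule ini(2)[OF Xo[of n]]) (use fg in \<open>auto simp: B_hom hom_def cz\<close>)
    qed (use fg in \<open>simp_all add: B_hom\<close>)
  qed
  moreover have "is_terminal B (constF z)" unfolding is_terminal_def
  proof (intro conjI ballI ex_ex1I)
    show "constF z \<in> Obj B" using Z by simp
    fix X assume "X \<in> Obj B"
    then have X: "is_functor D C X" by simp
    have Xo: "FOb X n \<in> Obj C" for n using X by simp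
    define a where "a n = (SOME f. f \<in> hom C (FOb X n) z)" for n
    have a: "a n \<in> hom C (FOb X n) z" for n unfolding a_def by (rule someI_ex[OF ter(1)[OF Xo]])
    have "is_ntrans D C \<lparr>NSrc = X, NTgt = constF z, NCmp = a\<rparr>"
    proof (rule I.is_ntransI)
      fix \<theta> assume th: "\<theta> \<in> Arr D"
      have "a (Cod D \<theta>) \<cdot>\<^bsub>C\<^esub> FAr X \<theta> = FAr (constF z) \<theta> \<cdot>\<^bsub>C\<^esub> a (Dom D \<theta>)"
        by (rule ter(2)[OF Xo[of "Dom D \<theta>"]])
          (use homD[OF a] X th zo in \<open>auto simp: hom_def constF_def\<close>)
      then show "NCmp \<lparr>NSrc = X, NTgt = constF z, NCmp = a\<rparr> (Cod D \<theta>) \<cdot>\<^bsub>C\<^esub> FAr (NSrc \<lparr>NSrc = X, NTgt = constF z, NCmp = a\<rparr>) \<theta> =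
        FAr (NTgt \<lparr>NSrc = X, NTgt = constF z, NCmp = a\<rparr>) \<theta> \<cdot>\<^bsub>C\<^esub> NCmp \<lparr>NSrc = X, NTgt = constF z, NCmp = a\<rparr> (Dom D \<theta>)" by simp
    qed (use X Z a in \<open>simp_all add: cz\<close>)
    then show "\<exists>f. f \<in> hom B X (constF z)" by (intro exI[of _ "\<lparr>NSrc = X, NTgt = constF z, NCmp = a\<rparr>"]) (simp add: B_hom)
    fix f g assume fg: "f \<in> hom B X (constF z)" "g \<in> hom B X (constF z)"
    show "f = g"
    proof (rule I.ntrans_eqI)
      show "NCmp f n = NCmp g n" for n
        by (rule ter(2)[OF Xo[of n]]) (use fg in \<open>auto simp: B_hom hom_def cz\<close>)
    qed (use fg in \<open>simp_all add: B_hom\<close>)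
  qed
  ultimately show ?thesis by (auto simp: pointed_def is_zero_def)
qed

end

theorem proposition4p9:
  fixes C :: "('o, 'a) cat" and W :: "('o, 'a) smap set"
  assumes "category C" and "has_finite_coproducts C" and "Delta_closed C W"
  shows "brown_cofibrant_category (Simp C) W (termwise_coprojections C) \<and>
    (pointed C \<longrightarrow>
      (\<forall>T. is_copair (Simp C) W (simplicial_suspension C W) T \<longrightarrow>
         (simplicial_distinguished_triangle C W T \<longleftrightarrow>
          brown_cofibration_sequence (Simp C) W (termwise_coprojections C)
            (simplicial_suspension C W) T)))"
proof -
  interpret closed_class C W
    using assms by (intro closed_class.intro coprods.intro coprods_axioms.intro closed_class_axioms.intro)
  \<comment> \<open>The parameter \<open>hh\<close> is instantiated by the contraction that comes
    from the minimum on the interval.\<close>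
  have "simplicial_brown C W I.hh" if "pointed C"
    by (intro simplicial_brown.intro simplicial_brown_axioms.intro brown_cylinder_Simp[unfolded One_nat_def])
       (use pointed_B[OF that] in \<open>simp add: B_eq\<close>)
  from simplicial_brown.triangle_iff_cofibration_sequence[OF this] show ?thesis
    using brown_B unfolding B_eq by blast
qed

end
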